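(* Let $\mathsf{A}$ be an abelian category, $\mathsf{V}$ a special preenveloping subcategory of $\mathsf{A}$ and $\mathsf{W}$ a special precovering subcategory of $\mathsf{A}$. Suppose that $\operatorname{Ext}^{j}_{\mathsf{A}}(X,V)=0$ for all $j\ge1$, $X\in{}^{\perp}\mathsf{V}$, $V\in\mathsf{V}$, and that $\operatorname{Ext}^{j}_{\mathsf{A}}(W,Y)=0$ for all $j\ge1$, $W\in\mathsf{W}$, $Y\in\mathsf{W}^{\perp}$. Let $M$ and $N$ be objects in $\mathsf{A}$. Then for each $n\in\mathbb{Z}$ there are natural isomorphisms $$\check{\operatorname{Ext}}{}^{n}_{\mathsf{V}}(M,N)\cong\operatorname{colim}_i\mathrm{S}^{-i}_{\mathsf{V}}\operatorname{Ext}^{n+i}_{\mathsf{A}}(M,N)\quad\text{and}\quad\widehat{\operatorname{Ext}}{}^{n}_{\mathsf{W}}(M,N)\cong\operatorname{colim}_j\mathrm{S}^{-j}_{\mathsf{W}}\operatorname{Ext}^{n+j}_{\mathsf{A}}(M,N).$$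
   Context: "Subcategory" means a full additive subcategory closed under isomorphisms; Ext is Yoneda Ext ($\operatorname{Ext}^0=\operatorname{Hom}$, $\operatorname{Ext}^{<0}=0$). ${}^{\perp}\mathsf{V}=\{M\mid\operatorname{Ext}^1_{\mathsf{A}}(M,V)=0\ \forall V\in\mathsf{V}\}$, $\mathsf{W}^{\perp}=\{N\mid\operatorname{Ext}^1_{\mathsf{A}}(W,N)=0\ \forall W\in\mathsf{W}\}$. A special $\mathsf{V}$-preenvelope of $M$ is an exact sequence $0\to M\to V\to C\to0$ with $V\in\mathsf{V}$, $C\in{}^{\perp}\mathsf{V}$; a special $\mathsf{W}$-precover of $M$ is an exact sequence $0\to K\to W\to M\to0$ with $W\in\mathsf{W}$, $K\in\mathsf{W}^{\perp}$. $\mathsf{V}$ is special preenveloping (resp. $\mathsf{W}$ special precovering) if every object has one. A special proper $\mathsf{V}$-coresolution of $M$ is an exact sequence $0\to M\to I^0\to I^1\to\cdots$ with $I^j\in\mathsf{V}$, staying exact under $\operatorname{Hom}_{\mathsf{A}}(-,V)$ for all $V\in\mathsf{V}$, with $\mathsf{\Theta}^i_{\mathsf{V}}M:=\operatorname{Ker}(I^i\to I^{i+1})\in{}^{\perp}\mathsf{V}$ for $i\ge1$; $\mathsf{\Theta}^0_{\mathsf{V}}M=M$, $\mathsf{\Theta}_{\mathsf{V}}=\mathsf{\Theta}^1_{\mathsf{V}}$. A special proper $\mathsf{W}$-resolution of $M$ is an exact sequence $\cdots\to P_1\to P_0\to M\to0$ with $P_j\in\mathsf{W}$, staying exact under $\operatorname{Hom}_{\mathsf{A}}(W,-)$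 for all $W\in\mathsf{W}$, with $\mathsf{\Omega}^{\mathsf{W}}_iM:=\operatorname{Coker}(P_{i+1}\to P_i)\in\mathsf{W}^{\perp}$ for $i\ge1$; $\mathsf{\Omega}_0^{\mathsf{W}}M=M$, $\mathsf{\Omega}^{\mathsf{W}}=\mathsf{\Omega}_1^{\mathsf{W}}$. Fix choices. Complete cohomology. $\overline{\operatorname{Hom}}{}^{\mathsf{V}}_{\mathsf{A}}(M,N)$ (resp. $\underline{\operatorname{Hom}}{}^{\mathsf{W}}_{\mathsf{A}}(M,N)$) is $\operatorname{Hom}_{\mathsf{A}}(M,N)$ modulo morphisms factoring through an object of $\mathsf{V}$ (resp. $\mathsf{W}$). With special $\mathsf{V}$-preenvelopes $0\to M\to I^0\to\mathsf{\Theta}_{\mathsf{V}}M\to0$ and $0\to N\to J^0\to\mathsf{\Theta}_{\mathsf{V}}N\to0$, the connecting morphism $\operatorname{Hom}_{\mathsf{A}}(M,N)\to\operatorname{Ext}^1_{\mathsf{A}}(\mathsf{\Theta}_{\mathsf{V}}M,N)$ induces a monomorphism $\overline{\delta}\colon\overline{\operatorname{Hom}}{}^{\mathsf{V}}_{\mathsf{A}}(M,N)\to\operatorname{Ext}^1_{\mathsf{A}}(\mathsf{\Theta}_{\mathsf{V}}M,N)$; the connecting morphism $\partial\colon\operatorname{Hom}_{\mathsf{A}}(\mathsf{\Theta}_{\mathsf{V}}M,\mathsf{\Theta}_{\mathsf{V}}N)\to\operatorname{Ext}^1_{\mathsf{A}}(\mathsf{\Theta}_{\mathsf{V}}M,N)$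 is epi and there is a unique $\beta\colon\operatorname{Ext}^1_{\mathsf{A}}(\mathsf{\Theta}_{\mathsf{V}}M,N)\to\overline{\operatorname{Hom}}{}^{\mathsf{V}}_{\mathsf{A}}(\mathsf{\Theta}_{\mathsf{V}}M,\mathsf{\Theta}_{\mathsf{V}}N)$ with $\beta\partial$ the canonical projection. Iterating $\beta\overline{\delta}$ gives a direct system over integers $i\ge\max\{0,-n\}$ and $\check{\operatorname{Ext}}{}^{n}_{\mathsf{V}}(M,N)=\operatorname{colim}_i\overline{\operatorname{Hom}}{}^{\mathsf{V}}_{\mathsf{A}}(\mathsf{\Theta}^i_{\mathsf{V}}M,\mathsf{\Theta}^{i+n}_{\mathsf{V}}N)$. Dually, with special $\mathsf{W}$-precovers of $M$ and $N$ there are a monomorphism $\overline{\delta}\colon\underline{\operatorname{Hom}}{}^{\mathsf{W}}_{\mathsf{A}}(M,N)\to\operatorname{Ext}^1_{\mathsf{A}}(M,\mathsf{\Omega}^{\mathsf{W}}N)$ induced by the connecting morphism and a unique $\beta\colon\operatorname{Ext}^1_{\mathsf{A}}(M,\mathsf{\Omega}^{\mathsf{W}}N)\to\underline{\operatorname{Hom}}{}^{\mathsf{W}}_{\mathsf{A}}(\mathsf{\Omega}^{\mathsf{W}}M,\mathsf{\Omega}^{\mathsf{W}}N)$ whose composite with the (epic) connecting morphism $\operatorname{Hom}_{\mathsf{A}}(\mathsf{\Omega}^{\mathsf{W}}M,\mathsf{\Omega}^{\mathsf{W}}N)\to\operatorname{Ext}^1_{\mathsf{A}}(M,\mathsf{\Omega}^{\mathsf{W}}N)$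 is the canonical projection; iterating $\beta\overline{\delta}$, $\widehat{\operatorname{Ext}}{}^{n}_{\mathsf{W}}(M,N)=\operatorname{colim}_i\underline{\operatorname{Hom}}{}^{\mathsf{W}}_{\mathsf{A}}(\mathsf{\Omega}^{\mathsf{W}}_{i+n}M,\mathsf{\Omega}^{\mathsf{W}}_iN)$ over $i\ge\max\{0,-n\}$. Satellites. For contravariant additive $\mathrm{F}\colon\mathsf{A}\to\mathsf{Ab}$ and a special $\mathsf{V}$-preenvelope $0\to M\to I\xrightarrow{\pi}\mathsf{\Theta}_{\mathsf{V}}M\to0$, $\mathrm{S}^{-1}_{\mathsf{V}}\mathrm{F}(M)=\operatorname{Ker}\mathrm{F}(\pi)$; for covariant additive $\mathrm{G}$ and a special $\mathsf{W}$-precover $0\to\mathsf{\Omega}^{\mathsf{W}}M\xrightarrow{\epsilon}P\to M\to0$, $\mathrm{S}^{-1}_{\mathsf{W}}\mathrm{G}(M)=\operatorname{Ker}\mathrm{G}(\epsilon)$. Inductively $\mathrm{S}^{-n}=\mathrm{S}^{-1}(\mathrm{S}^{-n+1})$ for $n>0$, $\mathrm{S}^0=\mathrm{id}$. $\mathrm{S}^{-i}_{\mathsf{V}}\operatorname{Ext}^k_{\mathsf{A}}(M,N)$ is the value at $M$ of $\mathrm{S}_{\mathsf{V}}^{-i}$ of $\operatorname{Ext}^k_{\mathsf{A}}(-,N)$, and $\mathrm{S}^{-i}_{\mathsf{W}}\operatorname{Ext}^k_{\mathsf{A}}(M,N)$ is the value at $N$ of $\mathrm{S}_{\mathsf{W}}^{-i}$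 of $\operatorname{Ext}^k_{\mathsf{A}}(M,-)$. For $k\ge1$, $\mathrm{S}^{-k}_{\mathsf{V}}\mathrm{F}(M)=\mathrm{S}^{-1}_{\mathsf{V}}\mathrm{F}(\mathsf{\Theta}^{k-1}_{\mathsf{V}}M)\subseteq\mathrm{F}(\mathsf{\Theta}^k_{\mathsf{V}}M)$, and dually $\mathrm{S}^{-k}_{\mathsf{W}}\mathrm{G}(N)\subseteq\mathrm{G}(\mathsf{\Omega}_k^{\mathsf{W}}N)$. The transition maps of the systems $\{\mathrm{S}^{-i}_{\mathsf{V}}\operatorname{Ext}^{n+i}_{\mathsf{A}}(M,N)\}_{i\ge1}$ and $\{\mathrm{S}^{-j}_{\mathsf{W}}\operatorname{Ext}^{n+j}_{\mathsf{A}}(M,N)\}_{j\ge1}$ are the restrictions of the connecting morphisms $\operatorname{Ext}^{n+i}_{\mathsf{A}}(\mathsf{\Theta}^i_{\mathsf{V}}M,N)\to\operatorname{Ext}^{n+i+1}_{\mathsf{A}}(\mathsf{\Theta}^{i+1}_{\mathsf{V}}M,N)$ and $\operatorname{Ext}^{n+j}_{\mathsf{A}}(M,\mathsf{\Omega}_j^{\mathsf{W}}N)\to\operatorname{Ext}^{n+j+1}_{\mathsf{A}}(M,\mathsf{\Omega}_{j+1}^{\mathsf{W}}N)$. *)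

theory Defs
  imports "HOL-Algebra.Coset"
begin

section \<open>Abelian categories\<close>

text \<open>
  Hom groups are written with the multiplicative records of HOL-Algebra, so the operation
  \<open>\<otimes>\<close> of a record below is always an addition of morphisms or of extension classes.
\<close>

record ('o, 'm) precat =
  obj :: "'o set"
  arr :: "'m set"
  dom :: "'m \<Rightarrow> 'o"
  cod :: "'m \<Rightarrow> 'o"
  idn :: "'o \<Rightarrow> 'm"
  cmp :: "'m \<Rightarrow> 'm \<Rightarrow> 'm"  (infixl "\<cdot>\<index>" 75)
  plus :: "'m \<Rightarrow> 'm \<Rightarrow> 'm"
  zer :: "'o \<Rightarrow> 'o \<Rightarrow> 'm"

definition homs :: "('o, 'm, 'z) precat_scheme \<Rightarrow> 'o \<Rightarrow> 'o \<Rightarrow> 'm set" where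
  "homs C A B = {f \<in> arr C. dom C f = A \<and> cod C f = B}"

definition hom_group :: "('o, 'm, 'z) precat_scheme \<Rightarrow> 'o \<Rightarrow> 'o \<Rightarrow> 'm monoid" where
  "hom_group C A B = \<lparr>carrier = homs C A B, mult = plus C, one = zer C A B\<rparr>"

definition is_mono :: "('o, 'm, 'z) precat_scheme \<Rightarrow> 'm \<Rightarrow> bool" where
  "is_mono C f \<longleftrightarrow> f \<in> arr C \<and>
     (\<forall>g\<in>arr C. \<forall>h\<in>arr C. dom C g = dom C h \<and> cod C g = dom C f \<and> cod C h = dom C f \<and>
        f \<cdot>\<^bsub>C\<^esub> g = f \<cdot>\<^bsub>C\<^esub> h \<longrightarrow> g = h)"

definition is_epi :: "('o, 'm, 'z) precat_scheme \<Rightarrow> 'm \<Rightarrow> bool" where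
  "is_epi C f \<longleftrightarrow> f \<in> arr C \<and>
     (\<forall>g\<in>arr C. \<forall>h\<in>arr C. cod C g = cod C h \<and> dom C g = cod C f \<and> dom C h = cod C f \<and>
        g \<cdot>\<^bsub>C\<^esub> f = h \<cdot>\<^bsub>C\<^esub> f \<longrightarrow> g = h)"

definition is_iso :: "('o, 'm, 'z) precat_scheme \<Rightarrow> 'm \<Rightarrow> bool" where
  "is_iso C f \<longleftrightarrow> f \<in> arr C \<and>
     (\<exists>g\<in>homs C (cod C f) (dom C f).
        g \<cdot>\<^bsub>C\<^esub> f = idn C (dom C f) \<and> f \<cdot>\<^bsub>C\<^esub> g = idn C (cod C f))"

definition is_kernel :: "('o, 'm, 'z) precat_scheme \<Rightarrow> 'm \<Rightarrow> 'm \<Rightarrow> bool" where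
  "is_kernel C k f \<longleftrightarrow> f \<in> arr C \<and> k \<in> arr C \<and> cod C k = dom C f \<and>
     f \<cdot>\<^bsub>C\<^esub> k = zer C (dom C k) (cod C f) \<and>
     (\<forall>h\<in>arr C. cod C h = dom C f \<and> f \<cdot>\<^bsub>C\<^esub> h = zer C (dom C h) (cod C f) \<longrightarrow>
        (\<exists>!u. u \<in> homs C (dom C h) (dom C k) \<and> k \<cdot>\<^bsub>C\<^esub> u = h))"

definition is_cokernel :: "('o, 'm, 'z) precat_scheme \<Rightarrow> 'm \<Rightarrow> 'm \<Rightarrow> bool" where
  "is_cokernel C c f \<longleftrightarrow> f \<in> arr C \<and> c \<in> arr C \<and> dom C c = cod C f \<and>
     c \<cdot>\<^bsub>C\<^esub> f = zer C (dom C f) (cod C c) \<and>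
     (\<forall>h\<in>arr C. dom C h = cod C f \<and> h \<cdot>\<^bsub>C\<^esub> f = zer C (dom C f) (cod C h) \<longrightarrow>
        (\<exists>!u. u \<in> homs C (cod C c) (cod C h) \<and> u \<cdot>\<^bsub>C\<^esub> c = h))"

definition is_zero_object :: "('o, 'm, 'z) precat_scheme \<Rightarrow> 'o \<Rightarrow> bool" where
  "is_zero_object C Z \<longleftrightarrow> Z \<in> obj C \<and>
     (\<forall>A\<in>obj C. homs C A Z = {zer C A Z} \<and> homs C Z A = {zer C Z A})"

definition is_biproduct ::
  "('o, 'm, 'z) precat_scheme \<Rightarrow> 'o \<Rightarrow> 'o \<Rightarrow> 'o \<Rightarrow> 'm \<Rightarrow> 'm \<Rightarrow> 'm \<Rightarrow> 'm \<Rightarrow> bool" where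
  "is_biproduct C A B S i j p q \<longleftrightarrow> S \<in> obj C \<and>
     i \<in> homs C A S \<and> j \<in> homs C B S \<and> p \<in> homs C S A \<and> q \<in> homs C S B \<and>
     p \<cdot>\<^bsub>C\<^esub> i = idn C A \<and> q \<cdot>\<^bsub>C\<^esub> j = idn C B \<and>
     p \<cdot>\<^bsub>C\<^esub> j = zer C B A \<and> q \<cdot>\<^bsub>C\<^esub> i = zer C A B \<and>
     plus C (i \<cdot>\<^bsub>C\<^esub> p) (j \<cdot>\<^bsub>C\<^esub> q) = idn C S"

locale abelian_category =
  fixes C :: "('o, 'm, 'z) precat_scheme" (structure)
  assumes dom_obj: "f \<in> arr C \<Longrightarrow> dom C f \<in> obj C"
    and cod_obj: "f \<in> arr C \<Longrightarrow> cod C f \<in> obj C"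
    and idn_hom: "A \<in> obj C \<Longrightarrow> idn C A \<in> homs C A A"
    and cmp_hom: "\<lbrakk>f \<in> homs C A B; g \<in> homs C B D\<rbrakk> \<Longrightarrow> g \<cdot> f \<in> homs C A D"
    and cmp_idn: "f \<in> homs C A B \<Longrightarrow> f \<cdot> idn C A = f"
    and idn_cmp: "f \<in> homs C A B \<Longrightarrow> idn C B \<cdot> f = f"
    and cmp_assoc: "\<lbrakk>f \<in> homs C A B; g \<in> homs C B D; h \<in> homs C D E\<rbrakk>
      \<Longrightarrow> h \<cdot> (g \<cdot> f) = (h \<cdot> g) \<cdot> f"
    and hom_comm_group: "\<lbrakk>A \<in> obj C; B \<in> obj C\<rbrakk> \<Longrightarrow> comm_group (hom_group C A B)"
    and cmp_plus: "\<lbrakk>f \<in> homs C A B; f' \<in> homs C A B; g \<in> homs C B D\<rbrakk>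
      \<Longrightarrow> g \<cdot> plus C f f' = plus C (g \<cdot> f) (g \<cdot> f')"
    and plus_cmp: "\<lbrakk>f \<in> homs C A B; g \<in> homs C B D; g' \<in> homs C B D\<rbrakk>
      \<Longrightarrow> plus C g g' \<cdot> f = plus C (g \<cdot> f) (g' \<cdot> f)"
    and ex_zero_object: "\<exists>Z. is_zero_object C Z"
    and ex_biproduct: "\<lbrakk>A \<in> obj C; B \<in> obj C\<rbrakk> \<Longrightarrow> \<exists>S i j p q. is_biproduct C A B S i j p q"
    and ex_kernel: "f \<in> arr C \<Longrightarrow> \<exists>k. is_kernel C k f"
    and ex_cokernel: "f \<in> arr C \<Longrightarrow> \<exists>c. is_cokernel C c f"
    and mono_normal: "is_mono C f \<Longrightarrow> \<exists>g. is_kernel C f g"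
    and epi_normal: "is_epi C f \<Longrightarrow> \<exists>g. is_cokernel C f g"

text \<open>Exactness of \<open>\<bullet> \<rightarrow> \<bullet> \<rightarrow> \<bullet>\<close> (first \<open>f\<close>, then \<open>g\<close>): the image of \<open>f\<close> is a kernel of \<open>g\<close>.\<close>

definition exact_at :: "('o, 'm, 'z) precat_scheme \<Rightarrow> 'm \<Rightarrow> 'm \<Rightarrow> bool" where
  "exact_at C f g \<longleftrightarrow> f \<in> arr C \<and> g \<in> arr C \<and> cod C f = dom C g \<and>
     (\<exists>m e. is_epi C e \<and> is_kernel C m g \<and> cod C e = dom C m \<and> f = m \<cdot>\<^bsub>C\<^esub> e)"

definition short_exact :: "('o, 'm, 'z) precat_scheme \<Rightarrow> 'm \<Rightarrow> 'm \<Rightarrow> bool" where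
  "short_exact C a b \<longleftrightarrow> is_mono C a \<and> exact_at C a b \<and> is_epi C b"

text \<open>\<open>p : P \<rightarrow> dom f\<close>, \<open>q : P \<rightarrow> dom g\<close> is a pullback of \<open>f\<close> and \<open>g\<close>; dually for pushouts.\<close>

definition is_pullback :: "('o, 'm, 'z) precat_scheme \<Rightarrow> 'm \<Rightarrow> 'm \<Rightarrow> 'm \<Rightarrow> 'm \<Rightarrow> bool" where
  "is_pullback C f g p q \<longleftrightarrow>
     f \<in> arr C \<and> g \<in> arr C \<and> p \<in> arr C \<and> q \<in> arr C \<and> cod C f = cod C g \<and>
     dom C p = dom C q \<and> cod C p = dom C f \<and> cod C q = dom C g \<and> f \<cdot>\<^bsub>C\<^esub> p = g \<cdot>\<^bsub>C\<^esub> q \<and>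
     (\<forall>x\<in>arr C. \<forall>y\<in>arr C. dom C x = dom C y \<and> cod C x = dom C f \<and> cod C y = dom C g \<and>
        f \<cdot>\<^bsub>C\<^esub> x = g \<cdot>\<^bsub>C\<^esub> y \<longrightarrow>
        (\<exists>!u. u \<in> homs C (dom C x) (dom C p) \<and> p \<cdot>\<^bsub>C\<^esub> u = x \<and> q \<cdot>\<^bsub>C\<^esub> u = y))"

definition is_pushout :: "('o, 'm, 'z) precat_scheme \<Rightarrow> 'm \<Rightarrow> 'm \<Rightarrow> 'm \<Rightarrow> 'm \<Rightarrow> bool" where
  "is_pushout C f g p q \<longleftrightarrow>
     f \<in> arr C \<and> g \<in> arr C \<and> p \<in> arr C \<and> q \<in> arr C \<and> dom C f = dom C g \<and>
     cod C p = cod C q \<and> dom C p = cod C f \<and> dom C q = cod C g \<and> p \<cdot>\<^bsub>C\<^esub> f = q \<cdot>\<^bsub>C\<^esub> g \<and>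
     (\<forall>x\<in>arr C. \<forall>y\<in>arr C. cod C x = cod C y \<and> dom C x = cod C f \<and> dom C y = cod C g \<and>
        x \<cdot>\<^bsub>C\<^esub> f = y \<cdot>\<^bsub>C\<^esub> g \<longrightarrow>
        (\<exists>!u. u \<in> homs C (cod C p) (cod C x) \<and> u \<cdot>\<^bsub>C\<^esub> p = x \<and> u \<cdot>\<^bsub>C\<^esub> q = y))"

definition full_additive_subcategory :: "('o, 'm, 'z) precat_scheme \<Rightarrow> 'o set \<Rightarrow> bool" where
  "full_additive_subcategory C V \<longleftrightarrow> V \<subseteq> obj C \<and>
     (\<exists>Z\<in>V. is_zero_object C Z) \<and>
     (\<forall>A\<in>V. \<forall>B\<in>V. \<forall>S i j p q. is_biproduct C A B S i j p q \<longrightarrow> S \<in> V) \<and>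
     (\<forall>f. is_iso C f \<and> dom C f \<in> V \<longrightarrow> cod C f \<in> V)"


section \<open>Yoneda Ext\<close>

text \<open>Chosen zero object and biproducts, used to write down zero extensions and Baer sums.\<close>

definition zobj :: "('o, 'm, 'z) precat_scheme \<Rightarrow> 'o" where
  "zobj C = (SOME Z. is_zero_object C Z)"

definition biprod :: "('o, 'm, 'z) precat_scheme \<Rightarrow> 'o \<Rightarrow> 'o \<Rightarrow> 'm \<times> 'm \<times> 'm \<times> 'm" where
  "biprod C A B = (SOME (i, j, p, q). \<exists>S. is_biproduct C A B S i j p q)"

definition in1 :: "('o, 'm, 'z) precat_scheme \<Rightarrow> 'o \<Rightarrow> 'o \<Rightarrow> 'm" where
  "in1 C A B = fst (biprod C A B)"

definition in2 :: "('o, 'm, 'z) precat_scheme \<Rightarrow> 'o \<Rightarrow> 'o \<Rightarrow> 'm" where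
  "in2 C A B = fst (snd (biprod C A B))"

definition pr1 :: "('o, 'm, 'z) precat_scheme \<Rightarrow> 'o \<Rightarrow> 'o \<Rightarrow> 'm" where
  "pr1 C A B = fst (snd (snd (biprod C A B)))"

definition pr2 :: "('o, 'm, 'z) precat_scheme \<Rightarrow> 'o \<Rightarrow> 'o \<Rightarrow> 'm" where
  "pr2 C A B = snd (snd (snd (biprod C A B)))"

definition dsum :: "('o, 'm, 'z) precat_scheme \<Rightarrow> 'm \<Rightarrow> 'm \<Rightarrow> 'm" where
  "dsum C f g = plus C
     (in1 C (cod C f) (cod C g) \<cdot>\<^bsub>C\<^esub> f \<cdot>\<^bsub>C\<^esub> pr1 C (dom C f) (dom C g))
     (in2 C (cod C f) (cod C g) \<cdot>\<^bsub>C\<^esub> g \<cdot>\<^bsub>C\<^esub> pr2 C (dom C f) (dom C g))"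

definition diag :: "('o, 'm, 'z) precat_scheme \<Rightarrow> 'o \<Rightarrow> 'm" where
  "diag C A = plus C (in1 C A A) (in2 C A A)"

definition codiag :: "('o, 'm, 'z) precat_scheme \<Rightarrow> 'o \<Rightarrow> 'm" where
  "codiag C A = plus C (pr1 C A A) (pr2 C A A)"

text \<open>
  For \<open>n \<ge> 1\<close> an \<open>n\<close>-extension \<open>0 \<rightarrow> N \<rightarrow> E\<^bsub>n-1\<^esub> \<rightarrow> \<dots> \<rightarrow> E\<^bsub>0\<^esub> \<rightarrow> M \<rightarrow> 0\<close> of \<open>M\<close> by \<open>N\<close> is the list of the
  \<open>n + 1\<close> arrows between \<open>N\<close> and \<open>M\<close>, from left to right.  In degree \<open>0\<close> the one-element list \<open>[f]\<close>
  stands for a morphism \<open>f : M \<rightarrow> N\<close>; note that this arrow points from \<open>M\<close> to \<open>N\<close>.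
\<close>

definition yext :: "('o, 'm, 'z) precat_scheme \<Rightarrow> nat \<Rightarrow> 'o \<Rightarrow> 'o \<Rightarrow> 'm list \<Rightarrow> bool" where
  "yext C n M N E \<longleftrightarrow>
     (if n = 0 then \<exists>f\<in>homs C M N. E = [f]
      else length E = n + 1 \<and> dom C (hd E) = N \<and> cod C (last E) = M \<and>
        is_mono C (hd E) \<and> is_epi C (last E) \<and> (\<forall>j<n. exact_at C (E ! j) (E ! Suc j)))"

text \<open>A morphism of extensions which is the identity at both ends.\<close>

definition yext_step :: "('o, 'm, 'z) precat_scheme \<Rightarrow> 'm list \<Rightarrow> 'm list \<Rightarrow> bool" where
  "yext_step C E F \<longleftrightarrow> (\<exists>n M N \<phi>. n \<ge> 1 \<and> yext C n M N E \<and> yext C n M N F \<and>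
     \<phi> 0 = idn C N \<and> \<phi> (Suc n) = idn C M \<and>
     (\<forall>j\<le>n. \<phi> j \<in> homs C (dom C (E ! j)) (dom C (F ! j)) \<and>
        F ! j \<cdot>\<^bsub>C\<^esub> \<phi> j = \<phi> (Suc j) \<cdot>\<^bsub>C\<^esub> E ! j))"

definition ext_class :: "('o, 'm, 'z) precat_scheme \<Rightarrow> 'm list \<Rightarrow> 'm list set" where
  "ext_class C E = {F. equivclp (yext_step C) E F}"

text \<open>\<open>F\<close> is obtained from \<open>E\<close> by pullback along \<open>f : M' \<rightarrow> M\<close> on the right.\<close>

definition pull_rel :: "('o, 'm, 'z) precat_scheme \<Rightarrow> 'm \<Rightarrow> 'm list \<Rightarrow> 'm list \<Rightarrow> bool" where
  "pull_rel C f E F \<longleftrightarrow>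
     (if length E = 1 then F = [hd E \<cdot>\<^bsub>C\<^esub> f]
      else \<exists>p q e. is_pullback C (last E) f p q \<and>
        e \<in> homs C (dom C (last (butlast E))) (dom C p) \<and>
        p \<cdot>\<^bsub>C\<^esub> e = last (butlast E) \<and>
        q \<cdot>\<^bsub>C\<^esub> e = zer C (dom C e) (dom C f) \<and>
        F = butlast (butlast E) @ [e, q])"

text \<open>\<open>F\<close> is obtained from \<open>E\<close> by pushout along \<open>g : N \<rightarrow> N'\<close> on the left.\<close>

definition push_rel :: "('o, 'm, 'z) precat_scheme \<Rightarrow> 'm \<Rightarrow> 'm list \<Rightarrow> 'm list \<Rightarrow> bool" where
  "push_rel C g E F \<longleftrightarrow>
     (if length E = 1 then F = [g \<cdot>\<^bsub>C\<^esub> hd E]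
      else \<exists>p q e. is_pushout C (hd E) g p q \<and>
        e \<in> homs C (cod C p) (cod C (hd (tl E))) \<and>
        e \<cdot>\<^bsub>C\<^esub> p = hd (tl E) \<and>
        e \<cdot>\<^bsub>C\<^esub> q = zer C (cod C g) (cod C e) \<and>
        F = [q, e] @ tl (tl E))"

text \<open>
  Operations on classes are unions over all representatives; since they respect equivalence,
  each union is a single class.
\<close>

definition ext_pull :: "('o, 'm, 'z) precat_scheme \<Rightarrow> 'm \<Rightarrow> 'm list set \<Rightarrow> 'm list set" where
  "ext_pull C f \<xi> = \<Union>{ext_class C F | E F. E \<in> \<xi> \<and> pull_rel C f E F}"

definition ext_push :: "('o, 'm, 'z) precat_scheme \<Rightarrow> 'm \<Rightarrow> 'm list set \<Rightarrow> 'm list set" where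
  "ext_push C g \<xi> = \<Union>{ext_class C F | E F. E \<in> \<xi> \<and> push_rel C g E F}"

definition baer_sum ::
  "('o, 'm, 'z) precat_scheme \<Rightarrow> 'o \<Rightarrow> 'o \<Rightarrow> 'm list set \<Rightarrow> 'm list set \<Rightarrow> 'm list set" where
  "baer_sum C M N \<xi> \<eta> = ext_push C (codiag C N) (ext_pull C (diag C M)
     (\<Union>{ext_class C (map2 (dsum C) E F) | E F. E \<in> \<xi> \<and> F \<in> \<eta>}))"

text \<open>
  The zero extension: \<open>0 \<rightarrow> N \<rightarrow> N \<oplus> M \<rightarrow> M \<rightarrow> 0\<close> for \<open>n = 1\<close>, and
  \<open>0 \<rightarrow> N = N \<rightarrow> 0 \<rightarrow> \<dots> \<rightarrow> 0 \<rightarrow> M = M \<rightarrow> 0\<close> for \<open>n \<ge> 2\<close>.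
\<close>

definition zero_ext :: "('o, 'm, 'z) precat_scheme \<Rightarrow> nat \<Rightarrow> 'o \<Rightarrow> 'o \<Rightarrow> 'm list" where
  "zero_ext C n M N =
     (if n = 0 then [zer C M N]
      else if n = 1 then [in1 C N M, pr2 C N M]
      else [idn C N] @
        map2 (zer C) (N # replicate (n - 2) (zobj C)) (replicate (n - 2) (zobj C) @ [M]) @
        [idn C M])"

text \<open>
  \<open>Ext\<^sup>k\<close> for integers \<open>k\<close>.  The element \<open>f\<close> of \<open>Ext\<^sup>0 M N = Hom M N\<close> is the class \<open>{[f]}\<close>;
  in negative degrees the group is trivial, with the empty set as its only element.
\<close>

definition Ext :: "('o, 'm, 'z) precat_scheme \<Rightarrow> int \<Rightarrow> 'o \<Rightarrow> 'o \<Rightarrow> 'm list set monoid" where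
  "Ext C k M N =
     (if k < 0 then \<lparr>carrier = {{}}, mult = (\<lambda>_ _. {}), one = {}\<rparr>
      else \<lparr>carrier = ext_class C ` {E. yext C (nat k) M N E},
            mult = (if k = 0 then (\<lambda>\<xi> \<eta>. {[plus C f g] | f g. [f] \<in> \<xi> \<and> [g] \<in> \<eta>})
                    else baer_sum C M N),
            one = ext_class C (zero_ext C (nat k) M N)\<rparr>)"

text \<open>
  For \<open>0 \<rightarrow> A \<rightarrow> B \<rightarrow> D \<rightarrow> 0\<close> given by \<open>a\<close> and \<open>b\<close>, the connecting morphisms are the Yoneda products
  with its class (no sign is inserted):
  \<open>Ext\<^sup>k A N \<rightarrow> Ext\<^bsup>k+1\<^esup> D N\<close> and \<open>Ext\<^sup>k M D \<rightarrow> Ext\<^bsup>k+1\<^esup> M A\<close>.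
\<close>

definition splice_right_rel ::
  "('o, 'm, 'z) precat_scheme \<Rightarrow> 'm \<Rightarrow> 'm \<Rightarrow> 'm list \<Rightarrow> 'm list \<Rightarrow> bool" where
  "splice_right_rel C a b E F \<longleftrightarrow>
     (if length E = 1 then push_rel C (hd E) [a, b] F
      else F = butlast E @ [a \<cdot>\<^bsub>C\<^esub> last E, b])"

definition splice_left_rel ::
  "('o, 'm, 'z) precat_scheme \<Rightarrow> 'm \<Rightarrow> 'm \<Rightarrow> 'm list \<Rightarrow> 'm list \<Rightarrow> bool" where
  "splice_left_rel C a b E F \<longleftrightarrow>
     (if length E = 1 then pull_rel C (hd E) [a, b] F
      else F = [a, hd E \<cdot>\<^bsub>C\<^esub> b] @ tl E)"

definition conn_contra ::
  "('o, 'm, 'z) precat_scheme \<Rightarrow> int \<Rightarrow> 'm \<Rightarrow> 'm \<Rightarrow> 'o \<Rightarrow> 'm list set \<Rightarrow> 'm list set" where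
  "conn_contra C k a b N \<xi> =
     (if k < 0 then \<one>\<^bsub>Ext C (k + 1) (cod C b) N\<^esub>
      else \<Union>{ext_class C F | E F. E \<in> \<xi> \<and> splice_right_rel C a b E F})"

definition conn_co ::
  "('o, 'm, 'z) precat_scheme \<Rightarrow> int \<Rightarrow> 'o \<Rightarrow> 'm \<Rightarrow> 'm \<Rightarrow> 'm list set \<Rightarrow> 'm list set" where
  "conn_co C k M a b \<xi> =
     (if k < 0 then \<one>\<^bsub>Ext C (k + 1) M (dom C a)\<^esub>
      else \<Union>{ext_class C F | E F. E \<in> \<xi> \<and> splice_left_rel C a b E F})"


section \<open>Special preenvelopes, precovers and (co)resolutions\<close>

definition left_perp :: "('o, 'm, 'z) precat_scheme \<Rightarrow> 'o set \<Rightarrow> 'o set" where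
  "left_perp C V = {M \<in> obj C. \<forall>U\<in>V. carrier (Ext C 1 M U) = {\<one>\<^bsub>Ext C 1 M U\<^esub>}}"

definition right_perp :: "('o, 'm, 'z) precat_scheme \<Rightarrow> 'o set \<Rightarrow> 'o set" where
  "right_perp C W = {N \<in> obj C. \<forall>U\<in>W. carrier (Ext C 1 U N) = {\<one>\<^bsub>Ext C 1 U N\<^esub>}}"

definition special_preenveloping :: "('o, 'm, 'z) precat_scheme \<Rightarrow> 'o set \<Rightarrow> bool" where
  "special_preenveloping C V \<longleftrightarrow> (\<forall>M\<in>obj C. \<exists>a b. short_exact C a b \<and>
     dom C a = M \<and> cod C a \<in> V \<and> cod C b \<in> left_perp C V)"

definition special_precovering :: "('o, 'm, 'z) precat_scheme \<Rightarrow> 'o set \<Rightarrow> bool" where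
  "special_precovering C W \<longleftrightarrow> (\<forall>M\<in>obj C. \<exists>a b. short_exact C a b \<and>
     cod C b = M \<and> dom C b \<in> W \<and> dom C a \<in> right_perp C W)"

text \<open>
  A coresolution is stored through its cosyzygies: \<open>cinc R i : \<Theta>\<^sup>i \<rightarrow> I\<^sup>i\<close> and
  \<open>cprj R i : I\<^sup>i \<rightarrow> \<Theta>\<^bsup>i+1\<^esup>\<close>, where \<open>\<Theta>\<^sup>0\<close> is the coresolved object, so that the differential
  \<open>I\<^sup>i \<rightarrow> I\<^bsup>i+1\<^esup>\<close> is their composite.  Dually \<open>rprj R i : P\<^sub>i \<rightarrow> \<Omega>\<^sub>i\<close> and
  \<open>rinc R i : \<Omega>\<^bsub>i+1\<^esub> \<rightarrow> P\<^sub>i\<close> for resolutions.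
\<close>

record 'm coresolution =
  cinc :: "nat \<Rightarrow> 'm"
  cprj :: "nat \<Rightarrow> 'm"

record 'm resolution =
  rinc :: "nat \<Rightarrow> 'm"
  rprj :: "nat \<Rightarrow> 'm"

definition cterm :: "('o, 'm, 'z) precat_scheme \<Rightarrow> 'm coresolution \<Rightarrow> nat \<Rightarrow> 'o" where
  "cterm C R i = cod C (cinc R i)"

definition Theta :: "('o, 'm, 'z) precat_scheme \<Rightarrow> 'm coresolution \<Rightarrow> nat \<Rightarrow> 'o" where
  "Theta C R i = dom C (cinc R i)"

definition cdiff :: "('o, 'm, 'z) precat_scheme \<Rightarrow> 'm coresolution \<Rightarrow> nat \<Rightarrow> 'm" where
  "cdiff C R i = cinc R (Suc i) \<cdot>\<^bsub>C\<^esub> cprj R i"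

definition special_proper_coresolution ::
  "('o, 'm, 'z) precat_scheme \<Rightarrow> 'o set \<Rightarrow> 'o \<Rightarrow> 'm coresolution \<Rightarrow> bool" where
  "special_proper_coresolution C V M R \<longleftrightarrow>
     (\<forall>i. cinc R i \<in> homs C (Theta C R i) (cterm C R i) \<and>
          cprj R i \<in> homs C (cterm C R i) (Theta C R (Suc i))) \<and>
     Theta C R 0 = M \<and> (\<forall>i. cterm C R i \<in> V) \<and>
     is_mono C (cinc R 0) \<and> exact_at C (cinc R 0) (cdiff C R 0) \<and>
     (\<forall>i. exact_at C (cdiff C R i) (cdiff C R (Suc i))) \<and>
     (\<forall>U\<in>V.
        (\<lambda>h. h \<cdot>\<^bsub>C\<^esub> cinc R 0) ` homs C (cterm C R 0) U = homs C M U \<and>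
        {h \<in> homs C (cterm C R 0) U. h \<cdot>\<^bsub>C\<^esub> cinc R 0 = zer C M U} =
          (\<lambda>h. h \<cdot>\<^bsub>C\<^esub> cdiff C R 0) ` homs C (cterm C R 1) U \<and>
        (\<forall>i. {h \<in> homs C (cterm C R (Suc i)) U.
                h \<cdot>\<^bsub>C\<^esub> cdiff C R i = zer C (cterm C R i) U} =
             (\<lambda>h. h \<cdot>\<^bsub>C\<^esub> cdiff C R (Suc i)) ` homs C (cterm C R (Suc (Suc i))) U)) \<and>
     (\<forall>i\<ge>1. is_kernel C (cinc R i) (cdiff C R i) \<and> Theta C R i \<in> left_perp C V)"

definition rterm :: "('o, 'm, 'z) precat_scheme \<Rightarrow> 'm resolution \<Rightarrow> nat \<Rightarrow> 'o" where
  "rterm C R i = dom C (rprj R i)"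

definition Omega :: "('o, 'm, 'z) precat_scheme \<Rightarrow> 'm resolution \<Rightarrow> nat \<Rightarrow> 'o" where
  "Omega C R i = cod C (rprj R i)"

definition rdiff :: "('o, 'm, 'z) precat_scheme \<Rightarrow> 'm resolution \<Rightarrow> nat \<Rightarrow> 'm" where
  "rdiff C R i = rinc R i \<cdot>\<^bsub>C\<^esub> rprj R (Suc i)"

definition special_proper_resolution ::
  "('o, 'm, 'z) precat_scheme \<Rightarrow> 'o set \<Rightarrow> 'o \<Rightarrow> 'm resolution \<Rightarrow> bool" where
  "special_proper_resolution C W M R \<longleftrightarrow>
     (\<forall>i. rprj R i \<in> homs C (rterm C R i) (Omega C R i) \<and>
          rinc R i \<in> homs C (Omega C R (Suc i)) (rterm C R i)) \<and>
     Omega C R 0 = M \<and> (\<forall>i. rterm C R i \<in> W) \<and>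
     is_epi C (rprj R 0) \<and> exact_at C (rdiff C R 0) (rprj R 0) \<and>
     (\<forall>i. exact_at C (rdiff C R (Suc i)) (rdiff C R i)) \<and>
     (\<forall>U\<in>W.
        (\<lambda>h. rprj R 0 \<cdot>\<^bsub>C\<^esub> h) ` homs C U (rterm C R 0) = homs C U M \<and>
        {h \<in> homs C U (rterm C R 0). rprj R 0 \<cdot>\<^bsub>C\<^esub> h = zer C U M} =
          (\<lambda>h. rdiff C R 0 \<cdot>\<^bsub>C\<^esub> h) ` homs C U (rterm C R 1) \<and>
        (\<forall>i. {h \<in> homs C U (rterm C R (Suc i)).
                rdiff C R i \<cdot>\<^bsub>C\<^esub> h = zer C U (rterm C R i)} =
             (\<lambda>h. rdiff C R (Suc i) \<cdot>\<^bsub>C\<^esub> h) ` homs C U (rterm C R (Suc (Suc i))))) \<and>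
     (\<forall>i\<ge>1. is_cokernel C (rprj R i) (rdiff C R i) \<and> Omega C R i \<in> right_perp C W)"

text \<open>
  The fixed choices.  The choice for \<open>\<Theta>M\<close> is the tail of the choice for \<open>M\<close>, so that
  \<open>\<Theta>\<^bsup>i+1\<^esup>M = \<Theta> (\<Theta>\<^sup>i M)\<close> on the nose; this is what makes \<open>S\<^bsup>-k\<^esup>F(M)\<close>, defined by iteration,
  literally a subgroup of \<open>F(\<Theta>\<^sup>k M)\<close>.  Splicing a chosen special preenvelope of every object gives
  such a family, and every such family arises in this way.
\<close>

definition coresolution_choice ::
  "('o, 'm, 'z) precat_scheme \<Rightarrow> 'o set \<Rightarrow> ('o \<Rightarrow> 'm coresolution) \<Rightarrow> bool" where
  "coresolution_choice C V I \<longleftrightarrow>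
     (\<forall>M\<in>obj C. special_proper_coresolution C V M (I M) \<and>
        I (Theta C (I M) 1) =
          \<lparr>cinc = (\<lambda>i. cinc (I M) (Suc i)), cprj = (\<lambda>i. cprj (I M) (Suc i))\<rparr>)"

definition resolution_choice ::
  "('o, 'm, 'z) precat_scheme \<Rightarrow> 'o set \<Rightarrow> ('o \<Rightarrow> 'm resolution) \<Rightarrow> bool" where
  "resolution_choice C W P \<longleftrightarrow>
     (\<forall>M\<in>obj C. special_proper_resolution C W M (P M) \<and>
        P (Omega C (P M) 1) =
          \<lparr>rinc = (\<lambda>i. rinc (P M) (Suc i)), rprj = (\<lambda>i. rprj (P M) (Suc i))\<rparr>)"

text \<open>
  The morphisms \<open>\<Theta>\<^sup>i f\<close> and \<open>\<Omega>\<^sub>i f\<close> induced by a lift of \<open>f\<close> to the chosen (co)resolutions.  They are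
  determined by \<open>f\<close> only up to morphisms factoring through \<open>V\<close> (resp. \<open>W\<close>) for \<open>i \<ge> 1\<close>.
\<close>

definition Theta_map ::
  "('o, 'm, 'z) precat_scheme \<Rightarrow> ('o \<Rightarrow> 'm coresolution) \<Rightarrow> 'm \<Rightarrow> nat \<Rightarrow> 'm" where
  "Theta_map C I f = (SOME \<theta>. \<exists>u. \<theta> 0 = f \<and>
     (\<forall>i. \<theta> i \<in> homs C (Theta C (I (dom C f)) i) (Theta C (I (cod C f)) i) \<and>
          u i \<in> homs C (cterm C (I (dom C f)) i) (cterm C (I (cod C f)) i) \<and>
          u i \<cdot>\<^bsub>C\<^esub> cinc (I (dom C f)) i = cinc (I (cod C f)) i \<cdot>\<^bsub>C\<^esub> \<theta> i \<and>
          \<theta> (Suc i) \<cdot>\<^bsub>C\<^esub> cprj (I (dom C f)) i = cprj (I (cod C f)) i \<cdot>\<^bsub>C\<^esub> u i))"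

definition Omega_map ::
  "('o, 'm, 'z) precat_scheme \<Rightarrow> ('o \<Rightarrow> 'm resolution) \<Rightarrow> 'm \<Rightarrow> nat \<Rightarrow> 'm" where
  "Omega_map C P f = (SOME \<theta>. \<exists>u. \<theta> 0 = f \<and>
     (\<forall>i. \<theta> i \<in> homs C (Omega C (P (dom C f)) i) (Omega C (P (cod C f)) i) \<and>
          u i \<in> homs C (rterm C (P (dom C f)) i) (rterm C (P (cod C f)) i) \<and>
          \<theta> i \<cdot>\<^bsub>C\<^esub> rprj (P (dom C f)) i = rprj (P (cod C f)) i \<cdot>\<^bsub>C\<^esub> u i \<and>
          u i \<cdot>\<^bsub>C\<^esub> rinc (P (dom C f)) i = rinc (P (cod C f)) i \<cdot>\<^bsub>C\<^esub> \<theta> (Suc i)))"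


section \<open>Colimits of sequences of abelian groups\<close>

text \<open>\<open>dl_iter t i d : G i \<rightarrow> G (i + d)\<close> is the composite of the transition maps \<open>t j : G j \<rightarrow> G (j + 1)\<close>.\<close>

primrec dl_iter :: "(nat \<Rightarrow> 'a \<Rightarrow> 'a) \<Rightarrow> nat \<Rightarrow> nat \<Rightarrow> 'a \<Rightarrow> 'a" where
  "dl_iter t i 0 x = x"
| "dl_iter t i (Suc d) x = t (i + d) (dl_iter t i d x)"

definition dl_class ::
  "nat \<Rightarrow> (nat \<Rightarrow> 'a monoid) \<Rightarrow> (nat \<Rightarrow> 'a \<Rightarrow> 'a) \<Rightarrow> nat \<Rightarrow> 'a \<Rightarrow> (nat \<times> 'a) set" where
  "dl_class i0 G t i x = {(j, y). i0 \<le> j \<and> y \<in> carrier (G j) \<and>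
     (\<exists>k. i \<le> k \<and> j \<le> k \<and> dl_iter t i (k - i) x = dl_iter t j (k - j) y)}"

text \<open>The colimit over the indices \<open>i \<ge> i0\<close>.\<close>

definition dir_colim ::
  "nat \<Rightarrow> (nat \<Rightarrow> 'a monoid) \<Rightarrow> (nat \<Rightarrow> 'a \<Rightarrow> 'a) \<Rightarrow> (nat \<times> 'a) set monoid" where
  "dir_colim i0 G t = \<lparr>
     carrier = {dl_class i0 G t i x | i x. i0 \<le> i \<and> x \<in> carrier (G i)},
     mult = (\<lambda>c d. \<Union>{dl_class i0 G t (max i j)
               (dl_iter t i (max i j - i) x \<otimes>\<^bsub>G (max i j)\<^esub> dl_iter t j (max i j - j) y)
             | i x j y. (i, x) \<in> c \<and> (j, y) \<in> d}),
     one = dl_class i0 G t i0 \<one>\<^bsub>G i0\<^esub>\<rparr>"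

text \<open>The map into the colimit of \<open>(H, t)\<close> induced by a morphism \<open>h\<close> of direct systems.\<close>

definition dir_colim_map ::
  "nat \<Rightarrow> (nat \<Rightarrow> 'a monoid) \<Rightarrow> (nat \<Rightarrow> 'a \<Rightarrow> 'a) \<Rightarrow> (nat \<Rightarrow> 'a \<Rightarrow> 'a) \<Rightarrow>
   (nat \<times> 'a) set \<Rightarrow> (nat \<times> 'a) set" where
  "dir_colim_map i0 H t h c = \<Union>{dl_class i0 H t i (h i x) | i x. (i, x) \<in> c}"


section \<open>Bifunctors\<close>

text \<open>
  Values of a functor \<open>A\<^sup>o\<^sup>p \<times> A \<rightarrow> Ab\<close> together with its action \<open>bleft B f N\<close> for
  \<open>f : M' \<rightarrow> M\<close> and \<open>bright B M g\<close> for \<open>g : N \<rightarrow> N'\<close>.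
\<close>

record ('o, 'm, 'x) bifunctor =
  bob :: "'o \<Rightarrow> 'o \<Rightarrow> 'x monoid"
  bleft :: "'m \<Rightarrow> 'o \<Rightarrow> 'x \<Rightarrow> 'x"
  bright :: "'o \<Rightarrow> 'm \<Rightarrow> 'x \<Rightarrow> 'x"

definition naturally_isomorphic ::
  "('o, 'm, 'z) precat_scheme \<Rightarrow> ('o, 'm, 'x) bifunctor \<Rightarrow> ('o, 'm, 'y) bifunctor \<Rightarrow> bool" where
  "naturally_isomorphic C B D \<longleftrightarrow> (\<exists>\<Phi>.
     (\<forall>M\<in>obj C. \<forall>N\<in>obj C. \<Phi> M N \<in> iso (bob B M N) (bob D M N)) \<and>
     (\<forall>M\<in>obj C. \<forall>M'\<in>obj C. \<forall>N\<in>obj C. \<forall>f\<in>homs C M' M. \<forall>x\<in>carrier (bob B M N).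
        \<Phi> M' N (bleft B f N x) = bleft D f N (\<Phi> M N x)) \<and>
     (\<forall>M\<in>obj C. \<forall>N\<in>obj C. \<forall>N'\<in>obj C. \<forall>g\<in>homs C N N'. \<forall>x\<in>carrier (bob B M N).
        \<Phi> M N' (bright B M g x) = bright D M g (\<Phi> M N x)))"


section \<open>Complete cohomology\<close>

definition factoring :: "('o, 'm, 'z) precat_scheme \<Rightarrow> 'o set \<Rightarrow> 'o \<Rightarrow> 'o \<Rightarrow> 'm set" where
  "factoring C U A B = {h \<cdot>\<^bsub>C\<^esub> g | g h X. X \<in> U \<and> g \<in> homs C A X \<and> h \<in> homs C X B}"

definition stab :: "('o, 'm, 'z) precat_scheme \<Rightarrow> 'o set \<Rightarrow> 'o \<Rightarrow> 'o \<Rightarrow> 'm set monoid" where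
  "stab C U A B = hom_group C A B Mod factoring C U A B"

definition stab_proj :: "('o, 'm, 'z) precat_scheme \<Rightarrow> 'o set \<Rightarrow> 'o \<Rightarrow> 'o \<Rightarrow> 'm \<Rightarrow> 'm set" where
  "stab_proj C U A B f = factoring C U A B #>\<^bsub>hom_group C A B\<^esub> f"

text \<open>The map on a quotient of Hom groups induced by \<open>\<delta>\<close>.\<close>

definition induced :: "('m \<Rightarrow> 'x) \<Rightarrow> 'm set \<Rightarrow> 'x" where
  "induced \<delta> c = (THE x. \<forall>f\<in>c. \<delta> f = x)"

text \<open>The unique \<open>\<beta> : E \<rightarrow> stab A B\<close> whose composite with \<open>\<gamma> : Hom A B \<rightarrow> E\<close> is the projection.\<close>

definition beta ::
  "('o, 'm, 'z) precat_scheme \<Rightarrow> 'o set \<Rightarrow> 'x monoid \<Rightarrow> 'o \<Rightarrow> 'o \<Rightarrow> ('m \<Rightarrow> 'x) \<Rightarrow> 'x \<Rightarrow> 'm set" where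
  "beta C U E A B \<gamma> = (THE b. b \<in> hom E (stab C U A B) \<and> b \<in> extensional (carrier E) \<and>
     (\<forall>g\<in>homs C A B. b (\<gamma> g) = stab_proj C U A B g))"

text \<open>
  \<open>\<beta>\<delta>\<close> for preenvelopes \<open>0 \<rightarrow> M \<rightarrow> I \<rightarrow> \<Theta>M \<rightarrow> 0\<close> given by \<open>a, p\<close> and \<open>0 \<rightarrow> N \<rightarrow> J \<rightarrow> \<Theta>N \<rightarrow> 0\<close> given by
  \<open>b, q\<close>; both connecting morphisms take values in \<open>Ext\<^sup>1 (\<Theta>M) N\<close>.
\<close>

definition stab_trans_V ::
  "('o, 'm, 'z) precat_scheme \<Rightarrow> 'o set \<Rightarrow> 'm \<Rightarrow> 'm \<Rightarrow> 'm \<Rightarrow> 'm \<Rightarrow> 'm set \<Rightarrow> 'm set" where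
  "stab_trans_V C V a p b q c =
     beta C V (Ext C 1 (cod C p) (dom C b)) (cod C p) (cod C q)
       (\<lambda>g. conn_co C 0 (cod C p) b q {[g]})
       (induced (\<lambda>f. conn_contra C 0 a p (dom C b) {[f]}) c)"

text \<open>
  \<open>\<beta>\<delta>\<close> for precovers \<open>0 \<rightarrow> \<Omega>M \<rightarrow> P \<rightarrow> M \<rightarrow> 0\<close> given by \<open>a, p\<close> and \<open>0 \<rightarrow> \<Omega>N \<rightarrow> Q \<rightarrow> N \<rightarrow> 0\<close> given by
  \<open>b, q\<close>; both connecting morphisms take values in \<open>Ext\<^sup>1 M (\<Omega>N)\<close>.
\<close>

definition stab_trans_W ::
  "('o, 'm, 'z) precat_scheme \<Rightarrow> 'o set \<Rightarrow> 'm \<Rightarrow> 'm \<Rightarrow> 'm \<Rightarrow> 'm \<Rightarrow> 'm set \<Rightarrow> 'm set" where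
  "stab_trans_W C W a p b q c =
     beta C W (Ext C 1 (cod C p) (dom C b)) (dom C a) (dom C b)
       (\<lambda>g. conn_contra C 0 a p (dom C b) {[g]})
       (induced (\<lambda>f. conn_co C 0 (cod C p) b q {[f]}) c)"

text \<open>\<open>shift n i\<close> is \<open>i + n\<close>, used only for \<open>i \<ge> max 0 (-n)\<close>, i.e. for \<open>i \<ge> nat (-n)\<close>.\<close>

definition shift :: "int \<Rightarrow> nat \<Rightarrow> nat" where
  "shift n i = nat (int i + n)"

definition check_sys ::
  "('o, 'm, 'z) precat_scheme \<Rightarrow> 'o set \<Rightarrow> ('o \<Rightarrow> 'm coresolution) \<Rightarrow> int \<Rightarrow> 'o \<Rightarrow> 'o \<Rightarrow>
   nat \<Rightarrow> 'm set monoid" where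
  "check_sys C V I n M N i = stab C V (Theta C (I M) i) (Theta C (I N) (shift n i))"

definition check_trans ::
  "('o, 'm, 'z) precat_scheme \<Rightarrow> 'o set \<Rightarrow> ('o \<Rightarrow> 'm coresolution) \<Rightarrow> int \<Rightarrow> 'o \<Rightarrow> 'o \<Rightarrow>
   nat \<Rightarrow> 'm set \<Rightarrow> 'm set" where
  "check_trans C V I n M N i = stab_trans_V C V (cinc (I M) i) (cprj (I M) i)
     (cinc (I N) (shift n i)) (cprj (I N) (shift n i))"

definition check_Ext ::
  "('o, 'm, 'z) precat_scheme \<Rightarrow> 'o set \<Rightarrow> ('o \<Rightarrow> 'm coresolution) \<Rightarrow> int \<Rightarrow>
   ('o, 'm, (nat \<times> 'm set) set) bifunctor" where
  "check_Ext C V I n = \<lparr>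
     bob = (\<lambda>M N. dir_colim (nat (- n)) (check_sys C V I n M N) (check_trans C V I n M N)),
     bleft = (\<lambda>f N. dir_colim_map (nat (- n))
       (check_sys C V I n (dom C f) N) (check_trans C V I n (dom C f) N)
       (\<lambda>i. induced (\<lambda>h. stab_proj C V (Theta C (I (dom C f)) i) (Theta C (I N) (shift n i))
              (h \<cdot>\<^bsub>C\<^esub> Theta_map C I f i)))),
     bright = (\<lambda>M g. dir_colim_map (nat (- n))
       (check_sys C V I n M (cod C g)) (check_trans C V I n M (cod C g))
       (\<lambda>i. induced (\<lambda>h. stab_proj C V (Theta C (I M) i) (Theta C (I (cod C g)) (shift n i))
              (Theta_map C I g (shift n i) \<cdot>\<^bsub>C\<^esub> h))))\<rparr>"

definition hat_sys ::
  "('o, 'm, 'z) precat_scheme \<Rightarrow> 'o set \<Rightarrow> ('o \<Rightarrow> 'm resolution) \<Rightarrow> int \<Rightarrow> 'o \<Rightarrow> 'o \<Rightarrow>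
   nat \<Rightarrow> 'm set monoid" where
  "hat_sys C W P n M N i = stab C W (Omega C (P M) (shift n i)) (Omega C (P N) i)"

definition hat_trans ::
  "('o, 'm, 'z) precat_scheme \<Rightarrow> 'o set \<Rightarrow> ('o \<Rightarrow> 'm resolution) \<Rightarrow> int \<Rightarrow> 'o \<Rightarrow> 'o \<Rightarrow>
   nat \<Rightarrow> 'm set \<Rightarrow> 'm set" where
  "hat_trans C W P n M N i = stab_trans_W C W
     (rinc (P M) (shift n i)) (rprj (P M) (shift n i)) (rinc (P N) i) (rprj (P N) i)"

definition hat_Ext ::
  "('o, 'm, 'z) precat_scheme \<Rightarrow> 'o set \<Rightarrow> ('o \<Rightarrow> 'm resolution) \<Rightarrow> int \<Rightarrow>
   ('o, 'm, (nat \<times> 'm set) set) bifunctor" where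
  "hat_Ext C W P n = \<lparr>
     bob = (\<lambda>M N. dir_colim (nat (- n)) (hat_sys C W P n M N) (hat_trans C W P n M N)),
     bleft = (\<lambda>f N. dir_colim_map (nat (- n))
       (hat_sys C W P n (dom C f) N) (hat_trans C W P n (dom C f) N)
       (\<lambda>i. induced (\<lambda>h. stab_proj C W (Omega C (P (dom C f)) (shift n i)) (Omega C (P N) i)
              (h \<cdot>\<^bsub>C\<^esub> Omega_map C P f (shift n i))))),
     bright = (\<lambda>M g. dir_colim_map (nat (- n))
       (hat_sys C W P n M (cod C g)) (hat_trans C W P n M (cod C g))
       (\<lambda>i. induced (\<lambda>h. stab_proj C W (Omega C (P M) (shift n i)) (Omega C (P (cod C g)) i)
              (Omega_map C P g i \<cdot>\<^bsub>C\<^esub> h))))\<rparr>"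


section \<open>Satellites\<close>

text \<open>Additive functors to abelian groups; the variance is not recorded.\<close>

record ('o, 'm, 'x) abfun =
  fob :: "'o \<Rightarrow> 'x monoid"
  fmor :: "'m \<Rightarrow> 'x \<Rightarrow> 'x"

text \<open>
  \<open>sat_V\<close> is \<open>S\<^bsup>-1\<^esup>\<close> for contravariant, \<open>sat_W\<close> for covariant functors.  On a morphism \<open>f\<close> they are the
  restriction of \<open>F(\<Theta>f)\<close> (resp. \<open>F(\<Omega>f)\<close>) to the kernels.
\<close>

definition sat_V ::
  "('o, 'm, 'z) precat_scheme \<Rightarrow> ('o \<Rightarrow> 'm coresolution) \<Rightarrow> ('o, 'm, 'x) abfun \<Rightarrow> ('o, 'm, 'x) abfun"
  where
  "sat_V C I F = \<lparr>
     fob = (\<lambda>M. (fob F (Theta C (I M) 1))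
       \<lparr>carrier := kernel (fob F (Theta C (I M) 1)) (fob F (cterm C (I M) 0))
                     (fmor F (cprj (I M) 0))\<rparr>),
     fmor = (\<lambda>f. fmor F (Theta_map C I f 1))\<rparr>"

definition sat_W ::
  "('o, 'm, 'z) precat_scheme \<Rightarrow> ('o \<Rightarrow> 'm resolution) \<Rightarrow> ('o, 'm, 'x) abfun \<Rightarrow> ('o, 'm, 'x) abfun"
  where
  "sat_W C P G = \<lparr>
     fob = (\<lambda>M. (fob G (Omega C (P M) 1))
       \<lparr>carrier := kernel (fob G (Omega C (P M) 1)) (fob G (rterm C (P M) 0))
                     (fmor G (rinc (P M) 0))\<rparr>),
     fmor = (\<lambda>f. fmor G (Omega_map C P f 1))\<rparr>"

text \<open>\<open>S\<^bsup>-1\<^esup>\<close> of a natural transformation, given by its components.\<close>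

definition sat_V_nat ::
  "('o, 'm, 'z) precat_scheme \<Rightarrow> ('o \<Rightarrow> 'm coresolution) \<Rightarrow> ('o \<Rightarrow> 'x \<Rightarrow> 'x) \<Rightarrow> 'o \<Rightarrow> 'x \<Rightarrow> 'x" where
  "sat_V_nat C I \<eta> M = \<eta> (Theta C (I M) 1)"

definition sat_W_nat ::
  "('o, 'm, 'z) precat_scheme \<Rightarrow> ('o \<Rightarrow> 'm resolution) \<Rightarrow> ('o \<Rightarrow> 'x \<Rightarrow> 'x) \<Rightarrow> 'o \<Rightarrow> 'x \<Rightarrow> 'x" where
  "sat_W_nat C P \<eta> M = \<eta> (Omega C (P M) 1)"

definition Ext_contra ::
  "('o, 'm, 'z) precat_scheme \<Rightarrow> int \<Rightarrow> 'o \<Rightarrow> ('o, 'm, 'm list set) abfun" where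
  "Ext_contra C k N = \<lparr>fob = (\<lambda>M. Ext C k M N), fmor = ext_pull C\<rparr>"

definition Ext_co ::
  "('o, 'm, 'z) precat_scheme \<Rightarrow> int \<Rightarrow> 'o \<Rightarrow> ('o, 'm, 'm list set) abfun" where
  "Ext_co C k M = \<lparr>fob = (\<lambda>N. Ext C k M N), fmor = ext_push C\<rparr>"

definition sat_V_sys ::
  "('o, 'm, 'z) precat_scheme \<Rightarrow> ('o \<Rightarrow> 'm coresolution) \<Rightarrow> int \<Rightarrow> 'o \<Rightarrow> 'o \<Rightarrow>
   nat \<Rightarrow> 'm list set monoid" where
  "sat_V_sys C I n M N i = fob ((sat_V C I ^^ i) (Ext_contra C (n + int i) N)) M"

definition sat_V_trans ::
  "('o, 'm, 'z) precat_scheme \<Rightarrow> ('o \<Rightarrow> 'm coresolution) \<Rightarrow> int \<Rightarrow> 'o \<Rightarrow> 'o \<Rightarrow>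
   nat \<Rightarrow> 'm list set \<Rightarrow> 'm list set" where
  "sat_V_trans C I n M N i = conn_contra C (n + int i) (cinc (I M) i) (cprj (I M) i) N"

definition colim_sat_V ::
  "('o, 'm, 'z) precat_scheme \<Rightarrow> ('o \<Rightarrow> 'm coresolution) \<Rightarrow> int \<Rightarrow>
   ('o, 'm, (nat \<times> 'm list set) set) bifunctor" where
  "colim_sat_V C I n = \<lparr>
     bob = (\<lambda>M N. dir_colim 1 (sat_V_sys C I n M N) (sat_V_trans C I n M N)),
     bleft = (\<lambda>f N. dir_colim_map 1 (sat_V_sys C I n (dom C f) N) (sat_V_trans C I n (dom C f) N)
       (\<lambda>i. fmor ((sat_V C I ^^ i) (Ext_contra C (n + int i) N)) f)),
     bright = (\<lambda>M g. dir_colim_map 1 (sat_V_sys C I n M (cod C g)) (sat_V_trans C I n M (cod C g))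
       (\<lambda>i. (sat_V_nat C I ^^ i) (\<lambda>_. ext_push C g) M))\<rparr>"

definition sat_W_sys ::
  "('o, 'm, 'z) precat_scheme \<Rightarrow> ('o \<Rightarrow> 'm resolution) \<Rightarrow> int \<Rightarrow> 'o \<Rightarrow> 'o \<Rightarrow>
   nat \<Rightarrow> 'm list set monoid" where
  "sat_W_sys C P n M N j = fob ((sat_W C P ^^ j) (Ext_co C (n + int j) M)) N"

definition sat_W_trans ::
  "('o, 'm, 'z) precat_scheme \<Rightarrow> ('o \<Rightarrow> 'm resolution) \<Rightarrow> int \<Rightarrow> 'o \<Rightarrow> 'o \<Rightarrow>
   nat \<Rightarrow> 'm list set \<Rightarrow> 'm list set" where
  "sat_W_trans C P n M N j = conn_co C (n + int j) M (rinc (P N) j) (rprj (P N) j)"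

definition colim_sat_W ::
  "('o, 'm, 'z) precat_scheme \<Rightarrow> ('o \<Rightarrow> 'm resolution) \<Rightarrow> int \<Rightarrow>
   ('o, 'm, (nat \<times> 'm list set) set) bifunctor" where
  "colim_sat_W C P n = \<lparr>
     bob = (\<lambda>M N. dir_colim 1 (sat_W_sys C P n M N) (sat_W_trans C P n M N)),
     bleft = (\<lambda>f N. dir_colim_map 1 (sat_W_sys C P n (dom C f) N) (sat_W_trans C P n (dom C f) N)
       (\<lambda>j. (sat_W_nat C P ^^ j) (\<lambda>_. ext_pull C f) N)),
     bright = (\<lambda>M g. dir_colim_map 1 (sat_W_sys C P n M (cod C g)) (sat_W_trans C P n M (cod C g))
       (\<lambda>j. fmor ((sat_W C P ^^ j) (Ext_co C (n + int j) M)) g))\<rparr>"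

end

theory Submission
  imports Defs
begin

text \<open>
  A morphism \<open>f : \<Theta>\<^sup>i M \<rightarrow> \<Theta>\<^sup>n\<^sup>+\<^sup>i N\<close> is sent to the Yoneda product of \<open>f\<close> with the short exact sequence
  starting at \<open>\<Theta>\<^sup>i M\<close> on one side and with the \<open>n + i\<close> short exact sequences of the coresolution of
  \<open>N\<close> on the other.  This class in \<open>Ext\<^sup>n\<^sup>+\<^sup>i\<^sup>+\<^sup>1(\<Theta>\<^sup>i\<^sup>+\<^sup>1 M, N)\<close> vanishes on the next term of the coresolution
  of \<open>M\<close>, hence lies in the satellite, and depends only on the stable class of \<open>f\<close>.

  Dimension shifting along the coresolution of \<open>N\<close> shows that the map is bijective in the colimit.
  The groups \<open>Ext\<^sup>j(\<Theta>\<^sup>k M, V)\<close> vanish for \<open>j, k \<ge> 1\<close>, so \<open>Ext\<^sup>1(\<Theta>\<^sup>i\<^sup>+\<^sup>1 M, \<Theta>\<^sup>n\<^sup>+\<^sup>i N)\<close> embeds into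
  \<open>Ext\<^sup>n\<^sup>+\<^sup>i\<^sup>+\<^sup>1(\<Theta>\<^sup>i\<^sup>+\<^sup>1 M, N)\<close>, and the transition map of the stable system already factors through
  this \<open>Ext\<^sup>1\<close>.  Conversely every class in \<open>Ext\<^sup>n\<^sup>+\<^sup>i(\<Theta>\<^sup>i M, N)\<close> with \<open>i \<ge> 1\<close> comes from some \<open>f\<close>, whose
  image is the value of the next transition map at that class.

  The second isomorphism is the first one in the opposite category, where an extension is read
  backwards.
\<close>


section \<open>Abelian categories\<close>

text \<open>Ext is given by Yoneda's definition and no projectives or injectives are available, so
  the group laws and both long exact sequences must come from zigzags of extensions. The main device
  is a ladder with arbitrary morphisms at its ends (\<open>emap\<close>): it covers equivalence,
  pullback, pushout and naturality at once, and a ladder from \<open>E\<close> to \<open>F\<close>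
  with ends \<open>g\<close> and \<open>f\<close> identifies the pushout of \<open>E\<close> along
  \<open>g\<close> with the pullback of \<open>F\<close> along \<open>f\<close>. Contravariant
  statements follow by reversal, which respects carriers but not the chosen biproducts and hence not
  literally the Baer sums; the comparison map is therefore built over an abstract calculus,
  satisfied by \<open>Ext C\<close> in either order of its arguments. Two points shape the
  comparison. It must raise the index by one, because only after a connecting morphism do the
  morphisms factoring through \<open>V\<close> become trivial. And an iterated satellite acts on a
  morphism by repeated one-step lifts, while the stable groups use a single lift to the whole
  coresolution; naturality holds because the two agree modulo morphisms factoring through
  \<open>V\<close>.\<close>

context abelian_category
begin

lemma homs_iff: "f \<in> homs C A B \<longleftrightarrow> f \<in> arr C \<and> dom C f = A \<and> cod C f = B"
  by (simp add: homs_def)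

lemma homsI [intro]: "\<lbrakk>f \<in> arr C; dom C f = A; cod C f = B\<rbrakk> \<Longrightarrow> f \<in> homs C A B"
  by (simp add: homs_def)

lemma homsD: "f \<in> homs C A B \<Longrightarrow> f \<in> arr C" "f \<in> homs C A B \<Longrightarrow> dom C f = A"
  "f \<in> homs C A B \<Longrightarrow> cod C f = B"
  by (simp_all add: homs_def)

lemma homs_obj: "f \<in> homs C A B \<Longrightarrow> A \<in> obj C" "f \<in> homs C A B \<Longrightarrow> B \<in> obj C"
  using dom_obj cod_obj by (auto simp: homs_def)

declare dom_obj [simp] cod_obj [simp]

lemma cmp_arr [simp]:
  assumes "f \<in> arr C" "g \<in> arr C" "cod C f = dom C g"
  shows "g \<cdot> f \<in> arr C" "dom C (g \<cdot> f) = dom C f" "cod C (g \<cdot> f) = cod C g"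
  using cmp_hom[of f "dom C f" "cod C f" g "cod C g"] assms by (auto simp: homs_def)

lemma idn_arr [simp]:
  assumes "A \<in> obj C" shows "idn C A \<in> arr C" "dom C (idn C A) = A" "cod C (idn C A) = A"
  using idn_hom[OF assms] by (auto simp: homs_def)

lemma cmp_id_right [simp]: "\<lbrakk>f \<in> arr C; dom C f = A\<rbrakk> \<Longrightarrow> f \<cdot> idn C A = f"
  using cmp_idn by (auto simp: homs_def)

lemma cmp_id_left [simp]: "\<lbrakk>f \<in> arr C; cod C f = B\<rbrakk> \<Longrightarrow> idn C B \<cdot> f = f"
  using idn_cmp by (auto simp: homs_def)

lemma assoc [simp]:
  "\<lbrakk>f \<in> arr C; g \<in> arr C; h \<in> arr C; cod C f = dom C g; cod C g = dom C h\<rbrakk>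
    \<Longrightarrow> (h \<cdot> g) \<cdot> f = h \<cdot> (g \<cdot> f)"
  using cmp_assoc[of f "dom C f" "cod C f" g "cod C g" h "cod C h"] by (auto simp: homs_def)

text \<open>The simplifier nests composites to the right, so a known product
  \<open>g \<cdot> f\<close> is hidden inside \<open>g \<cdot> (f \<cdot> x)\<close>; this form lets
  such an equation be applied to a longer composite.\<close>

lemma reassoc:
  "\<lbrakk>g \<cdot> f = h; x \<in> arr C; f \<in> arr C; g \<in> arr C; cod C x = dom C f; cod C f = dom C g\<rbrakk>
    \<Longrightarrow> g \<cdot> (f \<cdot> x) = h \<cdot> x"
  using assoc[of x f g] by simp

section \<open>The Hom groups and bilinearity of composition\<close>

lemma zer_hom: assumes "A \<in> obj C" "B \<in> obj C" shows "zer C A B \<in> homs C A B"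
proof -
  interpret G: comm_group "hom_group C A B" using assms by (rule hom_comm_group)
  show ?thesis using G.one_closed by (simp add: hom_group_def)
qed

lemma zer_arr [simp]:
  assumes "A \<in> obj C" "B \<in> obj C"
  shows "zer C A B \<in> arr C" "dom C (zer C A B) = A" "cod C (zer C A B) = B"
  using zer_hom[OF assms] by (auto simp: homs_def)

lemma plus_hom: assumes "f \<in> homs C A B" "g \<in> homs C A B" shows "plus C f g \<in> homs C A B"
proof -
  interpret G: comm_group "hom_group C A B" using assms by (intro hom_comm_group homs_obj)
  show ?thesis using G.m_closed assms by (simp add: hom_group_def)
qed

lemma plus_arr [simp]:
  assumes "f \<in> arr C" "g \<in> arr C" "dom C f = dom C g" "cod C f = cod C g"
  shows "plus C f g \<in> arr C" "dom C (plus C f g) = dom C g" "cod C (plus C f g) = cod C g"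
  using plus_hom[of f "dom C g" "cod C g" g] assms by (auto simp: homs_def)

lemma plus_comm:
  assumes "f \<in> arr C" "g \<in> arr C" "dom C f = dom C g" "cod C f = cod C g"
  shows "plus C f g = plus C g f"
proof -
  interpret G: comm_group "hom_group C (dom C f) (cod C f)" using assms by (intro hom_comm_group) auto
  show ?thesis using G.m_comm[of f g] assms by (simp add: hom_group_def homs_def)
qed

lemma plus_assoc:
  assumes "f \<in> arr C" "g \<in> arr C" "h \<in> arr C" "dom C f = dom C g" "cod C f = cod C g"
    "dom C g = dom C h" "cod C g = cod C h"
  shows "plus C (plus C f g) h = plus C f (plus C g h)"
proof -
  interpret G: comm_group "hom_group C (dom C f) (cod C f)" using assms by (intro hom_comm_group) auto
  show ?thesis using G.m_assoc[of f g h] assms by (simp add: hom_group_def homs_def)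
qed

lemma plus_zer [simp]:
  assumes "f \<in> arr C" "dom C f = A" "cod C f = B"
  shows "plus C f (zer C A B) = f" "plus C (zer C A B) f = f"
proof -
  have "A \<in> obj C" "B \<in> obj C" using assms by auto
  then interpret G: comm_group "hom_group C A B" by (intro hom_comm_group)
  show "plus C f (zer C A B) = f" "plus C (zer C A B) f = f"
    using G.r_one[of f] G.l_one[of f] assms by (simp_all add: hom_group_def homs_def)
qed

text \<open>Depends on the morphism alone, whereas the inverse of HOL-Algebra needs the Hom group to
  be named; \<open>hom_inv\<close> later identifies the two.\<close>

definition neg :: "'m \<Rightarrow> 'm" where
  "neg f = (SOME g. g \<in> homs C (dom C f) (cod C f) \<and> plus C f g = zer C (dom C f) (cod C f))"

lemma neg: 
  assumes "f \<in> arr C"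
  shows "neg f \<in> homs C (dom C f) (cod C f) \<and> plus C f (neg f) = zer C (dom C f) (cod C f)"
proof -
  interpret G: comm_group "hom_group C (dom C f) (cod C f)" using assms by (intro hom_comm_group) auto
  have "f \<in> carrier (hom_group C (dom C f) (cod C f))" using assms by (simp add: hom_group_def homs_def)
  then have "\<exists>g. g \<in> homs C (dom C f) (cod C f) \<and> plus C f g = zer C (dom C f) (cod C f)"
    using G.r_inv[of f] G.inv_closed[of f] by (auto simp: hom_group_def)
  then show ?thesis unfolding neg_def by (rule someI_ex)
qed

lemma neg_arr [simp]:
  assumes "f \<in> arr C"
  shows "neg f \<in> arr C" "dom C (neg f) = dom C f" "cod C (neg f) = cod C f"
  using neg[OF assms] by (auto simp: homs_def)

lemma plus_neg [simp]:
  assumes "f \<in> arr C"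
  shows "plus C f (neg f) = zer C (dom C f) (cod C f)" "plus C (neg f) f = zer C (dom C f) (cod C f)"
  using neg[OF assms] plus_comm[of f "neg f"] by (auto simp: homs_def assms)

lemma plus_cancel:
  assumes "f \<in> arr C" "g \<in> arr C" "h \<in> arr C" "dom C f = dom C g" "cod C f = cod C g"
    "dom C g = dom C h" "cod C g = cod C h" "plus C f h = plus C g h"
  shows "f = g"
proof -
  have "plus C (plus C f h) (neg h) = plus C (plus C g h) (neg h)" using assms by simp
  then show ?thesis using assms(1-7) by (simp add: plus_assoc)
qed

lemma diff_zero:
  assumes "f \<in> arr C" "g \<in> arr C" "dom C f = dom C g" "cod C f = cod C g"
    "plus C f (neg g) = zer C (dom C g) (cod C g)"
  shows "f = g"
  by (rule plus_cancel[of f g "neg g"]) (use assms in auto)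

lemma distl:
  assumes "f \<in> arr C" "f' \<in> arr C" "g \<in> arr C" "dom C f = dom C f'" "cod C f = cod C f'"
    "cod C f' = dom C g"
  shows "g \<cdot> plus C f f' = plus C (g \<cdot> f) (g \<cdot> f')"
  using cmp_plus[of f "dom C f" "cod C f" f' g "cod C g"] assms by (auto simp: homs_def)

lemma distr:
  assumes "f \<in> arr C" "g \<in> arr C" "g' \<in> arr C" "dom C g = dom C g'" "cod C g = cod C g'"
    "cod C f = dom C g'"
  shows "plus C g g' \<cdot> f = plus C (g \<cdot> f) (g' \<cdot> f)"
  using plus_cmp[of f "dom C f" "cod C f" g "cod C g" g'] assms by (auto simp: homs_def)

lemma plus_self_zer:
  assumes "f \<in> arr C" "plus C f f = f" shows "f = zer C (dom C f) (cod C f)"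
  by (rule plus_cancel[of f _ f]) (use assms in auto)

text \<open>Composition is additive, so the composite with zero equals its own double, and the only
  idempotent of a group is its unit.\<close>

lemma cmp_zer [simp]:
  assumes "g \<in> arr C" "A \<in> obj C" "dom C g = B"
  shows "g \<cdot> zer C A B = zer C A (cod C g)"
proof -
  have o: "B \<in> obj C" using assms by auto
  have "g \<cdot> plus C (zer C A B) (zer C A B) = plus C (g \<cdot> zer C A B) (g \<cdot> zer C A B)"
    using assms o by (intro distl) auto
  then have "plus C (g \<cdot> zer C A B) (g \<cdot> zer C A B) = g \<cdot> zer C A B" using o assms(2) by simp
  then have "g \<cdot> zer C A B = zer C (dom C (g \<cdot> zer C A B)) (cod C (g \<cdot> zer C A B))"
    using assms o by (intro plus_self_zer) auto
  then show ?thesis using assms o by simp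
qed

lemma zer_cmp [simp]:
  assumes "f \<in> arr C" "B \<in> obj C" "cod C f = A"
  shows "zer C A B \<cdot> f = zer C (dom C f) B"
proof -
  have o: "A \<in> obj C" using assms by auto
  have "plus C (zer C A B) (zer C A B) \<cdot> f = plus C (zer C A B \<cdot> f) (zer C A B \<cdot> f)"
    using assms o by (intro distr) auto
  then have "plus C (zer C A B \<cdot> f) (zer C A B \<cdot> f) = zer C A B \<cdot> f" using assms(2) o by simp
  then have "zer C A B \<cdot> f = zer C (dom C (zer C A B \<cdot> f)) (cod C (zer C A B \<cdot> f))"
    using assms o by (intro plus_self_zer) auto
  then show ?thesis using assms o by simp
qed

lemma neg_unique:
  assumes "f \<in> arr C" "g \<in> arr C" "dom C f = dom C g" "cod C f = cod C g"
    "plus C g f = zer C (dom C f) (cod C f)"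
  shows "g = neg f"
  by (rule plus_cancel[of g _ f]) (use assms in auto)

lemma cmp_neg [simp]:
  assumes "f \<in> arr C" "g \<in> arr C" "cod C f = dom C g" shows "g \<cdot> neg f = neg (g \<cdot> f)"
  by (rule neg_unique) (use assms distl[of "neg f" f g] in auto)

lemma neg_cmp [simp]:
  assumes "f \<in> arr C" "g \<in> arr C" "cod C f = dom C g" shows "neg g \<cdot> f = neg (g \<cdot> f)"
  by (rule neg_unique) (use assms distr[of f "neg g" g] in auto)

lemma neg_zer [simp]: "\<lbrakk>A \<in> obj C; B \<in> obj C\<rbrakk> \<Longrightarrow> neg (zer C A B) = zer C A B"
  by (rule neg_unique[symmetric]) auto

section \<open>Monomorphisms, epimorphisms, kernels and cokernels\<close>

lemma monoD: "\<lbrakk>is_mono C f; g \<in> arr C; h \<in> arr C; dom C g = dom C h; cod C g = dom C f;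
    cod C h = dom C f; f \<cdot> g = f \<cdot> h\<rbrakk> \<Longrightarrow> g = h"
  unfolding is_mono_def by blast

lemma epiD: "\<lbrakk>is_epi C f; g \<in> arr C; h \<in> arr C; cod C g = cod C h; dom C g = cod C f;
    dom C h = cod C f; g \<cdot> f = h \<cdot> f\<rbrakk> \<Longrightarrow> g = h"
  unfolding is_epi_def by blast

lemma mono_arr [simp]: "is_mono C f \<Longrightarrow> f \<in> arr C" by (simp add: is_mono_def)
lemma epi_arr [simp]: "is_epi C f \<Longrightarrow> f \<in> arr C" by (simp add: is_epi_def)

text \<open>Hom sets are groups, so two morphisms with equal composites can be subtracted, and only
  those with composite zero have to be tested.\<close>

lemma monoI:
  assumes "f \<in> arr C"
    and *: "\<And>x. \<lbrakk>x \<in> arr C; cod C x = dom C f; f \<cdot> x = zer C (dom C x) (cod C f)\<rbrakk>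
      \<Longrightarrow> x = zer C (dom C x) (dom C f)"
  shows "is_mono C f"
  unfolding is_mono_def
proof (intro conjI ballI impI)
  fix g h assume g: "g \<in> arr C" "h \<in> arr C"
    "dom C g = dom C h \<and> cod C g = dom C f \<and> cod C h = dom C f \<and> f \<cdot> g = f \<cdot> h"
  have "f \<cdot> plus C g (neg h) = zer C (dom C h) (cod C f)"
    using g assms(1) by (simp add: distl)
  then have "plus C g (neg h) = zer C (dom C h) (dom C f)"
    using *[of "plus C g (neg h)"] g assms(1) by simp
  then show "g = h" using diff_zero[of g h] g by simp
qed fact

lemma epiI:
  assumes "f \<in> arr C"
    and *: "\<And>x. \<lbrakk>x \<in> arr C; dom C x = cod C f; x \<cdot> f = zer C (dom C f) (cod C x)\<rbrakk>
      \<Longrightarrow> x = zer C (cod C f) (cod C x)"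
  shows "is_epi C f"
  unfolding is_epi_def
proof (intro conjI ballI impI)
  fix g h assume g: "g \<in> arr C" "h \<in> arr C"
    "cod C g = cod C h \<and> dom C g = cod C f \<and> dom C h = cod C f \<and> g \<cdot> f = h \<cdot> f"
  have "plus C g (neg h) \<cdot> f = zer C (dom C f) (cod C h)"
    using g assms(1) by (simp add: distr)
  then have "plus C g (neg h) = zer C (cod C f) (cod C h)"
    using *[of "plus C g (neg h)"] g assms(1) by simp
  then show "g = h" using diff_zero[of g h] g by simp
qed fact

lemma mono_zero:
  "\<lbrakk>is_mono C f; x \<in> arr C; cod C x = dom C f; f \<cdot> x = zer C (dom C x) (cod C f)\<rbrakk>
    \<Longrightarrow> x = zer C (dom C x) (dom C f)"
  by (rule monoD[of f]) auto

lemma epi_zero: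
  "\<lbrakk>is_epi C f; x \<in> arr C; dom C x = cod C f; x \<cdot> f = zer C (dom C f) (cod C x)\<rbrakk>
    \<Longrightarrow> x = zer C (cod C f) (cod C x)"
  by (rule epiD[of f]) auto

lemma kernelD:
  assumes "is_kernel C k f"
  shows "f \<in> arr C" "k \<in> arr C" "cod C k = dom C f" "f \<cdot> k = zer C (dom C k) (cod C f)"
  using assms by (auto simp: is_kernel_def)

lemma cokernelD:
  assumes "is_cokernel C c f"
  shows "f \<in> arr C" "c \<in> arr C" "dom C c = cod C f" "c \<cdot> f = zer C (dom C f) (cod C c)"
  using assms by (auto simp: is_cokernel_def)

lemma kernel_lift:
  assumes "is_kernel C k f" "h \<in> arr C" "cod C h = dom C f" "f \<cdot> h = zer C (dom C h) (cod C f)"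
  obtains u where "u \<in> arr C" "dom C u = dom C h" "cod C u = dom C k" "k \<cdot> u = h"
  using assms unfolding is_kernel_def homs_def by blast

lemma cokernel_desc:
  assumes "is_cokernel C c f" "h \<in> arr C" "dom C h = cod C f" "h \<cdot> f = zer C (dom C f) (cod C h)"
  obtains u where "u \<in> arr C" "dom C u = cod C c" "cod C u = cod C h" "u \<cdot> c = h"
  using assms unfolding is_cokernel_def homs_def by blast

lemma kernel_ex:
  assumes "is_kernel C k f" "h \<in> arr C" "cod C h = dom C f" "f \<cdot> h = zer C (dom C h) (cod C f)"
  shows "\<exists>u. u \<in> arr C \<and> dom C u = dom C h \<and> cod C u = dom C k \<and> k \<cdot> u = h"
  using kernel_lift[OF assms] by metis

lemma cokernel_ex:
  assumes "is_cokernel C c f" "h \<in> arr C" "dom C h = cod C f" "h \<cdot> f = zer C (dom C f) (cod C h)"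
  shows "\<exists>u. u \<in> arr C \<and> dom C u = cod C c \<and> cod C u = cod C h \<and> u \<cdot> c = h"
  using cokernel_desc[OF assms] by metis

lemma kernel_mono:
  assumes "is_kernel C k f" shows "is_mono C k"
proof (rule monoI)
  note kernelD[OF assms, simp]
  fix x assume x: "x \<in> arr C" "cod C x = dom C k" "k \<cdot> x = zer C (dom C x) (cod C k)"
  have *: "\<exists>!u. u \<in> homs C (dom C x) (dom C k) \<and> k \<cdot> u = zer C (dom C x) (dom C f)"
    using assms x unfolding is_kernel_def
    by (elim conjE ballE[of _ _ "zer C (dom C x) (dom C f)"]) auto
  moreover have "x \<in> homs C (dom C x) (dom C k) \<and> k \<cdot> x = zer C (dom C x) (dom C f)" using x by auto
  moreover have "zer C (dom C x) (dom C k) \<in> homs C (dom C x) (dom C k)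
    \<and> k \<cdot> zer C (dom C x) (dom C k) = zer C (dom C x) (dom C f)" using x by (auto simp: homs_def)
  ultimately show "x = zer C (dom C x) (dom C k)" by blast
qed (rule kernelD[OF assms])

lemma cokernel_epi:
  assumes "is_cokernel C c f" shows "is_epi C c"
proof (rule epiI)
  note cokernelD[OF assms, simp]
  fix x assume x: "x \<in> arr C" "dom C x = cod C c" "x \<cdot> c = zer C (dom C c) (cod C x)"
  have *: "\<exists>!u. u \<in> homs C (cod C c) (cod C x) \<and> u \<cdot> c = zer C (cod C f) (cod C x)"
    using assms x unfolding is_cokernel_def
    by (elim conjE ballE[of _ _ "zer C (cod C f) (cod C x)"]) auto
  moreover have "x \<in> homs C (cod C c) (cod C x) \<and> x \<cdot> c = zer C (cod C f) (cod C x)" using x by auto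
  moreover have "zer C (cod C c) (cod C x) \<in> homs C (cod C c) (cod C x)
    \<and> zer C (cod C c) (cod C x) \<cdot> c = zer C (cod C f) (cod C x)" using x by (auto simp: homs_def)
  ultimately show "x = zer C (cod C c) (cod C x)" by blast
qed (rule cokernelD[OF assms])

lemma kernelI:
  assumes "f \<in> arr C" "is_mono C k" "cod C k = dom C f" "f \<cdot> k = zer C (dom C k) (cod C f)"
    and *: "\<And>h. \<lbrakk>h \<in> arr C; cod C h = dom C f; f \<cdot> h = zer C (dom C h) (cod C f)\<rbrakk>
      \<Longrightarrow> \<exists>u. u \<in> arr C \<and> dom C u = dom C h \<and> cod C u = dom C k \<and> k \<cdot> u = h"
  shows "is_kernel C k f"
  unfolding is_kernel_def
proof (intro conjI ballI impI)
  fix h assume h: "h \<in> arr C" "cod C h = dom C f \<and> f \<cdot> h = zer C (dom C h) (cod C f)"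
  show "\<exists>!u. u \<in> homs C (dom C h) (dom C k) \<and> k \<cdot> u = h"
    using *[of h] h monoD[OF assms(2)] by (auto simp: homs_def intro!: ex_ex1I)
qed (use assms in auto)

lemma cokernelI:
  assumes "f \<in> arr C" "is_epi C c" "dom C c = cod C f" "c \<cdot> f = zer C (dom C f) (cod C c)"
    and *: "\<And>h. \<lbrakk>h \<in> arr C; dom C h = cod C f; h \<cdot> f = zer C (dom C f) (cod C h)\<rbrakk>
      \<Longrightarrow> \<exists>u. u \<in> arr C \<and> dom C u = cod C c \<and> cod C u = cod C h \<and> u \<cdot> c = h"
  shows "is_cokernel C c f"
  unfolding is_cokernel_def
proof (intro conjI ballI impI)
  fix h assume h: "h \<in> arr C" "dom C h = cod C f \<and> h \<cdot> f = zer C (dom C f) (cod C h)"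
  show "\<exists>!u. u \<in> homs C (cod C c) (cod C h) \<and> u \<cdot> c = h"
    using *[of h] h epiD[OF assms(2)] by (auto simp: homs_def intro!: ex_ex1I)
qed (use assms in auto)

text \<open>By normality \<open>f\<close> is the kernel of some \<open>g\<close>; since
  \<open>g \<cdot> f\<close> is zero, \<open>g\<close> factors through \<open>c\<close>. Whatever
  \<open>c\<close> kills is therefore killed by \<open>g\<close> and lifts along
  \<open>f\<close>.\<close>

lemma mono_is_kernel_of_cokernel:
  assumes "is_mono C f" "is_cokernel C c f" shows "is_kernel C f c"
proof -
  note cokernelD[OF assms(2), simp]
  obtain g where g: "is_kernel C f g" using mono_normal[OF assms(1)] by blast
  note kernelD[OF g, simp]
  obtain u where u: "u \<in> arr C" "dom C u = cod C c" "cod C u = cod C g" "u \<cdot> c = g"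
    by (rule cokernel_desc[OF assms(2), of g]) auto
  show ?thesis
  proof (rule kernelI)
    fix h assume h: "h \<in> arr C" "cod C h = dom C c" "c \<cdot> h = zer C (dom C h) (cod C c)"
    have "u \<cdot> (c \<cdot> h) = g \<cdot> h" by (rule reassoc[OF u(4)]) (use h u in auto)
    then have "g \<cdot> h = zer C (dom C h) (cod C g)" using h u by simp
    then show "\<exists>v. v \<in> arr C \<and> dom C v = dom C h \<and> cod C v = dom C f \<and> f \<cdot> v = h"
      by (intro kernel_ex[OF g]) (use h kernelD(3)[OF g] cokernelD(3)[OF assms(2)] in auto)
  qed (use assms in auto)
qed

lemma epi_is_cokernel_of_kernel:
  assumes "is_epi C f" "is_kernel C k f" shows "is_cokernel C f k"
proof -
  note kernelD[OF assms(2), simp]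
  obtain g where g: "is_cokernel C f g" using epi_normal[OF assms(1)] by blast
  note cokernelD[OF g, simp]
  obtain u where u: "u \<in> arr C" "dom C u = dom C g" "cod C u = dom C k" "k \<cdot> u = g"
    by (rule kernel_lift[OF assms(2), of g]) auto
  show ?thesis
  proof (rule cokernelI)
    fix h assume h: "h \<in> arr C" "dom C h = cod C k" "h \<cdot> k = zer C (dom C k) (cod C h)"
    have "h \<cdot> (k \<cdot> u) = zer C (dom C k) (cod C h) \<cdot> u" by (rule reassoc[OF h(3)]) (use h u in auto)
    then have "h \<cdot> g = zer C (dom C g) (cod C h)" using h u by simp
    then show "\<exists>v. v \<in> arr C \<and> dom C v = cod C f \<and> cod C v = cod C h \<and> v \<cdot> f = h"
      by (intro cokernel_ex[OF g]) (use h kernelD(3)[OF assms(2)] cokernelD(3)[OF g] in auto)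
  qed (use assms in auto)
qed

text \<open>As a normal epimorphism \<open>f\<close> is the cokernel of some \<open>k\<close>. Since
  \<open>f\<close> is mono, \<open>k\<close> vanishes, so the identity descends along
  \<open>f\<close> to a left inverse, and cancelling the epimorphism \<open>f\<close> makes it
  two-sided.\<close>

lemma mono_epi_iso:
  assumes "is_mono C f" "is_epi C f"
  obtains g where "g \<in> arr C" "dom C g = cod C f" "cod C g = dom C f"
    "g \<cdot> f = idn C (dom C f)" "f \<cdot> g = idn C (cod C f)"
proof -
  obtain k where k: "is_cokernel C f k" using epi_normal[OF assms(2)] by blast
  note cokernelD[OF k, simp]
  have "k = zer C (dom C k) (dom C f)" by (rule mono_zero[OF assms(1)]) auto
  then have z: "idn C (dom C f) \<cdot> k = zer C (dom C k) (dom C f)" by simp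
  obtain g where g: "g \<in> arr C" "dom C g = cod C f" "cod C g = dom C f" "g \<cdot> f = idn C (dom C f)"
    using cokernel_desc[OF k, of "idn C (dom C f)"] z by auto
  have "f \<cdot> g = idn C (cod C f)"
  proof (rule epiD[OF assms(2)])
    have "(f \<cdot> g) \<cdot> f = f \<cdot> (g \<cdot> f)" using g by (subst assoc) auto
    then show "(f \<cdot> g) \<cdot> f = idn C (cod C f) \<cdot> f" using g by simp
  qed (use g in auto)
  then show ?thesis using that g by blast
qed

lemma mono_cmp:
  assumes "is_mono C f" "is_mono C g" "cod C f = dom C g" shows "is_mono C (g \<cdot> f)"
proof (rule monoI)
  fix x assume x: "x \<in> arr C" "cod C x = dom C (g \<cdot> f)"
    "(g \<cdot> f) \<cdot> x = zer C (dom C x) (cod C (g \<cdot> f))"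
  then have "f \<cdot> x = zer C (dom C x) (cod C f)"
    using assms mono_zero[OF assms(2), of "f \<cdot> x"] by simp
  then show "x = zer C (dom C x) (dom C (g \<cdot> f))" using mono_zero[OF assms(1), of x] x assms by simp
qed (use assms in auto)

lemma epi_cmp:
  assumes "is_epi C f" "is_epi C g" "cod C f = dom C g" shows "is_epi C (g \<cdot> f)"
proof (rule epiI)
  fix x assume x: "x \<in> arr C" "dom C x = cod C (g \<cdot> f)"
    "x \<cdot> (g \<cdot> f) = zer C (dom C (g \<cdot> f)) (cod C x)"
  then have "(x \<cdot> g) \<cdot> f = zer C (dom C f) (cod C x)" using assms by simp
  then have "x \<cdot> g = zer C (dom C g) (cod C x)"
    using assms epi_zero[OF assms(1), of "x \<cdot> g"] x by simp
  then show "x = zer C (cod C (g \<cdot> f)) (cod C x)" using epi_zero[OF assms(2), of x] x assms by simp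
qed (use assms in auto)

lemma mono_cancel:
  assumes "is_mono C (g \<cdot> f)" "f \<in> arr C" "g \<in> arr C" "cod C f = dom C g" shows "is_mono C f"
proof (rule monoI)
  fix x assume x: "x \<in> arr C" "cod C x = dom C f" "f \<cdot> x = zer C (dom C x) (cod C f)"
  then show "x = zer C (dom C x) (dom C f)" using assms mono_zero[OF assms(1), of x] by simp
qed (use assms in auto)

lemma epi_cancel:
  assumes "is_epi C (g \<cdot> f)" "f \<in> arr C" "g \<in> arr C" "cod C f = dom C g" shows "is_epi C g"
proof (rule epiI)
  fix x assume x: "x \<in> arr C" "dom C x = cod C g" "x \<cdot> g = zer C (dom C g) (cod C x)"
  then have "x \<cdot> (g \<cdot> f) = zer C (dom C f) (cod C x)" using assms reassoc[OF x(3), of f] by simp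
  then show "x = zer C (cod C g) (cod C x)" using assms x epi_zero[OF assms(1), of x] by simp
qed (use assms in auto)

lemma idn_mono [simp]: "A \<in> obj C \<Longrightarrow> is_mono C (idn C A)" by (rule monoI) auto
lemma idn_epi [simp]: "A \<in> obj C \<Longrightarrow> is_epi C (idn C A)" by (rule epiI) auto

section \<open>Exactness and short exact sequences\<close>

lemma exact_at_arr:
  assumes "exact_at C f g" shows "f \<in> arr C" "g \<in> arr C" "cod C f = dom C g"
  using assms by (auto simp: exact_at_def)

lemma exact_at_zero:
  assumes "exact_at C f g" shows "g \<cdot> f = zer C (dom C f) (cod C g)"
proof -
  obtain m e where me: "is_epi C e" "is_kernel C m g" "cod C e = dom C m" "f = m \<cdot> e"
    using assms by (auto simp: exact_at_def)
  note kernelD[OF me(2), simp]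
  show ?thesis using me reassoc[OF kernelD(4)[OF me(2)], of e] by simp
qed

lemma exact_atI:
  assumes "is_epi C e" "is_kernel C m g" "cod C e = dom C m" "f = m \<cdot> e"
  shows "exact_at C f g"
  unfolding exact_at_def using assms kernelD[OF assms(2)] by auto

lemma exact_atE:
  assumes "exact_at C f g"
  obtains m e where "is_epi C e" "is_kernel C m g" "cod C e = dom C m" "f = m \<cdot> e"
  using assms unfolding exact_at_def by blast

text \<open>In the factorisation of \<open>f\<close> through the kernel \<open>m\<close> the epic
  part is also mono, hence invertible, so \<open>f\<close> inherits the universal property of
  \<open>m\<close>.\<close>

lemma exact_at_mono_kernel:
  assumes "exact_at C f g" "is_mono C f" shows "is_kernel C f g"
proof -
  obtain m e where me: "is_epi C e" "is_kernel C m g" "cod C e = dom C m" "f = m \<cdot> e"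
    using exact_atE[OF assms(1)] .
  note kernelD[OF me(2), simp]
  have "is_mono C e" by (rule mono_cancel[of m e]) (use me assms in auto)
  then obtain i where i: "i \<in> arr C" "dom C i = cod C e" "cod C i = dom C e"
    "i \<cdot> e = idn C (dom C e)" "e \<cdot> i = idn C (cod C e)" using mono_epi_iso me by metis
  have a: "e \<in> arr C" using me by auto
  show ?thesis
  proof (rule kernelI)
    fix h assume h: "h \<in> arr C" "cod C h = dom C g" "g \<cdot> h = zer C (dom C h) (cod C g)"
    obtain u where u: "u \<in> arr C" "dom C u = dom C h" "cod C u = dom C m" "m \<cdot> u = h"
      by (rule kernel_lift[OF me(2) h])
    have "f \<cdot> (i \<cdot> u) = h" using u i me a by (simp add: reassoc[OF i(5)])
    then show "\<exists>u. u \<in> arr C \<and> dom C u = dom C h \<and> cod C u = dom C f \<and> f \<cdot> u = h"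
      using u i me a by (intro exI[of _ "i \<cdot> u"]) auto
  qed (use assms exact_at_zero exact_at_arr in auto)
qed

lemma kernel_exact: "is_kernel C k f \<Longrightarrow> exact_at C k f"
  by (rule exact_atI[of "idn C (dom C k)" k]) (auto dest: kernelD)

lemma short_exact_iff: "short_exact C a b \<longleftrightarrow> is_kernel C a b \<and> is_epi C b"
  using exact_at_mono_kernel kernel_exact kernel_mono unfolding short_exact_def by blast

lemma short_exactD:
  assumes "short_exact C a b"
  shows "is_kernel C a b" "is_cokernel C b a" "is_mono C a" "is_epi C b"
    "a \<in> arr C" "b \<in> arr C" "cod C a = dom C b" "b \<cdot> a = zer C (dom C a) (cod C b)"
proof -
  show k: "is_kernel C a b" and e: "is_epi C b" using assms by (auto simp: short_exact_iff)
  show "is_cokernel C b a" using epi_is_cokernel_of_kernel[OF e k] .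
  show "is_mono C a" using kernel_mono[OF k] .
  show "a \<in> arr C" "b \<in> arr C" "cod C a = dom C b" "b \<cdot> a = zer C (dom C a) (cod C b)"
    using kernelD[OF k] by auto
qed

text \<open>The definition factors the left arrow through a kernel of the right one; here the right
  arrow is factored through a cokernel of the left one. The equivalence makes exactness self-dual,
  on which every passage to the opposite category rests.\<close>

lemma exact_at_alt:
  "exact_at C f g \<longleftrightarrow> (\<exists>m e. is_mono C m \<and> is_cokernel C e f \<and> dom C m = cod C e \<and> g = m \<cdot> e)"
proof
  assume ex: "exact_at C f g"
  obtain m e where me: "is_epi C e" "is_kernel C m g" "cod C e = dom C m" "f = m \<cdot> e"
    using exact_atE[OF ex] .
  note kernelD[OF me(2), simp]
  have a: "e \<in> arr C" using me by auto
  obtain c where c: "is_cokernel C c m" using ex_cokernel[of m] by auto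
  note cokernelD[OF c, simp]
  have cf: "is_cokernel C c f"
  proof (rule cokernelI)
    show "c \<cdot> f = zer C (dom C f) (cod C c)"
      using me a reassoc[OF cokernelD(4)[OF c], of e] by simp
    fix h assume h: "h \<in> arr C" "dom C h = cod C f" "h \<cdot> f = zer C (dom C f) (cod C h)"
    then have "(h \<cdot> m) \<cdot> e = zer C (dom C e) (cod C h)" using me a by simp
    then have "h \<cdot> m = zer C (dom C m) (cod C h)" using epi_zero[OF me(1), of "h \<cdot> m"] h me a by simp
    then show "\<exists>u. u \<in> arr C \<and> dom C u = cod C c \<and> cod C u = cod C h \<and> u \<cdot> c = h"
      by (intro cokernel_ex[OF c]) (use h me a in auto)
  qed (use me a cokernel_epi[OF c] in auto)
  obtain n where n: "n \<in> arr C" "dom C n = cod C c" "cod C n = cod C g" "n \<cdot> c = g"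
    by (rule cokernel_desc[OF c, of g]) auto
  \<comment> \<open>Suppose \<open>n\<close> kills \<open>x\<close> and let \<open>d\<close> be the
    cokernel of \<open>x\<close>. The kernel \<open>l\<close> of \<open>d \<cdot> c\<close> is
    killed by \<open>g\<close>, so it factors through \<open>m\<close> and is killed by
    \<open>c\<close>. Hence \<open>c\<close> factors through \<open>d \<cdot> c\<close>, so
    \<open>d\<close> has a left inverse, and \<open>x\<close> vanishes because \<open>d\<close>
    kills it.\<close>
  have "is_mono C n"
  proof (rule monoI)
    fix x assume x: "x \<in> arr C" "cod C x = dom C n" "n \<cdot> x = zer C (dom C x) (cod C n)"
    obtain d where d: "is_cokernel C d x" using ex_cokernel x by blast
    note cokernelD[OF d, simp]
    obtain n' where n': "n' \<in> arr C" "dom C n' = cod C d" "cod C n' = cod C n" "n' \<cdot> d = n"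
      by (rule cokernel_desc[OF d, of n]) (use x n in auto)
    have epi: "is_epi C (d \<cdot> c)" by (rule epi_cmp) (use cokernel_epi c d x n in auto)
    obtain l where l: "is_kernel C l (d \<cdot> c)" using ex_kernel[of "d \<cdot> c"] x n by auto
    note kernelD[OF l, simp]
    have dc: "cod C c = dom C d" using x n by simp
    have [simp]: "d \<in> arr C" "c \<in> arr C" by auto
    have cl: "cod C l = dom C c" using kernelD(3)[OF l] dc by simp
    have "d \<cdot> (c \<cdot> l) = (d \<cdot> c) \<cdot> l" using dc cl by (subst assoc) auto
    also have "\<dots> = zer C (dom C l) (cod C (d \<cdot> c))" by (rule kernelD(4)[OF l])
    finally have l0: "d \<cdot> (c \<cdot> l) = zer C (dom C l) (cod C d)" using dc by simp
    have "n \<cdot> (c \<cdot> l) = g \<cdot> l" by (rule reassoc[OF n(4)]) (use n cl in auto)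
    moreover have "n' \<cdot> (d \<cdot> (c \<cdot> l)) = n \<cdot> (c \<cdot> l)"
      by (rule reassoc[OF n'(4)]) (use n' cl dc in auto)
    ultimately have gl: "g \<cdot> l = zer C (dom C l) (cod C g)" using l0 n' n by simp
    obtain w where w: "w \<in> arr C" "dom C w = dom C l" "cod C w = dom C m" "m \<cdot> w = l"
      by (rule kernel_lift[OF me(2), of l]) (use gl cl n in auto)
    have "c \<cdot> (m \<cdot> w) = zer C (dom C m) (cod C c) \<cdot> w" by (rule reassoc) (use w in auto)
    then have cl0: "c \<cdot> l = zer C (dom C l) (cod C c)" using w by simp
    have "is_cokernel C (d \<cdot> c) l" using epi_is_cokernel_of_kernel[OF epi l] .
    from cokernel_ex[OF this, of c] obtain v
      where v: "v \<in> arr C" "dom C v = cod C d" "cod C v = cod C c" "v \<cdot> (d \<cdot> c) = c"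
      using cl0 dc cl by auto
    have "v \<cdot> d = idn C (cod C c)"
      by (rule epiD[OF cokernel_epi[OF c]]) (use v dc in auto)
    from reassoc[OF this, of x] show "x = zer C (dom C x) (dom C n)" using v x n by simp
  qed fact
  then show "\<exists>m e. is_mono C m \<and> is_cokernel C e f \<and> dom C m = cod C e \<and> g = m \<cdot> e"
    using cf n by blast
next
  assume "\<exists>m e. is_mono C m \<and> is_cokernel C e f \<and> dom C m = cod C e \<and> g = m \<cdot> e"
  then obtain m e where me: "is_mono C m" "is_cokernel C e f" "dom C m = cod C e" "g = m \<cdot> e" by blast
  note cokernelD[OF me(2), simp]
  have m [simp]: "m \<in> arr C" using me by auto
  obtain k where k: "is_kernel C k e" using ex_kernel[of e] by auto
  note kernelD[OF k, simp]
  have kg: "is_kernel C k g"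
  proof (rule kernelI)
    fix h assume h: "h \<in> arr C" "cod C h = dom C g" "g \<cdot> h = zer C (dom C h) (cod C g)"
    then have "e \<cdot> h = zer C (dom C h) (cod C e)" using mono_zero[OF me(1), of "e \<cdot> h"] me by simp
    then show "\<exists>u. u \<in> arr C \<and> dom C u = dom C h \<and> cod C u = dom C k \<and> k \<cdot> u = h"
      by (intro kernel_ex[OF k]) (use h me in auto)
  qed (use me kernel_mono[OF k] in auto)
  obtain u where u: "u \<in> arr C" "dom C u = dom C f" "cod C u = dom C k" "k \<cdot> u = f"
    by (rule kernel_lift[OF k, of f]) auto
  \<comment> \<open>The dual argument: with \<open>d\<close> the kernel of \<open>x\<close>, the
    cokernel \<open>l\<close> of \<open>k \<cdot> d\<close> kills \<open>f\<close>, hence factors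
    through \<open>e\<close> and kills \<open>k\<close>. So \<open>k\<close> factors through
    \<open>k \<cdot> d\<close>, and \<open>d\<close> has a right inverse.\<close>
  have "is_epi C u"
  proof (rule epiI)
    fix x assume x: "x \<in> arr C" "dom C x = cod C u" "x \<cdot> u = zer C (dom C u) (cod C x)"
    obtain d where d: "is_kernel C d x" using ex_kernel x by blast
    note kernelD[OF d, simp]
    obtain u' where u': "u' \<in> arr C" "cod C u' = dom C d" "dom C u' = dom C u" "d \<cdot> u' = u"
      by (rule kernel_lift[OF d, of u]) (use x u in auto)
    have kd: "dom C k = cod C d" using x u by simp
    have mono: "is_mono C (k \<cdot> d)" by (rule mono_cmp) (use kernel_mono k d kd in auto)
    obtain l where l: "is_cokernel C l (k \<cdot> d)" using ex_cokernel[of "k \<cdot> d"] kd by auto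
    note cokernelD[OF l, simp]
    have dl: "dom C l = cod C k" using kd by simp
    have l0: "l \<cdot> (k \<cdot> d) = zer C (dom C d) (cod C l)" using cokernelD(4)[OF l] kd by simp
    have "k \<cdot> (d \<cdot> u') = f" using u u' by simp
    moreover have "l \<cdot> ((k \<cdot> d) \<cdot> u') = zer C (dom C d) (cod C l) \<cdot> u'"
      by (rule reassoc[OF l0]) (use u' kd dl in auto)
    ultimately have "l \<cdot> f = zer C (dom C f) (cod C l)" using u' u kd by simp
    then obtain w where w: "w \<in> arr C" "dom C w = cod C e" "cod C w = cod C l" "w \<cdot> e = l"
      using cokernel_desc[OF me(2), of l] dl by auto
    have "w \<cdot> (e \<cdot> k) = l \<cdot> k" by (rule reassoc[OF w(4)]) (use w in auto)
    then have lk: "l \<cdot> k = zer C (dom C k) (cod C l)" using w by simp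
    have "is_kernel C (k \<cdot> d) l" using mono_is_kernel_of_cokernel[OF mono l] .
    from kernel_ex[OF this, of k] obtain v
      where v: "v \<in> arr C" "dom C v = dom C k" "cod C v = dom C d" "k \<cdot> (d \<cdot> v) = k"
      using lk dl kd by auto
    have "d \<cdot> v = idn C (dom C k)"
      by (rule monoD[OF kernel_mono[OF k]]) (use v kd in auto)
    moreover have "x \<cdot> (d \<cdot> v) = zer C (dom C d) (cod C x) \<cdot> v" by (rule reassoc) (use v kd x in auto)
    ultimately show "x = zer C (cod C u) (cod C x)" using v x u by simp
  qed fact
  then show "exact_at C f g" using exact_atI[OF _ kg] u by metis
qed

end


section \<open>The opposite category, biproducts and pullbacks\<close>

text \<open>Arrows keep their names, so lists of arrows of \<open>C\<close> can be reused after
  reversal. The result lives in the base record type, so \<open>opc (opc C)\<close> agrees with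
  \<open>C\<close> field by field without being the same record in general.\<close>

definition opc :: "('o, 'm, 'z) precat_scheme \<Rightarrow> ('o, 'm) precat" where
  "opc C = \<lparr>obj = obj C, arr = arr C, dom = cod C, cod = dom C, idn = idn C,
     cmp = (\<lambda>g f. cmp C f g), plus = plus C, zer = (\<lambda>A B. zer C B A)\<rparr>"

lemma opc_sel [simp]:
  "obj (opc C) = obj C" "arr (opc C) = arr C" "dom (opc C) = cod C" "cod (opc C) = dom C"
  "idn (opc C) = idn C" "cmp (opc C) g f = cmp C f g" "plus (opc C) = plus C"
  "zer (opc C) A B = zer C B A"
  by (simp_all add: opc_def)

lemma homs_opc [simp]: "homs (opc C) A B = homs C B A"
  by (auto simp: homs_def)

lemma hom_group_opc [simp]: "hom_group (opc C) A B = hom_group C B A"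
  by (simp add: hom_group_def)

lemma is_mono_opc [simp]: "is_mono (opc C) f = is_epi C f"
  by (simp add: is_mono_def is_epi_def)

lemma is_epi_opc [simp]: "is_epi (opc C) f = is_mono C f"
  by (simp add: is_mono_def is_epi_def)

lemma is_kernel_opc [simp]: "is_kernel (opc C) k f = is_cokernel C k f"
  by (simp add: is_kernel_def is_cokernel_def)

lemma is_cokernel_opc [simp]: "is_cokernel (opc C) k f = is_kernel C k f"
  by (simp add: is_kernel_def is_cokernel_def)

lemma is_zero_object_opc [simp]: "is_zero_object (opc C) Z = is_zero_object C Z"
  by (auto simp: is_zero_object_def)

lemma is_biproduct_opc [simp]: "is_biproduct (opc C) A B S i j p q = is_biproduct C A B S p q i j"
  by (auto simp: is_biproduct_def)

lemma is_pullback_opc [simp]: "is_pullback (opc C) f g p q = is_pushout C f g p q"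
  by (simp add: is_pullback_def is_pushout_def)

lemma is_pushout_opc [simp]: "is_pushout (opc C) f g p q = is_pullback C f g p q"
  by (simp add: is_pullback_def is_pushout_def)

context abelian_category
begin

lemma opc_abelian: "abelian_category (opc C)"
proof (rule abelian_category.intro)
  fix A B assume AB: "A \<in> obj (opc C)" "B \<in> obj (opc C)"
  obtain S i j p q where "is_biproduct C A B S i j p q" using ex_biproduct[of A B] AB by auto
  then have "is_biproduct (opc C) A B S p q i j" by simp
  then show "\<exists>S i j p q. is_biproduct (opc C) A B S i j p q" by blast
next
  show "comm_group (hom_group (opc C) A B)" if "A \<in> obj (opc C)" "B \<in> obj (opc C)" for A B
    using hom_comm_group[of B A] that by simp
qed (use ex_zero_object ex_kernel ex_cokernel mono_normal epi_normal in
    \<open>auto simp: homs_iff distl distr\<close>)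

lemma exact_at_opc [simp]: "exact_at (opc C) g f = exact_at C f g"
proof
  assume "exact_at (opc C) g f"
  then obtain m e where "is_mono C e" "is_cokernel C m f" "dom C e = cod C m" "g = e \<cdot> m"
    by (auto simp: exact_at_def)
  then show "exact_at C f g" unfolding exact_at_alt by blast
next
  assume ex: "exact_at C f g"
  then obtain m e where "is_mono C m" "is_cokernel C e f" "dom C m = cod C e" "g = m \<cdot> e"
    unfolding exact_at_alt by blast
  then show "exact_at (opc C) g f" using exact_at_arr[OF ex] by (auto simp: exact_at_def)
qed

lemma short_exact_opc [simp]: "short_exact (opc C) b a = short_exact C a b"
  by (auto simp: short_exact_def)

section \<open>Chosen biproducts\<close>

lemma biprod_is:
  assumes "A \<in> obj C" "B \<in> obj C"
  shows "is_biproduct C A B (cod C (in1 C A B)) (in1 C A B) (in2 C A B) (pr1 C A B) (pr2 C A B)"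
proof -
  have "\<exists>x. case x of (i, j, p, q) \<Rightarrow> \<exists>S. is_biproduct C A B S i j p q"
    using ex_biproduct[OF assms] by fast
  then have "case biprod C A B of (i, j, p, q) \<Rightarrow> \<exists>S. is_biproduct C A B S i j p q"
    unfolding biprod_def by (rule someI_ex)
  then obtain S where S: "is_biproduct C A B S (in1 C A B) (in2 C A B) (pr1 C A B) (pr2 C A B)"
    by (auto simp: in1_def in2_def pr1_def pr2_def split: prod.splits)
  then show ?thesis by (simp add: is_biproduct_def homs_iff)
qed

text \<open>A chosen biproduct stores only its four arrows, so its object has to be read off as a
  codomain.\<close>

definition ds :: "'o \<Rightarrow> 'o \<Rightarrow> 'o" where "ds A B = cod C (in1 C A B)"

lemma biproductD:
  assumes "is_biproduct C A B S i j p q"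
  shows "i \<in> arr C" "j \<in> arr C" "p \<in> arr C" "q \<in> arr C"
    "dom C i = A" "dom C j = B" "cod C i = S" "cod C j = S"
    "dom C p = S" "dom C q = S" "cod C p = A" "cod C q = B" "S \<in> obj C"
    "p \<cdot> i = idn C A" "q \<cdot> j = idn C B" "p \<cdot> j = zer C B A" "q \<cdot> i = zer C A B"
    "plus C (i \<cdot> p) (j \<cdot> q) = idn C S"
  using assms by (auto simp: is_biproduct_def homs_iff)

lemma biproductD':
  assumes "is_biproduct C A B S i j p q" "x \<in> arr C"
  shows "cod C x = A \<Longrightarrow> p \<cdot> (i \<cdot> x) = x" "cod C x = B \<Longrightarrow> q \<cdot> (j \<cdot> x) = x"
    "cod C x = B \<Longrightarrow> p \<cdot> (j \<cdot> x) = zer C (dom C x) A"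
    "cod C x = A \<Longrightarrow> q \<cdot> (i \<cdot> x) = zer C (dom C x) B"
proof -
  note b [simp] = biproductD[OF assms(1)]
  show "cod C x = A \<Longrightarrow> p \<cdot> (i \<cdot> x) = x" using assms reassoc[OF b(14), of x] by simp
  show "cod C x = B \<Longrightarrow> q \<cdot> (j \<cdot> x) = x" using assms reassoc[OF b(15), of x] by simp
  show "cod C x = B \<Longrightarrow> p \<cdot> (j \<cdot> x) = zer C (dom C x) A"
    using assms reassoc[OF b(16), of x] cod_obj[of i] dom_obj[of i] cod_obj[of p] by simp
  show "cod C x = A \<Longrightarrow> q \<cdot> (i \<cdot> x) = zer C (dom C x) B"
    using assms reassoc[OF b(17), of x] cod_obj[of j] dom_obj[of j] cod_obj[of q] by simp
qed

context
  fixes A B assumes AB: "A \<in> obj C" "B \<in> obj C"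
begin

lemmas biD = biproductD[OF biprod_is[OF AB]] 
lemmas biD' = biproductD'[OF biprod_is[OF AB]]

lemma bi_simps [simp]:
  "in1 C A B \<in> arr C" "in2 C A B \<in> arr C" "pr1 C A B \<in> arr C" "pr2 C A B \<in> arr C"
  "dom C (in1 C A B) = A" "dom C (in2 C A B) = B" "cod C (in1 C A B) = ds A B" "cod C (in2 C A B) = ds A B"
  "dom C (pr1 C A B) = ds A B" "dom C (pr2 C A B) = ds A B" "cod C (pr1 C A B) = A" "cod C (pr2 C A B) = B"
  "ds A B \<in> obj C"
  "pr1 C A B \<cdot> in1 C A B = idn C A" "pr2 C A B \<cdot> in2 C A B = idn C B"
  "pr1 C A B \<cdot> in2 C A B = zer C B A" "pr2 C A B \<cdot> in1 C A B = zer C A B"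
  "plus C (in1 C A B \<cdot> pr1 C A B) (in2 C A B \<cdot> pr2 C A B) = idn C (ds A B)"
  "\<lbrakk>x \<in> arr C; cod C x = A\<rbrakk> \<Longrightarrow> pr1 C A B \<cdot> (in1 C A B \<cdot> x) = x"
  "\<lbrakk>x \<in> arr C; cod C x = B\<rbrakk> \<Longrightarrow> pr2 C A B \<cdot> (in2 C A B \<cdot> x) = x"
  "\<lbrakk>x \<in> arr C; cod C x = B\<rbrakk> \<Longrightarrow> pr1 C A B \<cdot> (in2 C A B \<cdot> x) = zer C (dom C x) A"
  "\<lbrakk>x \<in> arr C; cod C x = A\<rbrakk> \<Longrightarrow> pr2 C A B \<cdot> (in1 C A B \<cdot> x) = zer C (dom C x) B"
  unfolding ds_def by (rule biD(1-4) biD(5-12) biD(13-18) biD'; assumption?)+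

lemma bi_decomp_left:
  assumes "x \<in> arr C" "cod C x = ds A B"
  shows "plus C (in1 C A B \<cdot> (pr1 C A B \<cdot> x)) (in2 C A B \<cdot> (pr2 C A B \<cdot> x)) = x"
proof -
  have "x = plus C (in1 C A B \<cdot> pr1 C A B) (in2 C A B \<cdot> pr2 C A B) \<cdot> x"
    using AB assms by simp
  also have "\<dots> = plus C (in1 C A B \<cdot> (pr1 C A B \<cdot> x)) (in2 C A B \<cdot> (pr2 C A B \<cdot> x))"
    using AB assms by (subst distr) auto
  finally show ?thesis by simp
qed

lemma bi_decomp_right:
  assumes "x \<in> arr C" "dom C x = ds A B"
  shows "plus C (x \<cdot> (in1 C A B \<cdot> pr1 C A B)) (x \<cdot> (in2 C A B \<cdot> pr2 C A B)) = x"
proof -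
  have "x = x \<cdot> plus C (in1 C A B \<cdot> pr1 C A B) (in2 C A B \<cdot> pr2 C A B)"
    using AB assms by simp
  also have "\<dots> = plus C (x \<cdot> (in1 C A B \<cdot> pr1 C A B)) (x \<cdot> (in2 C A B \<cdot> pr2 C A B))"
    using AB assms by (subst distl) auto
  finally show ?thesis by simp
qed

lemma bi_eq_left:
  assumes "x \<in> arr C" "y \<in> arr C" "cod C x = ds A B" "cod C y = ds A B" "dom C x = dom C y"
    "pr1 C A B \<cdot> x = pr1 C A B \<cdot> y" "pr2 C A B \<cdot> x = pr2 C A B \<cdot> y"
  shows "x = y"
  using bi_decomp_left[OF assms(1,3)] bi_decomp_left[OF assms(2,4)] unfolding assms(6,7) by (rule trans[OF sym])

lemma bi_eq_right:
  assumes "x \<in> arr C" "y \<in> arr C" "dom C x = ds A B" "dom C y = ds A B" "cod C x = cod C y"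
    "x \<cdot> in1 C A B = y \<cdot> in1 C A B" "x \<cdot> in2 C A B = y \<cdot> in2 C A B"
  shows "x = y"
proof -
  have "x \<cdot> (in1 C A B \<cdot> pr1 C A B) = (y \<cdot> in1 C A B) \<cdot> pr1 C A B"
    by (rule reassoc[OF assms(6)]) (use AB assms(1-5) in auto)
  then have 1: "x \<cdot> (in1 C A B \<cdot> pr1 C A B) = y \<cdot> (in1 C A B \<cdot> pr1 C A B)"
    using AB assms(2,4) by simp
  have "x \<cdot> (in2 C A B \<cdot> pr2 C A B) = (y \<cdot> in2 C A B) \<cdot> pr2 C A B"
    by (rule reassoc[OF assms(7)]) (use AB assms(1-5) in auto)
  then have 2: "x \<cdot> (in2 C A B \<cdot> pr2 C A B) = y \<cdot> (in2 C A B \<cdot> pr2 C A B)"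
    using AB assms(2,4) by simp
  show ?thesis
    using bi_decomp_right[OF assms(1,3)] bi_decomp_right[OF assms(2,4)] unfolding 1 2 by (rule trans[OF sym])
qed

end

section \<open>Pullbacks and maps of short exact sequences\<close>

lemma pullbackD:
  assumes "is_pullback C f g p q"
  shows "f \<in> arr C" "g \<in> arr C" "p \<in> arr C" "q \<in> arr C" "cod C f = cod C g" "dom C p = dom C q"
    "cod C p = dom C f" "cod C q = dom C g" "f \<cdot> p = g \<cdot> q"
  using assms by (auto simp: is_pullback_def)

lemma pullback_ex:
  assumes "is_pullback C f g p q" "x \<in> arr C" "y \<in> arr C" "dom C x = dom C y"
    "cod C x = dom C f" "cod C y = dom C g" "f \<cdot> x = g \<cdot> y"
  obtains u where "u \<in> arr C" "dom C u = dom C y" "cod C u = dom C q" "p \<cdot> u = x" "q \<cdot> u = y"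
proof -
  have "\<exists>u. u \<in> homs C (dom C x) (dom C p) \<and> p \<cdot> u = x \<and> q \<cdot> u = y"
    using assms unfolding is_pullback_def by blast
  then show ?thesis using that assms(4) pullbackD(6)[OF assms(1)] by (auto simp: homs_iff)
qed

lemma pullback_eq:
  assumes "is_pullback C f g p q" "u \<in> arr C" "v \<in> arr C" "dom C u = dom C v"
    "cod C u = dom C q" "cod C v = dom C q" "p \<cdot> u = p \<cdot> v" "q \<cdot> u = q \<cdot> v"
  shows "u = v"
proof -
  note d [simp] = pullbackD[OF assms(1)]
  have c: "f \<cdot> (p \<cdot> u) = g \<cdot> (q \<cdot> u)" using reassoc[OF d(9), of u] assms(2-6) by simp
  have "\<forall>x\<in>arr C. \<forall>y\<in>arr C. dom C x = dom C y \<and> cod C x = dom C f \<and> cod C y = dom C g \<and>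
      f \<cdot> x = g \<cdot> y \<longrightarrow> (\<exists>!u. u \<in> homs C (dom C x) (dom C p) \<and> p \<cdot> u = x \<and> q \<cdot> u = y)"
    using assms(1) unfolding is_pullback_def by (elim conjE)
  from mp[OF bspec[OF bspec[OF this, of "p \<cdot> u"], of "q \<cdot> u"]]
  have "\<exists>!w. w \<in> homs C (dom C (p \<cdot> u)) (dom C p) \<and> p \<cdot> w = p \<cdot> u \<and> q \<cdot> w = q \<cdot> u"
    using c assms(2-6) d by simp
  moreover have "u \<in> homs C (dom C (p \<cdot> u)) (dom C p)" "v \<in> homs C (dom C (p \<cdot> u)) (dom C p)"
    using assms(2-6) by auto
  ultimately show ?thesis using assms(7,8) by metis
qed

lemma pullbackI:
  assumes "f \<in> arr C" "g \<in> arr C" "p \<in> arr C" "q \<in> arr C" "cod C f = cod C g" "dom C p = dom C q"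
    "cod C p = dom C f" "cod C q = dom C g" "f \<cdot> p = g \<cdot> q"
    and ex: "\<And>x y. \<lbrakk>x \<in> arr C; y \<in> arr C; dom C x = dom C y; cod C x = dom C f; cod C y = dom C g;
      f \<cdot> x = g \<cdot> y\<rbrakk> \<Longrightarrow> \<exists>u. u \<in> arr C \<and> dom C u = dom C y \<and> cod C u = dom C q \<and> p \<cdot> u = x \<and> q \<cdot> u = y"
    and eq: "\<And>u v. \<lbrakk>u \<in> arr C; v \<in> arr C; dom C u = dom C v; cod C u = dom C q; cod C v = dom C q;
      p \<cdot> u = p \<cdot> v; q \<cdot> u = q \<cdot> v\<rbrakk> \<Longrightarrow> u = v"
  shows "is_pullback C f g p q"
  unfolding is_pullback_def
proof (intro conjI ballI impI)
  fix x y assume x: "x \<in> arr C" "y \<in> arr C"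
    "dom C x = dom C y \<and> cod C x = dom C f \<and> cod C y = dom C g \<and> f \<cdot> x = g \<cdot> y"
  then obtain u where u: "u \<in> arr C" "dom C u = dom C y" "cod C u = dom C q" "p \<cdot> u = x" "q \<cdot> u = y"
    using ex[of x y] by auto
  show "\<exists>!u. u \<in> homs C (dom C x) (dom C p) \<and> p \<cdot> u = x \<and> q \<cdot> u = y"
  proof (rule ex1I[of _ u])
    show "u \<in> homs C (dom C x) (dom C p) \<and> p \<cdot> u = x \<and> q \<cdot> u = y" using u x assms(1-9) by (auto simp: homs_iff)
    show "v = u" if "v \<in> homs C (dom C x) (dom C p) \<and> p \<cdot> v = x \<and> q \<cdot> v = y" for v
      by (rule eq) (use that u x assms(1-9) in \<open>auto simp: homs_iff\<close>)
  qed
qed (use assms in auto)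

text \<open>A pair of morphisms equalised by \<open>f\<close> and \<open>g\<close> is the same as a
  map into the direct sum that is killed by the difference map. In this form the normality of
  epimorphisms becomes applicable to pullbacks.\<close>

lemma pullback_kernel:
  assumes "is_pullback C f g p q"
  shows "is_kernel C (plus C (in1 C (dom C f) (dom C g) \<cdot> p) (in2 C (dom C f) (dom C g) \<cdot> q))
    (plus C (f \<cdot> pr1 C (dom C f) (dom C g)) (neg (g \<cdot> pr2 C (dom C f) (dom C g))))"
    (is "is_kernel C ?k ?t")
proof -
  note d [simp] = pullbackD[OF assms]
  let ?A = "dom C f" let ?B = "dom C g"
  have k [simp]: "?k \<in> arr C" "dom C ?k = dom C q" "cod C ?k = ds ?A ?B" by simp_all
  have t [simp]: "?t \<in> arr C" "dom C ?t = ds ?A ?B" "cod C ?t = cod C g" by simp_all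
  have tx: "?t \<cdot> x = plus C (f \<cdot> (pr1 C ?A ?B \<cdot> x)) (neg (g \<cdot> (pr2 C ?A ?B \<cdot> x)))"
    if "x \<in> arr C" "cod C x = ds ?A ?B" for x
    using that by (simp add: distr)
  have pk: "pr1 C ?A ?B \<cdot> (?k \<cdot> x) = p \<cdot> x" "pr2 C ?A ?B \<cdot> (?k \<cdot> x) = q \<cdot> x"
    if "x \<in> arr C" "cod C x = dom C q" for x
    using that by (simp_all add: distr distl)
  have pk1: "pr1 C ?A ?B \<cdot> ?k = p" "pr2 C ?A ?B \<cdot> ?k = q" by (simp_all add: distl)
  have ki: "\<exists>u. u \<in> arr C \<and> dom C u = dom C h \<and> cod C u = dom C ?k \<and> ?k \<cdot> u = h"
    if h: "h \<in> arr C" "cod C h = dom C ?t" "?t \<cdot> h = zer C (dom C h) (cod C ?t)" for h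
  proof -
    have "f \<cdot> (pr1 C ?A ?B \<cdot> h) = g \<cdot> (pr2 C ?A ?B \<cdot> h)"
      by (rule diff_zero) (use h in \<open>simp_all add: distr\<close>)
    then obtain u where u: "u \<in> arr C" "dom C u = dom C h" "cod C u = dom C q"
      "p \<cdot> u = pr1 C ?A ?B \<cdot> h" "q \<cdot> u = pr2 C ?A ?B \<cdot> h"
      using pullback_ex[OF assms, of "pr1 C ?A ?B \<cdot> h" "pr2 C ?A ?B \<cdot> h"] h by auto
    have "?k \<cdot> u = h"
      by (rule bi_eq_left[of ?A ?B]) (use u h pk[of u] in auto)
    then show ?thesis using u by auto
  qed
  show ?thesis
  proof (rule kernelI)
    show "is_mono C ?k"
    proof (rule monoI)
      fix x assume x: "x \<in> arr C" "cod C x = dom C ?k" "?k \<cdot> x = zer C (dom C x) (cod C ?k)"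
      show "x = zer C (dom C x) (dom C ?k)"
        by (rule pullback_eq[OF assms]) (use x pk[of x] in auto)
    qed simp
    show "?t \<cdot> ?k = zer C (dom C ?k) (cod C ?t)" using tx[of ?k] pk1 by simp
    show "\<exists>u. u \<in> arr C \<and> dom C u = dom C h \<and> cod C u = dom C ?k \<and> ?k \<cdot> u = h"
      if "h \<in> arr C" "cod C h = dom C ?t" "?t \<cdot> h = zer C (dom C h) (cod C ?t)" for h
      using ki[of h] that by blast
  qed simp_all
qed

lemma ex_pullback:
  assumes "f \<in> arr C" "g \<in> arr C" "cod C f = cod C g"
  shows "\<exists>p q. is_pullback C f g p q"
proof -
  let ?A = "dom C f" let ?B = "dom C g"
  let ?t = "plus C (f \<cdot> pr1 C ?A ?B) (neg (g \<cdot> pr2 C ?A ?B))"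
  note assms [simp]
  have t [simp]: "?t \<in> arr C" "dom C ?t = ds ?A ?B" "cod C ?t = cod C g" by simp_all
  obtain k where k: "is_kernel C k ?t" using ex_kernel by fastforce
  note kd [simp] = kernelD(1-3)[OF k]
  have ck [simp]: "cod C k = ds ?A ?B" using kd(3) t(2) by simp
  have "is_pullback C f g (pr1 C ?A ?B \<cdot> k) (pr2 C ?A ?B \<cdot> k)"
  proof (rule pullbackI)
    show "f \<cdot> (pr1 C ?A ?B \<cdot> k) = g \<cdot> (pr2 C ?A ?B \<cdot> k)"
      by (rule diff_zero) (use kernelD(4)[OF k] in \<open>simp_all add: distr\<close>)
    show "\<exists>u. u \<in> arr C \<and> dom C u = dom C y \<and> cod C u = dom C (pr2 C ?A ?B \<cdot> k) \<and>
        (pr1 C ?A ?B \<cdot> k) \<cdot> u = x \<and> (pr2 C ?A ?B \<cdot> k) \<cdot> u = y"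
      if x: "x \<in> arr C" "y \<in> arr C" "dom C x = dom C y" "cod C x = dom C f" "cod C y = dom C g" "f \<cdot> x = g \<cdot> y"
      for x y
    proof -
      let ?h = "plus C (in1 C ?A ?B \<cdot> x) (in2 C ?A ?B \<cdot> y)"
      have h: "?h \<in> arr C" "cod C ?h = ds ?A ?B" "dom C ?h = dom C y" using x by simp_all
      have h1: "pr1 C ?A ?B \<cdot> ?h = x" "pr2 C ?A ?B \<cdot> ?h = y" using x by (simp_all add: distl)
      have "?t \<cdot> ?h = plus C (f \<cdot> (pr1 C ?A ?B \<cdot> ?h)) (neg (g \<cdot> (pr2 C ?A ?B \<cdot> ?h)))"
        using h by (subst distr) auto
      also have "\<dots> = zer C (dom C ?h) (cod C ?t)" unfolding h1 using x h by simp
      finally obtain u where "u \<in> arr C" "dom C u = dom C ?h" "cod C u = dom C k" "k \<cdot> u = ?h"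
        using kernel_lift[OF k, of ?h] h kd t by metis
      then show ?thesis using h h1 by auto
    qed
    show "u = v" if "u \<in> arr C" "v \<in> arr C" "dom C u = dom C v" "cod C u = dom C (pr2 C ?A ?B \<cdot> k)"
      "cod C v = dom C (pr2 C ?A ?B \<cdot> k)" "(pr1 C ?A ?B \<cdot> k) \<cdot> u = (pr1 C ?A ?B \<cdot> k) \<cdot> v"
      "(pr2 C ?A ?B \<cdot> k) \<cdot> u = (pr2 C ?A ?B \<cdot> k) \<cdot> v" for u v
    proof (rule monoD[OF kernel_mono[OF k]])
      show "k \<cdot> u = k \<cdot> v" by (rule bi_eq_left[of ?A ?B]) (use that in auto)
    qed (use that in auto)
  qed simp_all
  then show ?thesis by blast
qed

text \<open>The difference map \<open>?t\<close> restricts to \<open>f\<close> on the first summand,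
  so it is epic and is the cokernel of the pullback embedding \<open>?k\<close>. If
  \<open>h \<cdot> q\<close> is zero, then \<open>h\<close> on the second summand kills
  \<open>?k\<close> and equals some \<open>s \<cdot> ?t\<close>. On the first summand
  \<open>s \<cdot> f\<close> is zero, so \<open>s\<close> is zero, and with it
  \<open>h\<close>.\<close>

lemma pullback_epi:
  assumes pb: "is_pullback C f g p q" and "is_epi C f"
  shows "is_epi C q"
proof (rule epiI)
  note d [simp] = pullbackD[OF pb]
  let ?A = "dom C f" let ?B = "dom C g"
  let ?k = "plus C (in1 C ?A ?B \<cdot> p) (in2 C ?A ?B \<cdot> q)"
  let ?t = "plus C (f \<cdot> pr1 C ?A ?B) (neg (g \<cdot> pr2 C ?A ?B))"
  have ti: "?t \<cdot> in1 C ?A ?B = f" by (simp add: distr)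
  have "is_epi C ?t" by (rule epi_cancel[of ?t "in1 C ?A ?B"]) (use assms(2) ti in simp_all)
  then have ck: "is_cokernel C ?t ?k" using pullback_kernel[OF pb] by (rule epi_is_cokernel_of_kernel)
  fix h assume h: "h \<in> arr C" "dom C h = cod C q" "h \<cdot> q = zer C (dom C q) (cod C h)"
  have "(h \<cdot> pr2 C ?A ?B) \<cdot> ?k = zer C (dom C ?k) (cod C h)"
    using h by (simp add: distl)
  then obtain s where s: "s \<in> arr C" "dom C s = cod C g" "cod C s = cod C h" "s \<cdot> ?t = h \<cdot> pr2 C ?A ?B"
    using cokernel_desc[OF ck, of "h \<cdot> pr2 C ?A ?B"] h by auto
  have "s \<cdot> f = s \<cdot> (?t \<cdot> in1 C ?A ?B)" by (simp add: ti)
  also have "\<dots> = (h \<cdot> pr2 C ?A ?B) \<cdot> in1 C ?A ?B" by (rule reassoc[OF s(4)]) (use s in simp_all)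
  also have "\<dots> = zer C (dom C f) (cod C s)" using h s by simp
  finally have "s = zer C (cod C f) (cod C s)" using s by (intro epi_zero[OF assms(2)]) auto
  then have "s \<cdot> ?t = zer C (cod C f) (cod C s) \<cdot> ?t" by simp
  then have "h \<cdot> pr2 C ?A ?B = zer C (ds ?A ?B) (cod C h)" unfolding s(4) using s h(1) by simp
  then have "(h \<cdot> pr2 C ?A ?B) \<cdot> in2 C ?A ?B = zer C ?B (cod C h)" using h by simp
  then show "h = zer C (cod C q) (cod C h)" using h by simp
qed (use pullbackD[OF pb] in auto)

lemma pullback_short_exact:
  assumes ab: "short_exact C a b" and pb: "is_pullback C b f p q"
    and e: "e \<in> arr C" "dom C e = dom C a" "cod C e = dom C q" "p \<cdot> e = a" "q \<cdot> e = zer C (dom C a) (dom C f)"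
  shows "short_exact C e q"
proof -
  note d [simp] = pullbackD[OF pb] note s = short_exactD[OF ab]
  have "is_mono C e" by (rule mono_cancel[of p e]) (use s e in auto)
  moreover have "\<exists>u. u \<in> arr C \<and> dom C u = dom C h \<and> cod C u = dom C e \<and> e \<cdot> u = h"
    if h: "h \<in> arr C" "cod C h = dom C q" "q \<cdot> h = zer C (dom C h) (cod C q)" for h
  proof -
    have "b \<cdot> (p \<cdot> h) = zer C (dom C h) (cod C b)"
      using reassoc[OF d(9), of h] h by simp
    then obtain u where u: "u \<in> arr C" "dom C u = dom C h" "cod C u = dom C a" "a \<cdot> u = p \<cdot> h"
      using kernel_lift[OF s(1), of "p \<cdot> h"] h by auto
    have "e \<cdot> u = h"
      by (rule pullback_eq[OF pb]) (use u e h reassoc[OF e(4), of u] reassoc[OF e(5), of u] in auto)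
    then show ?thesis using u e by auto
  qed
  ultimately have "is_kernel C e q" using e by (intro kernelI) auto
  then show ?thesis using pullback_epi[OF pb s(4)] by (simp add: short_exact_iff)
qed

text \<open>A morphism killed by \<open>u\<close> is killed by \<open>b\<close>, hence comes from
  the left end, where \<open>a'\<close> is mono; the dual argument gives that \<open>u\<close> is
  epic. Mono and epic together yield an inverse.\<close>

lemma short_five:
  assumes "short_exact C a b" "short_exact C a' b'" "u \<in> arr C" "dom C u = dom C b" "cod C u = dom C b'"
    "u \<cdot> a = a'" "b' \<cdot> u = b"
  obtains v where "v \<in> arr C" "dom C v = cod C u" "cod C v = dom C u"
    "v \<cdot> u = idn C (dom C u)" "u \<cdot> v = idn C (cod C u)"
proof -
  note s [simp] = short_exactD(5-8)[OF assms(1)] note s' [simp] = short_exactD(5-8)[OF assms(2)]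
  note u [simp] = assms(3-5)
  have da: "dom C a' = dom C a" using assms(6) by (metis cmp_arr(2) s(1,3) u(1,2))
  have cb: "cod C b' = cod C b" using assms(7) by (metis cmp_arr(3) s'(2) u(1,3))
  have "is_mono C u"
  proof (rule monoI)
    fix x assume x: "x \<in> arr C" "cod C x = dom C u" "u \<cdot> x = zer C (dom C x) (cod C u)"
    have "b \<cdot> x = zer C (dom C x) (cod C b)" using reassoc[OF assms(7), of x] x cb by simp
    then obtain y where y: "y \<in> arr C" "dom C y = dom C x" "cod C y = dom C a" "a \<cdot> y = x"
      using kernel_lift[OF short_exactD(1)[OF assms(1)], of x] x by auto
    have "a' \<cdot> y = zer C (dom C y) (cod C a')" using reassoc[OF assms(6), of y] x y by simp
    then have "y = zer C (dom C y) (dom C a)"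
      using mono_zero[OF short_exactD(3)[OF assms(2)], of y] y da by simp
    then show "x = zer C (dom C x) (dom C u)" using y by (metis cmp_zer s(1,3) dom_obj u(2) x(1))
  qed simp
  moreover have "is_epi C u"
  proof (rule epiI)
    fix x assume x: "x \<in> arr C" "dom C x = cod C u" "x \<cdot> u = zer C (dom C u) (cod C x)"
    have "x \<cdot> a' = zer C (dom C a') (cod C x)" using reassoc[OF x(3), of a] x assms(6) da by simp
    then obtain y where y: "y \<in> arr C" "dom C y = cod C b'" "cod C y = cod C x" "y \<cdot> b' = x"
      using cokernel_desc[OF short_exactD(2)[OF assms(2)], of x] x by auto
    have "y \<cdot> b = zer C (dom C b) (cod C y)" using reassoc[OF y(4), of u] assms(7) x y by simp
    then have "y = zer C (cod C b) (cod C y)"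
      using epi_zero[OF short_exactD(4)[OF assms(1)], of y] y cb by simp
    then show "x = zer C (cod C u) (cod C x)" using y x by (metis zer_cmp s'(2) cb u(3) cod_obj)
  qed simp
  ultimately show ?thesis using mono_epi_iso[of u] that by metis
qed

text \<open>The true pullback of \<open>b'\<close> along \<open>k\<close> is an extension with the
  same ends as \<open>[a, b]\<close>, so the comparison \<open>w\<close> is invertible by the short
  five lemma, and the given square inherits the universal property.\<close>

lemma short_exact_map_pullback:
  assumes ab: "short_exact C a b" and ab': "short_exact C a' b'"
    and u: "u \<in> homs C (dom C b) (dom C b')" "k \<in> homs C (cod C b) (cod C b')"
    and c: "u \<cdot> a = a'" "b' \<cdot> u = k \<cdot> b"
  shows "is_pullback C b' k u b"
proof -
  note s [simp] = short_exactD(5-8)[OF ab] note s' [simp] = short_exactD(5-8)[OF ab']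
  have u' [simp]: "u \<in> arr C" "dom C u = dom C b" "cod C u = dom C b'" "k \<in> arr C" "dom C k = cod C b"
    "cod C k = cod C b'" using u by (auto simp: homs_iff)
  have da: "dom C a' = dom C a" using c by (metis cmp_arr(2) s(1,3) u'(1,2))
  obtain p q where pb: "is_pullback C b' k p q" using ex_pullback[of b' k] by auto
  note d [simp] = pullbackD(3,4,6-9)[OF pb]
  obtain e where e: "e \<in> arr C" "dom C e = dom C a" "cod C e = dom C q" "p \<cdot> e = a'"
    "q \<cdot> e = zer C (dom C a) (dom C k)"
    using pullback_ex[OF pb, of a' "zer C (dom C a) (dom C k)"] da by auto
  have seq: "short_exact C e q" by (rule pullback_short_exact[OF ab' pb]) (use e da in auto)
  obtain w where w: "w \<in> arr C" "dom C w = dom C b" "cod C w = dom C q" "p \<cdot> w = u" "q \<cdot> w = b"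
    using pullback_ex[OF pb, of u b] c by auto
  have "p \<cdot> (w \<cdot> a) = u \<cdot> a" by (rule reassoc[OF w(4)]) (use w in simp_all)
  moreover have "q \<cdot> (w \<cdot> a) = b \<cdot> a" by (rule reassoc[OF w(5)]) (use w in simp_all)
  ultimately have wa: "w \<cdot> a = e"
    using pullback_eq[OF pb, of "w \<cdot> a" e] by (simp add: w(1-3) e c)
  obtain v where v: "v \<in> arr C" "dom C v = cod C w" "cod C v = dom C w"
    "v \<cdot> w = idn C (dom C w)" "w \<cdot> v = idn C (cod C w)"
    using short_five[OF ab seq, of w] w wa by auto
  show ?thesis
  proof (rule pullbackI)
    fix x y assume x: "x \<in> arr C" "y \<in> arr C" "dom C x = dom C y" "cod C x = dom C b'" "cod C y = dom C k"
      "b' \<cdot> x = k \<cdot> y"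
    obtain z where z: "z \<in> arr C" "dom C z = dom C y" "cod C z = dom C q" "p \<cdot> z = x" "q \<cdot> z = y"
      using pullback_ex[OF pb, of x y] x by auto
    have wv: "w \<cdot> (v \<cdot> z) = z" using reassoc[OF v(5), of z] w v z by simp
    have "u \<cdot> (v \<cdot> z) = x" "b \<cdot> (v \<cdot> z) = y"
      using reassoc[OF w(4), of "v \<cdot> z"] reassoc[OF w(5), of "v \<cdot> z"] w v z wv by auto
    then show "\<exists>u'. u' \<in> arr C \<and> dom C u' = dom C y \<and> cod C u' = dom C b \<and> u \<cdot> u' = x \<and> b \<cdot> u' = y"
      using v z w by (intro exI[of _ "v \<cdot> z"]) auto
  next
    fix x y assume x: "x \<in> arr C" "y \<in> arr C" "dom C x = dom C y" "cod C x = dom C b" "cod C y = dom C b"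
      "u \<cdot> x = u \<cdot> y" "b \<cdot> x = b \<cdot> y"
    have "w \<cdot> x = w \<cdot> y"
      by (rule pullback_eq[OF pb]) (use w x reassoc[OF w(4)] reassoc[OF w(5)] in auto)
    then have "v \<cdot> (w \<cdot> x) = v \<cdot> (w \<cdot> y)" by simp
    then show "x = y" using reassoc[OF v(4), of x] reassoc[OF v(4), of y] x w v by simp
  qed (simp_all add: c)
qed

text \<open>The difference of the identity and \<open>a \<cdot> r\<close> kills \<open>a\<close> and
  so descends along \<open>b\<close>; the induced map is the section.\<close>

lemma retraction_section:
  assumes "short_exact C a b" "r \<in> homs C (cod C a) (dom C a)" "r \<cdot> a = idn C (dom C a)"
  obtains s where "s \<in> homs C (cod C b) (dom C b)" "b \<cdot> s = idn C (cod C b)"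
proof -
  note s [simp] = short_exactD(5-8)[OF assms(1)]
  have r [simp]: "r \<in> arr C" "dom C r = dom C b" "cod C r = dom C a" using assms(2) by (auto simp: homs_iff)
  let ?h = "plus C (idn C (dom C b)) (neg (a \<cdot> r))"
  have "?h \<cdot> a = zer C (dom C a) (cod C ?h)" using assms(3) by (simp add: distr)
  then obtain s where t: "s \<in> arr C" "dom C s = cod C b" "cod C s = dom C b" "s \<cdot> b = ?h"
    using cokernel_desc[OF short_exactD(2)[OF assms(1)], of ?h] by auto
  have "(b \<cdot> s) \<cdot> b = b \<cdot> ?h" using t by simp
  also have "\<dots> = b" using reassoc[OF s(4), of r] by (simp add: distl)
  finally have "b \<cdot> s = idn C (cod C b)"
    using epiD[OF short_exactD(4)[OF assms(1)], of "b \<cdot> s" "idn C (cod C b)"] t by simp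
  then show ?thesis using that t by auto
qed

text \<open>The map \<open>t\<close> extends \<open>b\<close> over \<open>i\<close>; such a map
  arises when the pushout of \<open>[i, c]\<close> along \<open>b\<close> splits. Its kernel
  \<open>l\<close> is an extension of the same quotient by the smaller object
  \<open>dom C a\<close>, and \<open>l\<close> shows that pushing this extension out along
  \<open>a\<close> gives back \<open>[i, c]\<close>.\<close>

lemma kernel_of_extension:
  assumes ab: "short_exact C a b" and ic: "short_exact C i c" and "cod C a = dom C i"
    and t: "t \<in> homs C (cod C i) (cod C b)" "t \<cdot> i = b"
  obtains l a' where "l \<in> arr C" "cod C l = cod C i" "short_exact C a' (c \<cdot> l)" "l \<cdot> a' = i \<cdot> a"
    "dom C a' = dom C a"
proof -
  note s [simp] = short_exactD(5-8)[OF ab] note s' [simp] = short_exactD(5-8)[OF ic]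
  have t' [simp]: "t \<in> arr C" "dom C t = dom C c" "cod C t = cod C b" using t by (auto simp: homs_iff)
  have di: "dom C i = dom C b" using assms(3) by simp
  have et: "is_epi C t" by (rule epi_cancel[of t i]) (use t short_exactD(4)[OF ab] in auto)
  obtain l where l: "is_kernel C l t" using ex_kernel by fastforce
  note ld [simp] = kernelD[OF l]
  have cl: "cod C l = dom C c" by simp
  have ck: "is_cokernel C t l" using epi_is_cokernel_of_kernel[OF et l] .
  have "t \<cdot> (i \<cdot> a) = zer C (dom C a) (cod C t)" using reassoc[OF t(2), of a] di by simp
  then obtain a' where a': "a' \<in> arr C" "dom C a' = dom C a" "cod C a' = dom C l" "l \<cdot> a' = i \<cdot> a"
    using kernel_lift[OF l, of "i \<cdot> a"] di by auto
  have mia: "is_mono C (i \<cdot> a)"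
    by (rule mono_cmp) (use short_exactD(3)[OF ab] short_exactD(3)[OF ic] di in auto)
  have "is_kernel C a' (c \<cdot> l)"
  proof (rule kernelI)
    show "is_mono C a'" by (rule mono_cancel[of l a']) (use a' mia in auto)
    show "(c \<cdot> l) \<cdot> a' = zer C (dom C a') (cod C (c \<cdot> l))"
      using a' reassoc[OF s'(4), of a] di by simp
    fix h assume h: "h \<in> arr C" "cod C h = dom C (c \<cdot> l)" "(c \<cdot> l) \<cdot> h = zer C (dom C h) (cod C (c \<cdot> l))"
    then obtain y where y: "y \<in> arr C" "dom C y = dom C h" "cod C y = dom C i" "i \<cdot> y = l \<cdot> h"
      using kernel_lift[OF short_exactD(1)[OF ic], of "l \<cdot> h"] by auto
    have "b \<cdot> y = t \<cdot> (l \<cdot> h)" using reassoc[OF t(2), of y] y di by simp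
    also have "\<dots> = zer C (dom C h) (cod C b)" using reassoc[OF ld(4), of h] h by simp
    finally obtain z where z: "z \<in> arr C" "dom C z = dom C h" "cod C z = dom C a" "a \<cdot> z = y"
      using kernel_lift[OF short_exactD(1)[OF ab], of y] y di by auto
    have "a' \<cdot> z = h"
    proof (rule monoD[OF kernel_mono[OF l]])
      show "l \<cdot> (a' \<cdot> z) = l \<cdot> h" using reassoc[OF a'(4), of z] a' z y di by simp
    qed (use a' z h in auto)
    then show "\<exists>u. u \<in> arr C \<and> dom C u = dom C h \<and> cod C u = dom C a' \<and> a' \<cdot> u = h"
      using z a' by auto
  qed (use a' in auto)
  moreover have "is_epi C (c \<cdot> l)"
  proof (rule epiI)
    fix h assume h: "h \<in> arr C" "dom C h = cod C (c \<cdot> l)" "h \<cdot> (c \<cdot> l) = zer C (dom C (c \<cdot> l)) (cod C h)"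
    then obtain s where s: "s \<in> arr C" "dom C s = cod C t" "cod C s = cod C h" "s \<cdot> t = h \<cdot> c"
      using cokernel_desc[OF ck, of "h \<cdot> c"] by auto
    have "s \<cdot> b = (h \<cdot> c) \<cdot> i" using reassoc[OF s(4), of i] s t di by simp
    also have "\<dots> = zer C (dom C b) (cod C s)" using h s di by simp
    finally have "s = zer C (cod C b) (cod C s)"
      using s by (intro epi_zero[OF short_exactD(4)[OF ab]]) auto
    then have "h \<cdot> c = zer C (dom C c) (cod C h)" using s zer_cmp[of t "cod C h" "cod C b"] h by simp
    then show "h = zer C (cod C (c \<cdot> l)) (cod C h)"
      using h epi_zero[OF short_exactD(4)[OF ic], of h] by simp
  qed simp
  ultimately show ?thesis using that[of l a'] a' by (simp add: short_exact_iff)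
qed

text \<open>The right-hand square is a pullback, which describes the kernel, and the difference map
  is epic since it restricts to \<open>b'\<close> on one summand. The long exact sequence of this
  short exact sequence is the Mayer-Vietoris sequence of the square.\<close>

lemma mayer_vietoris_short_exact:
  assumes ab: "short_exact C a b" and ab': "short_exact C a' b'"
    and u: "u \<in> homs C (dom C b) (dom C b')" "k \<in> homs C (cod C b) (cod C b')"
    and c: "u \<cdot> a = a'" "b' \<cdot> u = k \<cdot> b"
  shows "short_exact C (plus C (in1 C (dom C b') (cod C b) \<cdot> u) (in2 C (dom C b') (cod C b) \<cdot> b))
    (plus C (b' \<cdot> pr1 C (dom C b') (cod C b)) (neg (k \<cdot> pr2 C (dom C b') (cod C b))))"
proof -
  note s [simp] = short_exactD(5-8)[OF ab] note s' [simp] = short_exactD(5-8)[OF ab']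
  have u' [simp]: "u \<in> arr C" "dom C u = dom C b" "cod C u = dom C b'" "k \<in> arr C" "dom C k = cod C b"
    "cod C k = cod C b'" using u by (auto simp: homs_iff)
  note pb = short_exact_map_pullback[OF assms]
  let ?t = "plus C (b' \<cdot> pr1 C (dom C b') (cod C b)) (neg (k \<cdot> pr2 C (dom C b') (cod C b)))"
  have ti: "?t \<cdot> in1 C (dom C b') (cod C b) = b'" by (simp add: distr)
  have "is_epi C ?t" by (rule epi_cancel[of ?t "in1 C (dom C b') (cod C b)"]) (use short_exactD(4)[OF ab'] ti in simp_all)
  then show ?thesis using pullback_kernel[OF pb] by (simp add: short_exact_iff)
qed

end


section \<open>Equivalence classes of extensions\<close>

text \<open>The extensions have \<open>n + 2\<close> arrows; \<open>g\<close> is the component at their left ends, \<open>f\<close> the one at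
  their right ends.\<close>

definition emap :: "('o, 'm, 'z) precat_scheme \<Rightarrow> nat \<Rightarrow> 'm \<Rightarrow> 'm \<Rightarrow> 'm list \<Rightarrow> 'm list \<Rightarrow> bool" where
  "emap C n g f E F \<longleftrightarrow> (\<exists>\<phi>. \<phi> 0 = g \<and> \<phi> (Suc (Suc n)) = f \<and>
     f \<in> homs C (cod C (E ! Suc n)) (cod C (F ! Suc n)) \<and>
     (\<forall>j\<le>Suc n. \<phi> j \<in> homs C (dom C (E ! j)) (dom C (F ! j)) \<and>
        F ! j \<cdot>\<^bsub>C\<^esub> \<phi> j = \<phi> (Suc j) \<cdot>\<^bsub>C\<^esub> E ! j))"

text \<open>Positions replace \<open>last\<close> and \<open>butlast\<close>, so that ladders can be
  compared index by index.\<close>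

lemma pull_rel_nth:
  assumes "length E = Suc (Suc n)"
  shows "pull_rel C f E F \<longleftrightarrow> (\<exists>p q e. is_pullback C (E ! Suc n) f p q \<and>
    e \<in> homs C (dom C (E ! n)) (dom C p) \<and> p \<cdot>\<^bsub>C\<^esub> e = E ! n \<and> q \<cdot>\<^bsub>C\<^esub> e = zer C (dom C e) (dom C f) \<and>
    F = E[n := e, Suc n := q])"
proof -
  obtain xs x y where E: "E = xs @ [x, y]" "length xs = n"
  proof
    show "E = take n E @ [E ! n, E ! Suc n]" using assms
      by (simp add: list_eq_iff_nth_eq nth_append less_Suc_eq nth_Cons split: nat.splits)
  qed (use assms in simp)
  have "butlast (butlast E) @ [e, q] = E[n := e, Suc n := q]" for e q
    using E by (simp add: butlast_append list_update_append)
  moreover have "last E = E ! Suc n" "last (butlast E) = E ! n" "length E \<noteq> 1"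
    using E by (auto simp: nth_append butlast_append)
  ultimately show ?thesis by (simp add: pull_rel_def)
qed

lemma pull_rel_1: "pull_rel C f [h] F \<longleftrightarrow> F = [h \<cdot>\<^bsub>C\<^esub> f]"
  by (simp add: pull_rel_def)

lemma yext_Suc:
  "yext C (Suc n) M N E \<longleftrightarrow> length E = Suc (Suc n) \<and> dom C (E ! 0) = N \<and> cod C (E ! Suc n) = M \<and>
     is_mono C (E ! 0) \<and> is_epi C (E ! Suc n) \<and> (\<forall>j\<le>n. exact_at C (E ! j) (E ! Suc j))"
proof -
  show ?thesis
  proof (cases "length E = Suc (Suc n)")
    case True
    then have "E \<noteq> []" by auto
    then have "hd E = E ! 0" "last E = E ! Suc n" using True by (simp_all add: hd_conv_nth last_conv_nth)
    then show ?thesis using True unfolding yext_def by (simp only: less_Suc_eq_le) simp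
  next
    case False then show ?thesis by (simp add: yext_def)
  qed
qed

lemma ext_class_self [simp]: "E \<in> ext_class C E"
  by (simp add: ext_class_def)

lemma ext_class_eq_iff: "ext_class C E = ext_class C F \<longleftrightarrow> equivclp (yext_step C) E F"
proof
  assume "ext_class C E = ext_class C F"
  then have "F \<in> ext_class C E" by simp
  then show "equivclp (yext_step C) E F" by (simp add: ext_class_def)
next
  assume *: "equivclp (yext_step C) E F"
  show "ext_class C E = ext_class C F"
    unfolding ext_class_def using equivclp_trans[OF *] equivclp_trans[OF equivclp_sym[OF *]] by blast
qed

lemma ext_class_step: "yext_step C E F \<Longrightarrow> ext_class C E = ext_class C F"
  unfolding ext_class_eq_iff by (rule r_into_equivclp)

lemma rev_nth_Suc:
  "length E = Suc (Suc n) \<Longrightarrow> j \<le> Suc n \<Longrightarrow> rev E ! j = E ! (Suc n - j)"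
  by (simp add: rev_nth)

section \<open>Ladders between extensions\<close>

context abelian_category
begin

text \<open>Equivalence steps become ladders with identities at both ends, so composition and
  universal properties of ladders apply to them.\<close>

lemma step_iff:
  "yext_step C E F \<longleftrightarrow> (\<exists>n M N. yext C (Suc n) M N E \<and> yext C (Suc n) M N F \<and>
     idn C M \<in> homs C M M \<and> emap C n (idn C N) (idn C M) E F)"
proof
  assume "yext_step C E F"
  then obtain n M N \<phi> where *: "n \<ge> 1" "yext C n M N E" "yext C n M N F"
     "\<phi> 0 = idn C N" "\<phi> (Suc n) = idn C M"
     "\<And>j. j\<le>n \<Longrightarrow> \<phi> j \<in> homs C (dom C (E ! j)) (dom C (F ! j)) \<and>
        F ! j \<cdot>\<^bsub>C\<^esub> \<phi> j = \<phi> (Suc j) \<cdot>\<^bsub>C\<^esub> E ! j" unfolding yext_step_def by blast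
  then obtain m where m: "n = Suc m" by (cases n) auto
  have "M \<in> obj C" using *(2) unfolding m yext_Suc by auto
  then have "idn C M \<in> homs C M M" by (rule idn_hom)
  then show "\<exists>n M N. yext C (Suc n) M N E \<and> yext C (Suc n) M N F \<and>
     idn C M \<in> homs C M M \<and> emap C n (idn C N) (idn C M) E F"
    using * unfolding m by (intro exI[of _ m] exI[of _ M] exI[of _ N]) (auto simp: emap_def yext_Suc)
next
  assume "\<exists>n M N. yext C (Suc n) M N E \<and> yext C (Suc n) M N F \<and>
     idn C M \<in> homs C M M \<and> emap C n (idn C N) (idn C M) E F"
  then show "yext_step C E F" unfolding yext_step_def emap_def by (metis le_add1 plus_1_eq_Suc)
qed

lemma yextD:
  assumes "yext C (Suc n) M N E"
  shows "length E = Suc (Suc n)" "dom C (E ! 0) = N" "cod C (E ! Suc n) = M"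
    "is_mono C (E ! 0)" "is_epi C (E ! Suc n)" "\<And>j. j \<le> n \<Longrightarrow> exact_at C (E ! j) (E ! Suc j)"
    "\<And>j. j \<le> Suc n \<Longrightarrow> E ! j \<in> arr C" "\<And>j. j \<le> n \<Longrightarrow> cod C (E ! j) = dom C (E ! Suc j)"
    "M \<in> obj C" "N \<in> obj C"
proof -
  show *: "length E = Suc (Suc n)" "dom C (E ! 0) = N" "cod C (E ! Suc n) = M"
    "is_mono C (E ! 0)" "is_epi C (E ! Suc n)" "\<And>j. j \<le> n \<Longrightarrow> exact_at C (E ! j) (E ! Suc j)"
    using assms by (auto simp: yext_Suc)
  show a: "E ! j \<in> arr C" if "j \<le> Suc n" for j
    using *(5) exact_at_arr(1)[OF *(6), of j] that by (cases "j = Suc n") auto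
  show "cod C (E ! j) = dom C (E ! Suc j)" if "j \<le> n" for j
    using exact_at_arr(3)[OF *(6)[OF that]] .
  show "M \<in> obj C" "N \<in> obj C" using *(2,3) a[of 0] a[of "Suc n"] by auto
qed

lemma yext_0: "yext C (Suc 0) M N [a, b] \<longleftrightarrow> short_exact C a b \<and> dom C a = N \<and> cod C b = M"
  by (auto simp: yext_Suc short_exact_def)

lemma emapE:
  assumes "emap C n g f E F"
  obtains \<phi> where "\<phi> 0 = g" "\<phi> (Suc (Suc n)) = f"
    "\<And>j. j \<le> Suc n \<Longrightarrow> \<phi> j \<in> arr C" "\<And>j. j \<le> Suc n \<Longrightarrow> dom C (\<phi> j) = dom C (E ! j)"
    "\<And>j. j \<le> Suc n \<Longrightarrow> cod C (\<phi> j) = dom C (F ! j)"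
    "f \<in> arr C" "dom C f = cod C (E ! Suc n)" "cod C f = cod C (F ! Suc n)"
    "\<And>j. j \<le> Suc n \<Longrightarrow> F ! j \<cdot> \<phi> j = \<phi> (Suc j) \<cdot> E ! j"
  using assms unfolding emap_def homs_iff by metis

lemma emapI:
  assumes "\<phi> 0 = g" "\<phi> (Suc (Suc n)) = f"
    "\<And>j. j \<le> Suc n \<Longrightarrow> \<phi> j \<in> homs C (dom C (E ! j)) (dom C (F ! j))"
    "f \<in> homs C (cod C (E ! Suc n)) (cod C (F ! Suc n))"
    "\<And>j. j \<le> Suc n \<Longrightarrow> F ! j \<cdot> \<phi> j = \<phi> (Suc j) \<cdot> E ! j"
  shows "emap C n g f E F"
  unfolding emap_def using assms by blast

lemma emap_ends:
  assumes "emap C n g f E F" "yext C (Suc n) M N E" "yext C (Suc n) M' N' F"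
  shows "g \<in> homs C N N'" "f \<in> homs C M M'"
  using assms unfolding emap_def by (auto simp: yext_Suc)

lemma emap_id:
  assumes "yext C (Suc n) M N E" shows "emap C n (idn C N) (idn C M) E E"
\<comment> \<open>The \<open>n + 2\<close> arrows connect \<open>n + 3\<close> objects, and the last
  of these is visible only as a codomain; explicit ladders treat its rung separately.\<close>
proof (rule emapI[where \<phi> = "\<lambda>j. if j = Suc (Suc n) then idn C M else idn C (dom C (E ! j))"])
  note y = yextD[OF assms]
  fix j assume j: "j \<le> Suc n"
  show "(if j = Suc (Suc n) then idn C M else idn C (dom C (E ! j))) \<in> homs C (dom C (E ! j)) (dom C (E ! j))"
    using y(7)[of j] j by (auto simp: homs_iff)
  show "E ! j \<cdot> (if j = Suc (Suc n) then idn C M else idn C (dom C (E ! j))) =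
    (if Suc j = Suc (Suc n) then idn C M else idn C (dom C (E ! Suc j))) \<cdot> E ! j"
    using y(7)[of j] y(8)[of j] y(3) j by auto
qed (use yextD[OF assms] in auto)

lemma emap_comp:
  assumes E: "yext C (Suc n) M N E" and F: "yext C (Suc n) M' N' F" and G: "yext C (Suc n) M'' N'' G"
    and "emap C n g f E F" "emap C n g' f' F G"
  shows "emap C n (g' \<cdot> g) (f' \<cdot> f) E G"
proof -
  obtain \<phi> where p: "\<phi> 0 = g" "\<phi> (Suc (Suc n)) = f"
    "\<And>j. j \<le> Suc n \<Longrightarrow> \<phi> j \<in> arr C" "\<And>j. j \<le> Suc n \<Longrightarrow> dom C (\<phi> j) = dom C (E ! j)"
    "\<And>j. j \<le> Suc n \<Longrightarrow> cod C (\<phi> j) = dom C (F ! j)"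
    "f \<in> arr C" "dom C f = cod C (E ! Suc n)" "cod C f = cod C (F ! Suc n)"
    "\<And>j. j \<le> Suc n \<Longrightarrow> F ! j \<cdot> \<phi> j = \<phi> (Suc j) \<cdot> E ! j"
    using emapE[OF assms(4)] by metis
  obtain \<psi> where q: "\<psi> 0 = g'" "\<psi> (Suc (Suc n)) = f'"
    "\<And>j. j \<le> Suc n \<Longrightarrow> \<psi> j \<in> arr C" "\<And>j. j \<le> Suc n \<Longrightarrow> dom C (\<psi> j) = dom C (F ! j)"
    "\<And>j. j \<le> Suc n \<Longrightarrow> cod C (\<psi> j) = dom C (G ! j)"
    "f' \<in> arr C" "dom C f' = cod C (F ! Suc n)" "cod C f' = cod C (G ! Suc n)"
    "\<And>j. j \<le> Suc n \<Longrightarrow> G ! j \<cdot> \<psi> j = \<psi> (Suc j) \<cdot> F ! j"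
    using emapE[OF assms(5)] by metis
  have s: "\<phi> (Suc j) \<in> arr C \<and> dom C (\<phi> (Suc j)) = cod C (E ! j) \<and> cod C (\<phi> (Suc j)) = cod C (F ! j)"
    if "j \<le> Suc n" for j
    using p(2,6,7,8) p(3,4,5)[of "Suc j"] yextD(8)[OF E, of j] yextD(8)[OF F, of j] that
    by (cases "j = Suc n") auto
  have t: "\<psi> (Suc j) \<in> arr C \<and> dom C (\<psi> (Suc j)) = cod C (F ! j) \<and> cod C (\<psi> (Suc j)) = cod C (G ! j)"
    if "j \<le> Suc n" for j
    using q(2,6,7,8) q(3,4,5)[of "Suc j"] yextD(8)[OF F, of j] yextD(8)[OF G, of j] that
    by (cases "j = Suc n") auto
  show ?thesis
  proof (rule emapI[where \<phi> = "\<lambda>j. \<psi> j \<cdot> \<phi> j"])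
    fix j assume j: "j \<le> Suc n"
    show "\<psi> j \<cdot> \<phi> j \<in> homs C (dom C (E ! j)) (dom C (G ! j))"
      using p(3-5)[OF j] q(3-5)[OF j] by (simp add: homs_iff)
    have "G ! j \<cdot> (\<psi> j \<cdot> \<phi> j) = (\<psi> (Suc j) \<cdot> F ! j) \<cdot> \<phi> j"
      by (rule reassoc[OF q(9)[OF j]])
        (use p(3-5)[OF j] q(3-5)[OF j] yextD(7)[OF G j] in auto)
    also have "\<dots> = \<psi> (Suc j) \<cdot> (\<phi> (Suc j) \<cdot> E ! j)"
      using p(3-5,9)[OF j] t[OF j] yextD(7)[OF F j] by simp
    finally show "G ! j \<cdot> (\<psi> j \<cdot> \<phi> j) = (\<psi> (Suc j) \<cdot> \<phi> (Suc j)) \<cdot> E ! j"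
      using s[OF j] t[OF j] yextD(7)[OF E j] by simp
  qed (use p q in \<open>auto simp: homs_iff\<close>)
qed

lemma emap_plus:
  assumes E: "yext C (Suc n) M N E" and F: "yext C (Suc n) M' N' F"
    and "emap C n g f E F" "emap C n g' f' E F"
  shows "emap C n (plus C g g') (plus C f f') E F"
proof -
  obtain \<phi> where p: "\<phi> 0 = g" "\<phi> (Suc (Suc n)) = f"
    "\<And>j. j \<le> Suc n \<Longrightarrow> \<phi> j \<in> arr C" "\<And>j. j \<le> Suc n \<Longrightarrow> dom C (\<phi> j) = dom C (E ! j)"
    "\<And>j. j \<le> Suc n \<Longrightarrow> cod C (\<phi> j) = dom C (F ! j)"
    "f \<in> arr C" "dom C f = cod C (E ! Suc n)" "cod C f = cod C (F ! Suc n)"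
    "\<And>j. j \<le> Suc n \<Longrightarrow> F ! j \<cdot> \<phi> j = \<phi> (Suc j) \<cdot> E ! j"
    using emapE[OF assms(3)] by metis
  obtain \<psi> where q: "\<psi> 0 = g'" "\<psi> (Suc (Suc n)) = f'"
    "\<And>j. j \<le> Suc n \<Longrightarrow> \<psi> j \<in> arr C" "\<And>j. j \<le> Suc n \<Longrightarrow> dom C (\<psi> j) = dom C (E ! j)"
    "\<And>j. j \<le> Suc n \<Longrightarrow> cod C (\<psi> j) = dom C (F ! j)"
    "f' \<in> arr C" "dom C f' = cod C (E ! Suc n)" "cod C f' = cod C (F ! Suc n)"
    "\<And>j. j \<le> Suc n \<Longrightarrow> F ! j \<cdot> \<psi> j = \<psi> (Suc j) \<cdot> E ! j"
    using emapE[OF assms(4)] by metis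
  have s: "\<phi> (Suc j) \<in> arr C \<and> dom C (\<phi> (Suc j)) = cod C (E ! j) \<and> cod C (\<phi> (Suc j)) = cod C (F ! j)"
    if "j \<le> Suc n" for j
    using p(2,6,7,8) p(3,4,5)[of "Suc j"] yextD(8)[OF E, of j] yextD(8)[OF F, of j] that
    by (cases "j = Suc n") auto
  have t: "\<psi> (Suc j) \<in> arr C \<and> dom C (\<psi> (Suc j)) = cod C (E ! j) \<and> cod C (\<psi> (Suc j)) = cod C (F ! j)"
    if "j \<le> Suc n" for j
    using q(2,6,7,8) q(3,4,5)[of "Suc j"] yextD(8)[OF E, of j] yextD(8)[OF F, of j] that
    by (cases "j = Suc n") auto
  show ?thesis
  proof (rule emapI[where \<phi> = "\<lambda>j. plus C (\<phi> j) (\<psi> j)"])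
    fix j assume j: "j \<le> Suc n"
    show "plus C (\<phi> j) (\<psi> j) \<in> homs C (dom C (E ! j)) (dom C (F ! j))"
      using p(3-5)[OF j] q(3-5)[OF j] by (simp add: homs_iff)
    have "F ! j \<cdot> plus C (\<phi> j) (\<psi> j) = plus C (F ! j \<cdot> \<phi> j) (F ! j \<cdot> \<psi> j)"
      using p(3-5)[OF j] q(3-5)[OF j] yextD(7)[OF F j] by (subst distl) auto
    also have "\<dots> = plus C (\<phi> (Suc j)) (\<psi> (Suc j)) \<cdot> E ! j"
      unfolding p(9)[OF j] q(9)[OF j] using s[OF j] t[OF j] yextD(7)[OF E j] by (subst distr) auto
    finally show "F ! j \<cdot> plus C (\<phi> j) (\<psi> j) = plus C (\<phi> (Suc j)) (\<psi> (Suc j)) \<cdot> E ! j" .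
  qed (use p q in \<open>auto simp: homs_iff\<close>)
qed

lemma emap_zero:
  assumes E: "yext C (Suc n) M N E" and F: "yext C (Suc n) M' N' F"
  shows "emap C n (zer C N N') (zer C M M') E F"
proof (rule emapI[where \<phi> = "\<lambda>j. if j = Suc (Suc n) then zer C M M' else zer C (dom C (E ! j)) (dom C (F ! j))"])
  fix j assume j: "j \<le> Suc n"
  note y = yextD(7)[OF E j] yextD(7)[OF F j]
  show "(if j = Suc (Suc n) then zer C M M' else zer C (dom C (E ! j)) (dom C (F ! j))) \<in>
      homs C (dom C (E ! j)) (dom C (F ! j))" using j y by (auto simp: homs_iff)
  show "F ! j \<cdot> (if j = Suc (Suc n) then zer C M M' else zer C (dom C (E ! j)) (dom C (F ! j))) =
      (if Suc j = Suc (Suc n) then zer C M M' else zer C (dom C (E ! Suc j)) (dom C (F ! Suc j))) \<cdot> E ! j"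
    using j y yextD(3,8,9)[OF E] yextD(3,8,9)[OF F] yextD(7)[OF F, of "Suc j"] by auto
qed (use yextD[OF E] yextD[OF F] in \<open>auto simp: homs_iff\<close>)

section \<open>Pullback of extensions along a morphism on the right\<close>

lemma exact_at_pull:
  assumes "exact_at C w x" "is_pullback C y f p q" "e \<in> homs C (dom C x) (dom C p)" "p \<cdot> e = x"
    "q \<cdot> e = zer C (dom C e) (dom C f)"
  shows "exact_at C w e"
proof -
  obtain m d where md: "is_epi C d" "is_kernel C m x" "cod C d = dom C m" "w = m \<cdot> d"
    using exact_atE[OF assms(1)] .
  note k [simp] = kernelD[OF md(2)] note pd [simp] = pullbackD(2-4,6-8)[OF assms(2)]
  have e [simp]: "e \<in> arr C" "dom C e = dom C x" "cod C e = dom C q" using assms(3) by (auto simp: homs_iff)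
  have x: "cod C x = dom C y" using assms(4) by auto
  have "is_kernel C m e"
  proof (rule kernelI)
    have "e \<cdot> m = zer C (dom C m) (dom C q)"
    proof (rule pullback_eq[OF assms(2)])
      show "p \<cdot> (e \<cdot> m) = p \<cdot> zer C (dom C m) (dom C q)"
        using reassoc[OF assms(4), of m] k(4) x by simp
      show "q \<cdot> (e \<cdot> m) = q \<cdot> zer C (dom C m) (dom C q)"
        using reassoc[OF assms(5), of m] by simp
    qed auto
    then show "e \<cdot> m = zer C (dom C m) (cod C e)" by simp
    fix h assume h: "h \<in> arr C" "cod C h = dom C e" "e \<cdot> h = zer C (dom C h) (cod C e)"
    have "x \<cdot> h = zer C (dom C h) (cod C x)" using reassoc[OF assms(4), of h] h x by simp
    then show "\<exists>u. u \<in> arr C \<and> dom C u = dom C h \<and> cod C u = dom C m \<and> m \<cdot> u = h"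
      by (intro kernel_ex[OF md(2)]) (use h in auto)
  qed (use kernel_mono[OF md(2)] in auto)
  then show ?thesis using exact_atI md by blast
qed

text \<open>The kernel of \<open>q\<close> is the kernel \<open>m\<close> of \<open>y\<close>,
  lifted to the pullback with zero second component; \<open>e\<close> factors through this lift by
  the same epimorphism by which \<open>x\<close> factors through \<open>m\<close>.\<close>

lemma exact_at_pull_last:
  assumes "exact_at C x y" "is_pullback C y f p q" "e \<in> homs C (dom C x) (dom C p)" "p \<cdot> e = x"
    "q \<cdot> e = zer C (dom C e) (dom C f)"
  shows "exact_at C e q"
proof -
  obtain m d where md: "is_epi C d" "is_kernel C m y" "cod C d = dom C m" "x = m \<cdot> d"
    using exact_atE[OF assms(1)] .
  note k [simp] = kernelD[OF md(2)] note pd [simp] = pullbackD(2-4,6-8)[OF assms(2)]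
  have c: "cod C f = cod C y" using pullbackD[OF assms(2)] by simp
  have d [simp]: "d \<in> arr C" using md by simp
  have e [simp]: "e \<in> arr C" "dom C e = dom C d" "cod C e = dom C q" using assms(3) md by (auto simp: homs_iff)
  obtain m' where m': "m' \<in> arr C" "dom C m' = dom C m" "cod C m' = dom C q" "p \<cdot> m' = m"
    "q \<cdot> m' = zer C (dom C m) (dom C f)"
    using pullback_ex[OF assms(2), of m "zer C (dom C m) (dom C f)"] c by auto
  have em: "e = m' \<cdot> d"
  proof (rule pullback_eq[OF assms(2)])
    show "p \<cdot> e = p \<cdot> (m' \<cdot> d)" using assms(4) md reassoc[OF m'(4), of d] m' by simp
    show "q \<cdot> e = q \<cdot> (m' \<cdot> d)" using assms(5) md reassoc[OF m'(5), of d] m' by simp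
  qed (use m' md in auto)
  have "is_kernel C m' q"
  proof (rule kernelI)
    show "is_mono C m'" by (rule mono_cancel[of p]) (use m' kernel_mono[OF md(2)] in auto)
    fix h assume h: "h \<in> arr C" "cod C h = dom C q" "q \<cdot> h = zer C (dom C h) (cod C q)"
    have "y \<cdot> (p \<cdot> h) = zer C (dom C h) (cod C y)"
      using reassoc[OF pullbackD(9)[OF assms(2)], of h] h c by simp
    then obtain u where u: "u \<in> arr C" "dom C u = dom C h" "cod C u = dom C m" "m \<cdot> u = p \<cdot> h"
      using kernel_lift[OF md(2), of "p \<cdot> h"] h by auto
    have "m' \<cdot> u = h"
    proof (rule pullback_eq[OF assms(2)])
      show "p \<cdot> (m' \<cdot> u) = p \<cdot> h" using u reassoc[OF m'(4), of u] m' by simp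
      show "q \<cdot> (m' \<cdot> u) = q \<cdot> h" using u h reassoc[OF m'(5), of u] m' by simp
    qed (use m' u h in auto)
    then show "\<exists>u. u \<in> arr C \<and> dom C u = dom C h \<and> cod C u = dom C m' \<and> m' \<cdot> u = h"
      using u m' by auto
  qed (use m' in auto)
  then show ?thesis using exact_atI[OF md(1), of m' q e] md m' em by simp
qed

lemma pull_ex:
  assumes E: "yext C (Suc n) M N E" and f: "f \<in> homs C M' M"
  shows "\<exists>F. pull_rel C f E F"
proof -
  note y = yextD[OF E]
  have f': "f \<in> arr C" "cod C f = M" "dom C f = M'" using f by (auto simp: homs_iff)
  obtain p q where pb: "is_pullback C (E ! Suc n) f p q"
    using ex_pullback[of "E ! Suc n" f] y(3) y(7)[of "Suc n"] f' by auto
  note pd = pullbackD[OF pb]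
  obtain e where "e \<in> arr C" "dom C e = dom C (zer C (dom C (E ! n)) M')" "cod C e = dom C q" "p \<cdot> e = E ! n"
    "q \<cdot> e = zer C (dom C (E ! n)) M'"
    by (rule pullback_ex[OF pb, of "E ! n" "zer C (dom C (E ! n)) M'"])
      (use y(3,7-9) f' exact_at_zero[OF y(6)[of n]] in auto)
  then show ?thesis
    unfolding pull_rel_nth[OF y(1)] using pb pd f' y(7)[of n] dom_obj[OF f'(1)]
    by (intro exI[of _ "E[n := e, Suc n := q]"] exI[of _ p] exI[of _ q] exI[of _ e]) (auto simp: homs_iff)
qed

lemma pull_rel_yext:
  assumes E: "yext C (Suc n) M N E" and f: "f \<in> homs C M' M" and "pull_rel C f E F"
  shows "yext C (Suc n) M' N F" "emap C n (idn C N) f F E"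
proof -
  note y = yextD[OF E]
  have f' [simp]: "f \<in> arr C" "cod C f = M" "dom C f = M'" using f by (auto simp: homs_iff)
  obtain p q e where pb: "is_pullback C (E ! Suc n) f p q" and e: "e \<in> homs C (dom C (E ! n)) (dom C p)"
    "p \<cdot> e = E ! n" "q \<cdot> e = zer C (dom C e) (dom C f)" and F: "F = E[n := e, Suc n := q]"
    using assms(3) unfolding pull_rel_nth[OF y(1)] by blast
  note pd = pullbackD[OF pb]
  have e' [simp]: "e \<in> arr C" "dom C e = dom C (E ! n)" "cod C e = dom C p" using e by (auto simp: homs_iff)
  have nth: "F ! j = (if j = n then e else if j = Suc n then q else E ! j)" if "j \<le> Suc n" for j
    unfolding F using that y(1) by (auto simp: nth_list_update)
  show "yext C (Suc n) M' N F"
    unfolding yext_Suc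
  proof (intro conjI allI impI)
    show "is_mono C (F ! 0)"
      using y(4) mono_cancel[of p e] e pd by (cases "n = 0") (auto simp: nth)
    show "exact_at C (F ! j) (F ! Suc j)" if j: "j \<le> n" for j
    proof -
      consider "j = n" | "Suc j = n" | "Suc j < n" using j by linarith
      then show ?thesis
      proof cases
        case 1 then show ?thesis
          using exact_at_pull_last[OF y(6)[of n] pb e] by (simp add: nth)
      next
        case 2
        then have "exact_at C (E ! j) (E ! n)" using y(6)[of j] by simp
        then show ?thesis using exact_at_pull[OF _ pb e, of "E ! j"] 2 by (auto simp: nth)
      next
        case 3 then show ?thesis using y(6)[of j] by (simp add: nth)
      qed
    qed
  qed (use y pullback_epi[OF pb] pd F nth[of 0] in \<open>auto simp: nth\<close>)
  have sq: "E ! Suc n \<cdot> p = f \<cdot> q" using pd by simp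
  show "emap C n (idn C N) f F E"
  proof (rule emapI[where \<phi> = "\<lambda>j. if j = Suc (Suc n) then f else if j = Suc n then p else idn C (dom C (F ! j))"])
    fix j assume j: "j \<le> Suc n"
    have o: "dom C (E ! j) \<in> obj C" using y(7)[OF j] by simp
    consider "j = Suc n" | "j = n" | "j < n" using j by linarith
    note cs = this
    from cs show "(if j = Suc (Suc n) then f else if j = Suc n then p else idn C (dom C (F ! j)))
      \<in> homs C (dom C (F ! j)) (dom C (E ! j))"
      using pd o j by cases (auto simp: nth homs_iff)
    from cs show "E ! j \<cdot> (if j = Suc (Suc n) then f else if j = Suc n then p else idn C (dom C (F ! j))) =
      (if Suc j = Suc (Suc n) then f else if Suc j = Suc n then p else idn C (dom C (F ! Suc j))) \<cdot> F ! j"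
    proof cases
      case 1 then show ?thesis using sq by (simp add: nth)
    next
      case 2 then show ?thesis using e y(7)[OF j] by (simp add: nth)
    next
      case 3
      then have "dom C (F ! Suc j) = cod C (E ! j)" using y(8)[of j] by (simp add: nth)
      then show ?thesis using 3 y(7)[OF j] by (simp add: nth)
    qed
  qed (use y pd nth[of 0] in \<open>auto simp: homs_iff nth\<close>)
qed

text \<open>Only the last middle object of the pullback is new, and a map into it is a compatible
  pair; the remaining rungs are kept. This universal property makes the pullback of a class
  independent of choices.\<close>

lemma pull_rel_universal:
  assumes E: "yext C (Suc n) M N E" and f: "f \<in> homs C M' M" and pr: "pull_rel C f E F"
    and G: "yext C (Suc n) M' N' G" and GE: "emap C n g f G E"
  shows "emap C n g (idn C M') G F"
proof -
  note y = yextD[OF E] note yG = yextD[OF G]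
  have f' [simp]: "f \<in> arr C" "cod C f = M" "dom C f = M'" using f by (auto simp: homs_iff)
  obtain p q e where pb: "is_pullback C (E ! Suc n) f p q" and e: "e \<in> homs C (dom C (E ! n)) (dom C p)"
    "p \<cdot> e = E ! n" "q \<cdot> e = zer C (dom C e) (dom C f)" and F: "F = E[n := e, Suc n := q]"
    using pr unfolding pull_rel_nth[OF y(1)] by blast
  note pd = pullbackD[OF pb]
  have e' [simp]: "e \<in> arr C" "dom C e = dom C (E ! n)" "cod C e = dom C p" using e by (auto simp: homs_iff)
  have nth: "F ! j = (if j = n then e else if j = Suc n then q else E ! j)" if "j \<le> Suc n" for j
    unfolding F using that y(1) by (auto simp: nth_list_update)
  obtain \<phi> where p: "\<phi> 0 = g" "\<phi> (Suc (Suc n)) = f"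
    "\<And>j. j \<le> Suc n \<Longrightarrow> \<phi> j \<in> arr C" "\<And>j. j \<le> Suc n \<Longrightarrow> dom C (\<phi> j) = dom C (G ! j)"
    "\<And>j. j \<le> Suc n \<Longrightarrow> cod C (\<phi> j) = dom C (E ! j)"
    "\<And>j. j \<le> Suc n \<Longrightarrow> E ! j \<cdot> \<phi> j = \<phi> (Suc j) \<cdot> G ! j"
    using emapE[OF GE] by metis
  obtain u where u: "u \<in> arr C" "dom C u = dom C (G ! Suc n)" "cod C u = dom C q"
    "p \<cdot> u = \<phi> (Suc n)" "q \<cdot> u = G ! Suc n"
    by (rule pullback_ex[OF pb, of "\<phi> (Suc n)" "G ! Suc n"])
      (use p(2) p(3-6)[of "Suc n"] yG(3) yG(7)[of "Suc n"] in auto)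
  have n1: "cod C (G ! n) = dom C (G ! Suc n)" "G ! n \<in> arr C" using yG by auto
  have eu: "e \<cdot> \<phi> n = u \<cdot> G ! n"
  proof (rule pullback_eq[OF pb])
    have "p \<cdot> (e \<cdot> \<phi> n) = E ! n \<cdot> \<phi> n" by (rule reassoc[OF e(2)]) (use p(3-5)[of n] pd in auto)
    also have "\<dots> = \<phi> (Suc n) \<cdot> G ! n" by (rule p(6)) simp
    also have "\<dots> = p \<cdot> (u \<cdot> G ! n)" by (rule reassoc[OF u(4), symmetric]) (use u n1 pd in auto)
    finally show "p \<cdot> (e \<cdot> \<phi> n) = p \<cdot> (u \<cdot> G ! n)" .
    have "q \<cdot> (e \<cdot> \<phi> n) = zer C (dom C e) (dom C f) \<cdot> \<phi> n"
      by (rule reassoc[OF e(3)]) (use p(3-5)[of n] pd in auto)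
    also have "\<dots> = zer C (dom C (G ! n)) M'" using p(3-5)[of n] yG by simp
    also have "\<dots> = G ! Suc n \<cdot> G ! n" using exact_at_zero[OF yG(6)[of n]] yG(3) by simp
    also have "\<dots> = q \<cdot> (u \<cdot> G ! n)" by (rule reassoc[OF u(5), symmetric]) (use u n1 pd in auto)
    finally show "q \<cdot> (e \<cdot> \<phi> n) = q \<cdot> (u \<cdot> G ! n)" .
  qed (use p(3-5)[of n] u n1 pd in auto)
  show ?thesis
  proof (rule emapI[where \<phi> = "\<lambda>j. if j = Suc (Suc n) then idn C M' else if j = Suc n then u else \<phi> j"])
    fix j assume j: "j \<le> Suc n"
    consider "j = Suc n" | "j = n" | "j < n" using j by linarith
    note cs = this
    from cs show "(if j = Suc (Suc n) then idn C M' else if j = Suc n then u else \<phi> j) \<in> homs C (dom C (G ! j)) (dom C (F ! j))"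
      using u p(3-5)[OF j] j by cases (auto simp: nth homs_iff)
    from cs show "F ! j \<cdot> (if j = Suc (Suc n) then idn C M' else if j = Suc n then u else \<phi> j) =
      (if Suc j = Suc (Suc n) then idn C M' else if Suc j = Suc n then u else \<phi> (Suc j)) \<cdot> G ! j"
    proof cases
      case 1 then show ?thesis using u yG by (simp add: nth)
    next
      case 2 then show ?thesis using eu by (simp add: nth)
    next
      case 3 then show ?thesis using p(6)[OF j] by (simp add: nth)
    qed
  qed (use p yG pd nth[of "Suc n"] in \<open>auto simp: homs_iff\<close>)
qed

section \<open>Pullback of equivalence classes\<close>

lemma class_yext:
  assumes "equivclp (yext_step C) E F" "yext C (Suc n) M N E"
  shows "yext C (Suc n) M N F"
  using assms(1)
proof (induction rule: equivclp_induct)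
  case base then show ?case by (rule assms(2))
next
  case (step F G)
  have *: "yext C (Suc n) M N G" if "yext C (Suc m) M' N' F" "yext C (Suc m) M' N' G" for m M' N'
  proof -
    note y = yextD(1-3)[OF step.IH] yextD(1-3)[OF that(1)]
    have "m = n" using y(1,4) by simp
    then show ?thesis using y that(2) by simp
  qed
  from step.hyps(2) show ?case unfolding step_iff using * by blast
qed

lemma step_emap:
  assumes "yext_step C E F" "yext C (Suc n) M N E \<or> yext C (Suc n) M N F"
  shows "emap C n (idn C N) (idn C M) E F" "yext C (Suc n) M N E" "yext C (Suc n) M N F"
proof -
  obtain m M' N' where *: "yext C (Suc m) M' N' E" "yext C (Suc m) M' N' F"
    "emap C m (idn C N') (idn C M') E F" using assms(1) unfolding step_iff by blast
  from assms(2) have "m = n \<and> M' = M \<and> N' = N"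
  proof
    assume "yext C (Suc n) M N E"
    note y = yextD(1-3)[OF this] yextD(1-3)[OF *(1)]
    have "m = n" using y(1,4) by simp
    then show ?thesis using y by simp
  next
    assume "yext C (Suc n) M N F"
    note y = yextD(1-3)[OF this] yextD(1-3)[OF *(2)]
    have "m = n" using y(1,4) by simp
    then show ?thesis using y by simp
  qed
  then show "emap C n (idn C N) (idn C M) E F" "yext C (Suc n) M N E" "yext C (Suc n) M N F"
    using * by auto
qed

lemma emap_step:
  assumes "yext C (Suc n) M N E" "yext C (Suc n) M N F" "emap C n (idn C N) (idn C M) E F"
  shows "ext_class C E = ext_class C F"
  using assms idn_hom[OF yextD(9)[OF assms(1)]] by (intro ext_class_step) (auto simp: step_iff)

lemma pull_rel_step:
  assumes E: "yext C (Suc n) M N E" and E': "yext C (Suc n) M N E'" and f: "f \<in> homs C M' M"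
    and F: "pull_rel C f E F" and F': "pull_rel C f E' F'" and s: "emap C n (idn C N) (idn C M) E E'"
  shows "ext_class C F = ext_class C F'"
proof -
  note pF = pull_rel_yext[OF E f F] note pF' = pull_rel_yext[OF E' f F']
  have "emap C n (idn C N \<cdot> idn C N) (idn C M \<cdot> f) F E'"
    by (rule emap_comp[OF pF(1) E E' pF(2) s])
  then have "emap C n (idn C N) f F E'" using f yextD(10)[OF E] by (simp add: homs_iff)
  then have "emap C n (idn C N) (idn C M') F F'"
    by (rule pull_rel_universal[OF E' f F' pF(1)])
  then show ?thesis using emap_step[OF pF(1) pF'(1)] by simp
qed

text \<open>Induction along the zigzag: at each list a pullback is chosen anew, and
  \<open>pull_rel_step\<close> compares neighbouring choices in whichever direction the step
  goes.\<close>

lemma pull_rel_class: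
  assumes E: "yext C (Suc n) M N E" and f: "f \<in> homs C M' M"
    and F: "pull_rel C f E F" and "equivclp (yext_step C) E E'" and "pull_rel C f E' F'"
  shows "ext_class C F = ext_class C F'"
  using assms(4,5)
proof (induction arbitrary: F' rule: equivclp_induct)
  case base
  then show ?case using pull_rel_step[OF E E f F base emap_id[OF E]] by simp
next
  case (step E1 E2)
  have y1: "yext C (Suc n) M N E1" by (rule class_yext[OF step.hyps(1) E])
  obtain F1 where F1: "pull_rel C f E1 F1" using pull_ex[OF y1 f] by blast
  have 1: "ext_class C F = ext_class C F1" by (rule step.IH[OF F1])
  from step.hyps(2) show ?case
  proof
    assume "yext_step C E1 E2"
    note s = step_emap[OF this disjI1, OF y1]
    show ?thesis using 1 pull_rel_step[OF y1 s(3) f F1 step.prems s(1)] by simp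
  next
    assume "yext_step C E2 E1"
    note s = step_emap[OF this disjI2, OF y1]
    show ?thesis using 1 pull_rel_step[OF s(2) y1 f step.prems F1 s(1)] by simp
  qed
qed

text \<open>The form in which \<open>ext_pull\<close> is normally evaluated in positive degree: a
  representative is recognised by a ladder, with no reference to a particular pullback.\<close>

lemma ext_pull_class:
  assumes E: "yext C (Suc n) M N E" and f: "f \<in> homs C M' M" and F: "yext C (Suc n) M' N F"
    and FE: "emap C n (idn C N) f F E"
  shows "ext_pull C f (ext_class C E) = ext_class C F"
proof -
  obtain F0 where F0: "pull_rel C f E F0" using pull_ex[OF E f] by blast
  have "ext_class C F = ext_class C F0"
    by (rule emap_step[OF F pull_rel_yext(1)[OF E f F0] pull_rel_universal[OF E f F0 F FE]])
  note 1 = this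
  have 2: "ext_class C F1 = ext_class C F0"
    if "E1 \<in> ext_class C E" "pull_rel C f E1 F1" for E1 F1
    using pull_rel_class[OF E f F0 _ that(2)] that(1) by (simp add: ext_class_def)
  show ?thesis
  proof (intro equalityI subsetI)
    fix x assume "x \<in> ext_pull C f (ext_class C E)"
    then show "x \<in> ext_class C F" unfolding ext_pull_def using 1 2 by blast
  next
    fix x assume "x \<in> ext_class C F"
    then show "x \<in> ext_pull C f (ext_class C E)"
      unfolding ext_pull_def 1 using F0 ext_class_self[of E C] by blast
  qed
qed

lemma ext_pull_ex:
  assumes E: "yext C (Suc n) M N E" and f: "f \<in> homs C M' M"
  obtains F where "yext C (Suc n) M' N F" "emap C n (idn C N) f F E"
    "ext_pull C f (ext_class C E) = ext_class C F"
proof -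
  obtain F where F: "pull_rel C f E F" using pull_ex[OF E f] by blast
  show ?thesis using that[of F] pull_rel_yext[OF E f F] ext_pull_class[OF E f pull_rel_yext[OF E f F]] by blast
qed

section \<open>Reversal of extensions, and pushouts by duality\<close>

lemma yext_rev:
  "yext (opc C) (Suc n) N M (rev E) \<longleftrightarrow> yext C (Suc n) M N E"
proof (cases "length E = Suc (Suc n)")
  case True
  have "(\<forall>j\<le>n. exact_at (opc C) (rev E ! j) (rev E ! Suc j)) \<longleftrightarrow> (\<forall>j\<le>n. exact_at C (E ! (n - j)) (E ! Suc (n - j)))"
    using True by (simp add: rev_nth_Suc Suc_diff_le)
  also have "\<dots> \<longleftrightarrow> (\<forall>j\<le>n. exact_at C (E ! j) (E ! Suc j))"
  proof safe
    fix j assume "\<forall>j\<le>n. exact_at C (E ! (n - j)) (E ! Suc (n - j))" "j \<le> n"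
    then show "exact_at C (E ! j) (E ! Suc j)" by (metis diff_diff_cancel diff_le_self)
  next
    fix j assume "\<forall>j\<le>n. exact_at C (E ! j) (E ! Suc j)" "j \<le> n"
    then show "exact_at C (E ! (n - j)) (E ! Suc (n - j))" by simp
  qed
  finally show ?thesis using True by (auto simp: yext_Suc rev_nth_Suc)
next
  case False then show ?thesis by (simp add: yext_Suc)
qed

lemma emap_rev:
  assumes E: "yext C (Suc n) M N E" and F: "yext C (Suc n) M' N' F" and "emap C n g f E F"
  shows "emap (opc C) n f g (rev F) (rev E)"
proof -
  obtain \<phi> where p: "\<phi> 0 = g" "\<phi> (Suc (Suc n)) = f"
    "\<And>j. j \<le> Suc n \<Longrightarrow> \<phi> j \<in> arr C" "\<And>j. j \<le> Suc n \<Longrightarrow> dom C (\<phi> j) = dom C (E ! j)"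
    "\<And>j. j \<le> Suc n \<Longrightarrow> cod C (\<phi> j) = dom C (F ! j)"
    "f \<in> arr C" "dom C f = cod C (E ! Suc n)" "cod C f = cod C (F ! Suc n)"
    "\<And>j. j \<le> Suc n \<Longrightarrow> F ! j \<cdot> \<phi> j = \<phi> (Suc j) \<cdot> E ! j"
    using emapE[OF assms(3)] by metis
  have s: "\<phi> (Suc j) \<in> arr C \<and> dom C (\<phi> (Suc j)) = cod C (E ! j) \<and> cod C (\<phi> (Suc j)) = cod C (F ! j)"
    if "j \<le> Suc n" for j
    using p(2,6,7,8) p(3,4,5)[of "Suc j"] yextD(8)[OF E, of j] yextD(8)[OF F, of j] that
    by (cases "j = Suc n") auto
  interpret O: abelian_category "opc C" by (rule opc_abelian)
  show ?thesis
  proof (rule O.emapI[where \<phi> = "\<lambda>j. \<phi> (Suc (Suc n) - j)"])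
    fix j assume j: "j \<le> Suc n"
    then have e: "Suc (Suc n) - j = Suc (Suc n - j)" "Suc (Suc n) - Suc j = Suc n - j" by auto
    show "\<phi> (Suc (Suc n) - j) \<in> homs (opc C) (dom (opc C) (rev F ! j)) (dom (opc C) (rev E ! j))"
      unfolding e using s[of "Suc n - j"] j yextD(1)[OF E] yextD(1)[OF F] by (simp add: rev_nth_Suc homs_iff)
    show "rev E ! j \<cdot>\<^bsub>opc C\<^esub> \<phi> (Suc (Suc n) - j) = \<phi> (Suc (Suc n) - Suc j) \<cdot>\<^bsub>opc C\<^esub> rev F ! j"
      unfolding e using p(9)[of "Suc n - j"] j yextD(1)[OF E] yextD(1)[OF F] by (simp add: rev_nth_Suc)
  qed (use p yextD(1)[OF E] yextD(1)[OF F] in \<open>auto simp: rev_nth_Suc homs_iff\<close>)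
qed

text \<open>Reversing twice lands in \<open>opc (opc C)\<close>, whose fields are those of
  \<open>C\<close>; unfolding \<open>emap_def\<close> closes the gap.\<close>

lemma emap_rev':
  assumes "yext C (Suc n) M N E" "yext C (Suc n) M' N' F" "emap (opc C) n f g (rev F) (rev E)"
  shows "emap C n g f E F"
proof -
  interpret O: abelian_category "opc C" by (rule opc_abelian)
  have "emap (opc (opc C)) n g f (rev (rev E)) (rev (rev F))"
    by (rule O.emap_rev) (use assms yext_rev in auto)
  then show ?thesis by (simp add: emap_def)
qed

lemma yext_step_rev: "yext_step (opc C) (rev E) (rev F) \<longleftrightarrow> yext_step C F E"
proof -
  interpret O: abelian_category "opc C" by (rule opc_abelian)
  have "yext_step (opc C) (rev E) (rev F) \<longleftrightarrow> (\<exists>n M N. yext C (Suc n) M N E \<and> yext C (Suc n) M N F \<and>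
     N \<in> obj C \<and> emap (opc C) n (idn C M) (idn C N) (rev E) (rev F))"
    (is "?L \<longleftrightarrow> ?R")
  proof
    show "?L \<Longrightarrow> ?R" unfolding O.step_iff yext_rev by (auto simp: homs_iff dest: yextD)
    assume ?R
    then obtain n M N where "yext C (Suc n) M N E" "yext C (Suc n) M N F" "N \<in> obj C"
      "emap (opc C) n (idn C M) (idn C N) (rev E) (rev F)" by blast
    then show ?L unfolding O.step_iff yext_rev
      by (intro exI[of _ n] exI[of _ N] exI[of _ M]) (simp add: homs_iff)
  qed
  also have "\<dots> \<longleftrightarrow> (\<exists>n M N. yext C (Suc n) M N F \<and> yext C (Suc n) M N E \<and>
     idn C M \<in> homs C M M \<and> emap C n (idn C N) (idn C M) F E)"
    using emap_rev emap_rev' by (meson idn_hom yextD(9,10))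
  finally show ?thesis by (simp add: step_iff)
qed

lemma equiv_rev: "equivclp (yext_step C) E F \<Longrightarrow> equivclp (yext_step (opc C)) (rev E) (rev F)"
proof (induction rule: equivclp_induct)
  case (step y z)
  then have "equivclp (yext_step (opc C)) (rev y) (rev z)"
    using yext_step_rev by (metis equivclp_sym r_into_equivclp)
  then show ?case using step.IH equivclp_trans by metis
qed simp

lemma ext_class_rev: "ext_class (opc C) (rev E) = rev ` ext_class C E"
proof -
  have "equivclp (yext_step C) E (rev F)" if "equivclp (yext_step (opc C)) (rev E) F" for F
    using that
  proof (induction rule: equivclp_induct)
    case (step y z)
    then have "equivclp (yext_step C) (rev y) (rev z)"
      using yext_step_rev[of "rev y" "rev z"] yext_step_rev[of "rev z" "rev y"]
      by (metis equivclp_sym r_into_equivclp rev_rev_ident)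
    then show ?case using step.IH equivclp_trans by metis
  qed simp
  then show ?thesis using equiv_rev
    by (auto simp: ext_class_def image_iff) (metis rev_rev_ident)
qed

lemma push_rel_rev:
  assumes "E \<noteq> []" shows "push_rel C g E F \<longleftrightarrow> pull_rel (opc C) g (rev E) (rev F)"
proof (cases "length E = 1")
  case True
  then show ?thesis using assms by (cases E) (auto simp: push_rel_def pull_rel_def)
next
  case False
  then obtain x y E' where E: "E = x # y # E'" using assms by (cases E; cases "tl E") auto
  have "F = [q, e] @ E' \<longleftrightarrow> rev F = rev E' @ [e, q]" for q e
    by (metis append_Cons append_Nil rev.simps(2) rev_append rev_rev_ident append_assoc)
  then show ?thesis by (simp add: E push_rel_def pull_rel_def butlast_append)
qed

text \<open>Carries the results on pullbacks over to pushouts. The empty list is excluded because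
  its first and last arrows are unspecified.\<close>

lemma ext_push_rev:
  assumes "[] \<notin> \<xi>" shows "rev ` ext_push C g \<xi> = ext_pull (opc C) g (rev ` \<xi>)"
proof -
  have "{rev ` ext_class C F |E F. E \<in> \<xi> \<and> push_rel C g E F} =
    {ext_class (opc C) F |E F. E \<in> rev ` \<xi> \<and> pull_rel (opc C) g E F}" (is "?L = ?R")
  proof safe
    fix E F assume "E \<in> \<xi>" "push_rel C g E F"
    then show "\<exists>E' F'. rev ` ext_class C F = ext_class (opc C) F' \<and> E' \<in> rev ` \<xi> \<and> pull_rel (opc C) g E' F'"
      using assms push_rel_rev[of E g F] ext_class_rev[of F] by (intro exI[of _ "rev E"] exI[of _ "rev F"]) auto
  next
    fix F E assume "E \<in> \<xi>" "pull_rel (opc C) g (rev E) F"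
    then show "\<exists>E F'. ext_class (opc C) F = rev ` ext_class C F' \<and> E \<in> \<xi> \<and> push_rel C g E F'"
      using assms push_rel_rev[of E g "rev F"] ext_class_rev[of "rev F"] by (intro exI[of _ "E"] exI[of _ "rev F"]) auto
  qed
  moreover have "(`) rev ` {ext_class C F |E F. E \<in> \<xi> \<and> push_rel C g E F} = ?L" by blast
  ultimately show ?thesis unfolding ext_push_def ext_pull_def image_Union by simp
qed

lemma class_not_Nil: "yext C (Suc n) M N E \<Longrightarrow> [] \<notin> ext_class C E"
  using class_yext[of E "[]" n M N] yextD(1)[of n M N "[]"] by (auto simp: ext_class_def)

lemma ext_push_class:
  assumes E: "yext C (Suc n) M N E" and g: "g \<in> homs C N N'" and F: "yext C (Suc n) M N' F"
    and EF: "emap C n g (idn C M) E F"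
  shows "ext_push C g (ext_class C E) = ext_class C F"
proof -
  interpret O: abelian_category "opc C" by (rule opc_abelian)
  have "rev ` ext_push C g (ext_class C E) = ext_pull (opc C) g (ext_class (opc C) (rev E))"
    using ext_push_rev[OF class_not_Nil[OF E]] by (simp add: ext_class_rev)
  also have "\<dots> = ext_class (opc C) (rev F)"
    by (rule O.ext_pull_class[of n N M]) (use E F g emap_rev[OF E F EF] in \<open>auto simp: yext_rev\<close>)
  finally have "rev ` ext_push C g (ext_class C E) = rev ` ext_class C F" by (simp add: ext_class_rev)
  then show ?thesis by (simp add: inj_image_eq_iff)
qed

lemma ext_push_ex:
  assumes E: "yext C (Suc n) M N E" and g: "g \<in> homs C N N'"
  obtains F where "yext C (Suc n) M N' F" "emap C n g (idn C M) E F"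
    "ext_push C g (ext_class C E) = ext_class C F"
proof -
  interpret O: abelian_category "opc C" by (rule opc_abelian)
  obtain F where F: "yext (opc C) (Suc n) N' M F" "emap (opc C) n (idn C M) g F (rev E)"
    using O.ext_pull_ex[of n N M "rev E" g N'] E g by (auto simp: yext_rev)
  have F': "yext C (Suc n) M N' (rev F)" using F(1) yext_rev[of n N' M "rev F"] by simp
  then have "emap C n g (idn C M) E (rev F)" using emap_rev'[OF E F'] F(2) by simp
  then show ?thesis using that F' ext_push_class[OF E g F'] by blast
qed

text \<open>The universal property turns the ladder into one from \<open>E\<close> to the pullback
  of \<open>F\<close> with the identity at the right end, and such a ladder exhibits its target as
  the pushout of \<open>E\<close>. Many naturality statements below reduce to this exchange.\<close>

lemma push_eq_pull:
  assumes E: "yext C (Suc n) M' N E" and F: "yext C (Suc n) M N' F" and EF: "emap C n g f E F"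
  shows "ext_push C g (ext_class C E) = ext_pull C f (ext_class C F)"
proof -
  note gf = emap_ends[OF EF E F]
  obtain F0 where F0: "pull_rel C f F F0" using pull_ex[OF F gf(2)] by blast
  note y = pull_rel_yext[OF F gf(2) F0]
  have "emap C n g (idn C M') E F0" by (rule pull_rel_universal[OF F gf(2) F0 E EF])
  then have "ext_push C g (ext_class C E) = ext_class C F0" by (rule ext_push_class[OF E gf(1) y(1)])
  then show ?thesis using ext_pull_class[OF F gf(2) y] by simp
qed

end


section \<open>The groups Ext\<close>

text \<open>Negative, zero and positive degrees are encoded differently in \<open>Ext\<close>, so
  statements about all integer degrees split in this way.\<close>

lemma int_cases3:
  obtains "k < 0" | "k = 0" | n where "k = int (Suc n)"
  by (metis int_cases3 not0_implies_Suc of_nat_0_less_iff not_less_zero zero_less_imp_eq_int neg_0_less_iff_less linorder_cases)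

lemma Ext_neg [simp]:
  assumes "k < 0"
  shows "carrier (Ext C k M N) = {{}}" "x \<otimes>\<^bsub>Ext C k M N\<^esub> y = {}" "\<one>\<^bsub>Ext C k M N\<^esub> = {}"
  using assms by (simp_all add: Ext_def)

lemma Ext_Suc_carrier:
  "carrier (Ext C (int (Suc n)) M N) = ext_class C ` {E. yext C (Suc n) M N E}"
  unfolding Ext_def by (simp del: of_nat_Suc)

lemma Ext_Suc_mult: "x \<otimes>\<^bsub>Ext C (int (Suc n)) M N\<^esub> y = baer_sum C M N x y"
  unfolding Ext_def by (simp del: of_nat_Suc)

lemma Ext_Suc_one: "\<one>\<^bsub>Ext C (int (Suc n)) M N\<^esub> = ext_class C (zero_ext C (Suc n) M N)"
  unfolding Ext_def by (simp del: of_nat_Suc)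

lemma pull_empty [simp]: "ext_pull C f {} = {}" by (simp add: ext_pull_def)
lemma push_empty [simp]: "ext_push C f {} = {}" by (simp add: ext_push_def)

context abelian_category
begin

text \<open>Equivalence steps exist only between lists of length at least two, so a morphism in
  degree zero is equivalent only to itself.\<close>

lemma ext_class_single: "ext_class C [f] = {[f]}"
proof -
  have "F = [f]" if "equivclp (yext_step C) [f] F" for F
    using that
  proof (induction rule: equivclp_induct)
    case (step y z)
    then show ?case using yextD(1) by (fastforce simp: step_iff)
  qed simp
  then show ?thesis by (auto simp: ext_class_def)
qed

lemma Ext_0_carrier: "carrier (Ext C 0 M N) = (\<lambda>f. {[f]}) ` homs C M N"
proof -
  have "{E. yext C 0 M N E} = (\<lambda>f. [f]) ` homs C M N" by (auto simp: yext_def)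
  then show ?thesis by (simp add: Ext_def image_image ext_class_single)
qed

lemma Ext_0_mult: "{[f]} \<otimes>\<^bsub>Ext C 0 M N\<^esub> {[g]} = {[plus C f g]}"
  by (auto simp: Ext_def)

lemma Ext_0_one: "\<one>\<^bsub>Ext C 0 M N\<^esub> = {[zer C M N]}"
  by (simp add: Ext_def zero_ext_def ext_class_single)

lemma pull_single: "ext_pull C f {[h]} = {[h \<cdot> f]}"
  by (auto simp: ext_pull_def pull_rel_1 ext_class_single)

lemma push_single: "ext_push C g {[h]} = {[g \<cdot> h]}"
  by (auto simp: ext_push_def push_rel_def ext_class_single)

section \<open>Functoriality of Ext in both arguments\<close>

lemma pull_closed:
  assumes "x \<in> carrier (Ext C k M N)" "f \<in> homs C M' M"
  shows "ext_pull C f x \<in> carrier (Ext C k M' N)"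
proof (cases k rule: int_cases3)
  case 1 then show ?thesis using assms by simp
next
  case 2 then show ?thesis using assms by (auto simp: Ext_0_carrier pull_single homs_iff)
next
  case (3 n)
  then obtain E where "yext C (Suc n) M N E" "x = ext_class C E" using assms by (auto simp: Ext_Suc_carrier simp del: of_nat_Suc)
  then show ?thesis using ext_pull_ex[OF _ assms(2)] unfolding 3 Ext_Suc_carrier
    by (metis (mono_tags, lifting) imageI mem_Collect_eq)
qed

lemma push_closed:
  assumes "x \<in> carrier (Ext C k M N)" "g \<in> homs C N N'"
  shows "ext_push C g x \<in> carrier (Ext C k M N')"
proof (cases k rule: int_cases3)
  case 1 then show ?thesis using assms by simp
next
  case 2 then show ?thesis using assms by (auto simp: Ext_0_carrier push_single homs_iff)
next
  case (3 n)
  then obtain E where "yext C (Suc n) M N E" "x = ext_class C E" using assms by (auto simp: Ext_Suc_carrier simp del: of_nat_Suc)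
  then show ?thesis using ext_push_ex[OF _ assms(2)] unfolding 3 Ext_Suc_carrier
    by (metis (mono_tags, lifting) imageI mem_Collect_eq)
qed

lemma ExtE:
  assumes "x \<in> carrier (Ext C (int (Suc n)) M N)"
  obtains E where "yext C (Suc n) M N E" "x = ext_class C E"
  using assms by (auto simp: Ext_Suc_carrier simp del: of_nat_Suc)

lemma ExtI: "yext C (Suc n) M N E \<Longrightarrow> ext_class C E \<in> carrier (Ext C (int (Suc n)) M N)"
  by (auto simp: Ext_Suc_carrier simp del: of_nat_Suc)

lemma pull_id:
  assumes "x \<in> carrier (Ext C k M N)" shows "ext_pull C (idn C M) x = x"
proof (cases k rule: int_cases3)
  case 1 then show ?thesis using assms by simp
next
  case 2 then show ?thesis using assms by (auto simp: Ext_0_carrier pull_single homs_iff)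
next
  case (3 n)
  then obtain E where E: "yext C (Suc n) M N E" "x = ext_class C E" using ExtE assms by metis
  show ?thesis unfolding E(2) by (rule ext_pull_class[OF E(1) idn_hom E(1) emap_id[OF E(1)]]) (rule yextD(9)[OF E(1)])
qed

lemma push_id:
  assumes "x \<in> carrier (Ext C k M N)" shows "ext_push C (idn C N) x = x"
proof (cases k rule: int_cases3)
  case 1 then show ?thesis using assms by simp
next
  case 2 then show ?thesis using assms by (auto simp: Ext_0_carrier push_single homs_iff)
next
  case (3 n)
  then obtain E where E: "yext C (Suc n) M N E" "x = ext_class C E" using ExtE assms by metis
  show ?thesis unfolding E(2) by (rule ext_push_class[OF E(1) idn_hom E(1) emap_id[OF E(1)]]) (rule yextD(10)[OF E(1)])
qed

lemma pull_comp:
  assumes "x \<in> carrier (Ext C k M N)" "f \<in> homs C M' M" "f' \<in> homs C M'' M'"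
  shows "ext_pull C f' (ext_pull C f x) = ext_pull C (f \<cdot> f') x"
proof (cases k rule: int_cases3)
  case 1 then show ?thesis using assms by simp
next
  case 2 then show ?thesis using assms by (auto simp: Ext_0_carrier pull_single homs_iff)
next
  case (3 n)
  then obtain E where E: "yext C (Suc n) M N E" "x = ext_class C E" using ExtE assms by metis
  obtain F where F: "yext C (Suc n) M' N F" "emap C n (idn C N) f F E"
    "ext_pull C f (ext_class C E) = ext_class C F" using ext_pull_ex[OF E(1) assms(2)] .
  obtain G where G: "yext C (Suc n) M'' N G" "emap C n (idn C N) f' G F"
    "ext_pull C f' (ext_class C F) = ext_class C G" using ext_pull_ex[OF F(1) assms(3)] .
  have "emap C n (idn C N \<cdot> idn C N) (f \<cdot> f') G E" by (rule emap_comp[OF G(1) F(1) E(1) G(2) F(2)])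
  then have "emap C n (idn C N) (f \<cdot> f') G E" using yextD(10)[OF E(1)] by simp
  from ext_pull_class[OF E(1) _ G(1) this] show ?thesis using assms cmp_hom E F G by simp
qed

lemma push_comp:
  assumes "x \<in> carrier (Ext C k M N)" "g \<in> homs C N N'" "g' \<in> homs C N' N''"
  shows "ext_push C g' (ext_push C g x) = ext_push C (g' \<cdot> g) x"
proof (cases k rule: int_cases3)
  case 1 then show ?thesis using assms by simp
next
  case 2 then show ?thesis using assms by (auto simp: Ext_0_carrier push_single homs_iff)
next
  case (3 n)
  then obtain E where E: "yext C (Suc n) M N E" "x = ext_class C E" using ExtE assms by metis
  obtain F where F: "yext C (Suc n) M N' F" "emap C n g (idn C M) E F"
    "ext_push C g (ext_class C E) = ext_class C F" using ext_push_ex[OF E(1) assms(2)] .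
  obtain G where G: "yext C (Suc n) M N'' G" "emap C n g' (idn C M) F G"
    "ext_push C g' (ext_class C F) = ext_class C G" using ext_push_ex[OF F(1) assms(3)] .
  have "emap C n (g' \<cdot> g) (idn C M \<cdot> idn C M) E G" by (rule emap_comp[OF E(1) F(1) G(1) F(2) G(2)])
  then have "emap C n (g' \<cdot> g) (idn C M) E G" using yextD(9)[OF E(1)] by simp
  from ext_push_class[OF E(1) _ G(1) this] show ?thesis using assms cmp_hom E F G by simp
qed

lemma push_pull:
  assumes "x \<in> carrier (Ext C k M N)" "f \<in> homs C M' M" "g \<in> homs C N N'"
  shows "ext_push C g (ext_pull C f x) = ext_pull C f (ext_push C g x)"
proof (cases k rule: int_cases3)
  case 1 then show ?thesis using assms by simp
next
  case 2 then show ?thesis using assms by (auto simp: Ext_0_carrier push_single pull_single homs_iff)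
next
  case (3 n)
  then obtain E where E: "yext C (Suc n) M N E" "x = ext_class C E" using ExtE assms by metis
  obtain F where F: "yext C (Suc n) M' N F" "emap C n (idn C N) f F E"
    "ext_pull C f (ext_class C E) = ext_class C F" using ext_pull_ex[OF E(1) assms(2)] .
  obtain G where G: "yext C (Suc n) M N' G" "emap C n g (idn C M) E G"
    "ext_push C g (ext_class C E) = ext_class C G" using ext_push_ex[OF E(1) assms(3)] .
  have "emap C n (g \<cdot> idn C N) (idn C M \<cdot> f) F G" by (rule emap_comp[OF F(1) E(1) G(1) F(2) G(2)])
  then have "emap C n g f F G" using assms by (simp add: homs_iff)
  from push_eq_pull[OF F(1) G(1) this] show ?thesis using E F G by simp
qed

section \<open>The zero extension\<close>

lemma zobj_zero: "is_zero_object C (zobj C)"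
  unfolding zobj_def by (rule someI_ex[OF ex_zero_object])

lemma zobj_obj [simp]: "zobj C \<in> obj C"
  using zobj_zero by (simp add: is_zero_object_def)

lemma zobj_in: "\<lbrakk>f \<in> arr C; cod C f = zobj C\<rbrakk> \<Longrightarrow> f = zer C (dom C f) (zobj C)"
  using zobj_zero unfolding is_zero_object_def by (metis homsI dom_obj singletonD)

lemma zobj_out: "\<lbrakk>f \<in> arr C; dom C f = zobj C\<rbrakk> \<Longrightarrow> f = zer C (zobj C) (cod C f)"
  using zobj_zero unfolding is_zero_object_def by (metis homsI cod_obj singletonD)

lemma zobj_epi: "A \<in> obj C \<Longrightarrow> is_epi C (zer C A (zobj C))"
  by (rule epiI) (use zobj_out in auto)

lemma zobj_mono: "A \<in> obj C \<Longrightarrow> is_mono C (zer C (zobj C) A)"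
  by (rule monoI) (use zobj_in in auto)

lemma id_kernel: assumes "A \<in> obj C" "B \<in> obj C" shows "is_kernel C (idn C A) (zer C A B)"
  by (rule kernelI) (use assms in auto)

lemma zero_kernel: assumes "A \<in> obj C" shows "is_kernel C (zer C (zobj C) A) (idn C A)"
proof (rule kernelI)
  fix h assume h: "h \<in> arr C" "cod C h = dom C (idn C A)" "idn C A \<cdot> h = zer C (dom C h) (cod C (idn C A))"
  then show "\<exists>u. u \<in> arr C \<and> dom C u = dom C h \<and> cod C u = dom C (zer C (zobj C) A) \<and> zer C (zobj C) A \<cdot> u = h"
    using assms by (intro exI[of _ "zer C (dom C h) (zobj C)"]) auto
qed (use assms zobj_mono in auto)

lemma split_short_exact:
  assumes "A \<in> obj C" "B \<in> obj C" shows "short_exact C (in1 C A B) (pr2 C A B)"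
  unfolding short_exact_iff
proof
  show "is_epi C (pr2 C A B)" by (rule epi_cancel[of _ "in2 C A B"]) (use assms in auto)
  have "is_mono C (in1 C A B)" by (rule mono_cancel[of "pr1 C A B"]) (use assms in auto)
  then show "is_kernel C (in1 C A B) (pr2 C A B)"
  proof (rule kernelI[rotated])
    fix h assume h: "h \<in> arr C" "cod C h = dom C (pr2 C A B)"
      "pr2 C A B \<cdot> h = zer C (dom C h) (cod C (pr2 C A B))"
    have "in1 C A B \<cdot> (pr1 C A B \<cdot> h) = h"
      by (rule bi_eq_left[OF assms]) (use h assms in auto)
    then show "\<exists>u. u \<in> arr C \<and> dom C u = dom C h \<and> cod C u = dom C (in1 C A B) \<and> in1 C A B \<cdot> u = h"
      using h assms by (intro exI[of _ "pr1 C A B \<cdot> h"]) auto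
  qed (use assms in auto)
qed

text \<open>\<open>ob M N j\<close> is the domain of the arrow at position \<open>j\<close>:
  \<open>N\<close> twice, then zero objects, then \<open>M\<close>. In degree two there are no zero
  objects and the middle arrow goes from \<open>N\<close> to \<open>M\<close>.\<close>

lemma zero_ext_nth:
  fixes n :: nat
  defines "ob M N \<equiv> \<lambda>j. if j \<le> 1 then N else if j < Suc (Suc n) then zobj C else M"
  shows "length (zero_ext C (Suc (Suc n)) M N) = Suc (Suc (Suc n))"
    "zero_ext C (Suc (Suc n)) M N ! 0 = idn C N"
    "\<lbrakk>0 < j; j < Suc (Suc n)\<rbrakk> \<Longrightarrow> zero_ext C (Suc (Suc n)) M N ! j = zer C (ob M N j) (ob M N (Suc j))"
    "zero_ext C (Suc (Suc n)) M N ! Suc (Suc n) = idn C M"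
proof -
  let ?L = "map2 (zer C) (N # replicate n (zobj C)) (replicate n (zobj C) @ [M])"
  have Z: "zero_ext C (Suc (Suc n)) M N = idn C N # ?L @ [idn C M]" by (simp add: zero_ext_def)
  show "length (zero_ext C (Suc (Suc n)) M N) = Suc (Suc (Suc n))"
    "zero_ext C (Suc (Suc n)) M N ! 0 = idn C N"
    "zero_ext C (Suc (Suc n)) M N ! Suc (Suc n) = idn C M"
    unfolding Z by (simp_all add: nth_append del: zip_Cons_Cons zip_append)
  assume j: "0 < j" "j < Suc (Suc n)"
  then obtain i where i: "j = Suc i" "i \<le> n" by (cases j) auto
  have "zero_ext C (Suc (Suc n)) M N ! j = ?L ! i"
    unfolding Z i using i by (simp add: nth_append del: zip_Cons_Cons zip_append)
  also have "\<dots> = zer C ((N # replicate n (zobj C)) ! i) ((replicate n (zobj C) @ [M]) ! i)"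
    using i by (subst nth_map) (simp_all add: nth_zip del: zip_Cons_Cons zip_append)
  also have "\<dots> = zer C (ob M N j) (ob M N (Suc j))"
    unfolding ob_def i using i by (cases i) (auto simp: nth_append)
  finally show "zero_ext C (Suc (Suc n)) M N ! j = zer C (ob M N j) (ob M N (Suc j))" .
qed

lemma zero_ext_yext:
  assumes "M \<in> obj C" "N \<in> obj C" shows "yext C (Suc n) M N (zero_ext C (Suc n) M N)"
proof (cases n)
  case 0
  then show ?thesis using split_short_exact[OF assms(2,1)] assms by (simp add: zero_ext_def yext_0)
next
  case (Suc m)
  define ob where "ob j = (if j \<le> 1 then N else if j < Suc (Suc m) then zobj C else M)" for j
  note nth = zero_ext_nth[where n = m and M = M and N = N, folded ob_def]
  have o: "ob j \<in> obj C" for j using assms by (simp add: ob_def)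
  show ?thesis unfolding Suc yext_Suc
  proof (intro conjI allI impI)
    fix j assume j: "j \<le> Suc m"
    consider "j = 0" | "0 < j" "j < Suc m" | "j = Suc m" using j by linarith
    then show "exact_at C (zero_ext C (Suc (Suc m)) M N ! j) (zero_ext C (Suc (Suc m)) M N ! Suc j)"
    proof cases
      case 1
      have "ob 1 = N" by (simp add: ob_def)
      then show ?thesis using kernel_exact[OF id_kernel[OF assms(2) o]] nth(2) nth(3)[of 1] 1 by simp
    next
      case 2
      then have "ob (Suc j) = zobj C" by (simp add: ob_def)
      then have "exact_at C (zer C (ob j) (ob (Suc j))) (zer C (ob (Suc j)) (ob (Suc (Suc j))))"
        by (intro exact_atI[OF zobj_epi[OF o] id_kernel]) (use o in auto)
      then show ?thesis using nth(3)[of j] nth(3)[of "Suc j"] 2 by simp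
    next
      case 3
      have "ob (Suc (Suc m)) = M" by (simp add: ob_def)
      moreover have "exact_at C (zer C (ob j) M) (idn C M)"
        by (rule exact_atI[OF zobj_epi[OF o] zero_kernel[OF assms(1)]]) (use o assms in auto)
      ultimately show ?thesis using nth(3)[of j] nth(4) 3 by simp
    qed
  qed (use nth assms in auto)
qed

text \<open>In degree at least two the zero extension ends in a copy of \<open>M\<close>, to which
  the last arrow of \<open>E\<close> maps; in degree one the second summand takes this role. All
  rungs further left are zero, so the zero extension represents every pushout along a zero
  morphism.\<close>

lemma emap_to_zero_ext:
  assumes E: "yext C (Suc n) M N E" and N': "N' \<in> obj C"
  shows "emap C n (zer C N N') (idn C M) E (zero_ext C (Suc n) M N')"
proof -
  note y = yextD[OF E]
  note z = yextD[OF zero_ext_yext[OF y(9) N', of n]]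
  show ?thesis
  proof (cases n)
    case 0
    have Z: "zero_ext C (Suc n) M N' = [in1 C N' M, pr2 C N' M]" using 0 by (simp add: zero_ext_def)
    have ba: "E ! Suc 0 \<cdot> E ! 0 = zer C N M" using exact_at_zero[OF y(6)[of 0]] y(2,3) 0 by simp
    have a: "E ! 0 \<in> arr C" "E ! Suc 0 \<in> arr C" "cod C (E ! 0) = dom C (E ! Suc 0)" using y 0 by auto
    show ?thesis unfolding Z
    proof (rule emapI[where \<phi> = "\<lambda>j. if j = 0 then zer C N N' else if j = 1 then in2 C N' M \<cdot> E ! 1 else idn C M"])
      fix j assume "j \<le> Suc n"
      then consider "j = 0" | "j = 1" using 0 by linarith
      note cs = this
      from cs show "(if j = 0 then zer C N N' else if j = 1 then in2 C N' M \<cdot> E ! 1 else idn C M)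
        \<in> homs C (dom C (E ! j)) (dom C ([in1 C N' M, pr2 C N' M] ! j))"
        using y(2,3,9,10) N' 0 a by cases (auto simp: homs_iff)
      from cs show "[in1 C N' M, pr2 C N' M] ! j \<cdot> (if j = 0 then zer C N N' else if j = 1 then in2 C N' M \<cdot> E ! 1 else idn C M)
        = (if Suc j = 0 then zer C N N' else if Suc j = 1 then in2 C N' M \<cdot> E ! 1 else idn C M) \<cdot> E ! j"
        using y(2,3,9,10) N' 0 a ba by cases auto
    qed (use y 0 N' in \<open>auto simp: homs_iff\<close>)
  next
    case (Suc m)
    let ?Z = "zero_ext C (Suc n) M N'"
    note nth = zero_ext_nth[where n = m and M = M and N = N', folded Suc]
    show ?thesis
    proof (rule emapI[where \<phi> = "\<lambda>j. if j = Suc (Suc n) then idn C M else if j = Suc n then E ! Suc n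
        else zer C (dom C (E ! j)) (dom C (?Z ! j))"])
      fix j assume j: "j \<le> Suc n"
      note aj = y(7)[OF j] z(7)[OF j]
      consider "j = Suc n" | "j = n" | "j < n" using j by linarith
      note cs = this
      have dl: "dom C (?Z ! Suc n) = M" using nth(4) y(9) by simp
      from cs show "(if j = Suc (Suc n) then idn C M else if j = Suc n then E ! Suc n
        else zer C (dom C (E ! j)) (dom C (?Z ! j))) \<in> homs C (dom C (E ! j)) (dom C (?Z ! j))"
        using aj dl y(3,5) by cases (auto simp: homs_iff)
      from cs show "?Z ! j \<cdot> (if j = Suc (Suc n) then idn C M else if j = Suc n then E ! Suc n
        else zer C (dom C (E ! j)) (dom C (?Z ! j))) =
        (if Suc j = Suc (Suc n) then idn C M else if Suc j = Suc n then E ! Suc n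
        else zer C (dom C (E ! Suc j)) (dom C (?Z ! Suc j))) \<cdot> E ! j"
      proof cases
        case 1 then show ?thesis using nth(4) y(3,5) by simp
      next
        case 2 then show ?thesis using aj z(8)[of n] dl exact_at_zero[OF y(6)[of n]] y(3) by simp
      next
        case 3 then show ?thesis using aj z(8)[of j] y(8)[of j] z(7)[of "Suc j"] by simp
      qed
    qed (use y z nth Suc in \<open>auto simp: homs_iff\<close>)
  qed
qed

lemma push_zero:
  assumes "x \<in> carrier (Ext C k M N)" "M \<in> obj C" "N \<in> obj C" "N' \<in> obj C"
  shows "ext_push C (zer C N N') x = \<one>\<^bsub>Ext C k M N'\<^esub>"
proof (cases k rule: int_cases3)
  case 1 then show ?thesis using assms by simp
next
  case 2 then show ?thesis using assms by (auto simp: Ext_0_carrier push_single Ext_0_one homs_iff)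
next
  case (3 n)
  then obtain E where E: "yext C (Suc n) M N E" "x = ext_class C E" using ExtE assms by metis
  show ?thesis unfolding E(2) 3 Ext_Suc_one
    by (rule ext_push_class[OF E(1) _ zero_ext_yext emap_to_zero_ext[OF E(1)]]) (use assms zer_hom in auto)
qed

lemma one_closed:
  assumes "M \<in> obj C" "N \<in> obj C" shows "\<one>\<^bsub>Ext C k M N\<^esub> \<in> carrier (Ext C k M N)"
proof (cases k rule: int_cases3)
  case 2 then show ?thesis using assms zer_hom by (auto simp: Ext_0_carrier Ext_0_one)
next
  case (3 n) then show ?thesis unfolding 3 Ext_Suc_one by (intro ExtI zero_ext_yext assms)
qed simp

lemma pull_zero:
  assumes "x \<in> carrier (Ext C k M N)" "M \<in> obj C" "N \<in> obj C" "M' \<in> obj C"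
  shows "ext_pull C (zer C M' M) x = \<one>\<^bsub>Ext C k M' N\<^esub>"
proof (cases k rule: int_cases3)
  case 1 then show ?thesis using assms by simp
next
  case 2 then show ?thesis using assms by (auto simp: Ext_0_carrier pull_single Ext_0_one homs_iff)
next
  case (3 n)
  then obtain E where E: "yext C (Suc n) M N E" "x = ext_class C E" using ExtE assms by metis
  obtain F where F: "yext C (Suc n) M' N F" using zero_ext_yext assms by blast
  \<comment> \<open>The zero ladder from an extension of \<open>M'\<close> to \<open>E\<close>
    exchanges the pullback along zero for a pushout along zero, which is already known.\<close>
  have "ext_push C (zer C N N) (ext_class C F) = ext_pull C (zer C M' M) x"
    unfolding E(2) by (rule push_eq_pull[OF F E(1) emap_zero[OF F E(1)]])
  then show ?thesis using push_zero[of "ext_class C F" k M' N N] ExtI[OF F] 3 assms by (simp del: of_nat_Suc)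
qed

section \<open>Direct sums of extensions\<close>

lemma dsum_simps:
  assumes "f \<in> arr C" "g \<in> arr C"
  shows "dsum C f g \<in> arr C" "dom C (dsum C f g) = ds (dom C f) (dom C g)"
    "cod C (dsum C f g) = ds (cod C f) (cod C g)"
    "pr1 C (cod C f) (cod C g) \<cdot> dsum C f g = f \<cdot> pr1 C (dom C f) (dom C g)"
    "pr2 C (cod C f) (cod C g) \<cdot> dsum C f g = g \<cdot> pr2 C (dom C f) (dom C g)"
    "dsum C f g \<cdot> in1 C (dom C f) (dom C g) = in1 C (cod C f) (cod C g) \<cdot> f"
    "dsum C f g \<cdot> in2 C (dom C f) (dom C g) = in2 C (cod C f) (cod C g) \<cdot> g"
  using assms by (simp_all add: dsum_def distl distr)

lemma dsum_comp:
  assumes "f \<in> arr C" "g \<in> arr C" "f' \<in> arr C" "g' \<in> arr C" "cod C f = dom C f'" "cod C g = dom C g'"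
  shows "dsum C f' g' \<cdot> dsum C f g = dsum C (f' \<cdot> f) (g' \<cdot> g)"
proof -
  note d = dsum_simps[OF assms(1,2)] dsum_simps[OF assms(3,4)] dsum_simps[of "f' \<cdot> f" "g' \<cdot> g"]
  show ?thesis
  proof (rule bi_eq_left[of "cod C f'" "cod C g'"])
    have "pr1 C (cod C f') (cod C g') \<cdot> (dsum C f' g' \<cdot> dsum C f g) = f' \<cdot> (pr1 C (cod C f) (cod C g) \<cdot> dsum C f g)"
      using assms d reassoc[OF d(11), of "dsum C f g"] by simp
    then show "pr1 C (cod C f') (cod C g') \<cdot> (dsum C f' g' \<cdot> dsum C f g) = pr1 C (cod C f') (cod C g') \<cdot> dsum C (f' \<cdot> f) (g' \<cdot> g)"
      using assms d by simp
    have "pr2 C (cod C f') (cod C g') \<cdot> (dsum C f' g' \<cdot> dsum C f g) = g' \<cdot> (pr2 C (cod C f) (cod C g) \<cdot> dsum C f g)"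
      using assms d reassoc[OF d(12), of "dsum C f g"] by simp
    then show "pr2 C (cod C f') (cod C g') \<cdot> (dsum C f' g' \<cdot> dsum C f g) = pr2 C (cod C f') (cod C g') \<cdot> dsum C (f' \<cdot> f) (g' \<cdot> g)"
      using assms d by simp
  qed (use assms d in auto)
qed

lemma dsum_epi:
  assumes "is_epi C f" "is_epi C g" shows "is_epi C (dsum C f g)"
proof (rule epiI)
  have a [simp]: "f \<in> arr C" "g \<in> arr C" using assms by auto
  note d = dsum_simps[OF a]
  show "dsum C f g \<in> arr C" by (rule d)
  fix x assume x: "x \<in> arr C" "dom C x = cod C (dsum C f g)" "x \<cdot> dsum C f g = zer C (dom C (dsum C f g)) (cod C x)"
  let ?A = "cod C f" let ?B = "cod C g"
  have "x \<cdot> in1 C ?A ?B = zer C ?A (cod C x)"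
  proof (rule epiD[OF assms(1)])
    have "x \<cdot> (dsum C f g \<cdot> in1 C (dom C f) (dom C g)) = zer C (dom C f) (cod C x)"
      using reassoc[OF x(3), of "in1 C (dom C f) (dom C g)"] x d by simp
    then show "(x \<cdot> in1 C ?A ?B) \<cdot> f = zer C ?A (cod C x) \<cdot> f" using x d by simp
  qed (use x d in auto)
  moreover have "x \<cdot> in2 C ?A ?B = zer C ?B (cod C x)"
  proof (rule epiD[OF assms(2)])
    have "x \<cdot> (dsum C f g \<cdot> in2 C (dom C f) (dom C g)) = zer C (dom C g) (cod C x)"
      using reassoc[OF x(3), of "in2 C (dom C f) (dom C g)"] x d by simp
    then show "(x \<cdot> in2 C ?A ?B) \<cdot> g = zer C ?B (cod C x) \<cdot> g" using x d by simp
  qed (use x d in auto)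
  ultimately show "x = zer C (cod C (dsum C f g)) (cod C x)"
    by - (rule bi_eq_right[of ?A ?B]; (use x d in auto))
qed

lemma dsum_kernel:
  assumes "is_kernel C k f" "is_kernel C l g" shows "is_kernel C (dsum C k l) (dsum C f g)"
proof -
  note [simp] = kernelD[OF assms(1)] kernelD[OF assms(2)]
  note d = dsum_simps[of k l] dsum_simps[of f g]
  let ?A = "dom C f" let ?B = "dom C g"
  show ?thesis
  proof (rule kernelI)
    show "is_mono C (dsum C k l)"
    proof (rule monoI)
      fix x assume x: "x \<in> arr C" "cod C x = dom C (dsum C k l)" "dsum C k l \<cdot> x = zer C (dom C x) (cod C (dsum C k l))"
      have "pr1 C (dom C k) (dom C l) \<cdot> x = zer C (dom C x) (dom C k)"
        using reassoc[OF d(4), of x] x d kernel_mono[OF assms(1)]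
        by (intro monoD[of k "pr1 C (dom C k) (dom C l) \<cdot> x" "zer C (dom C x) (dom C k)"]) auto
      moreover have "pr2 C (dom C k) (dom C l) \<cdot> x = zer C (dom C x) (dom C l)"
        using reassoc[OF d(5), of x] x d kernel_mono[OF assms(2)]
        by (intro monoD[of l "pr2 C (dom C k) (dom C l) \<cdot> x" "zer C (dom C x) (dom C l)"]) auto
      ultimately show "x = zer C (dom C x) (dom C (dsum C k l))"
        by - (rule bi_eq_left[of "dom C k" "dom C l"]; (use x d in auto))
    qed (use d in auto)
    show "dsum C f g \<cdot> dsum C k l = zer C (dom C (dsum C k l)) (cod C (dsum C f g))"
      using d by (simp add: dsum_comp) (simp add: dsum_def)
    fix h assume h: "h \<in> arr C" "cod C h = dom C (dsum C f g)" "dsum C f g \<cdot> h = zer C (dom C h) (cod C (dsum C f g))"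
    have "f \<cdot> (pr1 C ?A ?B \<cdot> h) = zer C (dom C h) (cod C f)" using reassoc[OF d(11), of h] h d by simp
    then obtain u where u: "u \<in> arr C" "dom C u = dom C h" "cod C u = dom C k" "k \<cdot> u = pr1 C ?A ?B \<cdot> h"
      using kernel_ex[OF assms(1), of "pr1 C ?A ?B \<cdot> h"] h d by auto
    have "g \<cdot> (pr2 C ?A ?B \<cdot> h) = zer C (dom C h) (cod C g)" using reassoc[OF d(12), of h] h d by simp
    then obtain v where v: "v \<in> arr C" "dom C v = dom C h" "cod C v = dom C l" "l \<cdot> v = pr2 C ?A ?B \<cdot> h"
      using kernel_ex[OF assms(2), of "pr2 C ?A ?B \<cdot> h"] h d by auto
    let ?w = "plus C (in1 C (dom C k) (dom C l) \<cdot> u) (in2 C (dom C k) (dom C l) \<cdot> v)"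
    have w: "?w \<in> arr C" "dom C ?w = dom C h" "cod C ?w = ds (dom C k) (dom C l)"
      "pr1 C (dom C k) (dom C l) \<cdot> ?w = u" "pr2 C (dom C k) (dom C l) \<cdot> ?w = v"
      using u v by (simp_all add: distl)
    have "dsum C k l \<cdot> ?w = h"
    proof (rule bi_eq_left[of ?A ?B])
      show "pr1 C ?A ?B \<cdot> (dsum C k l \<cdot> ?w) = pr1 C ?A ?B \<cdot> h"
        using reassoc[OF d(4), of ?w] w u d by simp
      show "pr2 C ?A ?B \<cdot> (dsum C k l \<cdot> ?w) = pr2 C ?A ?B \<cdot> h"
        using reassoc[OF d(5), of ?w] w v d by simp
    qed (use w d h in auto)
    then show "\<exists>u. u \<in> arr C \<and> dom C u = dom C h \<and> cod C u = dom C (dsum C k l) \<and> dsum C k l \<cdot> u = h"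
      using w d by (intro exI[of _ ?w]) auto
  qed (use d in auto)
qed

lemma dsum_exact:
  assumes "exact_at C f g" "exact_at C f' g'" shows "exact_at C (dsum C f f') (dsum C g g')"
proof -
  obtain m e where me: "is_epi C e" "is_kernel C m g" "cod C e = dom C m" "f = m \<cdot> e"
    using exact_atE[OF assms(1)] .
  obtain m' e' where me': "is_epi C e'" "is_kernel C m' g'" "cod C e' = dom C m'" "f' = m' \<cdot> e'"
    using exact_atE[OF assms(2)] .
  show ?thesis
    by (rule exact_atI[OF dsum_epi[OF me(1) me'(1)] dsum_kernel[OF me(2) me'(2)]])
      (use me me' kernelD[OF me(2)] kernelD[OF me'(2)] in \<open>auto simp: dsum_simps dsum_comp\<close>)
qed

text \<open>Monomorphisms are kernels, and kernels are already known to be stable under direct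
  sums.\<close>

lemma dsum_mono:
  assumes "is_mono C f" "is_mono C g" shows "is_mono C (dsum C f g)"
proof -
  obtain c where "is_kernel C f c" using mono_normal assms by blast
  moreover obtain c' where "is_kernel C g c'" using mono_normal assms by blast
  ultimately show ?thesis using dsum_kernel kernel_mono by blast
qed

lemma dsum_yext:
  assumes E: "yext C (Suc n) M N E" and F: "yext C (Suc n) M' N' F"
  shows "yext C (Suc n) (ds M M') (ds N N') (map2 (dsum C) E F)"
proof -
  note y = yextD[OF E] and z = yextD[OF F]
  have nth: "map2 (dsum C) E F ! j = dsum C (E ! j) (F ! j)" if "j \<le> Suc n" for j
    using that y(1) z(1) by simp
  show ?thesis unfolding yext_Suc
  proof (intro conjI allI impI)
    show "exact_at C (map2 (dsum C) E F ! j) (map2 (dsum C) E F ! Suc j)" if "j \<le> n" for j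
      using dsum_exact[OF y(6) z(6), of j j] that by (simp add: nth)
  qed (use y z in \<open>auto simp: nth dsum_simps dsum_mono dsum_epi\<close>)
qed

lemma emap_pr:
  assumes E: "yext C (Suc n) M N E" and F: "yext C (Suc n) M' N' F"
  shows "emap C n (pr1 C N N') (pr1 C M M') (map2 (dsum C) E F) E"
    "emap C n (pr2 C N N') (pr2 C M M') (map2 (dsum C) E F) F"
proof -
  note y = yextD[OF E] and z = yextD[OF F]
  have nth: "map2 (dsum C) E F ! j = dsum C (E ! j) (F ! j)" if "j \<le> Suc n" for j
    using that y(1) z(1) by simp
  define A where "A j = (if j = Suc (Suc n) then M else dom C (E ! j))" for j
  define B where "B j = (if j = Suc (Suc n) then M' else dom C (F ! j))" for j
  have AB: "A 0 = N" "B 0 = N'" "A (Suc (Suc n)) = M" "B (Suc (Suc n)) = M'"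
    "\<And>j. j \<le> Suc n \<Longrightarrow> dom C (E ! j) = A j \<and> dom C (F ! j) = B j \<and> cod C (E ! j) = A (Suc j) \<and> cod C (F ! j) = B (Suc j)"
    using y z by (auto simp: A_def B_def le_Suc_eq)
  show "emap C n (pr1 C N N') (pr1 C M M') (map2 (dsum C) E F) E"
  proof (rule emapI[where \<phi> = "\<lambda>j. pr1 C (A j) (B j)"])
    fix j assume j: "j \<le> Suc n"
    show "pr1 C (A j) (B j) \<in> homs C (dom C (map2 (dsum C) E F ! j)) (dom C (E ! j))"
      using AB(5)[OF j] y(7)[OF j] z(7)[OF j] dom_obj[of "E ! j"] dom_obj[of "F ! j"] by (auto simp: homs_iff nth[OF j] dsum_simps simp del: dom_obj)
    show "E ! j \<cdot> pr1 C (A j) (B j) = pr1 C (A (Suc j)) (B (Suc j)) \<cdot> map2 (dsum C) E F ! j"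
      using AB(5)[OF j] dsum_simps(4)[OF y(7)[OF j] z(7)[OF j]] nth[OF j] by simp
  qed (use AB y z in \<open>auto simp: homs_iff nth dsum_simps\<close>)
  show "emap C n (pr2 C N N') (pr2 C M M') (map2 (dsum C) E F) F"
  proof (rule emapI[where \<phi> = "\<lambda>j. pr2 C (A j) (B j)"])
    fix j assume j: "j \<le> Suc n"
    show "pr2 C (A j) (B j) \<in> homs C (dom C (map2 (dsum C) E F ! j)) (dom C (F ! j))"
      using AB(5)[OF j] y(7)[OF j] z(7)[OF j] dom_obj[of "E ! j"] dom_obj[of "F ! j"] by (auto simp: homs_iff nth[OF j] dsum_simps simp del: dom_obj)
    show "F ! j \<cdot> pr2 C (A j) (B j) = pr2 C (A (Suc j)) (B (Suc j)) \<cdot> map2 (dsum C) E F ! j"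
      using AB(5)[OF j] dsum_simps(5)[OF y(7)[OF j] z(7)[OF j]] nth[OF j] by simp
  qed (use AB y z in \<open>auto simp: homs_iff nth dsum_simps\<close>)
qed

lemma emap_in:
  assumes E: "yext C (Suc n) M N E" and F: "yext C (Suc n) M' N' F"
  shows "emap C n (in1 C N N') (in1 C M M') E (map2 (dsum C) E F)"
    "emap C n (in2 C N N') (in2 C M M') F (map2 (dsum C) E F)"
proof -
  note y = yextD[OF E] and z = yextD[OF F]
  have nth: "map2 (dsum C) E F ! j = dsum C (E ! j) (F ! j)" if "j \<le> Suc n" for j
    using that y(1) z(1) by simp
  define A where "A j = (if j = Suc (Suc n) then M else dom C (E ! j))" for j
  define B where "B j = (if j = Suc (Suc n) then M' else dom C (F ! j))" for j
  have AB: "A 0 = N" "B 0 = N'" "A (Suc (Suc n)) = M" "B (Suc (Suc n)) = M'"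
    "\<And>j. j \<le> Suc n \<Longrightarrow> dom C (E ! j) = A j \<and> dom C (F ! j) = B j \<and> cod C (E ! j) = A (Suc j) \<and> cod C (F ! j) = B (Suc j)"
    using y z by (auto simp: A_def B_def le_Suc_eq)
  show "emap C n (in1 C N N') (in1 C M M') E (map2 (dsum C) E F)"
  proof (rule emapI[where \<phi> = "\<lambda>j. in1 C (A j) (B j)"])
    fix j assume j: "j \<le> Suc n"
    show "in1 C (A j) (B j) \<in> homs C (dom C (E ! j)) (dom C (map2 (dsum C) E F ! j))"
      using AB(5)[OF j] y(7)[OF j] z(7)[OF j] dom_obj[of "E ! j"] dom_obj[of "F ! j"] by (auto simp: homs_iff nth[OF j] dsum_simps simp del: dom_obj)
    show "map2 (dsum C) E F ! j \<cdot> in1 C (A j) (B j) = in1 C (A (Suc j)) (B (Suc j)) \<cdot> E ! j"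
      using AB(5)[OF j] dsum_simps(6)[OF y(7)[OF j] z(7)[OF j]] nth[OF j] by simp
  qed (use AB y z in \<open>auto simp: homs_iff nth dsum_simps\<close>)
  show "emap C n (in2 C N N') (in2 C M M') F (map2 (dsum C) E F)"
  proof (rule emapI[where \<phi> = "\<lambda>j. in2 C (A j) (B j)"])
    fix j assume j: "j \<le> Suc n"
    show "in2 C (A j) (B j) \<in> homs C (dom C (F ! j)) (dom C (map2 (dsum C) E F ! j))"
      using AB(5)[OF j] y(7)[OF j] z(7)[OF j] dom_obj[of "E ! j"] dom_obj[of "F ! j"] by (auto simp: homs_iff nth[OF j] dsum_simps simp del: dom_obj)
    show "map2 (dsum C) E F ! j \<cdot> in2 C (A j) (B j) = in2 C (A (Suc j)) (B (Suc j)) \<cdot> F ! j"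
      using AB(5)[OF j] dsum_simps(7)[OF y(7)[OF j] z(7)[OF j]] nth[OF j] by simp
  qed (use AB y z in \<open>auto simp: homs_iff nth dsum_simps\<close>)
qed

lemma emap_pair:
  assumes E: "yext C (Suc n) M N E" and F: "yext C (Suc n) M' N' F" and G: "yext C (Suc n) M'' N'' G"
    and "emap C n g f G E" "emap C n g' f' G F"
  shows "emap C n (plus C (in1 C N N' \<cdot> g) (in2 C N N' \<cdot> g')) (plus C (in1 C M M' \<cdot> f) (in2 C M M' \<cdot> f'))
    G (map2 (dsum C) E F)"
proof -
  note D = dsum_yext[OF E F]
  have 1: "emap C n (in1 C N N' \<cdot> g) (in1 C M M' \<cdot> f) G (map2 (dsum C) E F)"
    by (rule emap_comp[OF G E D assms(4) emap_in(1)[OF E F]])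
  have 2: "emap C n (in2 C N N' \<cdot> g') (in2 C M M' \<cdot> f') G (map2 (dsum C) E F)"
    by (rule emap_comp[OF G F D assms(5) emap_in(2)[OF E F]])
  show ?thesis by (rule emap_plus[OF G D 1 2])
qed

text \<open>Each step is preceded by a projection and the two are paired to a ladder between the
  direct sums; its ends are pairs of projections, that is, identities.\<close>

lemma dsum_step:
  assumes E: "yext C (Suc n) M N E" and E': "yext C (Suc n) M N E'"
    and F: "yext C (Suc n) M' N' F" and F': "yext C (Suc n) M' N' F'"
    and e: "emap C n (idn C N) (idn C M) E E'" and f: "emap C n (idn C N') (idn C M') F F'"
  shows "ext_class C (map2 (dsum C) E F) = ext_class C (map2 (dsum C) E' F')"
proof -
  note D = dsum_yext[OF E F] note D' = dsum_yext[OF E' F']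
  have o: "N \<in> obj C" "N' \<in> obj C" "M \<in> obj C" "M' \<in> obj C" using yextD[OF E] yextD[OF F] by auto
  have 1: "emap C n (idn C N \<cdot> pr1 C N N') (idn C M \<cdot> pr1 C M M') (map2 (dsum C) E F) E'"
    by (rule emap_comp[OF D E E' emap_pr(1)[OF E F] e])
  have 2: "emap C n (idn C N' \<cdot> pr2 C N N') (idn C M' \<cdot> pr2 C M M') (map2 (dsum C) E F) F'"
    by (rule emap_comp[OF D F F' emap_pr(2)[OF E F] f])
  have "emap C n (idn C (ds N N')) (idn C (ds M M')) (map2 (dsum C) E F) (map2 (dsum C) E' F')"
    using emap_pair[OF E' F' D 1 2] o by simp
  then show ?thesis by (rule emap_step[OF D D'])
qed

lemma dsum_class_left:
  assumes E: "yext C (Suc n) M N E" and F: "yext C (Suc n) M' N' F" and "equivclp (yext_step C) E E'"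
  shows "ext_class C (map2 (dsum C) E F) = ext_class C (map2 (dsum C) E' F)"
  using assms(3)
proof (induction rule: equivclp_induct)
  case (step E1 E2)
  have y: "yext C (Suc n) M N E1" by (rule class_yext[OF step.hyps(1) E])
  from step.hyps(2) show ?case
  proof
    assume "yext_step C E1 E2"
    note s = step_emap[OF this disjI1, OF y]
    show ?thesis using dsum_step[OF y s(3) F F s(1) emap_id[OF F]] step.IH by simp
  next
    assume "yext_step C E2 E1"
    note s = step_emap[OF this disjI2, OF y]
    show ?thesis using dsum_step[OF s(2) y F F s(1) emap_id[OF F]] step.IH by simp
  qed
qed simp

lemma dsum_class_right:
  assumes E: "yext C (Suc n) M N E" and F: "yext C (Suc n) M' N' F" and "equivclp (yext_step C) F F'"
  shows "ext_class C (map2 (dsum C) E F) = ext_class C (map2 (dsum C) E F')"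
  using assms(3)
proof (induction rule: equivclp_induct)
  case (step F1 F2)
  have y: "yext C (Suc n) M' N' F1" by (rule class_yext[OF step.hyps(1) F])
  from step.hyps(2) show ?case
  proof
    assume "yext_step C F1 F2"
    note s = step_emap[OF this disjI1, OF y]
    show ?thesis using dsum_step[OF E E y s(3) emap_id[OF E] s(1)] step.IH by simp
  next
    assume "yext_step C F2 F1"
    note s = step_emap[OF this disjI2, OF y]
    show ?thesis using dsum_step[OF E E s(2) y emap_id[OF E] s(1)] step.IH by simp
  qed
qed simp

section \<open>Baer sums and the group structure\<close>

lemma baer_sum_class:
  assumes E: "yext C (Suc n) M N E" and F: "yext C (Suc n) M N F"
  shows "baer_sum C M N (ext_class C E) (ext_class C F) =
    ext_push C (codiag C N) (ext_pull C (diag C M) (ext_class C (map2 (dsum C) E F)))"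
proof -
  have *: "ext_class C (map2 (dsum C) E' F') = ext_class C (map2 (dsum C) E F)"
    if "E' \<in> ext_class C E" "F' \<in> ext_class C F" for E' F'
  proof -
    have e: "equivclp (yext_step C) E E'" "equivclp (yext_step C) F F'" using that by (auto simp: ext_class_def)
    show ?thesis
      using dsum_class_left[OF E F e(1)] dsum_class_right[OF class_yext[OF e(1) E] F e(2)] by simp
  qed
  have "\<Union>{ext_class C (map2 (dsum C) E' F') | E' F'. E' \<in> ext_class C E \<and> F' \<in> ext_class C F} =
    ext_class C (map2 (dsum C) E F)"
  proof (intro equalityI subsetI)
    fix x assume "x \<in> \<Union>{ext_class C (map2 (dsum C) E' F') | E' F'. E' \<in> ext_class C E \<and> F' \<in> ext_class C F}"
    then show "x \<in> ext_class C (map2 (dsum C) E F)" using * by blast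
  next
    fix x assume "x \<in> ext_class C (map2 (dsum C) E F)"
    then show "x \<in> \<Union>{ext_class C (map2 (dsum C) E' F') | E' F'. E' \<in> ext_class C E \<and> F' \<in> ext_class C F}"
      using ext_class_self[of E C] ext_class_self[of F C] by blast
  qed
  then show ?thesis by (simp add: baer_sum_def)
qed

lemma diag_arr [simp]:
  assumes "A \<in> obj C"
  shows "diag C A \<in> arr C" "dom C (diag C A) = A" "cod C (diag C A) = ds A A"
    "pr1 C A A \<cdot> diag C A = idn C A" "pr2 C A A \<cdot> diag C A = idn C A"
    "codiag C A \<in> arr C" "dom C (codiag C A) = ds A A" "cod C (codiag C A) = A"
    "codiag C A \<cdot> in1 C A A = idn C A" "codiag C A \<cdot> in2 C A A = idn C A"
  using assms by (simp_all add: diag_def codiag_def distl distr)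

lemma diag_hom: "A \<in> obj C \<Longrightarrow> diag C A \<in> homs C A (ds A A)"
  "A \<in> obj C \<Longrightarrow> codiag C A \<in> homs C (ds A A) A" by (auto simp: homs_iff)

lemma pr_hom: "\<lbrakk>A \<in> obj C; B \<in> obj C\<rbrakk> \<Longrightarrow> pr1 C A B \<in> homs C (ds A B) A"
  "\<lbrakk>A \<in> obj C; B \<in> obj C\<rbrakk> \<Longrightarrow> pr2 C A B \<in> homs C (ds A B) B"
  "\<lbrakk>A \<in> obj C; B \<in> obj C\<rbrakk> \<Longrightarrow> in1 C A B \<in> homs C A (ds A B)"
  "\<lbrakk>A \<in> obj C; B \<in> obj C\<rbrakk> \<Longrightarrow> in2 C A B \<in> homs C B (ds A B)"
  by (auto simp: homs_iff)

lemma pull_dsum_pr: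
  assumes E: "yext C (Suc n) M N E" and F: "yext C (Suc n) M' N' F" and h: "h \<in> homs C L (ds M M')"
  shows "ext_push C (pr1 C N N') (ext_pull C h (ext_class C (map2 (dsum C) E F))) = ext_pull C (pr1 C M M' \<cdot> h) (ext_class C E)"
    "ext_push C (pr2 C N N') (ext_pull C h (ext_class C (map2 (dsum C) E F))) = ext_pull C (pr2 C M M' \<cdot> h) (ext_class C F)"
proof -
  note D = dsum_yext[OF E F]
  have o: "N \<in> obj C" "N' \<in> obj C" "M \<in> obj C" "M' \<in> obj C" using yextD[OF E] yextD[OF F] by auto
  show "ext_push C (pr1 C N N') (ext_pull C h (ext_class C (map2 (dsum C) E F))) = ext_pull C (pr1 C M M' \<cdot> h) (ext_class C E)"
    using push_pull[OF ExtI[OF D] h pr_hom(1)[OF o(1,2)]] push_eq_pull[OF D E emap_pr(1)[OF E F]]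
      pull_comp[OF ExtI[OF E] pr_hom(1)[OF o(3,4)] h] by simp
  show "ext_push C (pr2 C N N') (ext_pull C h (ext_class C (map2 (dsum C) E F))) = ext_pull C (pr2 C M M' \<cdot> h) (ext_class C F)"
    using push_pull[OF ExtI[OF D] h pr_hom(2)[OF o(1,2)]] push_eq_pull[OF D F emap_pr(2)[OF E F]]
      pull_comp[OF ExtI[OF F] pr_hom(2)[OF o(3,4)] h] by simp
qed

text \<open>Pairing the ladders from \<open>G\<close> to its two pushouts gives a ladder to their
  direct sum with the identity at the left and the diagonal at the right; thus a class with values
  in a biproduct is recovered from its components.\<close>

lemma pair_unique:
  assumes z: "z \<in> carrier (Ext C (int (Suc n)) M (ds A B))" and o: "A \<in> obj C" "B \<in> obj C"
    and E: "yext C (Suc n) M A E" "ext_push C (pr1 C A B) z = ext_class C E"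
    and F: "yext C (Suc n) M B F" "ext_push C (pr2 C A B) z = ext_class C F"
  shows "z = ext_pull C (diag C M) (ext_class C (map2 (dsum C) E F))"
proof -
  obtain G where G: "yext C (Suc n) M (ds A B) G" "z = ext_class C G" using ExtE z by metis
  have oM: "M \<in> obj C" using yextD[OF G(1)] by simp
  obtain E' where E': "yext C (Suc n) M A E'" "emap C n (pr1 C A B) (idn C M) G E'" "ext_class C E' = ext_class C E"
    using ext_push_ex[OF G(1) pr_hom(1)[OF o]] E(2) G(2) by metis
  obtain F' where F': "yext C (Suc n) M B F'" "emap C n (pr2 C A B) (idn C M) G F'" "ext_class C F' = ext_class C F"
    using ext_push_ex[OF G(1) pr_hom(2)[OF o]] F(2) G(2) by metis
  have "emap C n (idn C (ds A B)) (diag C M) G (map2 (dsum C) E' F')"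
    using emap_pair[OF E'(1) F'(1) G(1) E'(2) F'(2)] o oM by (simp add: diag_def)
  then have "z = ext_pull C (diag C M) (ext_class C (map2 (dsum C) E' F'))"
    using ext_pull_class[OF dsum_yext[OF E'(1) F'(1)] diag_hom(1)[OF oM] G(1)] G(2) by simp
  also have "ext_class C (map2 (dsum C) E' F') = ext_class C (map2 (dsum C) E F)"
    using dsum_class_left[OF E'(1) F'(1)] dsum_class_right[OF E(1) F'(1)] E'(3) F'(3) ext_class_eq_iff by metis
  finally show ?thesis .
qed

text \<open>The class pushed into \<open>ds N N\<close> along the pair of \<open>\<alpha>\<close>
  and \<open>\<beta>\<close> has the two pushouts as components, so \<open>pair_unique\<close>
  rewrites it as the inner part of the Baer sum, and the codiagonal turns the pair into the
  sum.\<close>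

lemma baer_push:
  assumes z: "z \<in> carrier (Ext C (int (Suc n)) M A)" and a: "\<alpha> \<in> homs C A N" "\<beta> \<in> homs C A N"
  shows "baer_sum C M N (ext_push C \<alpha> z) (ext_push C \<beta> z) = ext_push C (plus C \<alpha> \<beta>) z"
proof -
  have o: "A \<in> obj C" "N \<in> obj C" using homs_obj a by auto
  have ar [simp]: "\<alpha> \<in> arr C" "\<beta> \<in> arr C" "dom C \<alpha> = A" "dom C \<beta> = A" "cod C \<alpha> = N" "cod C \<beta> = N"
    using a by (auto simp: homs_iff)
  obtain E where E: "yext C (Suc n) M N E" "ext_push C \<alpha> z = ext_class C E" using ExtE push_closed[OF z a(1)] by metis
  obtain F where F: "yext C (Suc n) M N F" "ext_push C \<beta> z = ext_class C F" using ExtE push_closed[OF z a(2)] by metis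
  let ?s = "plus C (in1 C N N \<cdot> \<alpha>) (in2 C N N \<cdot> \<beta>)"
  have s: "?s \<in> homs C A (ds N N)" using o by (auto simp: homs_iff)
  have s': "pr1 C N N \<cdot> ?s = \<alpha>" "pr2 C N N \<cdot> ?s = \<beta>" "codiag C N \<cdot> ?s = plus C \<alpha> \<beta>"
    using o reassoc[OF diag_arr(9)[of N], of \<alpha>] reassoc[OF diag_arr(10)[of N], of \<beta>] by (simp_all add: distl)
  have "ext_push C ?s z = ext_pull C (diag C M) (ext_class C (map2 (dsum C) E F))"
    by (rule pair_unique[OF push_closed[OF z s] o(2) o(2) E(1) _ F(1)])
      (use push_comp[OF z s pr_hom(1)[OF o(2,2)]] push_comp[OF z s pr_hom(2)[OF o(2,2)]] s' E F in auto)
  then show ?thesis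
    using baer_sum_class[OF E(1) F(1)] push_comp[OF z s diag_hom(2)[OF o(2)]] E F s' by simp
qed

text \<open>The codiagonal ladder from the direct sum of \<open>G\<close> with itself to
  \<open>G\<close> exchanges the pushout along the codiagonal of \<open>N\<close> for a pullback
  along that of \<open>M\<close>, which reduces the Baer sum to a pullback along the sum of
  \<open>\<alpha>\<close> and \<open>\<beta>\<close>.\<close>

lemma baer_pull:
  assumes z: "z \<in> carrier (Ext C (int (Suc n)) M N)" and a: "\<alpha> \<in> homs C L M" "\<beta> \<in> homs C L M"
  shows "baer_sum C L N (ext_pull C \<alpha> z) (ext_pull C \<beta> z) = ext_pull C (plus C \<alpha> \<beta>) z"
proof -
  obtain G where G: "yext C (Suc n) M N G" "z = ext_class C G" using ExtE z by metis
  have o: "L \<in> obj C" "M \<in> obj C" "N \<in> obj C" using homs_obj a yextD[OF G(1)] by auto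
  have ar [simp]: "\<alpha> \<in> arr C" "\<beta> \<in> arr C" "dom C \<alpha> = L" "dom C \<beta> = L" "cod C \<alpha> = M" "cod C \<beta> = M"
    using a by (auto simp: homs_iff)
  note D = dsum_yext[OF G(1) G(1)]
  obtain E where E: "yext C (Suc n) L N E" "ext_pull C \<alpha> z = ext_class C E" using ExtE pull_closed[OF z a(1)] by metis
  obtain F where F: "yext C (Suc n) L N F" "ext_pull C \<beta> z = ext_class C F" using ExtE pull_closed[OF z a(2)] by metis
  let ?s = "plus C (in1 C M M \<cdot> \<alpha>) (in2 C M M \<cdot> \<beta>)"
  have s: "?s \<in> homs C L (ds M M)" using o by (auto simp: homs_iff)
  have s': "pr1 C M M \<cdot> ?s = \<alpha>" "pr2 C M M \<cdot> ?s = \<beta>" "codiag C M \<cdot> ?s = plus C \<alpha> \<beta>"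
    using o reassoc[OF diag_arr(9)[of M], of \<alpha>] reassoc[OF diag_arr(10)[of M], of \<beta>] by (simp_all add: distl)
  have "ext_pull C ?s (ext_class C (map2 (dsum C) G G)) = ext_pull C (diag C L) (ext_class C (map2 (dsum C) E F))"
    by (rule pair_unique[OF pull_closed[OF ExtI[OF D] s] o(3) o(3) E(1) _ F(1)])
      (use pull_dsum_pr[OF G(1) G(1) s] s' E F G in auto)
  moreover have "emap C n (codiag C N) (codiag C M) (map2 (dsum C) G G) G"
    using emap_plus[OF D G(1) emap_pr[OF G(1) G(1)]] by (simp add: codiag_def)
  then have "ext_push C (codiag C N) (ext_class C (map2 (dsum C) G G)) = ext_pull C (codiag C M) z"
    using push_eq_pull[OF D G(1)] G(2) by simp
  ultimately show ?thesis
    using baer_sum_class[OF E(1) F(1)] E F s' push_pull[OF ExtI[OF D] s diag_hom(2)[OF o(3)]]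
      pull_comp[OF z diag_hom(2)[OF o(2)] s] by simp
qed

lemma push_add:
  assumes z: "z \<in> carrier (Ext C k M A)" and a: "\<alpha> \<in> homs C A N" "\<beta> \<in> homs C A N"
  shows "ext_push C (plus C \<alpha> \<beta>) z = ext_push C \<alpha> z \<otimes>\<^bsub>Ext C k M N\<^esub> ext_push C \<beta> z"
proof (cases k rule: int_cases3)
  case 1 then show ?thesis using z by simp
next
  case 2
  then show ?thesis using z a by (auto simp: Ext_0_carrier Ext_0_mult push_single homs_iff distr)
next
  case (3 n) then show ?thesis using baer_push[of z n M A \<alpha> N \<beta>] assms by (simp add: Ext_Suc_mult del: of_nat_Suc)
qed

lemma pull_add:
  assumes z: "z \<in> carrier (Ext C k M N)" and a: "\<alpha> \<in> homs C L M" "\<beta> \<in> homs C L M"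
  shows "ext_pull C (plus C \<alpha> \<beta>) z = ext_pull C \<alpha> z \<otimes>\<^bsub>Ext C k L N\<^esub> ext_pull C \<beta> z"
proof (cases k rule: int_cases3)
  case 1 then show ?thesis using z by simp
next
  case 2
  then show ?thesis using z a by (auto simp: Ext_0_carrier Ext_0_mult pull_single homs_iff distl)
next
  case (3 n) then show ?thesis using baer_pull[of z n M N \<alpha> L \<beta>] assms by (simp add: Ext_Suc_mult del: of_nat_Suc)
qed

text \<open>Realises two classes inside one, so that with \<open>push_add\<close> their sum becomes
  a pushout along a sum of morphisms; this reduces the group laws of Ext to those of the Hom
  groups.\<close>

lemma pair_ex:
  assumes x: "x \<in> carrier (Ext C k M A)" and y: "y \<in> carrier (Ext C k M B)"
    and o: "M \<in> obj C" "A \<in> obj C" "B \<in> obj C"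
  obtains z where "z \<in> carrier (Ext C k M (ds A B))" "ext_push C (pr1 C A B) z = x" "ext_push C (pr2 C A B) z = y"
proof (cases k rule: int_cases3)
  case 1 then show ?thesis using that x y by simp
next
  case 2
  then obtain f g where "f \<in> homs C M A" "g \<in> homs C M B" "x = {[f]}" "y = {[g]}"
    using x y by (auto simp: Ext_0_carrier)
  then show ?thesis using o 2
    by (intro that[of "{[plus C (in1 C A B \<cdot> f) (in2 C A B \<cdot> g)]}"])
      (auto simp: Ext_0_carrier push_single homs_iff distl)
next
  case (3 n)
  obtain E where E: "yext C (Suc n) M A E" "x = ext_class C E" using ExtE x 3 by metis
  obtain F where F: "yext C (Suc n) M B F" "y = ext_class C F" using ExtE y 3 by metis
  have h: "diag C M \<in> homs C M (ds M M)" using diag_hom o by blast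
  show ?thesis
    by (rule that[of "ext_pull C (diag C M) (ext_class C (map2 (dsum C) E F))"])
      (use 3 pull_closed[OF ExtI[OF dsum_yext[OF E(1) F(1)]] h] pull_dsum_pr[OF E(1) F(1) h] o E F
        pull_id[OF ExtI[OF E(1)]] pull_id[OF ExtI[OF F(1)]] in \<open>auto simp del: of_nat_Suc\<close>)
qed

lemma mult_closed:
  assumes x: "x \<in> carrier (Ext C k M N)" and y: "y \<in> carrier (Ext C k M N)" and o: "M \<in> obj C" "N \<in> obj C"
  shows "x \<otimes>\<^bsub>Ext C k M N\<^esub> y \<in> carrier (Ext C k M N)"
proof -
  obtain z where z: "z \<in> carrier (Ext C k M (ds N N))" "ext_push C (pr1 C N N) z = x" "ext_push C (pr2 C N N) z = y"
    using pair_ex[OF x y o(1) o(2) o(2)] .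
  show ?thesis using push_add[OF z(1) pr_hom(1)[OF o(2,2)] pr_hom(2)[OF o(2,2)]]
      push_closed[OF z(1) plus_hom[OF pr_hom(1)[OF o(2,2)] pr_hom(2)[OF o(2,2)]]] z by simp
qed

lemma push_mult:
  assumes x: "x \<in> carrier (Ext C k M N)" and y: "y \<in> carrier (Ext C k M N)" and o: "M \<in> obj C"
    and g: "g \<in> homs C N N'"
  shows "ext_push C g (x \<otimes>\<^bsub>Ext C k M N\<^esub> y) = ext_push C g x \<otimes>\<^bsub>Ext C k M N'\<^esub> ext_push C g y"
proof -
  have o': "N \<in> obj C" using homs_obj g by auto
  obtain z where z: "z \<in> carrier (Ext C k M (ds N N))" "ext_push C (pr1 C N N) z = x" "ext_push C (pr2 C N N) z = y"
    using pair_ex[OF x y o o' o'] .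
  note p = pr_hom(1)[OF o' o'] pr_hom(2)[OF o' o']
  have "ext_push C g (x \<otimes>\<^bsub>Ext C k M N\<^esub> y) = ext_push C (g \<cdot> plus C (pr1 C N N) (pr2 C N N)) z"
    using push_add[OF z(1) p] push_comp[OF z(1) plus_hom[OF p] g] z by simp
  also have "g \<cdot> plus C (pr1 C N N) (pr2 C N N) = plus C (g \<cdot> pr1 C N N) (g \<cdot> pr2 C N N)"
    using g p by (subst distl) (auto simp: homs_iff)
  also have "ext_push C \<dots> z = ext_push C (g \<cdot> pr1 C N N) z \<otimes>\<^bsub>Ext C k M N'\<^esub> ext_push C (g \<cdot> pr2 C N N) z"
    by (rule push_add[OF z(1) cmp_hom[OF p(1) g] cmp_hom[OF p(2) g]])
  finally show ?thesis using push_comp[OF z(1) p(1) g] push_comp[OF z(1) p(2) g] z by simp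
qed

lemma pull_mult:
  assumes x: "x \<in> carrier (Ext C k M N)" and y: "y \<in> carrier (Ext C k M N)" and o: "N \<in> obj C"
    and f: "f \<in> homs C M' M"
  shows "ext_pull C f (x \<otimes>\<^bsub>Ext C k M N\<^esub> y) = ext_pull C f x \<otimes>\<^bsub>Ext C k M' N\<^esub> ext_pull C f y"
proof -
  have o': "M \<in> obj C" using homs_obj f by auto
  obtain z where z: "z \<in> carrier (Ext C k M (ds N N))" "ext_push C (pr1 C N N) z = x" "ext_push C (pr2 C N N) z = y"
    using pair_ex[OF x y o' o o] .
  note p = pr_hom(1)[OF o o] pr_hom(2)[OF o o]
  have "ext_pull C f (x \<otimes>\<^bsub>Ext C k M N\<^esub> y) = ext_push C (plus C (pr1 C N N) (pr2 C N N)) (ext_pull C f z)"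
    using push_add[OF z(1) p] push_pull[OF z(1) f plus_hom[OF p]] z by simp
  also have "\<dots> = ext_push C (pr1 C N N) (ext_pull C f z) \<otimes>\<^bsub>Ext C k M' N\<^esub> ext_push C (pr2 C N N) (ext_pull C f z)"
    by (rule push_add[OF pull_closed[OF z(1) f] p])
  finally show ?thesis using push_pull[OF z(1) f p(1)] push_pull[OF z(1) f p(2)] z by simp
qed

text \<open>Commutativity and associativity hold for sums of projections of a biproduct and are
  transported to the given classes as its components; the inverse is the pushout along minus the
  identity.\<close>

lemma Ext_group:
  assumes o: "M \<in> obj C" "N \<in> obj C" shows "comm_group (Ext C k M N)"
proof (rule comm_groupI)
  fix x y assume x: "x \<in> carrier (Ext C k M N)" and y: "y \<in> carrier (Ext C k M N)"
  show "x \<otimes>\<^bsub>Ext C k M N\<^esub> y \<in> carrier (Ext C k M N)" by (rule mult_closed[OF x y o])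
  obtain z where z: "z \<in> carrier (Ext C k M (ds N N))" "ext_push C (pr1 C N N) z = x" "ext_push C (pr2 C N N) z = y"
    using pair_ex[OF x y o(1) o(2) o(2)] .
  note p = pr_hom(1)[OF o(2,2)] pr_hom(2)[OF o(2,2)]
  have "plus C (pr1 C N N) (pr2 C N N) = plus C (pr2 C N N) (pr1 C N N)"
    using o by (intro plus_comm) auto
  then show "x \<otimes>\<^bsub>Ext C k M N\<^esub> y = y \<otimes>\<^bsub>Ext C k M N\<^esub> x"
    using push_add[OF z(1) p] push_add[OF z(1) p(2,1)] z by simp
  fix w assume w: "w \<in> carrier (Ext C k M N)"
  have od: "ds N N \<in> obj C" using o by simp
  obtain v where v: "v \<in> carrier (Ext C k M (ds (ds N N) N))"
    "ext_push C (pr1 C (ds N N) N) v = z" "ext_push C (pr2 C (ds N N) N) v = w"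
    using pair_ex[OF z(1) w o(1) od o(2)] .
  let ?a = "pr1 C N N \<cdot> pr1 C (ds N N) N" let ?b = "pr2 C N N \<cdot> pr1 C (ds N N) N" let ?c = "pr2 C (ds N N) N"
  have h: "?a \<in> homs C (ds (ds N N) N) N" "?b \<in> homs C (ds (ds N N) N) N" "?c \<in> homs C (ds (ds N N) N) N"
    using o by (auto simp: homs_iff)
  have e: "ext_push C ?a v = x" "ext_push C ?b v = y" "ext_push C ?c v = w"
    using push_comp[OF v(1) pr_hom(1)[OF od o(2)] p(1)] push_comp[OF v(1) pr_hom(1)[OF od o(2)] p(2)] v z by simp_all
  have "plus C (plus C ?a ?b) ?c = plus C ?a (plus C ?b ?c)" using h by (intro plus_assoc) (auto simp: homs_iff)
  then show "x \<otimes>\<^bsub>Ext C k M N\<^esub> y \<otimes>\<^bsub>Ext C k M N\<^esub> w = x \<otimes>\<^bsub>Ext C k M N\<^esub> (y \<otimes>\<^bsub>Ext C k M N\<^esub> w)"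
    using push_add[OF v(1) plus_hom[OF h(1,2)] h(3)] push_add[OF v(1) h(1) plus_hom[OF h(2,3)]]
      push_add[OF v(1) h(1,2)] push_add[OF v(1) h(2,3)] e by simp
next
  show "\<one>\<^bsub>Ext C k M N\<^esub> \<in> carrier (Ext C k M N)" by (rule one_closed[OF o])
  fix x assume x: "x \<in> carrier (Ext C k M N)"
  show "\<one>\<^bsub>Ext C k M N\<^esub> \<otimes>\<^bsub>Ext C k M N\<^esub> x = x"
    using push_add[OF x zer_hom[OF o(2,2)] idn_hom[OF o(2)]] push_zero[OF x o o(2)] push_id[OF x] o by simp
  have n: "neg (idn C N) \<in> homs C N N" using o by (auto simp: homs_iff)
  have "plus C (neg (idn C N)) (idn C N) = zer C N N" using o by simp
  then have "ext_push C (neg (idn C N)) x \<otimes>\<^bsub>Ext C k M N\<^esub> x = \<one>\<^bsub>Ext C k M N\<^esub>"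
    using push_add[OF x n idn_hom[OF o(2)]] push_id[OF x] push_zero[OF x o o(2)] by simp
  then show "\<exists>y\<in>carrier (Ext C k M N). y \<otimes>\<^bsub>Ext C k M N\<^esub> x = \<one>\<^bsub>Ext C k M N\<^esub>"
    using push_closed[OF x n] by blast
qed

lemma push_group_hom:
  assumes "M \<in> obj C" "g \<in> homs C N N'" shows "ext_push C g \<in> hom (Ext C k M N) (Ext C k M N')"
  by (rule homI) (use assms push_closed push_mult in auto)

lemma pull_group_hom:
  assumes "N \<in> obj C" "f \<in> homs C M' M" shows "ext_pull C f \<in> hom (Ext C k M N) (Ext C k M' N)"
  by (rule homI) (use assms pull_closed pull_mult in auto)

lemma pull_one:
  assumes "N \<in> obj C" "f \<in> homs C M' M" shows "ext_pull C f \<one>\<^bsub>Ext C k M N\<^esub> = \<one>\<^bsub>Ext C k M' N\<^esub>"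
  using hom_one[OF pull_group_hom[OF assms] ] Ext_group homs_obj assms comm_group.axioms by meson

lemma push_one:
  assumes "M \<in> obj C" "g \<in> homs C N N'" shows "ext_push C g \<one>\<^bsub>Ext C k M N\<^esub> = \<one>\<^bsub>Ext C k M N'\<^esub>"
  using hom_one[OF push_group_hom[OF assms]] Ext_group homs_obj assms comm_group.axioms by meson

end


section \<open>Yoneda products with short exact sequences\<close>

definition splice :: "('o, 'm, 'z) precat_scheme \<Rightarrow> 'm \<Rightarrow> 'm \<Rightarrow> 'm list \<Rightarrow> 'm list" where
  "splice C a b G = a # (hd G \<cdot>\<^bsub>C\<^esub> b) # tl G"

lemma splice_nth:
  assumes "length G = Suc (Suc n)"
  shows "length (splice C a b G) = Suc (Suc (Suc n))" "splice C a b G ! 0 = a"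
    "splice C a b G ! Suc 0 = G ! 0 \<cdot>\<^bsub>C\<^esub> b"
    "splice C a b G ! Suc (Suc j) = G ! Suc j"
  using assms by (cases G; simp add: splice_def)+

lemma splice_left_long:
  "length E \<noteq> 1 \<Longrightarrow> splice_left_rel C a b E F \<longleftrightarrow> F = splice C a b E"
  by (simp add: splice_left_rel_def splice_def)

lemma rev_butlast: "rev (butlast xs) = tl (rev xs)"
  by (metis butlast_rev rev_rev_ident)

context abelian_category
begin

lemma pull_rel_rev:
  assumes "E \<noteq> []" shows "pull_rel C g E F \<longleftrightarrow> push_rel (opc C) g (rev E) (rev F)"
proof (cases "length E = 1")
  case True
  then show ?thesis using assms by (cases E) (auto simp: push_rel_def pull_rel_def)
next
  case False
  then obtain x y E' where E: "rev E = x # y # E'" using assms by (cases "rev E"; cases "tl (rev E)") auto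
  then have "E = rev E' @ [y, x]" by (metis append.assoc append_Cons append_Nil rev.simps(2) rev_rev_ident)
  moreover have "F = rev E' @ [e, q] \<longleftrightarrow> rev F = [q, e] @ E'" for q e
    by (metis append_Cons append_Nil rev.simps(2) rev_append rev_rev_ident append_assoc)
  ultimately show ?thesis by (simp add: push_rel_def pull_rel_def butlast_append)
qed

lemma splice_right_rev:
  assumes "E \<noteq> []" shows "splice_right_rel C a b E F \<longleftrightarrow> splice_left_rel (opc C) b a (rev E) (rev F)"
proof (cases "length E = 1")
  case True
  then obtain h where "E = [h]" by (cases E) auto
  then show ?thesis by (simp add: splice_right_rel_def splice_left_rel_def push_rel_rev)
next
  case False
  have "F = butlast E @ [x, b] \<longleftrightarrow> rev F = b # x # tl (rev E)" for x
  proof -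
    have "rev (butlast E @ [x, b]) = b # x # tl (rev E)" by (simp add: rev_butlast)
    then show ?thesis by (metis rev_rev_ident)
  qed
  then show ?thesis using False assms by (simp add: splice_right_rel_def splice_left_rel_def hd_rev)
qed

text \<open>Following \<open>b\<close> by the monomorphism \<open>G ! 0\<close> keeps the kernel
  \<open>a\<close>, and preceding \<open>G ! 0\<close> by the epimorphism \<open>b\<close> keeps the
  image; this gives exactness at the two new places.\<close>

lemma splice_yext:
  assumes ab: "short_exact C a b" and G: "yext C (Suc n) M (cod C b) G"
  shows "yext C (Suc (Suc n)) M (dom C a) (splice C a b G)"
proof -
  note y = yextD[OF G] note s [simp] = short_exactD(5-8)[OF ab] note nth = splice_nth[OF y(1), of C a b]
  have m [simp]: "G ! 0 \<in> arr C" using y by auto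
  have k: "is_kernel C a (G ! 0 \<cdot> b)"
  proof (rule kernelI)
    fix h assume h: "h \<in> arr C" "cod C h = dom C (G ! 0 \<cdot> b)" "(G ! 0 \<cdot> b) \<cdot> h = zer C (dom C h) (cod C (G ! 0 \<cdot> b))"
    then have "b \<cdot> h = zer C (dom C h) (cod C b)" using mono_zero[OF y(4), of "b \<cdot> h"] y(2) by simp
    then show "\<exists>u. u \<in> arr C \<and> dom C u = dom C h \<and> cod C u = dom C a \<and> a \<cdot> u = h"
      using kernel_ex[OF short_exactD(1)[OF ab], of h] h y(2) by simp
  qed (use y short_exactD(3)[OF ab] in auto)
  show ?thesis unfolding yext_Suc
  proof (intro conjI allI impI)
    fix j assume j: "j \<le> Suc n"
    consider "j = 0" | "j = 1" | i where "j = Suc (Suc i)" by (metis One_nat_def not0_implies_Suc)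
    then show "exact_at C (splice C a b G ! j) (splice C a b G ! Suc j)"
    proof cases
      case 1 then show ?thesis using kernel_exact[OF k] nth by simp
    next
      case 2
      have "exact_at C (G ! 0 \<cdot> b) (G ! Suc 0)"
        by (rule exact_atI[OF short_exactD(4)[OF ab] exact_at_mono_kernel[OF y(6) y(4)]]) (use y in auto)
      then show ?thesis using nth 2 by simp
    next
      case 3 then show ?thesis using y(6)[of "Suc i"] j nth by simp
    qed
  qed (use y nth short_exactD(3)[OF ab] in auto)
qed

lemma ses_emap:
  assumes ab: "short_exact C a b" and ab': "short_exact C a' b'"
  shows "emap C 0 g f [a, b] [a', b'] \<longleftrightarrow> g \<in> homs C (dom C a) (dom C a') \<and> f \<in> homs C (cod C b) (cod C b') \<and>
    (\<exists>u\<in>homs C (dom C b) (dom C b'). a' \<cdot> g = u \<cdot> a \<and> b' \<cdot> u = f \<cdot> b)"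
proof
  assume "emap C 0 g f [a, b] [a', b']"
  then obtain \<phi> where "\<phi> 0 = g" "\<phi> (Suc (Suc 0)) = f" "f \<in> homs C (cod C b) (cod C b')"
    "\<And>j. j \<le> Suc 0 \<Longrightarrow> \<phi> j \<in> homs C (dom C ([a, b] ! j)) (dom C ([a', b'] ! j)) \<and>
        [a', b'] ! j \<cdot> \<phi> j = \<phi> (Suc j) \<cdot> [a, b] ! j" unfolding emap_def by auto
  from this(1-3) this(4)[of 0] this(4)[of 1]
  show "g \<in> homs C (dom C a) (dom C a') \<and> f \<in> homs C (cod C b) (cod C b') \<and>
    (\<exists>u\<in>homs C (dom C b) (dom C b'). a' \<cdot> g = u \<cdot> a \<and> b' \<cdot> u = f \<cdot> b)" by auto
next
  assume "g \<in> homs C (dom C a) (dom C a') \<and> f \<in> homs C (cod C b) (cod C b') \<and>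
    (\<exists>u\<in>homs C (dom C b) (dom C b'). a' \<cdot> g = u \<cdot> a \<and> b' \<cdot> u = f \<cdot> b)"
  then obtain u where u: "g \<in> homs C (dom C a) (dom C a')" "f \<in> homs C (cod C b) (cod C b')"
    "u \<in> homs C (dom C b) (dom C b')" "a' \<cdot> g = u \<cdot> a" "b' \<cdot> u = f \<cdot> b" by blast
  show "emap C 0 g f [a, b] [a', b']"
    by (rule emapI[where \<phi> = "\<lambda>j. if j = 0 then g else if j = 1 then u else f"]) (use u in \<open>auto simp: le_Suc_eq\<close>)
qed

lemma emap_splice:
  assumes ab: "short_exact C a b" and ab': "short_exact C a' b'"
    and G: "yext C (Suc n) M (cod C b) G" and G': "yext C (Suc n) M' (cod C b') G'"
    and e: "emap C n k f G G'" and u: "u \<in> homs C (dom C b) (dom C b')" and g: "g \<in> homs C (dom C a) (dom C a')"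
    and c: "a' \<cdot> g = u \<cdot> a" "b' \<cdot> u = k \<cdot> b"
  shows "emap C (Suc n) g f (splice C a b G) (splice C a' b' G')"
proof -
  note s [simp] = short_exactD(5-8)[OF ab] note s' [simp] = short_exactD(5-8)[OF ab']
  note y = yextD[OF G] note y' = yextD[OF G']
  note nth = splice_nth[OF y(1), of C a b] splice_nth[OF y'(1), of C a' b']
  obtain \<phi> where p: "\<phi> 0 = k" "\<phi> (Suc (Suc n)) = f"
    "\<And>j. j \<le> Suc n \<Longrightarrow> \<phi> j \<in> arr C" "\<And>j. j \<le> Suc n \<Longrightarrow> dom C (\<phi> j) = dom C (G ! j)"
    "\<And>j. j \<le> Suc n \<Longrightarrow> cod C (\<phi> j) = dom C (G' ! j)"
    "f \<in> arr C" "dom C f = cod C (G ! Suc n)" "cod C f = cod C (G' ! Suc n)"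
    "\<And>j. j \<le> Suc n \<Longrightarrow> G' ! j \<cdot> \<phi> j = \<phi> (Suc j) \<cdot> G ! j"
    using emapE[OF e] by metis
  have u' [simp]: "u \<in> arr C" "dom C u = dom C b" "cod C u = dom C b'" using u by (auto simp: homs_iff)
  have m [simp]: "G ! 0 \<in> arr C" "G' ! 0 \<in> arr C" using y y' by auto
  have k [simp]: "k \<in> arr C" "dom C k = cod C b" "cod C k = cod C b'" using p(1) p(3-5)[of 0] y(2) y'(2) by auto
  have p1: "\<phi> (Suc 0) \<in> arr C" "dom C (\<phi> (Suc 0)) = cod C (G ! 0)"
    using p(3-5)[of "Suc 0"] y(8)[of 0] by auto
  have "(G' ! 0 \<cdot> b') \<cdot> u = G' ! 0 \<cdot> (k \<cdot> b)" using c y'(2) by simp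
  also have "\<dots> = (\<phi> (Suc 0) \<cdot> G ! 0) \<cdot> b"
    by (rule reassoc) (use p(9)[of 0] p(1) y y' in auto)
  finally have sq: "(G' ! 0 \<cdot> b') \<cdot> u = \<phi> (Suc 0) \<cdot> (G ! 0 \<cdot> b)" using p1 y(2) by simp
  show ?thesis
  proof (rule emapI[where \<phi> = "\<lambda>j. if j = 0 then g else if j = 1 then u else \<phi> (j - 1)"])
    fix j assume j: "j \<le> Suc (Suc n)"
    consider "j = 0" | "j = 1" | i where "j = Suc (Suc i)" by (metis One_nat_def not0_implies_Suc)
    note cs = this
    from cs show "(if j = 0 then g else if j = 1 then u else \<phi> (j - 1)) \<in> homs C (dom C (splice C a b G ! j)) (dom C (splice C a' b' G' ! j))"
    proof cases
      case 1 then show ?thesis using g nth by simp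
    next
      case 2 then show ?thesis using nth y y' by (simp add: homs_iff)
    next
      case 3 then show ?thesis using p(3-5)[of "Suc i"] j nth by (simp add: homs_iff)
    qed
    from cs show "splice C a' b' G' ! j \<cdot> (if j = 0 then g else if j = 1 then u else \<phi> (j - 1)) =
      (if Suc j = 0 then g else if Suc j = 1 then u else \<phi> (Suc j - 1)) \<cdot> splice C a b G ! j"
    proof cases
      case 1 then show ?thesis using c nth by simp
    next
      case 2 then show ?thesis using sq nth by simp
    next
      case 3 then show ?thesis using p(9)[of "Suc i"] j nth by simp
    qed
  qed (use p nth in \<open>auto simp: homs_iff\<close>)
qed

text \<open>Exactness factors the second arrow as \<open>m \<cdot> e\<close>; cutting there leaves a
  short exact sequence ending in \<open>e\<close> and a shorter extension starting with
  \<open>m\<close>.\<close>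

lemma splice_decompose:
  assumes E: "yext C (Suc (Suc n)) M N E"
  obtains a b G where "E = splice C a b G" "short_exact C a b" "dom C a = N" "yext C (Suc n) M (cod C b) G"
proof -
  note y = yextD[OF E]
  obtain m e where me: "is_epi C e" "is_kernel C m (E ! Suc (Suc 0))" "cod C e = dom C m" "E ! Suc 0 = m \<cdot> e"
    by (rule exact_atE[OF y(6)[of "Suc 0"]]) auto
  note k [simp] = kernelD[OF me(2)]
  have e [simp]: "e \<in> arr C" using me by auto
  have a [simp]: "E ! 0 \<in> arr C" using y by auto
  have ce: "cod C (E ! 0) = dom C e" using y(8)[of 0] me by simp
  have k1: "is_kernel C (E ! 0) (m \<cdot> e)" using exact_at_mono_kernel[OF y(6)[of 0] y(4)] me by simp
  note k1' = kernelD[OF k1]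
  have "is_kernel C (E ! 0) e"
  proof (rule kernelI)
    show "e \<cdot> E ! 0 = zer C (dom C (E ! 0)) (cod C e)"
      using mono_zero[OF kernel_mono[OF me(2)], of "e \<cdot> E ! 0"] k1'(4) ce me by simp
    fix h assume h: "h \<in> arr C" "cod C h = dom C e" "e \<cdot> h = zer C (dom C h) (cod C e)"
    then have "(m \<cdot> e) \<cdot> h = zer C (dom C h) (cod C (m \<cdot> e))" using me by simp
    then show "\<exists>u. u \<in> arr C \<and> dom C u = dom C h \<and> cod C u = dom C (E ! 0) \<and> E ! 0 \<cdot> u = h"
      using kernel_ex[OF k1, of h] h me by simp
  qed (use ce y in auto)
  then have s: "short_exact C (E ! 0) e" using me by (simp add: short_exact_iff)
  obtain x x' E' where El: "E = x # x' # E'" using y(1) by (cases E; cases "tl E") auto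
  have sp: "E = splice C (E ! 0) e (m # E')" using me El by (simp add: splice_def)
  have "yext C (Suc n) M (cod C e) (m # E')" unfolding yext_Suc
  proof (intro conjI allI impI)
    show "length (m # E') = Suc (Suc n)" using y(1) El by simp
    show "is_mono C ((m # E') ! 0)" using kernel_mono[OF me(2)] by simp
    show "exact_at C ((m # E') ! j) ((m # E') ! Suc j)" if "j \<le> n" for j
      using kernel_exact[OF me(2)] y(6)[of "Suc j"] El that by (cases j) auto
  qed (use me y El in auto)
  then show ?thesis using that[OF sp s] y by blast
qed

text \<open>The rung at the second object carries the kernel of \<open>b\<close> into that of
  \<open>b'\<close>, so it induces \<open>k\<close> on the objects at which the extensions are
  cut.\<close>

lemma emap_decompose:
  assumes ab: "short_exact C a b" and ab': "short_exact C a' b'"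
    and G: "yext C (Suc n) M (cod C b) G" and G': "yext C (Suc n) M' (cod C b') G'"
    and e: "emap C (Suc n) g f (splice C a b G) (splice C a' b' G')"
  obtains u k where "u \<in> homs C (dom C b) (dom C b')" "k \<in> homs C (cod C b) (cod C b')"
    "a' \<cdot> g = u \<cdot> a" "b' \<cdot> u = k \<cdot> b" "emap C n k f G G'"
proof -
  note s [simp] = short_exactD(5-8)[OF ab] note s' [simp] = short_exactD(5-8)[OF ab']
  note y = yextD[OF G] note y' = yextD[OF G']
  note nth = splice_nth[OF y(1), of C a b] splice_nth[OF y'(1), of C a' b']
  obtain \<phi> where p: "\<phi> 0 = g" "\<phi> (Suc (Suc (Suc n))) = f"
    "\<And>j. j \<le> Suc (Suc n) \<Longrightarrow> \<phi> j \<in> arr C" "\<And>j. j \<le> Suc (Suc n) \<Longrightarrow> dom C (\<phi> j) = dom C (splice C a b G ! j)"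
    "\<And>j. j \<le> Suc (Suc n) \<Longrightarrow> cod C (\<phi> j) = dom C (splice C a' b' G' ! j)"
    "f \<in> arr C" "dom C f = cod C (splice C a b G ! Suc (Suc n))" "cod C f = cod C (splice C a' b' G' ! Suc (Suc n))"
    "\<And>j. j \<le> Suc (Suc n) \<Longrightarrow> splice C a' b' G' ! j \<cdot> \<phi> j = \<phi> (Suc j) \<cdot> splice C a b G ! j"
    using emapE[OF e] by metis
  have m [simp]: "G ! 0 \<in> arr C" "G' ! 0 \<in> arr C" using y y' by auto
  let ?u = "\<phi> (Suc 0)"
  have u [simp]: "?u \<in> arr C" "dom C ?u = dom C b" "cod C ?u = dom C b'"
    using p(3-5)[of "Suc 0"] nth y(2) y'(2) by auto
  have g [simp]: "g \<in> arr C" "cod C g = dom C a'" "dom C g = dom C a" using p(1) p(3-5)[of 0] nth by auto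
  have c1: "a' \<cdot> g = ?u \<cdot> a" using p(1) p(9)[of 0] nth by simp
  have "(b' \<cdot> ?u) \<cdot> a = zer C (dom C a) (cod C (b' \<cdot> ?u))"
    using c1[symmetric] reassoc[OF s'(4), of g] by simp
  then obtain k where k: "k \<in> arr C" "dom C k = cod C b" "cod C k = cod C b'" "k \<cdot> b = b' \<cdot> ?u"
    using cokernel_ex[OF short_exactD(2)[OF ab], of "b' \<cdot> ?u"] by auto
  have p2: "\<phi> (Suc (Suc 0)) \<in> arr C" "dom C (\<phi> (Suc (Suc 0))) = cod C (G ! 0)"
    "cod C (\<phi> (Suc (Suc 0))) = cod C (G' ! 0)"
    using p(3-5)[of "Suc (Suc 0)"] y(8)[of 0] y'(8)[of 0] nth by auto
  have mk: "G' ! 0 \<cdot> k = \<phi> (Suc (Suc 0)) \<cdot> G ! 0"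
  proof (rule epiD[OF short_exactD(4)[OF ab]])
    have "G' ! 0 \<cdot> (b' \<cdot> ?u) = \<phi> (Suc (Suc 0)) \<cdot> (G ! 0 \<cdot> b)"
      using p(9)[of "Suc 0"] nth y' by simp
    then show "(G' ! 0 \<cdot> k) \<cdot> b = (\<phi> (Suc (Suc 0)) \<cdot> G ! 0) \<cdot> b" using k y y' p2 by simp
  qed (use k y y' p2 in auto)
  have "emap C n k f G G'"
  proof (rule emapI[where \<phi> = "\<lambda>j. if j = 0 then k else \<phi> (Suc j)"])
    fix j assume j: "j \<le> Suc n"
    show "(if j = 0 then k else \<phi> (Suc j)) \<in> homs C (dom C (G ! j)) (dom C (G' ! j))"
      using k y y' j p(3-5)[of "Suc j"] nth by (cases j) (auto simp: homs_iff)
    show "G' ! j \<cdot> (if j = 0 then k else \<phi> (Suc j)) = (if Suc j = 0 then k else \<phi> (Suc (Suc j))) \<cdot> G ! j"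
      using mk p(9)[of "Suc j"] j nth by (cases j) auto
  qed (use p nth in \<open>auto simp: homs_iff\<close>)
  then show ?thesis using that[of ?u k] c1 k by (auto simp: homs_iff)
qed

section \<open>The covariant connecting morphism\<close>

lemma co_neg: "k < 0 \<Longrightarrow> conn_co C k M a b x = \<one>\<^bsub>Ext C (k + 1) M (dom C a)\<^esub>"
  by (simp add: conn_co_def)

lemma co_0:
  assumes ab: "short_exact C a b" and h: "h \<in> homs C M (cod C b)"
  shows "conn_co C 0 M a b {[h]} = ext_pull C h (ext_class C [a, b])"
proof -
  have E: "yext C (Suc 0) (cod C b) (dom C a) [a, b]" using ab by (simp add: yext_0)
  obtain F where F: "pull_rel C h [a, b] F" using pull_ex[OF E h] by blast
  note F' = pull_rel_yext[OF E h F]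
  have *: "ext_class C F' = ext_class C F" if "pull_rel C h [a, b] F'" for F'
    using pull_rel_class[OF E h F _ that] by simp
  have "conn_co C 0 M a b {[h]} = \<Union>{ext_class C F | F. pull_rel C h [a, b] F}"
    by (auto simp: conn_co_def splice_left_rel_def)
  also have "\<dots> = ext_class C F" using F * by blast
  finally show ?thesis using ext_pull_class[OF E h F'] by simp
qed

lemma co_class:
  assumes ab: "short_exact C a b" and G: "yext C (Suc n) M (cod C b) G"
  shows "conn_co C (int (Suc n)) M a b (ext_class C G) = ext_class C (splice C a b G)"
proof -
  note s [simp] = short_exactD(5-8)[OF ab]
  have *: "ext_class C (splice C a b G') = ext_class C (splice C a b G)" if "equivclp (yext_step C) G G'" for G'
    using that
  proof (induction rule: equivclp_induct)
    case (step G1 G2)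
    have y: "yext C (Suc n) M (cod C b) G1" by (rule class_yext[OF step.hyps(1) G])
    have st: "ext_class C (splice C a b H) = ext_class C (splice C a b H')"
      if H: "yext C (Suc n) M (cod C b) H" "yext C (Suc n) M (cod C b) H'"
        "emap C n (idn C (cod C b)) (idn C M) H H'" for H H'
    proof -
      have "emap C (Suc n) (idn C (dom C a)) (idn C M) (splice C a b H) (splice C a b H')"
        by (rule emap_splice[OF ab ab H, of "idn C (dom C b)"]) (auto simp: homs_iff)
      then show ?thesis using emap_step[OF splice_yext[OF ab H(1)] splice_yext[OF ab H(2)]] by simp
    qed
    from step.hyps(2) show ?case
    proof
      assume "yext_step C G1 G2"
      note t = step_emap[OF this disjI1, OF y]
      show ?thesis using st[OF y t(3) t(1)] step.IH by simp
    next
      assume "yext_step C G2 G1"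
      note t = step_emap[OF this disjI2, OF y]
      show ?thesis using st[OF t(2) y t(1)] step.IH by simp
    qed
  qed simp
  have l: "splice_left_rel C a b G' F \<longleftrightarrow> F = splice C a b G'" if "equivclp (yext_step C) G G'" for G' F
    using splice_left_long yextD(1)[OF class_yext[OF that G]] by (metis One_nat_def Suc_inject old.nat.distinct(1))
  have u: "conn_co C (int (Suc n)) M a b (ext_class C G) =
    \<Union>{ext_class C F |E F. E \<in> ext_class C G \<and> splice_left_rel C a b E F}"
    by (simp add: conn_co_def del: of_nat_Suc)
  show ?thesis unfolding u
  proof (intro equalityI subsetI)
    fix x assume "x \<in> \<Union>{ext_class C F |E F. E \<in> ext_class C G \<and> splice_left_rel C a b E F}"
    then obtain G' F where F: "G' \<in> ext_class C G" "splice_left_rel C a b G' F" "x \<in> ext_class C F" by blast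
    then have e: "equivclp (yext_step C) G G'" by (simp add: ext_class_def)
    show "x \<in> ext_class C (splice C a b G)" using F(2,3) *[OF e] unfolding l[OF e] by simp
  next
    fix x assume x: "x \<in> ext_class C (splice C a b G)"
    have "splice_left_rel C a b G (splice C a b G)" using l by simp
    then have "ext_class C (splice C a b G) \<in> {ext_class C F |E F. E \<in> ext_class C G \<and> splice_left_rel C a b E F}"
      using ext_class_self[of G C] by blast
    then show "x \<in> \<Union>{ext_class C F |E F. E \<in> ext_class C G \<and> splice_left_rel C a b E F}"
      using x by (rule UnionI)
  qed
qed

lemma Suc1: "int (Suc n) + 1 = int (Suc (Suc n))" "0 + 1 = int (Suc 0)" by simp_all

lemma sesI: "short_exact C a b \<Longrightarrow> yext C (Suc 0) (cod C b) (dom C a) [a, b]"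
  by (simp add: yext_0)

lemma co_closed:
  assumes ab: "short_exact C a b" and x: "x \<in> carrier (Ext C k M (cod C b))" and o: "M \<in> obj C"
  shows "conn_co C k M a b x \<in> carrier (Ext C (k + 1) M (dom C a))"
proof (cases k rule: int_cases3)
  case 1 then show ?thesis using one_closed[OF o, of "dom C a" "k + 1"] short_exactD(5)[OF ab] by (simp add: co_neg)
next
  case 2
  then obtain h where h: "h \<in> homs C M (cod C b)" "x = {[h]}" using x by (auto simp: Ext_0_carrier)
  show ?thesis using pull_closed[OF ExtI[OF sesI[OF ab]] h(1)] co_0[OF ab h(1)] 2 h by simp
next
  case (3 n)
  then obtain G where G: "yext C (Suc n) M (cod C b) G" "x = ext_class C G" using ExtE x by metis
  show ?thesis unfolding 3 G(2) co_class[OF ab G(1)] Suc1 by (rule ExtI[OF splice_yext[OF ab G(1)]])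
qed

lemma co_pull:
  assumes ab: "short_exact C a b" and x: "x \<in> carrier (Ext C k M (cod C b))" and f: "f \<in> homs C M' M"
  shows "ext_pull C f (conn_co C k M a b x) = conn_co C k M' a b (ext_pull C f x)"
proof (cases k rule: int_cases3)
  case 1 then show ?thesis using pull_one[OF _ f, of "dom C a" "k + 1"] short_exactD(5)[OF ab] by (simp add: co_neg)
next
  case 2
  then obtain h where h: "h \<in> homs C M (cod C b)" "x = {[h]}" using x by (auto simp: Ext_0_carrier)
  show ?thesis unfolding 2 h(2) pull_single
    using co_0[OF ab h(1)] co_0[OF ab cmp_hom[OF f h(1)]] pull_comp[OF ExtI[OF sesI[OF ab]] h(1) f] by simp
next
  case (3 n)
  then obtain G where G: "yext C (Suc n) M (cod C b) G" "x = ext_class C G" using ExtE x by metis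
  obtain F where F: "yext C (Suc n) M' (cod C b) F" "emap C n (idn C (cod C b)) f F G"
    "ext_pull C f (ext_class C G) = ext_class C F" using ext_pull_ex[OF G(1) f] .
  have "emap C (Suc n) (idn C (dom C a)) f (splice C a b F) (splice C a b G)"
    by (rule emap_splice[OF ab ab F(1) G(1) F(2), of "idn C (dom C b)"]) (use short_exactD(5-8)[OF ab] in \<open>auto simp: homs_iff\<close>)
  then show ?thesis unfolding 3 G(2) F(3) co_class[OF ab G(1)] co_class[OF ab F(1)]
    by (rule ext_pull_class[OF splice_yext[OF ab G(1)] f splice_yext[OF ab F(1)]])
qed

text \<open>In degree zero this is the exchange of pushout and pullback; in positive degree the
  ladder of the pushout along \<open>\<kappa>\<close> is spliced with the given map of short exact
  sequences.\<close>

lemma co_nat: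
  assumes ab: "short_exact C a b" and ab': "short_exact C a' b'" and x: "x \<in> carrier (Ext C k M (cod C b))"
    and o: "M \<in> obj C" and e: "emap C 0 g \<kappa> [a, b] [a', b']"
  shows "ext_push C g (conn_co C k M a b x) = conn_co C k M a' b' (ext_push C \<kappa> x)"
proof -
  obtain u where u: "g \<in> homs C (dom C a) (dom C a')" "\<kappa> \<in> homs C (cod C b) (cod C b')"
    "u \<in> homs C (dom C b) (dom C b')" "a' \<cdot> g = u \<cdot> a" "b' \<cdot> u = \<kappa> \<cdot> b"
    using e unfolding ses_emap[OF ab ab'] by blast
  show ?thesis
  proof (cases k rule: int_cases3)
    case 1 then show ?thesis using push_one[OF o u(1)] by (simp add: co_neg)
  next
    case 2
    then obtain h where h: "h \<in> homs C M (cod C b)" "x = {[h]}" using x by (auto simp: Ext_0_carrier)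
    have "ext_push C g (ext_class C [a, b]) = ext_pull C \<kappa> (ext_class C [a', b'])"
      by (rule push_eq_pull[OF sesI[OF ab] sesI[OF ab'] e])
    then show ?thesis unfolding 2 h(2) push_single
      using co_0[OF ab h(1)] co_0[OF ab' cmp_hom[OF h(1) u(2)]] pull_comp[OF ExtI[OF sesI[OF ab']] u(2) h(1)]
        push_pull[OF ExtI[OF sesI[OF ab]] h(1) u(1)] by simp
  next
    case (3 n)
    then obtain G where G: "yext C (Suc n) M (cod C b) G" "x = ext_class C G" using ExtE x by metis
    obtain F where F: "yext C (Suc n) M (cod C b') F" "emap C n \<kappa> (idn C M) G F"
      "ext_push C \<kappa> (ext_class C G) = ext_class C F" using ext_push_ex[OF G(1) u(2)] .
    have "emap C (Suc n) g (idn C M) (splice C a b G) (splice C a' b' F)"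
      by (rule emap_splice[OF ab ab' G(1) F(1,2) u(3,1,4,5)])
    then show ?thesis unfolding 3 G(2) F(3) co_class[OF ab G(1)] co_class[OF ab' F(1)]
      by (rule ext_push_class[OF splice_yext[OF ab G(1)] u(1) splice_yext[OF ab' F(1)]])
  qed
qed

text \<open>Realises two classes as the restrictions of one class on \<open>ds M M\<close>, so that
  an operation commuting with pullbacks is additive.\<close>

lemma ext_add_pull_in:
  assumes x: "x \<in> carrier (Ext C k M N)" and y: "y \<in> carrier (Ext C k M N)" and o: "M \<in> obj C" "N \<in> obj C"
  obtains w where "w \<in> carrier (Ext C k (ds M M) N)" "ext_pull C (in1 C M M) w = x" "ext_pull C (in2 C M M) w = y"
    "ext_pull C (plus C (in1 C M M) (in2 C M M)) w = x \<otimes>\<^bsub>Ext C k M N\<^esub> y"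
proof -
  interpret G: comm_group "Ext C k M N" by (rule Ext_group[OF o])
  note p = pr_hom[OF o(1) o(1)] have od: "ds M M \<in> obj C" using o by simp
  let ?x = "ext_pull C (pr1 C M M) x" let ?y = "ext_pull C (pr2 C M M) y"
  note c = pull_closed[OF x p(1)] pull_closed[OF y p(2)]
  have "ext_pull C (in1 C M M) ?x = x" "ext_pull C (in2 C M M) ?x = \<one>\<^bsub>Ext C k M N\<^esub>"
    "ext_pull C (in1 C M M) ?y = \<one>\<^bsub>Ext C k M N\<^esub>" "ext_pull C (in2 C M M) ?y = y"
    using pull_comp[OF x p(1) p(3)] pull_comp[OF x p(1) p(4)] pull_comp[OF y p(2) p(3)] pull_comp[OF y p(2) p(4)]
      pull_id[OF x] pull_id[OF y] pull_zero[OF x o o(1)] pull_zero[OF y o o(1)] o by simp_all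
  moreover define w where "w = ?x \<otimes>\<^bsub>Ext C k (ds M M) N\<^esub> ?y"
  moreover have w: "w \<in> carrier (Ext C k (ds M M) N)" unfolding w_def by (rule mult_closed[OF c od o(2)])
  ultimately have "ext_pull C (in1 C M M) w = x" "ext_pull C (in2 C M M) w = y"
    using pull_mult[OF c o(2) p(3)] pull_mult[OF c o(2) p(4)] x y by simp_all
  then show ?thesis using that w pull_add[OF w p(3,4)] by simp
qed

lemma ext_add_push_pr:
  assumes x: "x \<in> carrier (Ext C k M N)" and y: "y \<in> carrier (Ext C k M N)" and o: "M \<in> obj C" "N \<in> obj C"
  obtains w where "w \<in> carrier (Ext C k M (ds N N))" "ext_push C (pr1 C N N) w = x" "ext_push C (pr2 C N N) w = y"
    "ext_push C (plus C (pr1 C N N) (pr2 C N N)) w = x \<otimes>\<^bsub>Ext C k M N\<^esub> y"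
  using pair_ex[OF x y o(1) o(2) o(2)] push_add pr_hom[OF o(2) o(2)] by metis

lemma co_group_hom:
  assumes ab: "short_exact C a b" and o: "M \<in> obj C"
  shows "conn_co C k M a b \<in> hom (Ext C k M (cod C b)) (Ext C (k + 1) M (dom C a))"
proof (rule homI)
  show "conn_co C k M a b x \<in> carrier (Ext C (k + 1) M (dom C a))" if "x \<in> carrier (Ext C k M (cod C b))" for x
    by (rule co_closed[OF ab that o])
  fix x y assume xy: "x \<in> carrier (Ext C k M (cod C b))" "y \<in> carrier (Ext C k M (cod C b))"
  have o': "cod C b \<in> obj C" "ds M M \<in> obj C" using short_exactD(6)[OF ab] o by auto
  obtain w where w: "w \<in> carrier (Ext C k (ds M M) (cod C b))" "ext_pull C (in1 C M M) w = x" "ext_pull C (in2 C M M) w = y"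
    "ext_pull C (plus C (in1 C M M) (in2 C M M)) w = x \<otimes>\<^bsub>Ext C k M (cod C b)\<^esub> y"
    using ext_add_pull_in[OF xy o o'(1)] .
  note p = pr_hom(3,4)[OF o o]
  show "conn_co C k M a b (x \<otimes>\<^bsub>Ext C k M (cod C b)\<^esub> y) =
    conn_co C k M a b x \<otimes>\<^bsub>Ext C (k + 1) M (dom C a)\<^esub> conn_co C k M a b y"
    using co_pull[OF ab w(1) p(1)] co_pull[OF ab w(1) p(2)] co_pull[OF ab w(1) plus_hom[OF p]]
      pull_add[OF co_closed[OF ab w(1) o'(2)] p] w by simp
qed

section \<open>Ext of the opposite category and the contravariant connecting morphism\<close>

abbreviation revs where "revs \<equiv> (`) rev"

lemma revs_revs [simp]: "revs (revs x) = x" by (simp add: image_image)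
lemma revs_inj: "revs x = revs y \<longleftrightarrow> x = y" by (simp add: inj_image_eq_iff)

lemma Ext_not_Nil: "x \<in> carrier (Ext C k M N) \<Longrightarrow> [] \<notin> x"
proof (cases k rule: int_cases3)
  case (3 n) then show "x \<in> carrier (Ext C k M N) \<Longrightarrow> [] \<notin> x" using ExtE class_not_Nil by metis
qed (auto simp: Ext_0_carrier)

text \<open>Only carriers and units are compared: the biproducts chosen in \<open>opc C\<close> can
  differ from those in \<open>C\<close>, so Baer sums are not literally reversed into each other.
  Additivity on the contravariant side is proved through naturality instead.\<close>

lemma Ext_opc_carrier: "carrier (Ext (opc C) k N M) = revs ` carrier (Ext C k M N)"
proof (cases k rule: int_cases3)
  case 1 then show ?thesis by simp
next
  case 2
  interpret O: abelian_category "opc C" by (rule opc_abelian)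
  show ?thesis unfolding 2 O.Ext_0_carrier Ext_0_carrier by (simp add: image_image)
next
  case (3 n)
  have "{E. yext (opc C) (Suc n) N M E} = rev ` {E. yext C (Suc n) M N E}"
  proof (intro equalityI subsetI)
    fix x assume "x \<in> {E. yext (opc C) (Suc n) N M E}"
    then have "yext C (Suc n) M N (rev x)" using yext_rev[of n N M "rev x"] by simp
    then show "x \<in> rev ` {E. yext C (Suc n) M N E}" by (metis imageI mem_Collect_eq rev_rev_ident)
  qed (auto simp: yext_rev)
  then show ?thesis unfolding 3 Ext_Suc_carrier by (simp add: image_image ext_class_rev)
qed

lemma revs_closed: "x \<in> carrier (Ext C k M N) \<Longrightarrow> revs x \<in> carrier (Ext (opc C) k N M)"
  by (auto simp: Ext_opc_carrier)

lemma revs_closed_iff: "revs x \<in> carrier (Ext (opc C) k N M) \<longleftrightarrow> x \<in> carrier (Ext C k M N)"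
  by (auto simp: Ext_opc_carrier revs_inj)

lemma push_opc: "x \<in> carrier (Ext C k M N) \<Longrightarrow> revs (ext_push C g x) = ext_pull (opc C) g (revs x)"
  by (rule ext_push_rev) (rule Ext_not_Nil)

lemma pull_opc:
  assumes "x \<in> carrier (Ext C k M N)" shows "revs (ext_pull C g x) = ext_push (opc C) g (revs x)"
proof -
  have n: "[] \<notin> x" using Ext_not_Nil assms by blast
  have "{revs (ext_class C F) |E F. E \<in> x \<and> pull_rel C g E F} =
    {ext_class (opc C) F |E F. E \<in> revs x \<and> push_rel (opc C) g E F}" (is "?L = ?revs")
  proof safe
    fix E F assume "E \<in> x" "pull_rel C g E F"
    then show "\<exists>E' F'. revs (ext_class C F) = ext_class (opc C) F' \<and> E' \<in> revs x \<and> push_rel (opc C) g E' F'"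
      using n pull_rel_rev[of E g F] ext_class_rev[of F] by (intro exI[of _ "rev E"] exI[of _ "rev F"]) auto
  next
    fix F E assume "E \<in> x" "push_rel (opc C) g (rev E) F"
    then show "\<exists>E F'. ext_class (opc C) F = revs (ext_class C F') \<and> E \<in> x \<and> pull_rel C g E F'"
      using n pull_rel_rev[of E g "rev F"] ext_class_rev[of "rev F"] by (intro exI[of _ "E"] exI[of _ "rev F"]) auto
  qed
  moreover have "revs ` {ext_class C F |E F. E \<in> x \<and> pull_rel C g E F} = ?L" by blast
  ultimately show ?thesis unfolding ext_push_def ext_pull_def image_Union by simp
qed

text \<open>The zero extensions of degree one use biproducts chosen separately, so the unit is
  recognised as a pushout along zero, which reversal turns into a pullback along zero.\<close>

lemma one_opc:
  assumes o: "M \<in> obj C" "N \<in> obj C" shows "revs \<one>\<^bsub>Ext C k M N\<^esub> = \<one>\<^bsub>Ext (opc C) k N M\<^esub>"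
proof -
  interpret O: abelian_category "opc C" by (rule opc_abelian)
  note x = one_closed[OF o, of k]
  have "revs (ext_push C (zer C N N) \<one>\<^bsub>Ext C k M N\<^esub>) = \<one>\<^bsub>Ext (opc C) k N M\<^esub>"
    using push_opc[OF x] O.pull_zero[OF revs_closed[OF x], of N] o by simp
  then show ?thesis using push_zero[OF x o o(2)] by simp
qed

lemma cc_opc:
  assumes "x \<in> carrier (Ext C k M N)" "M = dom C a" "N \<in> obj C" "short_exact C a b"
  shows "revs (conn_contra C k a b N x) = conn_co (opc C) k N b a (revs x)"
proof (cases "k < 0")
  case True then show ?thesis using assms short_exactD(6)[OF assms(4)]
    by (simp add: conn_contra_def conn_co_def one_opc)
next
  case False
  have n: "[] \<notin> x" using Ext_not_Nil assms(1) by blast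
  have "{revs (ext_class C F) |E F. E \<in> x \<and> splice_right_rel C a b E F} =
    {ext_class (opc C) F |E F. E \<in> revs x \<and> splice_left_rel (opc C) b a E F}" (is "?L = ?revs")
  proof safe
    fix E F assume "E \<in> x" "splice_right_rel C a b E F"
    then show "\<exists>E' F'. revs (ext_class C F) = ext_class (opc C) F' \<and> E' \<in> revs x \<and> splice_left_rel (opc C) b a E' F'"
      using n splice_right_rev[of E a b F] ext_class_rev[of F] by (intro exI[of _ "rev E"] exI[of _ "rev F"]) auto
  next
    fix F E assume "E \<in> x" "splice_left_rel (opc C) b a (rev E) F"
    then show "\<exists>E F'. ext_class (opc C) F = revs (ext_class C F') \<and> E \<in> x \<and> splice_right_rel C a b E F'"
      using n splice_right_rev[of E a b "rev F"] ext_class_rev[of "rev F"] by (intro exI[of _ "E"] exI[of _ "rev F"]) auto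
  qed
  moreover have "revs ` {ext_class C F |E F. E \<in> x \<and> splice_right_rel C a b E F} = ?L" by blast
  ultimately show ?thesis using False unfolding conn_contra_def conn_co_def by (simp add: image_Union)
qed

lemma cc_closed:
  assumes ab: "short_exact C a b" and x: "x \<in> carrier (Ext C k (dom C a) N)" and o: "N \<in> obj C"
  shows "conn_contra C k a b N x \<in> carrier (Ext C (k + 1) (cod C b) N)"
proof -
  interpret O: abelian_category "opc C" by (rule opc_abelian)
  have "conn_co (opc C) k N b a (revs x) \<in> carrier (Ext (opc C) (k + 1) N (cod C b))"
    using O.co_closed[of b a "revs x" k N] ab revs_closed[OF x] o by simp
  then show ?thesis using cc_opc[OF x refl o ab] revs_closed_iff by metis
qed

lemma cc_push:
  assumes ab: "short_exact C a b" and x: "x \<in> carrier (Ext C k (dom C a) N)" and g: "g \<in> homs C N N'"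
  shows "ext_push C g (conn_contra C k a b N x) = conn_contra C k a b N' (ext_push C g x)"
proof -
  interpret O: abelian_category "opc C" by (rule opc_abelian)
  have o: "N \<in> obj C" "N' \<in> obj C" using homs_obj g by auto
  have "revs (ext_push C g (conn_contra C k a b N x)) = revs (conn_contra C k a b N' (ext_push C g x))"
    using O.co_pull[of b a "revs x" k N g N'] ab revs_closed[OF x] g o cc_opc[OF x refl o(1) ab]
      cc_opc[OF push_closed[OF x g] refl o(2) ab] push_opc[OF cc_closed[OF ab x o(1)]] push_opc[OF x] by simp
  then show ?thesis by (simp add: revs_inj)
qed

lemma cc_nat:
  assumes ab: "short_exact C a b" and ab': "short_exact C a' b'" and x: "x \<in> carrier (Ext C k (dom C a') N)"
    and o: "N \<in> obj C" and e: "emap C 0 g \<kappa> [a, b] [a', b']"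
  shows "conn_contra C k a b N (ext_pull C g x) = ext_pull C \<kappa> (conn_contra C k a' b' N x)"
proof -
  interpret O: abelian_category "opc C" by (rule opc_abelian)
  have h: "g \<in> homs C (dom C a) (dom C a')" "\<kappa> \<in> homs C (cod C b) (cod C b')"
    using e unfolding ses_emap[OF ab ab'] by auto
  have "emap (opc C) 0 \<kappa> g [b', a'] [b, a]"
    using emap_rev[OF sesI[OF ab] sesI[OF ab'] e] by simp
  then have "ext_push (opc C) \<kappa> (conn_co (opc C) k N b' a' (revs x)) = conn_co (opc C) k N b a (ext_push (opc C) g (revs x))"
    using O.co_nat[of b' a' b a "revs x" k N \<kappa> g] ab ab' revs_closed[OF x] o by simp
  then have "revs (conn_contra C k a b N (ext_pull C g x)) = revs (ext_pull C \<kappa> (conn_contra C k a' b' N x))"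
    using cc_opc[OF x refl o ab'] cc_opc[OF pull_closed[OF x h(1)] refl o ab] pull_opc[OF x]
      pull_opc[OF cc_closed[OF ab' x o]] by simp
  then show ?thesis by (simp add: revs_inj)
qed

lemma cc_group_hom:
  assumes ab: "short_exact C a b" and o: "N \<in> obj C"
  shows "conn_contra C k a b N \<in> hom (Ext C k (dom C a) N) (Ext C (k + 1) (cod C b) N)"
proof (rule homI)
  show "conn_contra C k a b N x \<in> carrier (Ext C (k + 1) (cod C b) N)" if "x \<in> carrier (Ext C k (dom C a) N)" for x
    by (rule cc_closed[OF ab that o])
  fix x y assume xy: "x \<in> carrier (Ext C k (dom C a) N)" "y \<in> carrier (Ext C k (dom C a) N)"
  have o': "dom C a \<in> obj C" "ds N N \<in> obj C" using short_exactD(5)[OF ab] o by auto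
  obtain w where w: "w \<in> carrier (Ext C k (dom C a) (ds N N))" "ext_push C (pr1 C N N) w = x" "ext_push C (pr2 C N N) w = y"
    "ext_push C (plus C (pr1 C N N) (pr2 C N N)) w = x \<otimes>\<^bsub>Ext C k (dom C a) N\<^esub> y"
    using ext_add_push_pr[OF xy o'(1) o] .
  note p = pr_hom(1,2)[OF o o]
  show "conn_contra C k a b N (x \<otimes>\<^bsub>Ext C k (dom C a) N\<^esub> y) =
    conn_contra C k a b N x \<otimes>\<^bsub>Ext C (k + 1) (cod C b) N\<^esub> conn_contra C k a b N y"
    using cc_push[OF ab w(1) p(1)] cc_push[OF ab w(1) p(2)] cc_push[OF ab w(1) plus_hom[OF p]]
      push_add[OF cc_closed[OF ab w(1) o'(2)] p] w by simp
qed

lemma cc_0: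
  assumes ab: "short_exact C a b" and h: "h \<in> homs C (dom C a) N"
  shows "conn_contra C 0 a b N {[h]} = ext_push C h (ext_class C [a, b])"
proof -
  interpret O: abelian_category "opc C" by (rule opc_abelian)
  have x: "{[h]} \<in> carrier (Ext C 0 (dom C a) N)" using h by (auto simp: Ext_0_carrier)
  have "revs (conn_contra C 0 a b N {[h]}) = revs (ext_push C h (ext_class C [a, b]))"
    using cc_opc[OF x refl homs_obj(2)[OF h] ab] O.co_0[of b a h N] ab h
      push_opc[OF ExtI[OF sesI[OF ab]]] ext_class_rev[of "[a, b]"] by simp
  then show ?thesis by (simp add: revs_inj)
qed

lemma cc_class:
  assumes ab: "short_exact C a b" and G: "yext C (Suc n) (dom C a) N G"
  shows "conn_contra C (int (Suc n)) a b N (ext_class C G) = ext_class C (butlast G @ [a \<cdot> last G, b])"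
    "yext C (Suc (Suc n)) (cod C b) N (butlast G @ [a \<cdot> last G, b])"
proof -
  interpret O: abelian_category "opc C" by (rule opc_abelian)
  have o: "N \<in> obj C" using yextD(10)[OF G] .
  have G': "yext (opc C) (Suc n) N (cod (opc C) a) (rev G)" using G yext_rev by simp
  have ne: "G \<noteq> []" using yextD(1)[OF G] by auto
  let ?L = "butlast G @ [a \<cdot> last G, b]"
  have sp: "splice (opc C) b a (rev G) = rev ?L"
    using ne by (simp add: splice_def hd_rev rev_butlast)
  have "revs (conn_contra C (int (Suc n)) a b N (ext_class C G)) = conn_co (opc C) (int (Suc n)) N b a (revs (ext_class C G))"
    by (rule cc_opc[OF ExtI[OF G] refl o ab])
  also have "revs (ext_class C G) = ext_class (opc C) (rev G)" by (rule ext_class_rev[symmetric])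
  also have "conn_co (opc C) (int (Suc n)) N b a \<dots> = ext_class (opc C) (splice (opc C) b a (rev G))"
    by (rule O.co_class) (use ab G' in auto)
  also have "\<dots> = revs (ext_class C ?L)" unfolding sp by (rule ext_class_rev)
  finally show "conn_contra C (int (Suc n)) a b N (ext_class C G) = ext_class C ?L"
    by (simp add: revs_inj)
  have "yext (opc C) (Suc (Suc n)) N (dom (opc C) b) (rev ?L)"
    unfolding sp[symmetric] by (rule O.splice_yext) (use ab G' in auto)
  then show "yext C (Suc (Suc n)) (cod C b) N ?L" using yext_rev[of "Suc n" N "cod C b" ?L] by simp
qed

lemma co_one: "\<lbrakk>short_exact C a b; M \<in> obj C\<rbrakk> \<Longrightarrow> conn_co C k M a b \<one>\<^bsub>Ext C k M (cod C b)\<^esub> = \<one>\<^bsub>Ext C (k + 1) M (dom C a)\<^esub>"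
  by (rule hom_one[OF co_group_hom]) (auto intro!: comm_group.axioms(2) Ext_group dest: short_exactD(5,6))

lemma cc_one: "\<lbrakk>short_exact C a b; N \<in> obj C\<rbrakk> \<Longrightarrow> conn_contra C k a b N \<one>\<^bsub>Ext C k (dom C a) N\<^esub> = \<one>\<^bsub>Ext C (k + 1) (cod C b) N\<^esub>"
  by (rule hom_one[OF cc_group_hom]) (auto intro!: comm_group.axioms(2) Ext_group dest: short_exactD(5,6))

text \<open>In positive degree both sides are the class of the same list, so no sign enters. In
  degree zero one side uses a pushout and the other a pullback of the given sequences, and a ladder
  between the spliced extensions compares them.\<close>

lemma co_cc:
  assumes ab: "short_exact C a b" and cd: "short_exact C c d" and x: "x \<in> carrier (Ext C k (dom C c) (cod C b))"
  shows "conn_co C (k + 1) (cod C d) a b (conn_contra C k c d (cod C b) x) =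
    conn_contra C (k + 1) c d (dom C a) (conn_co C k (dom C c) a b x)"
proof -
  note s = short_exactD(5-8)[OF ab] note s' = short_exactD(5-8)[OF cd]
  show ?thesis
  proof (cases k rule: int_cases3)
    case 1
    then show ?thesis using co_one[OF ab, of "cod C d" "k + 1"] cc_one[OF cd, of "dom C a" "k + 1"] s s'
      by (simp add: co_neg conn_contra_def[of C k])
  next
    case 2
    then obtain h where h: "h \<in> homs C (dom C c) (cod C b)" "x = {[h]}" using x by (auto simp: Ext_0_carrier)
    obtain F where F: "yext C (Suc 0) (cod C d) (cod C b) F" "emap C 0 h (idn C (cod C d)) [c, d] F"
      "ext_push C h (ext_class C [c, d]) = ext_class C F" using ext_push_ex[OF sesI[OF cd] h(1)] .
    obtain c' d' where cd': "F = [c', d']" using yextD(1)[OF F(1)]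
      by (metis length_0_conv length_Suc_conv)
    have F1: "short_exact C c' d'" "dom C c' = cod C b" "cod C d' = cod C d" using F(1) by (auto simp: cd' yext_0)
    obtain G where G: "yext C (Suc 0) (dom C c) (dom C a) G" "emap C 0 (idn C (dom C a)) h G [a, b]"
      "ext_pull C h (ext_class C [a, b]) = ext_class C G" using ext_pull_ex[OF sesI[OF ab] h(1)] .
    obtain a' b' where ab': "G = [a', b']" using yextD(1)[OF G(1)]
      by (metis length_0_conv length_Suc_conv)
    have G1: "short_exact C a' b'" "dom C a' = dom C a" "cod C b' = dom C c" using G(1) by (auto simp: ab' yext_0)
    have l: "conn_co C 1 (cod C d) a b (ext_class C F) = ext_class C (splice C a b F)"
      using co_class[OF ab F(1)] by simp
    have y: "yext C (Suc 0) (cod C d) (cod C b') [c, d]" using sesI[OF cd] G1 by simp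
    have r: "conn_contra C 1 c d (dom C a) (ext_class C G) = ext_class C (splice C a' b' [c, d])"
      using cc_class(1)[OF cd G(1)] by (simp add: ab' splice_def)
    obtain u where u: "u \<in> homs C (dom C b') (dom C b)" "a \<cdot> idn C (dom C a) = u \<cdot> a'" "b \<cdot> u = h \<cdot> b'"
      using G(2) unfolding ab' ses_emap[OF G1(1) ab] by blast
    have "emap C (Suc 0) (idn C (dom C a)) (idn C (cod C d)) (splice C a' b' [c, d]) (splice C a b F)"
      by (rule emap_splice[OF G1(1) ab y F(1,2) u(1) _ u(2,3)]) (use G1 s in \<open>auto simp: homs_iff\<close>)
    then have "ext_class C (splice C a' b' [c, d]) = ext_class C (splice C a b F)"
      using emap_step[OF splice_yext[OF G1(1) y, unfolded G1(2)] splice_yext[OF ab F(1)]] by simp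
    then show ?thesis unfolding 2 h(2) co_0[OF ab h(1)] cc_0[OF cd h(1)] F(3) G(3) using l r by simp
  next
    case (3 n)
    then obtain G where G: "yext C (Suc n) (dom C c) (cod C b) G" "x = ext_class C G" using ExtE x by metis
    note p = cc_class[OF cd G(1)] note q = co_class[OF ab G(1)] splice_yext[OF ab G(1)]
    obtain g g' G' where Gl: "G = g # g' # G'" using yextD(1)[OF G(1)] by (cases G; cases "tl G") auto
    have "splice C a b (butlast G @ [c \<cdot> last G, d]) = butlast (splice C a b G) @ [c \<cdot> last (splice C a b G), d]"
      by (simp add: Gl splice_def)
    then show ?thesis unfolding 3 G(2) p(1) q(1) Suc1 co_class[OF ab p(2)] cc_class(1)[OF cd q(2)] by simp
  qed
qed

text \<open>The left component of a map of short exact sequences gives a pushout, the right one a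
  pullback, and both are the same class. This is why the stable transition map sends the class of
  \<open>f\<close> to the class of a morphism \<open>g\<close> induced on the next
  cosyzygies.\<close>

lemma cc0_co0:
  assumes ab: "short_exact C a p" and bq: "short_exact C b q" and e: "emap C 0 f g [a, p] [b, q]"
  shows "conn_contra C 0 a p (dom C b) {[f]} = conn_co C 0 (cod C p) b q {[g]}"
proof -
  have h: "f \<in> homs C (dom C a) (dom C b)" "g \<in> homs C (cod C p) (cod C q)"
    using e unfolding ses_emap[OF ab bq] by auto
  show ?thesis unfolding cc_0[OF ab h(1)] co_0[OF bq h(2)] by (rule push_eq_pull[OF sesI[OF ab] sesI[OF bq] e])
qed

end


section \<open>The long exact sequences\<close>

context abelian_category
begin

lemma yext_pairE:
  assumes "yext C (Suc 0) M N E"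
  obtains a b where "E = [a, b]" "short_exact C a b" "dom C a = N" "cod C b = M"
proof -
  obtain a b where "E = [a, b]" using yextD(1)[OF assms] by (metis length_0_conv length_Suc_conv)
  then show ?thesis using that assms by (auto simp: yext_0)
qed

lemma sesE:
  assumes "x \<in> carrier (Ext C 1 M N)"
  obtains a b where "x = ext_class C [a, b]" "short_exact C a b" "dom C a = N" "cod C b = M"
  using ExtE[of x 0 M N] assms yext_pairE by (metis One_nat_def of_nat_1)

lemma ses_in_Ext: "short_exact C a b \<Longrightarrow> ext_class C [a, b] \<in> carrier (Ext C 1 (cod C b) (dom C a))"
  using ExtI[OF sesI] by simp

lemma ses_push:
  assumes "short_exact C a b" "g \<in> homs C (dom C a) N'"
  obtains a' b' where "short_exact C a' b'" "dom C a' = N'" "cod C b' = cod C b"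
    "emap C 0 g (idn C (cod C b)) [a, b] [a', b']" "ext_push C g (ext_class C [a, b]) = ext_class C [a', b']"
  using ext_push_ex[OF sesI[OF assms(1)] assms(2)] yext_pairE by metis

lemma ses_pull:
  assumes "short_exact C a b" "f \<in> homs C M' (cod C b)"
  obtains a' b' where "short_exact C a' b'" "dom C a' = dom C a" "cod C b' = M'"
    "emap C 0 (idn C (dom C a)) f [a', b'] [a, b]" "ext_pull C f (ext_class C [a, b]) = ext_class C [a', b']"
  using ext_pull_ex[OF sesI[OF assms(1)] assms(2)] yext_pairE by metis

text \<open>The split extension has a retraction, and having one is invariant under steps in both
  directions, so it reaches every list in the class of the zero extension.\<close>

lemma split_class:
  assumes ab: "short_exact C a b"
    and "ext_class C [a, b] = \<one>\<^bsub>Ext C 1 (cod C b) (dom C a)\<^esub>"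
  obtains r where "r \<in> homs C (cod C a) (dom C a)" "r \<cdot> a = idn C (dom C a)"
proof -
  let ?M = "cod C b" let ?N = "dom C a"
  have o: "?M \<in> obj C" "?N \<in> obj C" using short_exactD(5,6)[OF ab] by auto
  define P where "P E \<longleftrightarrow> (\<exists>a b r. E = [a, b] \<and> short_exact C a b \<and> dom C a = ?N \<and> cod C b = ?M \<and>
    r \<in> homs C (cod C a) ?N \<and> r \<cdot> a = idn C ?N)" for E
  have Z: "zero_ext C (Suc 0) ?M ?N = [in1 C ?N ?M, pr2 C ?N ?M]" by (simp add: zero_ext_def)
  have "equivclp (yext_step C) (zero_ext C (Suc 0) ?M ?N) [a, b]"
    unfolding ext_class_eq_iff[symmetric] using assms(2) Ext_Suc_one[of C 0 ?M ?N] by simp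
  then have "P [a, b]"
  proof (induction rule: equivclp_induct)
    case base
    show ?case unfolding P_def Z using split_short_exact[OF o(2,1)] o
      by (intro exI[of _ "in1 C ?N ?M"] exI[of _ "pr2 C ?N ?M"] exI[of _ "pr1 C ?N ?M"]) (auto simp: homs_iff)
  next
    case (step y z)
    obtain c d r where r: "y = [c, d]" "short_exact C c d" "dom C c = ?N" "cod C d = ?M"
      "r \<in> homs C (cod C c) ?N" "r \<cdot> c = idn C ?N" using step.IH unfolding P_def by blast
    have y: "yext C (Suc 0) ?M ?N y" using sesI[OF r(2)] r by simp
    note s [simp] = short_exactD(5-8)[OF r(2)]
    have r' [simp]: "r \<in> arr C" "dom C r = dom C d" "cod C r = ?N" using r by (auto simp: homs_iff)
    from step.hyps(2) show ?case
    proof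
      assume "yext_step C y z"
      note st = step_emap[OF this disjI1, OF y]
      obtain c' d' where z: "z = [c', d']" "short_exact C c' d'" "dom C c' = ?N" "cod C d' = ?M"
        using yext_pairE[OF st(3)] .
      note s' [simp] = short_exactD(5-8)[OF z(2)]
      obtain u where u: "u \<in> homs C (dom C d) (dom C d')" "d' \<cdot> u = idn C ?M \<cdot> d"
        using st(1) unfolding r(1) z(1) ses_emap[OF r(2) z(2)] by blast
      obtain t where t: "t \<in> homs C (cod C d) (dom C d)" "d \<cdot> t = idn C (cod C d)"
        using retraction_section[OF r(2)] r by metis
      have "d' \<cdot> (u \<cdot> t) = idn C ?M" using u t z r reassoc[OF u(2), of t] by (auto simp: homs_iff)
      moreover have "u \<cdot> t \<in> homs C ?M (dom C d')" using u t r by (auto simp: homs_iff)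
      moreover interpret O: abelian_category "opc C" by (rule opc_abelian)
      have "short_exact (opc C) d' c'" using z by simp
      ultimately obtain r2 where "r2 \<in> homs C (dom C d') ?N" "r2 \<cdot> c' = idn C ?N"
        using O.retraction_section[of d' c' "u \<cdot> t"] z by auto
      then show ?thesis unfolding P_def using z s' by (metis (no_types, lifting))
    next
      assume "yext_step C z y"
      note st = step_emap[OF this disjI2, OF y]
      obtain c' d' where z: "z = [c', d']" "short_exact C c' d'" "dom C c' = ?N" "cod C d' = ?M"
        using yext_pairE[OF st(2)] .
      note s' [simp] = short_exactD(5-8)[OF z(2)]
      obtain u where u: "u \<in> homs C (dom C d') (dom C d)" "c \<cdot> idn C ?N = u \<cdot> c'"
        using st(1) unfolding r(1) z(1) ses_emap[OF z(2) r(2)] by blast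
      have "(r \<cdot> u) \<cdot> c' = idn C ?N" "r \<cdot> u \<in> homs C (cod C c') ?N"
        using u r z by (auto simp: homs_iff)
      then show ?thesis unfolding P_def using z by blast
    qed
  qed
  then show ?thesis using that unfolding P_def by auto
qed

text \<open>The map out of the biproduct given by \<open>a\<close> on the first summand and the
  identity on the second is the middle rung of a ladder from the split extension to
  \<open>[a, b]\<close> over \<open>b\<close>.\<close>

lemma pull_self:
  assumes ab: "short_exact C a b"
  shows "ext_pull C b (ext_class C [a, b]) = \<one>\<^bsub>Ext C 1 (dom C b) (dom C a)\<^esub>"
proof -
  note s [simp] = short_exactD(5-8)[OF ab]
  let ?A = "dom C a" let ?B = "dom C b"
  have sp: "short_exact C (in1 C ?A ?B) (pr2 C ?A ?B)" by (rule split_short_exact) auto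
  have "emap C 0 (idn C ?A) b [in1 C ?A ?B, pr2 C ?A ?B] [a, b]"
    unfolding ses_emap[OF sp ab]
    by (intro conjI bexI[of _ "plus C (a \<cdot> pr1 C ?A ?B) (pr2 C ?A ?B)"]) (auto simp: homs_iff distl distr reassoc[OF s(4)])
  then have "ext_pull C b (ext_class C [a, b]) = ext_class C [in1 C ?A ?B, pr2 C ?A ?B]"
    using ext_pull_class[OF sesI[OF ab], of b ?B] sesI[OF sp] by (simp add: homs_iff)
  then show ?thesis using Ext_Suc_one[of C 0 ?B ?A] by (simp add: zero_ext_def)
qed

lemma push_diff:
  assumes z: "z \<in> carrier (Ext C k M A)" and o: "M \<in> obj C" and f: "f \<in> homs C A N" "g \<in> homs C A N"
    and e: "ext_push C f z = ext_push C g z"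
  shows "ext_push C (plus C f (neg g)) z = \<one>\<^bsub>Ext C k M N\<^esub>"
proof -
  have n: "neg g \<in> homs C A N" using f by (auto simp: homs_iff)
  have "ext_push C (plus C f (neg g)) z = ext_push C (plus C g (neg g)) z"
    using push_add[OF z f(1) n] push_add[OF z f(2) n] e by simp
  also have "plus C g (neg g) = zer C A N" using f by (auto simp: homs_iff)
  finally show ?thesis using push_zero[OF z o] homs_obj[OF f(1)] by simp
qed

text \<open>Induction along the zigzag between the two sequences, each step being a ladder to which
  \<open>co_nat\<close> applies; products may then be computed with any representative.\<close>

lemma co_class_cong:
  assumes ab: "short_exact C a b" and ab': "short_exact C a' b'" and d: "dom C a = dom C a'" "cod C b = cod C b'"
    and e: "ext_class C [a, b] = ext_class C [a', b']" and x: "x \<in> carrier (Ext C k M (cod C b))" and o: "M \<in> obj C"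
  shows "conn_co C k M a b x = conn_co C k M a' b' x"
proof -
  let ?D = "cod C b" let ?A = "dom C a"
  have nat: "conn_co C k M c d x = conn_co C k M c' d' x"
    if "short_exact C c d" "short_exact C c' d'" "emap C 0 (idn C ?A) (idn C ?D) [c, d] [c', d']"
      "dom C c = ?A" "cod C d = ?D" "dom C c' = ?A" for c d c' d'
    using co_nat[OF that(1,2) _ o that(3), of x k] push_id[OF x] push_id[of "conn_co C k M c d x"]
      co_closed[OF that(1) _ o, of x k] x that by simp
  have "equivclp (yext_step C) [a, b] [a', b']" using e by (simp add: ext_class_eq_iff)
  then have "\<forall>c d. [a', b'] = [c, d] \<longrightarrow> conn_co C k M c d x = conn_co C k M a b x"
  proof (induction rule: equivclp_induct)
    case (step y z)
    have y: "yext C (Suc 0) ?D ?A y" by (rule class_yext[OF step.hyps(1) sesI[OF ab]])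
    obtain c d where c: "y = [c, d]" "short_exact C c d" "dom C c = ?A" "cod C d = ?D" using yext_pairE[OF y] .
    from step.hyps(2) show ?case
    proof
      assume "yext_step C y z"
      note st = step_emap[OF this disjI1, OF y]
      obtain c' d' where z: "z = [c', d']" "short_exact C c' d'" "dom C c' = ?A" "cod C d' = ?D"
        using yext_pairE[OF st(3)] .
      show ?thesis using nat[OF c(2) z(2) _ c(3,4) z(3)] st(1) step.IH z c by simp
    next
      assume "yext_step C z y"
      note st = step_emap[OF this disjI2, OF y]
      obtain c' d' where z: "z = [c', d']" "short_exact C c' d'" "dom C c' = ?A" "cod C d' = ?D"
        using yext_pairE[OF st(2)] .
      show ?thesis using nat[OF z(2) c(2) _ z(3,4) c(3)] st(1) step.IH z c by simp
    qed
  qed simp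
  then show ?thesis by simp
qed

lemma co_push_class:
  assumes ab: "short_exact C a b" and ab': "short_exact C a' b'" and g: "g \<in> homs C (dom C a) (dom C a')"
    and d: "cod C b = cod C b'" and e: "ext_push C g (ext_class C [a, b]) = ext_class C [a', b']"
    and x: "x \<in> carrier (Ext C k M (cod C b))" and o: "M \<in> obj C"
  shows "ext_push C g (conn_co C k M a b x) = conn_co C k M a' b' x"
proof -
  obtain a2 b2 where 2: "short_exact C a2 b2" "dom C a2 = dom C a'" "cod C b2 = cod C b"
    "emap C 0 g (idn C (cod C b)) [a, b] [a2, b2]" "ext_push C g (ext_class C [a, b]) = ext_class C [a2, b2]"
    using ses_push[OF ab g] .
  have "ext_push C g (conn_co C k M a b x) = conn_co C k M a2 b2 x"
    using co_nat[OF ab 2(1) x o 2(4)] push_id[OF x] by simp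
  also have "\<dots> = conn_co C k M a' b' x"
    by (rule co_class_cong[OF 2(1) ab']) (use 2 d e x o in auto)
  finally show ?thesis .
qed

lemma co_pull_class:
  assumes ab: "short_exact C a b" and ab': "short_exact C a' b'" and f: "f \<in> homs C (cod C b) (cod C b')"
    and d: "dom C a = dom C a'" and e: "ext_pull C f (ext_class C [a', b']) = ext_class C [a, b]"
    and x: "x \<in> carrier (Ext C k M (cod C b))" and o: "M \<in> obj C"
  shows "conn_co C k M a' b' (ext_push C f x) = conn_co C k M a b x"
proof -
  obtain a2 b2 where 2: "short_exact C a2 b2" "dom C a2 = dom C a'" "cod C b2 = cod C b"
    "emap C 0 (idn C (dom C a')) f [a2, b2] [a', b']" "ext_pull C f (ext_class C [a', b']) = ext_class C [a2, b2]"
    using ses_pull[OF ab' f] .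
  have x2: "x \<in> carrier (Ext C k M (cod C b2))" using x 2 by simp
  have "conn_co C k M a' b' (ext_push C f x) = conn_co C k M a2 b2 x"
    using co_nat[OF 2(1) ab' x2 o 2(4)] push_id[OF co_closed[OF 2(1) x2 o]] 2 by simp
  also have "\<dots> = conn_co C k M a b x"
    by (rule co_class_cong[OF 2(1) ab]) (use 2 d e x o in auto)
  finally show ?thesis .
qed

text \<open>If the pushout of \<open>[i, c]\<close> along \<open>a\<close> splits, then
  \<open>a\<close> extends over \<open>i\<close> to a map \<open>?t\<close>; the map
  \<open>h\<close> it induces on quotients exhibits \<open>[i, c]\<close> as the pullback of
  \<open>[a, b]\<close>.\<close>

lemma les_first:
  assumes ab: "short_exact C a b" and x: "x \<in> carrier (Ext C 1 X (dom C a))"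
    and z: "ext_push C a x = \<one>\<^bsub>Ext C 1 X (cod C a)\<^esub>"
  shows "\<exists>h\<in>homs C X (cod C b). x = ext_pull C h (ext_class C [a, b])"
proof -
  note s [simp] = short_exactD(5-8)[OF ab]
  obtain i c where ic: "x = ext_class C [i, c]" "short_exact C i c" "dom C i = dom C a" "cod C c = X"
    using sesE[OF x] .
  note s' [simp] = short_exactD(5-8)[OF ic(2)]
  have ah: "a \<in> homs C (dom C i) (cod C a)" using ic by (auto simp: homs_iff)
  obtain i' c' where ic': "short_exact C i' c'" "dom C i' = cod C a" "cod C c' = cod C c"
    "emap C 0 a (idn C (cod C c)) [i, c] [i', c']" "ext_push C a (ext_class C [i, c]) = ext_class C [i', c']"
    using ses_push[OF ic(2) ah] .
  obtain r where r: "r \<in> homs C (cod C i') (dom C i')" "r \<cdot> i' = idn C (dom C i')"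
    using split_class[OF ic'(1)] z ic ic' by metis
  obtain u where u: "u \<in> homs C (dom C c) (dom C c')" "i' \<cdot> a = u \<cdot> i"
    using ic'(4) unfolding ses_emap[OF ic(2) ic'(1)] by blast
  note s2 [simp] = short_exactD(5-8)[OF ic'(1)]
  have u' [simp]: "u \<in> arr C" "dom C u = dom C c" "cod C u = dom C c'" using u by (auto simp: homs_iff)
  have r' [simp]: "r \<in> arr C" "dom C r = dom C c'" "cod C r = dom C b" using r ic' by (auto simp: homs_iff)
  let ?t = "r \<cdot> u"
  have ti: "?t \<cdot> i = a" using u(2)[symmetric] reassoc[OF r(2), of a] ic' by simp
  have "(b \<cdot> ?t) \<cdot> i = zer C (dom C i) (cod C (b \<cdot> ?t))" using ti ic by simp
  then obtain h where h: "h \<in> arr C" "dom C h = cod C c" "cod C h = cod C b" "h \<cdot> c = b \<cdot> ?t"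
    using cokernel_ex[OF short_exactD(2)[OF ic(2)], of "b \<cdot> ?t"] by auto
  have "emap C 0 (idn C (dom C a)) h [i, c] [a, b]" unfolding ses_emap[OF ic(2) ab]
    using ic h ti by (intro conjI bexI[of _ ?t]) (auto simp: homs_iff)
  then have "ext_pull C h (ext_class C [a, b]) = x"
    using ext_pull_class[OF sesI[OF ab], of h X "[i, c]"] sesI[OF ic(2)] h ic by (auto simp: homs_iff)
  then show ?thesis using h ic by (auto simp: homs_iff)
qed

text \<open>The pullback of the sequence along \<open>h\<close> splits, and its section followed by
  the map to the middle of \<open>[a, b]\<close> lifts \<open>h\<close>.\<close>

lemma les_hom:
  assumes ab: "short_exact C a b" and h: "h \<in> homs C X (cod C b)"
    and z: "ext_pull C h (ext_class C [a, b]) = \<one>\<^bsub>Ext C 1 X (dom C a)\<^esub>"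
  shows "\<exists>g\<in>homs C X (dom C b). b \<cdot> g = h"
proof -
  obtain a' b' where ab': "short_exact C a' b'" "dom C a' = dom C a" "cod C b' = X"
    "emap C 0 (idn C (dom C a)) h [a', b'] [a, b]" "ext_pull C h (ext_class C [a, b]) = ext_class C [a', b']"
    using ses_pull[OF ab h] .
  obtain r where r: "r \<in> homs C (cod C a') (dom C a')" "r \<cdot> a' = idn C (dom C a')"
    using split_class[OF ab'(1)] z ab' by metis
  obtain t where t: "t \<in> homs C (cod C b') (dom C b')" "b' \<cdot> t = idn C (cod C b')"
    using retraction_section[OF ab'(1) r] .
  obtain u where u: "u \<in> homs C (dom C b') (dom C b)" "b \<cdot> u = h \<cdot> b'"
    using ab'(4) unfolding ses_emap[OF ab'(1) ab] by blast
  note s [simp] = short_exactD(5-8)[OF ab] note s' [simp] = short_exactD(5-8)[OF ab'(1)]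
  have "b \<cdot> (u \<cdot> t) = h" using reassoc[OF u(2), of t] t u h ab' by (auto simp: homs_iff)
  then show ?thesis using t u ab' by (intro bexI[of _ "u \<cdot> t"]) (auto simp: homs_iff)
qed

text \<open>Splitting of the pushout along \<open>b\<close> extends \<open>b\<close> over
  \<open>i\<close>; the kernel of this extended map, described by
  \<open>kernel_of_extension\<close>, provides the preimage.\<close>

lemma les_middle_first:
  assumes ab: "short_exact C a b" and x: "x \<in> carrier (Ext C 1 X (dom C b))"
    and z: "ext_push C b x = \<one>\<^bsub>Ext C 1 X (cod C b)\<^esub>"
  shows "\<exists>y\<in>carrier (Ext C 1 X (dom C a)). ext_push C a y = x"
proof -
  note s [simp] = short_exactD(5-8)[OF ab]
  obtain i c where ic: "x = ext_class C [i, c]" "short_exact C i c" "dom C i = dom C b" "cod C c = X"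
    using sesE[OF x] .
  note s' [simp] = short_exactD(5-8)[OF ic(2)]
  have bh: "b \<in> homs C (dom C i) (cod C b)" using ic by (auto simp: homs_iff)
  obtain i' c' where ic': "short_exact C i' c'" "dom C i' = cod C b" "cod C c' = cod C c"
    "emap C 0 b (idn C (cod C c)) [i, c] [i', c']" "ext_push C b (ext_class C [i, c]) = ext_class C [i', c']"
    using ses_push[OF ic(2) bh] .
  obtain r where r: "r \<in> homs C (cod C i') (dom C i')" "r \<cdot> i' = idn C (dom C i')"
    using split_class[OF ic'(1)] z ic ic' by metis
  obtain u where u: "u \<in> homs C (dom C c) (dom C c')" "i' \<cdot> b = u \<cdot> i"
    using ic'(4) unfolding ses_emap[OF ic(2) ic'(1)] by blast
  note s2 [simp] = short_exactD(5-8)[OF ic'(1)]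
  have u' [simp]: "u \<in> arr C" "dom C u = dom C c" "cod C u = dom C c'" using u by (auto simp: homs_iff)
  have r' [simp]: "r \<in> arr C" "dom C r = dom C c'" "cod C r = cod C b" using r ic' by (auto simp: homs_iff)
  have ti: "(r \<cdot> u) \<cdot> i = b" using u(2)[symmetric] reassoc[OF r(2), of b] ic' by simp
  obtain l a' where l: "l \<in> arr C" "cod C l = cod C i" "short_exact C a' (c \<cdot> l)" "l \<cdot> a' = i \<cdot> a" "dom C a' = dom C a"
    using kernel_of_extension[OF ab ic(2) _ _ ti] ic by (auto simp: homs_iff)
  have c: "cod C (c \<cdot> l) = X" "dom C (c \<cdot> l) = dom C l" using l ic by auto
  have "emap C 0 a (idn C X) [a', c \<cdot> l] [i, c]" unfolding ses_emap[OF l(3) ic(2)]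
    using l ic c short_exactD(5-8)[OF l(3)] by (intro conjI bexI[of _ l]) (auto simp: homs_iff dest: yextD)
  moreover have "a \<in> homs C (dom C a) (dom C b)" by (auto simp: homs_iff)
  ultimately have "ext_push C a (ext_class C [a', c \<cdot> l]) = x"
    using ext_push_class[of 0 X "dom C a" "[a', c \<cdot> l]" a "dom C b" "[i, c]"] sesI[OF l(3)] sesI[OF ic(2)] l ic c by simp
  moreover have "ext_class C [a', c \<cdot> l] \<in> carrier (Ext C 1 X (dom C a))"
    using ses_in_Ext[OF l(3)] l c by simp
  ultimately show ?thesis by blast
qed

section \<open>The covariant long exact sequence in all degrees, and its dual\<close>

definition les_co :: "nat \<Rightarrow> bool" where
  "les_co n \<longleftrightarrow> (\<forall>a b X x. short_exact C a b \<and> X \<in> obj C \<and> x \<in> carrier (Ext C (int n) X (cod C b)) \<and>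
    conn_co C (int n) X a b x = \<one>\<^bsub>Ext C (int (Suc n)) X (dom C a)\<^esub> \<longrightarrow>
    (\<exists>y\<in>carrier (Ext C (int n) X (dom C b)). ext_push C b y = x))"

text \<open>Proved together with \<open>les_co\<close> by an alternating induction:
  \<open>les_middle (Suc n)\<close> yields \<open>les_co (Suc n)\<close>, which yields
  \<open>les_middle (Suc (Suc n))\<close>.\<close>

definition les_middle :: "nat \<Rightarrow> bool" where
  "les_middle n \<longleftrightarrow> (\<forall>a b X x. short_exact C a b \<and> X \<in> obj C \<and> x \<in> carrier (Ext C (int n) X (dom C b)) \<and>
    ext_push C b x = \<one>\<^bsub>Ext C (int n) X (cod C b)\<^esub> \<longrightarrow>
    (\<exists>y\<in>carrier (Ext C (int n) X (dom C a)). ext_push C a y = x))"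

lemma les_co_zero: "les_co 0"
  unfolding les_co_def
proof (intro allI impI)
  fix a b X x
  assume *: "short_exact C a b \<and> X \<in> obj C \<and> x \<in> carrier (Ext C (int 0) X (cod C b)) \<and>
    conn_co C (int 0) X a b x = \<one>\<^bsub>Ext C (int (Suc 0)) X (dom C a)\<^esub>"
  then obtain h where h: "h \<in> homs C X (cod C b)" "x = {[h]}" by (auto simp: Ext_0_carrier)
  then have "ext_pull C h (ext_class C [a, b]) = \<one>\<^bsub>Ext C 1 X (dom C a)\<^esub>" using co_0[OF conjunct1[OF *] h(1)] * h(2) by simp
  from les_hom[OF conjunct1[OF *] h(1) this] obtain g where g: "g \<in> homs C X (dom C b)" "b \<cdot> g = h" by blast
  then show "\<exists>y\<in>carrier (Ext C (int 0) X (dom C b)). ext_push C b y = x"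
    using h by (intro bexI[of _ "{[g]}"]) (auto simp: Ext_0_carrier push_single)
qed

text \<open>The squares along which a Mayer-Vietoris argument applies are the maps of short exact
  sequences that are the identity on the left.\<close>

lemma les_mayer_vietoris:
  assumes m: "les_middle n" and ab: "short_exact C a b" and ab': "short_exact C a' b'"
    and u: "u \<in> homs C (dom C b) (dom C b')" "k \<in> homs C (cod C b) (cod C b')" "u \<cdot> a = a'" "b' \<cdot> u = k \<cdot> b"
    and o: "X \<in> obj C" and x: "x \<in> carrier (Ext C (int n) X (cod C b))" and y: "y \<in> carrier (Ext C (int n) X (dom C b'))"
    and e: "ext_push C k x = ext_push C b' y"
  shows "\<exists>z\<in>carrier (Ext C (int n) X (dom C b)). ext_push C b z = x"
proof -
  note s [simp] = short_exactD(5-8)[OF ab] note s' [simp] = short_exactD(5-8)[OF ab']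
  have u' [simp]: "u \<in> arr C" "dom C u = dom C b" "cod C u = dom C b'" "k \<in> arr C" "dom C k = cod C b"
    "cod C k = cod C b'" using u by (auto simp: homs_iff)
  let ?B = "dom C b'" let ?D = "cod C b"
  have oo: "?B \<in> obj C" "?D \<in> obj C" by auto
  let ?i = "plus C (in1 C ?B ?D \<cdot> u) (in2 C ?B ?D \<cdot> b)"
  let ?t = "plus C (b' \<cdot> pr1 C ?B ?D) (neg (k \<cdot> pr2 C ?B ?D))"
  have ses: "short_exact C ?i ?t" by (rule mayer_vietoris_short_exact[OF ab ab' u])
  obtain w where w: "w \<in> carrier (Ext C (int n) X (ds ?B ?D))" "ext_push C (pr1 C ?B ?D) w = y" "ext_push C (pr2 C ?B ?D) w = x"
    using pair_ex[OF y x o oo] .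
  note p = pr_hom[OF oo]
  have h: "b' \<in> homs C ?B (cod C b')" "k \<in> homs C ?D (cod C b')" by (auto simp: homs_iff)
  have "ext_push C ?t w = \<one>\<^bsub>Ext C (int n) X (cod C b')\<^esub>"
    by (rule push_diff[OF w(1) o cmp_hom[OF p(1) h(1)] cmp_hom[OF p(2) h(2)]])
      (use push_comp[OF w(1) p(1) h(1)] push_comp[OF w(1) p(2) h(2)] w e in simp)
  moreover have d: "cod C ?t = cod C b'" "dom C ?t = ds ?B ?D" "dom C ?i = dom C b" by simp_all
  ultimately obtain z where z: "z \<in> carrier (Ext C (int n) X (dom C b))" "ext_push C ?i z = w"
    using m ses o w(1) unfolding les_middle_def by (metis (no_types, lifting))
  have i: "?i \<in> homs C (dom C b) (ds ?B ?D)" by (auto simp: homs_iff)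
  have "pr2 C ?B ?D \<cdot> ?i = b" by (simp add: distl)
  then have "ext_push C b z = x" using push_comp[OF z(1) i p(2)] z w by simp
  then show ?thesis using z by blast
qed

text \<open>Vanishing of a Yoneda product is read off along the zigzag of morphisms that connects it
  with the zero extension.\<close>

lemma les_co_Suc:
  assumes m: "les_middle (Suc n)" shows "les_co (Suc n)"
  unfolding les_co_def
proof (intro allI impI)
  fix a b X x
  assume *: "short_exact C a b \<and> X \<in> obj C \<and> x \<in> carrier (Ext C (int (Suc n)) X (cod C b)) \<and>
    conn_co C (int (Suc n)) X a b x = \<one>\<^bsub>Ext C (int (Suc (Suc n))) X (dom C a)\<^esub>"
  then have ab: "short_exact C a b" and o: "X \<in> obj C" by auto
  let ?A = "dom C a"
  have oA: "?A \<in> obj C" using short_exactD(5)[OF ab] by simp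
  obtain G where G: "yext C (Suc n) X (cod C b) G" "x = ext_class C G" using * ExtE by metis
  \<comment> \<open>\<open>Q\<close> speaks of every way to write a list as a splice, since the
    induction runs over bare lists and each of them is cut anew.\<close>
  define Q where "Q E \<longleftrightarrow> (\<forall>a b G. E = splice C a b G \<and> short_exact C a b \<and> yext C (Suc n) X (cod C b) G \<longrightarrow>
    (\<exists>y\<in>carrier (Ext C (int (Suc n)) X (dom C b)). ext_push C b y = ext_class C G))" for E
  note Z = zero_ext_yext[OF o oA, of "Suc n"]
  have "ext_class C (zero_ext C (Suc (Suc n)) X ?A) = ext_class C (splice C a b G)"
    using * co_class[OF ab G(1)] G(2) Ext_Suc_one[of C "Suc n" X ?A] by (simp del: of_nat_Suc)
  then have "equivclp (yext_step C) (zero_ext C (Suc (Suc n)) X ?A) (splice C a b G)"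
    by (simp add: ext_class_eq_iff)
  then have "Q (splice C a b G)"
  proof (induction rule: equivclp_induct)
    case base
    show ?case unfolding Q_def
    proof (intro allI impI)
      fix c d H assume H: "zero_ext C (Suc (Suc n)) X ?A = splice C c d H \<and> short_exact C c d \<and> yext C (Suc n) X (cod C d) H"
      then have cd: "short_exact C c d" and yH: "yext C (Suc n) X (cod C d) H" by auto
      note s [simp] = short_exactD(5-8)[OF cd]
      have od: "cod C d \<in> obj C" "dom C d \<in> obj C" by auto
      \<comment> \<open>The zero extension begins with an identity, so the object at which it is cut
        is zero and the remaining class is trivial.\<close>
      have "c = idn C ?A" using H splice_nth(2)[OF yextD(1)[OF yH], of C c d] zero_ext_nth(2)[of n X ?A] by simp
      then have "d = d \<cdot> c" "dom C c = ?A" "dom C d = ?A" using oA s(1,3) by auto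
      then have d0: "d = zer C (dom C d) (cod C d)" using s(4) by simp
      have "idn C (cod C d) = zer C (cod C d) (cod C d)"
        by (rule epiD[OF short_exactD(4)[OF cd]]) (use d0 od zer_cmp[of d "cod C d" "cod C d"] in auto)
      then have 1: "ext_class C H = \<one>\<^bsub>Ext C (int (Suc n)) X (cod C d)\<^esub>"
        using push_id[OF ExtI[OF yH]] push_zero[OF ExtI[OF yH] o od(1,1)] by simp
      have "d \<in> homs C (dom C d) (cod C d)" by (auto simp: homs_iff)
      then show "\<exists>y\<in>carrier (Ext C (int (Suc n)) X (dom C d)). ext_push C d y = ext_class C H"
        using one_closed[OF o od(2), of "int (Suc n)"] push_one[OF o, of d "dom C d" "cod C d" "int (Suc n)"] 1 by auto
    qed
  next
    case (step y z)
    have y: "yext C (Suc (Suc n)) X ?A y" by (rule class_yext[OF step.hyps(1) Z])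
    show ?case unfolding Q_def
    proof (intro allI impI)
      fix c d H assume H: "z = splice C c d H \<and> short_exact C c d \<and> yext C (Suc n) X (cod C d) H"
      then have cd: "short_exact C c d" and yH: "yext C (Suc n) X (cod C d) H" by auto
      obtain c' d' H' where H': "y = splice C c' d' H'" "short_exact C c' d'" "dom C c' = ?A" "yext C (Suc n) X (cod C d') H'"
        using splice_decompose[OF y] .
      note s [simp] = short_exactD(5-8)[OF cd] note s' [simp] = short_exactD(5-8)[OF H'(2)]
      obtain \<eta> where \<eta>: "\<eta> \<in> carrier (Ext C (int (Suc n)) X (dom C d'))" "ext_push C d' \<eta> = ext_class C H'"
        using step.IH H' unfolding Q_def by blast
      have dh: "d \<in> homs C (dom C d) (cod C d)" "d' \<in> homs C (dom C d') (cod C d')" by (auto simp: homs_iff)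
      from step.hyps(2) show "\<exists>y\<in>carrier (Ext C (int (Suc n)) X (dom C d)). ext_push C d y = ext_class C H"
      proof
        assume "yext_step C y z"
        note st = step_emap[OF this disjI1, OF y]
        obtain u k where u: "u \<in> homs C (dom C d') (dom C d)" "k \<in> homs C (cod C d') (cod C d)"
          "d \<cdot> u = k \<cdot> d'" "emap C n k (idn C X) H' H"
          using emap_decompose[OF H'(2) cd H'(4) yH] st(1) H H'(1) by metis
        have "ext_class C H = ext_push C k (ext_class C H')"
          by (rule ext_push_class[OF H'(4) u(2) yH u(4), symmetric])
        also have "\<dots> = ext_push C d (ext_push C u \<eta>)"
          using push_comp[OF \<eta>(1) dh(2) u(2)] push_comp[OF \<eta>(1) u(1) dh(1)] \<eta>(2) u(3) by simp
        finally show ?thesis using push_closed[OF \<eta>(1) u(1)] by auto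
      next
        assume "yext_step C z y"
        note st = step_emap[OF this disjI2, OF y]
        have cA: "dom C c = ?A" using yextD(2)[OF st(2)] H splice_nth(2)[OF yextD(1)[OF yH], of C c d] by simp
        obtain u k where u: "u \<in> homs C (dom C d) (dom C d')" "k \<in> homs C (cod C d) (cod C d')"
          "c' \<cdot> idn C ?A = u \<cdot> c" "d' \<cdot> u = k \<cdot> d" "emap C n k (idn C X) H H'"
          using emap_decompose[OF cd H'(2) yH H'(4)] st(1) H H'(1) by metis
        have uc: "u \<cdot> c = c'" using u(3) H'(3) by simp
        \<comment> \<open>Against the direction of a step only the image of the class under
          \<open>k\<close> is known to lift. The map of sequences given by \<open>u\<close> and
          \<open>k\<close> is the identity on the left, so Mayer-Vietoris lifts the class
          itself.\<close>
        have "ext_push C k (ext_class C H) = ext_push C d' \<eta>"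
          using ext_push_class[OF yH u(2) H'(4) u(5)] \<eta>(2) by simp
        from les_mayer_vietoris[OF m cd H'(2) u(1,2) uc u(4) o ExtI[OF yH] \<eta>(1) this]
        show ?thesis .
      qed
    qed
  qed
  then show "\<exists>y\<in>carrier (Ext C (int (Suc n)) X (dom C b)). ext_push C b y = x"
    unfolding Q_def using ab G by blast
qed

lemma splice_elim:
  assumes x: "x \<in> carrier (Ext C (int (Suc (Suc n))) X B)"
  obtains e f \<xi> where "short_exact C e f" "dom C e = B" "\<xi> \<in> carrier (Ext C (int (Suc n)) X (cod C f))"
    "x = conn_co C (int (Suc n)) X e f \<xi>"
proof -
  obtain E where E: "yext C (Suc (Suc n)) X B E" "x = ext_class C E" using ExtE x by metis
  obtain e f G where G: "E = splice C e f G" "short_exact C e f" "dom C e = B" "yext C (Suc n) X (cod C f) G"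
    using splice_decompose[OF E(1)] .
  show ?thesis using that[OF G(2,3) ExtI[OF G(4)]] co_class[OF G(2,4)] G(1) E(2) by simp
qed

text \<open>If a product of an extension with \<open>\<xi>\<close> dies after pushing out along \<open>g\<close>, then \<open>\<xi>\<close> can be
  replaced by a class over which the pushed out extension splits.\<close>

lemma splice_push_trivial:
  assumes c: "les_co (Suc n)" and o: "X \<in> obj C" and ef: "short_exact C e f"
    and \<xi>: "\<xi> \<in> carrier (Ext C (int (Suc n)) X (cod C f))" and g: "g \<in> homs C (dom C e) N"
    and z: "ext_push C g (conn_co C (int (Suc n)) X e f \<xi>) = \<one>\<^bsub>Ext C (int (Suc (Suc n))) X N\<^esub>"
  obtains e2 f2 \<eta> where "short_exact C e2 f2" "dom C e2 = dom C e"
    "\<eta> \<in> carrier (Ext C (int (Suc n)) X (cod C f2))" "conn_co C (int (Suc n)) X e f \<xi> = conn_co C (int (Suc n)) X e2 f2 \<eta>"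
    "ext_push C g (ext_class C [e2, f2]) = \<one>\<^bsub>Ext C 1 (cod C f2) N\<^esub>"
proof -
  obtain e' f' where e': "short_exact C e' f'" "dom C e' = N" "cod C f' = cod C f"
    "emap C 0 g (idn C (cod C f)) [e, f] [e', f']" "ext_push C g (ext_class C [e, f]) = ext_class C [e', f']"
    using ses_push[OF ef g] .
  note s' [simp] = short_exactD(5-8)[OF e'(1)] note s [simp] = short_exactD(5-8)[OF ef]
  have "conn_co C (int (Suc n)) X e' f' \<xi> = \<one>\<^bsub>Ext C (int (Suc (Suc n))) X (dom C e')\<^esub>"
    using co_nat[OF ef e'(1) \<xi> o e'(4)] push_id[OF \<xi>] z e' by simp
  moreover have "\<xi> \<in> carrier (Ext C (int (Suc n)) X (cod C f'))" using \<xi> e' by simp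
  ultimately obtain \<eta> where \<eta>: "\<eta> \<in> carrier (Ext C (int (Suc n)) X (dom C f'))" "ext_push C f' \<eta> = \<xi>"
    using c e'(1) o unfolding les_co_def by blast
  have fh: "f' \<in> homs C (dom C f') (cod C f)" using e' by (auto simp: homs_iff)
  obtain e2 f2 where 2: "short_exact C e2 f2" "dom C e2 = dom C e" "cod C f2 = dom C f'"
    "ext_pull C f' (ext_class C [e, f]) = ext_class C [e2, f2]"
    using ses_pull[OF ef fh] by metis
  have "conn_co C (int (Suc n)) X e f \<xi> = conn_co C (int (Suc n)) X e2 f2 \<eta>"
    using co_pull_class[OF 2(1) ef _ 2(2,4) _ o, of \<eta> "int (Suc n)"] \<eta> fh 2 by simp
  \<comment> \<open>Pushing out and pulling back commute, and the pushout \<open>[e', f']\<close>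
    becomes split when it is pulled back along its own \<open>f'\<close>.\<close>
  moreover have "ext_push C g (ext_class C [e2, f2]) = \<one>\<^bsub>Ext C 1 (cod C f2) N\<^esub>"
    using push_pull[OF ses_in_Ext[OF ef] fh g] 2 e' pull_self[OF e'(1)] by simp
  ultimately show ?thesis using that 2 \<eta> by simp
qed

text \<open>The class is a product with a short exact sequence \<open>[e, f]\<close>, which
  \<open>splice_push_trivial\<close> replaces by one whose pushout along \<open>b\<close> splits.
  The degree one statement then lifts the new sequence along \<open>a\<close>, and its product with
  the same \<open>\<eta>\<close> lifts the class.\<close>

lemma les_middle_Suc:
  assumes c: "les_co (Suc n)" shows "les_middle (Suc (Suc n))"
  unfolding les_middle_def
proof (intro allI impI)
  fix a b X x
  assume *: "short_exact C a b \<and> X \<in> obj C \<and> x \<in> carrier (Ext C (int (Suc (Suc n))) X (dom C b)) \<and>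
    ext_push C b x = \<one>\<^bsub>Ext C (int (Suc (Suc n))) X (cod C b)\<^esub>"
  then have ab: "short_exact C a b" and o: "X \<in> obj C" by auto
  note s [simp] = short_exactD(5-8)[OF ab]
  obtain e f \<xi> where e: "short_exact C e f" "dom C e = dom C b" "\<xi> \<in> carrier (Ext C (int (Suc n)) X (cod C f))"
    "x = conn_co C (int (Suc n)) X e f \<xi>" using splice_elim * by metis
  have bh: "b \<in> homs C (dom C e) (cod C b)" using e by (auto simp: homs_iff)
  obtain e2 f2 \<eta> where 2: "short_exact C e2 f2" "dom C e2 = dom C e"
    "\<eta> \<in> carrier (Ext C (int (Suc n)) X (cod C f2))" "conn_co C (int (Suc n)) X e f \<xi> = conn_co C (int (Suc n)) X e2 f2 \<eta>"
    "ext_push C b (ext_class C [e2, f2]) = \<one>\<^bsub>Ext C 1 (cod C f2) (cod C b)\<^esub>"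
    using splice_push_trivial[OF c o e(1,3) bh] * e(4) by metis
  have "ext_class C [e2, f2] \<in> carrier (Ext C 1 (cod C f2) (dom C b))" using ses_in_Ext[OF 2(1)] 2 e by simp
  from les_middle_first[OF ab this 2(5)]
  obtain \<epsilon> where \<epsilon>: "\<epsilon> \<in> carrier (Ext C 1 (cod C f2) (dom C a))" "ext_push C a \<epsilon> = ext_class C [e2, f2]" by blast
  obtain e3 f3 where 3: "\<epsilon> = ext_class C [e3, f3]" "short_exact C e3 f3" "dom C e3 = dom C a" "cod C f3 = cod C f2"
    using sesE[OF \<epsilon>(1)] .
  have \<eta>3: "\<eta> \<in> carrier (Ext C (int (Suc n)) X (cod C f3))" using 2 3 by simp
  have ah: "a \<in> homs C (dom C e3) (dom C e2)" using 3 2 e by (auto simp: homs_iff)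
  have "ext_push C a (conn_co C (int (Suc n)) X e3 f3 \<eta>) = x"
    using co_push_class[OF 3(2) 2(1) ah _ _ \<eta>3 o] 2 3 \<epsilon> e by simp
  then show "\<exists>y\<in>carrier (Ext C (int (Suc (Suc n))) X (dom C a)). ext_push C a y = x"
    using co_closed[OF 3(2) \<eta>3 o] 3 unfolding Suc1 by (metis)
qed

lemma les_middle_all: "les_middle (Suc n)"
proof (induction n)
  case 0
  show ?case unfolding les_middle_def using les_middle_first by auto
next
  case (Suc n)
  then show ?case by (intro les_middle_Suc les_co_Suc)
qed

lemma les_co_all: "les_co n"
  by (cases n) (use les_co_zero les_co_Suc les_middle_all in auto)

text \<open>As for \<open>les_middle_Suc\<close>, but the sequence \<open>[e2, f2]\<close> now
  splits after pushing along \<open>a\<close>, so it is a pullback of \<open>[a, b]\<close> along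
  some \<open>h\<close>, and pushing \<open>\<eta>\<close> along \<open>h\<close> gives the
  preimage.\<close>

lemma les_left:
  assumes ab: "short_exact C a b" and o: "X \<in> obj C" and k: "k \<ge> 0"
    and x: "x \<in> carrier (Ext C (k + 1) X (dom C a))" and z: "ext_push C a x = \<one>\<^bsub>Ext C (k + 1) X (cod C a)\<^esub>"
  shows "\<exists>y\<in>carrier (Ext C k X (cod C b)). conn_co C k X a b y = x"
proof (cases k rule: int_cases3)
  case 1 then show ?thesis using k by simp
next
  case 2
  then obtain h where "h \<in> homs C X (cod C b)" "x = ext_pull C h (ext_class C [a, b])"
    using les_first[OF ab, of x X] x z by auto
  then show ?thesis using co_0[OF ab] 2 by (intro bexI[of _ "{[h]}"]) (auto simp: Ext_0_carrier)
next
  case (3 n)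
  note s [simp] = short_exactD(5-8)[OF ab]
  obtain e f \<xi> where e: "short_exact C e f" "dom C e = dom C a" "\<xi> \<in> carrier (Ext C (int (Suc n)) X (cod C f))"
    "x = conn_co C (int (Suc n)) X e f \<xi>" using splice_elim x unfolding 3 Suc1 by metis
  have ah: "a \<in> homs C (dom C e) (cod C a)" using e by (auto simp: homs_iff)
  obtain e2 f2 \<eta> where 2: "short_exact C e2 f2" "dom C e2 = dom C e"
    "\<eta> \<in> carrier (Ext C (int (Suc n)) X (cod C f2))" "conn_co C (int (Suc n)) X e f \<xi> = conn_co C (int (Suc n)) X e2 f2 \<eta>"
    "ext_push C a (ext_class C [e2, f2]) = \<one>\<^bsub>Ext C 1 (cod C f2) (cod C a)\<^esub>"
    using splice_push_trivial[OF les_co_all o e(1,3) ah] z e(4) unfolding 3 Suc1 by metis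
  have "ext_class C [e2, f2] \<in> carrier (Ext C 1 (cod C f2) (dom C a))" using ses_in_Ext[OF 2(1)] 2 e by simp
  from les_first[OF ab this 2(5)] obtain h where h: "h \<in> homs C (cod C f2) (cod C b)"
    "ext_class C [e2, f2] = ext_pull C h (ext_class C [a, b])" by blast
  have "conn_co C (int (Suc n)) X a b (ext_push C h \<eta>) = x"
    using co_pull_class[OF 2(1) ab h(1) _ h(2)[symmetric] 2(3) o] 2 e by simp
  then show ?thesis using push_closed[OF 2(3) h(1)] 3 by blast
qed

lemma les_right:
  assumes ab: "short_exact C a b" and o: "X \<in> obj C" and k: "k \<ge> 0"
    and x: "x \<in> carrier (Ext C k X (cod C b))" and z: "conn_co C k X a b x = \<one>\<^bsub>Ext C (k + 1) X (dom C a)\<^esub>"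
  shows "\<exists>y\<in>carrier (Ext C k X (dom C b)). ext_push C b y = x"
proof -
  obtain n where n: "k = int n" using k zero_le_imp_eq_int by blast
  have "int n + 1 = int (Suc n)" by simp
  then show ?thesis using les_co_all[of n] ab o x z unfolding les_co_def n by metis
qed

text \<open>In the opposite category the sequence reads \<open>[b, a]\<close>, and the contravariant
  statement is the covariant one.\<close>

lemma les_left':
  assumes ab: "short_exact C a b" and o: "N \<in> obj C" and k: "k \<ge> 0"
    and x: "x \<in> carrier (Ext C (k + 1) (cod C b) N)" and z: "ext_pull C b x = \<one>\<^bsub>Ext C (k + 1) (dom C b) N\<^esub>"
  shows "\<exists>y\<in>carrier (Ext C k (dom C a) N). conn_contra C k a b N y = x"
proof -
  interpret O: abelian_category "opc C" by (rule opc_abelian)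
  note s [simp] = short_exactD(5-8)[OF ab]
  have "ext_push (opc C) b (revs x) = \<one>\<^bsub>Ext (opc C) (k + 1) N (dom C b)\<^esub>"
    using pull_opc[OF x, of b] z one_opc[of "dom C b" N "k + 1"] o by simp
  then obtain y where y: "y \<in> carrier (Ext (opc C) k N (dom C a))" "conn_co (opc C) k N b a y = revs x"
    using O.les_left[of b a N k "revs x"] ab o k revs_closed[OF x] by auto
  then have c: "revs y \<in> carrier (Ext C k (dom C a) N)" using revs_closed_iff[of "revs y"] by simp
  have "revs (conn_contra C k a b N (revs y)) = revs x" using cc_opc[OF c refl o ab] y by simp
  then show ?thesis using c by (auto simp: revs_inj)
qed

lemma les_right':
  assumes ab: "short_exact C a b" and o: "N \<in> obj C" and k: "k \<ge> 0"
    and x: "x \<in> carrier (Ext C k (dom C a) N)" and z: "conn_contra C k a b N x = \<one>\<^bsub>Ext C (k + 1) (cod C b) N\<^esub>"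
  shows "\<exists>y\<in>carrier (Ext C k (cod C a) N). ext_pull C a y = x"
proof -
  interpret O: abelian_category "opc C" by (rule opc_abelian)
  note s [simp] = short_exactD(5-8)[OF ab]
  have "conn_co (opc C) k N b a (revs x) = \<one>\<^bsub>Ext (opc C) (k + 1) N (cod C b)\<^esub>"
    using cc_opc[OF x refl o ab] z one_opc[of "cod C b" N "k + 1"] o by simp
  then obtain y where y: "y \<in> carrier (Ext (opc C) k N (cod C a))" "ext_push (opc C) a y = revs x"
    using O.les_right[of b a N k "revs x"] ab o k revs_closed[OF x] by auto
  then have c: "revs y \<in> carrier (Ext C k (cod C a) N)" using revs_closed_iff[of "revs y"] by simp
  have "revs (ext_pull C a (revs y)) = revs x" using pull_opc[OF c] y by simp
  then show ?thesis using c by (auto simp: revs_inj)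
qed

end


section \<open>Direct limits and stable morphisms\<close>

text \<open>The start \<open>i0\<close> is a parameter because the stable system exists only from
  \<open>nat (- n)\<close> on, while that of the satellites starts at 1.\<close>

locale dirsys =
  fixes i0 :: nat and G :: "nat \<Rightarrow> 'a monoid" and t :: "nat \<Rightarrow> 'a \<Rightarrow> 'a"
  assumes closed: "\<lbrakk>i0 \<le> i; x \<in> carrier (G i)\<rbrakk> \<Longrightarrow> t i x \<in> carrier (G (Suc i))"
    and mclosed: "\<lbrakk>i0 \<le> i; x \<in> carrier (G i); y \<in> carrier (G i)\<rbrakk> \<Longrightarrow> x \<otimes>\<^bsub>G i\<^esub> y \<in> carrier (G i)"
    and mult: "\<lbrakk>i0 \<le> i; x \<in> carrier (G i); y \<in> carrier (G i)\<rbrakk>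
      \<Longrightarrow> t i (x \<otimes>\<^bsub>G i\<^esub> y) = t i x \<otimes>\<^bsub>G (Suc i)\<^esub> t i y"
begin

lemma iter_closed: "\<lbrakk>i0 \<le> i; x \<in> carrier (G i)\<rbrakk> \<Longrightarrow> dl_iter t i d x \<in> carrier (G (i + d))"
  by (induction d) (auto intro: closed)

lemma iter_add: "dl_iter t i (d + e) x = dl_iter t (i + d) e (dl_iter t i d x)"
  by (induction e) (auto simp: add.assoc)

lemma iter_mult: "\<lbrakk>i0 \<le> i; x \<in> carrier (G i); y \<in> carrier (G i)\<rbrakk> \<Longrightarrow>
  dl_iter t i d (x \<otimes>\<^bsub>G i\<^esub> y) = dl_iter t i d x \<otimes>\<^bsub>G (i + d)\<^esub> dl_iter t i d y"
  by (induction d) (auto intro: mult simp: iter_closed)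

abbreviation "to k i x \<equiv> dl_iter t i (k - i) x"

lemma to_closed: "\<lbrakk>i0 \<le> i; i \<le> k; x \<in> carrier (G i)\<rbrakk> \<Longrightarrow> to k i x \<in> carrier (G k)"
  using iter_closed[of i x "k - i"] by simp

lemma to_to: "\<lbrakk>i \<le> j; j \<le> k\<rbrakk> \<Longrightarrow> to k j (to j i x) = to k i x"
  using iter_add[of i "j - i" "k - j" x] by simp

lemma to_mult: "\<lbrakk>i0 \<le> i; i \<le> k; x \<in> carrier (G i); y \<in> carrier (G i)\<rbrakk> \<Longrightarrow>
  to k i (x \<otimes>\<^bsub>G i\<^esub> y) = to k i x \<otimes>\<^bsub>G k\<^esub> to k i y"
  using iter_mult[of i x y "k - i"] by simp

abbreviation "cl \<equiv> dl_class i0 G t"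

lemma cl_iff: "(j, y) \<in> cl i x \<longleftrightarrow> i0 \<le> j \<and> y \<in> carrier (G j) \<and> (\<exists>k\<ge>max i j. to k i x = to k j y)"
  by (auto simp: dl_class_def)

lemma cl_self: "\<lbrakk>i0 \<le> i; x \<in> carrier (G i)\<rbrakk> \<Longrightarrow> (i, x) \<in> cl i x"
  by (auto simp: cl_iff)

lemma cl_mono: "\<lbrakk>i \<le> k; j \<le> k; to k i x = to k j y; k \<le> l\<rbrakk> \<Longrightarrow> to l i x = to l j y"
  using to_to[of i k l x] to_to[of j k l y] by simp

lemma cl_eqI:
  assumes "i \<le> k" "j \<le> k" "to k i x = to k j y"
  shows "cl i x = cl j y"
proof -
  have "(l, z) \<in> cl j' y'" if lz: "(l, z) \<in> cl i' x'" and "i' \<le> k" "j' \<le> k" "to k i' x' = to k j' y'" for l z i' x' j' y'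
  proof -
    obtain m where m: "m \<ge> max i' l" "to m i' x' = to m l z" using lz by (auto simp: cl_iff)
    have "to (max k m) j' y' = to (max k m) l z"
      using cl_mono[of i' k j' x' y' "max k m"] cl_mono[of i' m l x' z "max k m"] that m by simp
    then show ?thesis using that(1,3) m(1) by (auto simp: cl_iff intro!: exI[of _ "max k m"])
  qed
  from this[OF _ assms] this[OF _ assms(2,1) assms(3)[symmetric]] show ?thesis by auto
qed

lemma cl_eq_iff:
  assumes "i0 \<le> j" "y \<in> carrier (G j)"
  shows "cl i x = cl j y \<longleftrightarrow> (\<exists>k\<ge>max i j. to k i x = to k j y)"
proof
  assume "cl i x = cl j y"
  then have "(j, y) \<in> cl i x" using cl_self[OF assms] by simp
  then show "\<exists>k\<ge>max i j. to k i x = to k j y" by (simp add: cl_iff)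
next
  assume "\<exists>k\<ge>max i j. to k i x = to k j y"
  then obtain k where "max i j \<le> k" "to k i x = to k j y" by blast
  then show "cl i x = cl j y" using cl_eqI[of i k j x y] by simp
qed

lemma cl_to: "i \<le> k \<Longrightarrow> cl k (to k i x) = cl i x"
  by (rule cl_eqI[of k k i]) auto

lemma cl_Suc: "cl (Suc i) (t i x) = cl i x"
  using cl_to[of i "Suc i" x] by (simp add: Suc_diff_le)

lemma colim_carrier: "c \<in> carrier (dir_colim i0 G t) \<longleftrightarrow> (\<exists>i x. i0 \<le> i \<and> x \<in> carrier (G i) \<and> c = cl i x)"
  by (auto simp: dir_colim_def)

lemma cl_in_colim: "\<lbrakk>i0 \<le> i; x \<in> carrier (G i)\<rbrakk> \<Longrightarrow> cl i x \<in> carrier (dir_colim i0 G t)"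
  by (auto simp: colim_carrier)

text \<open>The product in \<open>dir_colim\<close> is a union over all pairs of representatives;
  additivity of the transition maps makes every member of the union the same class.\<close>

lemma colim_mult:
  assumes i: "i0 \<le> i" and x: "x \<in> carrier (G i)" and y: "y \<in> carrier (G i)"
  shows "cl i x \<otimes>\<^bsub>dir_colim i0 G t\<^esub> cl i y = cl i (x \<otimes>\<^bsub>G i\<^esub> y)"
proof -
  have *: "cl (max j l) (to (max j l) j z \<otimes>\<^bsub>G (max j l)\<^esub> to (max j l) l w) = cl i (x \<otimes>\<^bsub>G i\<^esub> y)"
    if jz: "(j, z) \<in> cl i x" and lw: "(l, w) \<in> cl i y" for j z l w
  proof -
    obtain a where a: "a \<ge> max i j" "to a i x = to a j z" using jz by (auto simp: cl_iff)
    obtain b where b: "b \<ge> max i l" "to b i y = to b l w" using lw by (auto simp: cl_iff)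
    have c: "i0 \<le> j" "z \<in> carrier (G j)" "i0 \<le> l" "w \<in> carrier (G l)" using that by (auto simp: cl_iff)
    let ?m = "max j l" let ?k = "max a b"
    have k: "?m \<le> ?k" "i \<le> ?k" "j \<le> ?k" "l \<le> ?k" "i0 \<le> ?m" using a b c by auto
    have cz: "to ?m j z \<in> carrier (G ?m)" and cw: "to ?m l w \<in> carrier (G ?m)"
      using c by (auto intro!: to_closed)
    have "to ?k ?m (to ?m j z \<otimes>\<^bsub>G ?m\<^esub> to ?m l w) = to ?k j z \<otimes>\<^bsub>G ?k\<^esub> to ?k l w"
      using to_mult[OF k(5,1) cz cw] to_to[of j ?m ?k z] to_to[of l ?m ?k w] k by simp
    also have "\<dots> = to ?k i x \<otimes>\<^bsub>G ?k\<^esub> to ?k i y"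
      using cl_mono[of i a j x z ?k] cl_mono[of i b l y w ?k] a b by simp
    also have "\<dots> = to ?k i (x \<otimes>\<^bsub>G i\<^esub> y)" using to_mult[OF i k(2) x y] by simp
    finally show ?thesis using k by (intro cl_eqI[of _ ?k]) auto
  qed
  have "cl i x \<otimes>\<^bsub>dir_colim i0 G t\<^esub> cl i y = \<Union>{cl (max j l) (to (max j l) j z \<otimes>\<^bsub>G (max j l)\<^esub> to (max j l) l w)
      | j z l w. (j, z) \<in> cl i x \<and> (l, w) \<in> cl i y}"
    by (simp add: dir_colim_def)
  also have "\<dots> = cl i (x \<otimes>\<^bsub>G i\<^esub> y)"
  proof (intro equalityI subsetI)
    fix u assume "u \<in> \<Union>{cl (max j l) (to (max j l) j z \<otimes>\<^bsub>G (max j l)\<^esub> to (max j l) l w)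
      | j z l w. (j, z) \<in> cl i x \<and> (l, w) \<in> cl i y}"
    then obtain j z l w where "(j, z) \<in> cl i x" "(l, w) \<in> cl i y"
      "u \<in> cl (max j l) (to (max j l) j z \<otimes>\<^bsub>G (max j l)\<^esub> to (max j l) l w)" by blast
    then show "u \<in> cl i (x \<otimes>\<^bsub>G i\<^esub> y)" using * by simp
  next
    fix u assume "u \<in> cl i (x \<otimes>\<^bsub>G i\<^esub> y)"
    then have "u \<in> cl (max i i) (to (max i i) i x \<otimes>\<^bsub>G (max i i)\<^esub> to (max i i) i y)" by simp
    then show "u \<in> \<Union>{cl (max j l) (to (max j l) j z \<otimes>\<^bsub>G (max j l)\<^esub> to (max j l) l w)
      | j z l w. (j, z) \<in> cl i x \<and> (l, w) \<in> cl i y}"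
      using cl_self[OF i x] cl_self[OF i y] by blast
  qed
  finally show ?thesis .
qed

lemma colim_common:
  assumes "c \<in> carrier (dir_colim i0 G t)" "d \<in> carrier (dir_colim i0 G t)"
  obtains i x y where "i0 \<le> i" "m \<le> i" "x \<in> carrier (G i)" "y \<in> carrier (G i)" "c = cl i x" "d = cl i y"
proof -
  obtain i x j y where *: "i0 \<le> i" "x \<in> carrier (G i)" "c = cl i x" "i0 \<le> j" "y \<in> carrier (G j)" "d = cl j y"
    using assms by (auto simp: colim_carrier)
  let ?k = "max m (max i j)"
  show ?thesis
    by (rule that[of ?k "to ?k i x" "to ?k j y"]) (use * cl_to in \<open>auto intro!: to_closed\<close>)
qed

end

text \<open>The offset \<open>e\<close> allows maps that raise the index: the comparison map has
  offset 1, the actions of morphisms on the colimits have offset 0.\<close>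

locale dirsys_map = G: dirsys i0 G t + H: dirsys j0 H s
  for i0 :: nat and G :: "nat \<Rightarrow> 'a monoid" and t and j0 :: nat and H :: "nat \<Rightarrow> 'b monoid" and s +
  fixes e :: nat and h :: "nat \<Rightarrow> 'a \<Rightarrow> 'b"
  assumes h_closed: "\<lbrakk>i0 \<le> i; x \<in> carrier (G i)\<rbrakk> \<Longrightarrow> h i x \<in> carrier (H (i + e))"
    and h_compat: "\<lbrakk>i0 \<le> i; x \<in> carrier (G i)\<rbrakk> \<Longrightarrow> s (i + e) (h i x) = h (Suc i) (t i x)"
    and le: "j0 \<le> i0 + e"
begin

lemma h_iter: "\<lbrakk>i0 \<le> i; x \<in> carrier (G i)\<rbrakk> \<Longrightarrow> dl_iter s (i + e) d (h i x) = h (i + d) (dl_iter t i d x)"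
proof (induction d)
  case (Suc d)
  have "s (i + e + d) (h (i + d) (dl_iter t i d x)) = h (Suc (i + d)) (t (i + d) (dl_iter t i d x))"
    using h_compat[of "i + d" "dl_iter t i d x"] G.iter_closed[OF Suc.prems, of d] Suc.prems by (simp add: ac_simps)
  then show ?case using Suc by simp
qed simp

lemma h_cl: "\<lbrakk>i0 \<le> i; x \<in> carrier (G i); (j, y) \<in> G.cl i x\<rbrakk> \<Longrightarrow> H.cl (j + e) (h j y) = H.cl (i + e) (h i x)"
proof -
  assume i: "i0 \<le> i" "x \<in> carrier (G i)" and "(j, y) \<in> G.cl i x"
  then obtain k where k: "k \<ge> max i j" "G.to k i x = G.to k j y" "i0 \<le> j" "y \<in> carrier (G j)" by (auto simp: G.cl_iff)
  have "dl_iter s (i + e) (k - i) (h i x) = h k (G.to k i x)" using h_iter[OF i, of "k - i"] k by simp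
  moreover have "dl_iter s (j + e) (k - j) (h j y) = h k (G.to k j y)" using h_iter[OF k(3,4), of "k - j"] k by simp
  ultimately show ?thesis using k by (intro H.cl_eqI[of _ "k + e"]) auto
qed

definition map_cl :: "(nat \<times> 'a) set \<Rightarrow> (nat \<times> 'b) set" where
  "map_cl c = \<Union>{H.cl (i + e) (h i x) | i x. (i, x) \<in> c}"

lemma map_cl: assumes i: "i0 \<le> i" "x \<in> carrier (G i)" shows "map_cl (G.cl i x) = H.cl (i + e) (h i x)"
proof (intro equalityI subsetI)
  fix u assume "u \<in> map_cl (G.cl i x)"
  then obtain j y where "(j, y) \<in> G.cl i x" "u \<in> H.cl (j + e) (h j y)" unfolding map_cl_def by blast
  then show "u \<in> H.cl (i + e) (h i x)" using h_cl[OF i] by simp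
next
  fix u assume "u \<in> H.cl (i + e) (h i x)"
  then show "u \<in> map_cl (G.cl i x)" unfolding map_cl_def using G.cl_self[OF i] by blast
qed

text \<open>Bijectivity at each stage is too much to ask of the comparison map. In the colimit it is
  enough that elements with equal images become equal after one transition, and that every element
  has the same limit class as some image.\<close>

lemma map_cl_iso:
  assumes hom: "\<And>i x y. \<lbrakk>i0 \<le> i; x \<in> carrier (G i); y \<in> carrier (G i)\<rbrakk> \<Longrightarrow> h i (x \<otimes>\<^bsub>G i\<^esub> y) = h i x \<otimes>\<^bsub>H (i + e)\<^esub> h i y"
    and inj: "\<And>i x y. \<lbrakk>i0 \<le> i; x \<in> carrier (G i); y \<in> carrier (G i); h i x = h i y\<rbrakk> \<Longrightarrow> t i x = t i y"
    and surj: "\<And>i x. \<lbrakk>i0 \<le> i; j0 \<le> i; x \<in> carrier (H i)\<rbrakk> \<Longrightarrow> \<exists>y\<in>carrier (G i). H.cl (i + e) (h i y) = H.cl i x"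
  shows "map_cl \<in> iso (dir_colim i0 G t) (dir_colim j0 H s)"
proof (rule isoI)
  have cl: "map_cl c \<in> carrier (dir_colim j0 H s)" if "c \<in> carrier (dir_colim i0 G t)" for c
    using that le h_closed map_cl by (fastforce simp: G.colim_carrier intro!: H.cl_in_colim)
  show "map_cl \<in> hom (dir_colim i0 G t) (dir_colim j0 H s)"
  proof (rule homI[OF cl])
    fix c d assume "c \<in> carrier (dir_colim i0 G t)" "d \<in> carrier (dir_colim i0 G t)"
    then obtain i x y where i: "i0 \<le> i" "x \<in> carrier (G i)" "y \<in> carrier (G i)" "c = G.cl i x" "d = G.cl i y"
      using G.colim_common[of c d 0] by metis
    have j: "j0 \<le> i + e" using i(1) le by simp
    show "map_cl (c \<otimes>\<^bsub>dir_colim i0 G t\<^esub> d) = map_cl c \<otimes>\<^bsub>dir_colim j0 H s\<^esub> map_cl d"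
      unfolding i(4,5) G.colim_mult[OF i(1-3)] map_cl[OF i(1,2)] map_cl[OF i(1,3)]
        H.colim_mult[OF j h_closed[OF i(1,2)] h_closed[OF i(1,3)]] map_cl[OF i(1) G.mclosed[OF i(1-3)]] hom[OF i(1-3)] ..
  qed
  show "bij_betw map_cl (carrier (dir_colim i0 G t)) (carrier (dir_colim j0 H s))"
  proof (rule bij_betwI')
    fix c d assume "c \<in> carrier (dir_colim i0 G t)" "d \<in> carrier (dir_colim i0 G t)"
    then obtain i x y where i: "i0 \<le> i" "x \<in> carrier (G i)" "y \<in> carrier (G i)" "c = G.cl i x" "d = G.cl i y"
      using G.colim_common[of c d 0] by metis
    show "(map_cl c = map_cl d) = (c = d)"
    proof
      assume "map_cl c = map_cl d"
      then have "H.cl (i + e) (h i x) = H.cl (i + e) (h i y)" using map_cl[OF i(1,2)] map_cl[OF i(1,3)] i by simp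
      then obtain k where k: "k \<ge> i + e" "H.to k (i + e) (h i x) = H.to k (i + e) (h i y)"
        using H.cl_eq_iff[of "i + e" "h i y"] h_closed[OF i(1,3)] i(1) le by auto
      \<comment> \<open>At stage \<open>i + ?d\<close> the images under \<open>h\<close> agree; one
        more transition makes the elements themselves agree.\<close>
      let ?d = "k - (i + e)"
      have "h (i + ?d) (dl_iter t i ?d x) = h (i + ?d) (dl_iter t i ?d y)"
        using h_iter[OF i(1,2), of ?d] h_iter[OF i(1,3), of ?d] k by simp
      then have "t (i + ?d) (dl_iter t i ?d x) = t (i + ?d) (dl_iter t i ?d y)"
        using inj[of "i + ?d"] G.iter_closed[OF i(1,2)] G.iter_closed[OF i(1,3)] i(1) by simp
      then have "dl_iter t i (Suc ?d) x = dl_iter t i (Suc ?d) y" by simp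
      then show "c = d" unfolding i(4,5) by (intro G.cl_eqI[of i "i + Suc ?d" i]) auto
    qed simp
  next
    fix c assume "c \<in> carrier (dir_colim i0 G t)" then show "map_cl c \<in> carrier (dir_colim j0 H s)" by (rule cl)
  next
    fix d assume d: "d \<in> carrier (dir_colim j0 H s)"
    obtain i x where i: "j0 \<le> i" "i0 \<le> i" "x \<in> carrier (H i)" "d = H.cl i x"
      using H.colim_common[OF d d, of i0] by metis
    obtain y where y: "y \<in> carrier (G i)" "H.cl (i + e) (h i y) = H.cl i x" using surj[OF i(2,1,3)] by blast
    have "G.cl i y \<in> carrier (dir_colim i0 G t)" by (rule G.cl_in_colim[OF i(2) y(1)])
    then show "\<exists>c\<in>carrier (dir_colim i0 G t). d = map_cl c"
      using map_cl[OF i(2) y(1)] y(2) i(4) by metis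
  qed
qed

end

lemma dir_colim_map_cl:
  assumes "dirsys i0 G t" "dirsys i0 H s"
    and "\<And>i x. \<lbrakk>i0 \<le> i; x \<in> carrier (G i)\<rbrakk> \<Longrightarrow> h i x \<in> carrier (H i)"
    and "\<And>i x. \<lbrakk>i0 \<le> i; x \<in> carrier (G i)\<rbrakk> \<Longrightarrow> s i (h i x) = h (Suc i) (t i x)"
    and i: "i0 \<le> i" "x \<in> carrier (G i)"
  shows "dir_colim_map i0 H s h (dl_class i0 G t i x) = dl_class i0 H s i (h i x)"
proof -
  interpret G: dirsys i0 G t by fact
  interpret H: dirsys i0 H s by fact
  interpret dirsys_map i0 G t i0 H s 0 h by unfold_locales (use assms in auto)
  have "dir_colim_map i0 H s h c = map_cl c" for c by (simp add: dir_colim_map_def map_cl_def)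
  then show ?thesis using map_cl[OF i] by simp
qed

section \<open>Stable Hom groups\<close>

context abelian_category
begin

lemma hom_group_simps [simp]:
  "carrier (hom_group C A B) = homs C A B" "f \<otimes>\<^bsub>hom_group C A B\<^esub> g = plus C f g" "\<one>\<^bsub>hom_group C A B\<^esub> = zer C A B"
  by (simp_all add: hom_group_def)

lemma neg_hom: "f \<in> homs C A B \<Longrightarrow> neg f \<in> homs C A B" by (auto simp: homs_iff)

lemma factoring_I: "\<lbrakk>X \<in> U; g \<in> homs C A X; h \<in> homs C X B\<rbrakk> \<Longrightarrow> h \<cdot> g \<in> factoring C U A B"
  unfolding factoring_def by blast

lemma factoring_E:
  assumes "f \<in> factoring C U A B"
  obtains X g h where "X \<in> U" "g \<in> homs C A X" "h \<in> homs C X B" "f = h \<cdot> g"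
  using assms unfolding factoring_def by blast

lemma factoring_hom: "f \<in> factoring C U A B \<Longrightarrow> f \<in> homs C A B"
  by (auto elim!: factoring_E intro: cmp_hom)

lemma factoring_left: "\<lbrakk>f \<in> factoring C U A B; k \<in> homs C B D\<rbrakk> \<Longrightarrow> k \<cdot> f \<in> factoring C U A D"
  using cmp_hom by (elim factoring_E) (simp add: cmp_assoc factoring_I)

lemma factoring_right: "\<lbrakk>f \<in> factoring C U A B; k \<in> homs C D A\<rbrakk> \<Longrightarrow> f \<cdot> k \<in> factoring C U D B"
  using cmp_hom by (elim factoring_E) (simp add: cmp_assoc[symmetric] factoring_I)

context
  fixes U assumes U: "full_additive_subcategory C U"
begin

lemma ds_sub: "\<lbrakk>A \<in> U; B \<in> U\<rbrakk> \<Longrightarrow> ds A B \<in> U"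
  using U biprod_is unfolding full_additive_subcategory_def ds_def by (meson subsetD)

text \<open>The sum factors through the biproduct of the two intermediate objects, which again
  belongs to \<open>U\<close>.\<close>

lemma factoring_plus:
  assumes "f \<in> factoring C U A B" "f' \<in> factoring C U A B" shows "plus C f f' \<in> factoring C U A B"
proof -
  obtain X g h where 1: "X \<in> U" "g \<in> homs C A X" "h \<in> homs C X B" "f = h \<cdot> g" using factoring_E[OF assms(1)] .
  obtain Y g' h' where 2: "Y \<in> U" "g' \<in> homs C A Y" "h' \<in> homs C Y B" "f' = h' \<cdot> g'" using factoring_E[OF assms(2)] .
  note a [simp] = homsD[OF 1(2)] homsD[OF 1(3)] homsD[OF 2(2)] homsD[OF 2(3)]
  have o [simp]: "X \<in> obj C" "Y \<in> obj C" "A \<in> obj C" "B \<in> obj C" using homs_obj 1 2 by auto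
  have "plus C (h \<cdot> pr1 C X Y) (h' \<cdot> pr2 C X Y) \<cdot> plus C (in1 C X Y \<cdot> g) (in2 C X Y \<cdot> g') = plus C f f'"
    using 1(4) 2(4) by (simp add: distl distr)
  moreover have "plus C (in1 C X Y \<cdot> g) (in2 C X Y \<cdot> g') \<in> homs C A (ds X Y)"
    "plus C (h \<cdot> pr1 C X Y) (h' \<cdot> pr2 C X Y) \<in> homs C (ds X Y) B" by (auto simp: homs_iff)
  ultimately show ?thesis using factoring_I[OF ds_sub[OF 1(1) 2(1)]] by metis
qed

lemma factoring_neg: assumes "f \<in> factoring C U A B" shows "neg f \<in> factoring C U A B"
proof -
  obtain X g h where 1: "X \<in> U" "g \<in> homs C A X" "h \<in> homs C X B" "f = h \<cdot> g" using factoring_E[OF assms(1)] .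
  have "neg f = neg h \<cdot> g" using 1 by (simp add: homs_iff)
  then show ?thesis using factoring_I[OF 1(1,2) neg_hom[OF 1(3)]] by simp
qed

lemma factoring_zer:
  assumes "A \<in> obj C" "B \<in> obj C" shows "zer C A B \<in> factoring C U A B"
proof -
  obtain Z where "Z \<in> U" "Z \<in> obj C" using U unfolding full_additive_subcategory_def by blast
  then have "zer C Z B \<cdot> zer C A Z \<in> factoring C U A B" 
    by (intro factoring_I[OF _ zer_hom zer_hom]) (use assms in auto)
  then show ?thesis using assms \<open>Z \<in> obj C\<close> by simp
qed

context
  fixes A B assumes AB: "A \<in> obj C" "B \<in> obj C"
begin

lemma hom_inv: "f \<in> homs C A B \<Longrightarrow> inv\<^bsub>hom_group C A B\<^esub> f = neg f"
proof -
  interpret G: comm_group "hom_group C A B" by (rule hom_comm_group[OF AB])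
  assume f: "f \<in> homs C A B"
  show ?thesis by (rule G.inv_equality) (use f neg_hom in \<open>auto simp: homs_iff\<close>)
qed

lemma factoring_normal: "normal (factoring C U A B) (hom_group C A B)"
proof -
  interpret G: comm_group "hom_group C A B" by (rule hom_comm_group[OF AB])
  have "subgroup (factoring C U A B) (hom_group C A B)"
    by (rule subgroup.intro) (use factoring_hom factoring_plus factoring_zer[OF AB] factoring_neg hom_inv in auto)
  then show ?thesis by (rule G.subgroup_imp_normal)
qed

lemma stab_carrier: "carrier (stab C U A B) = stab_proj C U A B ` homs C A B"
  by (auto simp: stab_def stab_proj_def FactGroup_def RCOSETS_def)

lemma stab_mult:
  assumes "f \<in> homs C A B" "g \<in> homs C A B"
  shows "stab_proj C U A B f \<otimes>\<^bsub>stab C U A B\<^esub> stab_proj C U A B g = stab_proj C U A B (plus C f g)"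
  using normal.rcos_sum[OF factoring_normal] assms by (simp add: stab_def stab_proj_def FactGroup_def)

lemma stab_proj_mem:
  assumes "f \<in> homs C A B"
  shows "g \<in> stab_proj C U A B f \<longleftrightarrow> g \<in> homs C A B \<and> plus C g (neg f) \<in> factoring C U A B"
proof -
  interpret N: normal "factoring C U A B" "hom_group C A B" by (rule factoring_normal)
  have "g \<in> homs C A B" if "g \<in> stab_proj C U A B f"
    using that N.r_coset_subset_G[OF N.subset, of f] assms by (auto simp: stab_proj_def)
  then show ?thesis
    using N.rcos_module[OF N.is_group, of f g] assms hom_inv[OF assms] by (auto simp: stab_proj_def)
qed

lemma stab_proj_eq:
  assumes "f \<in> homs C A B" "g \<in> homs C A B"
  shows "stab_proj C U A B f = stab_proj C U A B g \<longleftrightarrow> plus C f (neg g) \<in> factoring C U A B"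
proof -
  interpret N: normal "factoring C U A B" "hom_group C A B" by (rule factoring_normal)
  have "f \<in> stab_proj C U A B f"
    using N.rcos_self[OF _ N.subgroup_axioms, of f] assms by (simp add: stab_proj_def)
  moreover have "stab_proj C U A B g = stab_proj C U A B f" if "f \<in> stab_proj C U A B g"
    using N.repr_independence[OF _ _ N.subgroup_axioms, of f g] that assms by (simp add: stab_proj_def)
  ultimately show ?thesis using stab_proj_mem[OF assms(2)] assms(1) by auto
qed

lemma stab_proj_memD:
  assumes "f \<in> homs C A B" "g \<in> stab_proj C U A B f"
  shows "g \<in> homs C A B" "stab_proj C U A B g = stab_proj C U A B f"
  using assms stab_proj_mem stab_proj_eq by auto

lemma stab_proj_self: "f \<in> homs C A B \<Longrightarrow> f \<in> stab_proj C U A B f"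
  using stab_proj_mem[of f f] factoring_zer[OF AB] by (auto simp: homs_iff)

lemma induced_eq:
  assumes f: "f \<in> homs C A B"
    and d: "\<And>g. \<lbrakk>g \<in> homs C A B; stab_proj C U A B g = stab_proj C U A B f\<rbrakk> \<Longrightarrow> \<delta> g = \<delta> f"
  shows "induced \<delta> (stab_proj C U A B f) = \<delta> f"
  unfolding induced_def
proof (rule the_equality)
  show "\<forall>g\<in>stab_proj C U A B f. \<delta> g = \<delta> f" using d stab_proj_memD[OF f] by blast
  show "x = \<delta> f" if "\<forall>g\<in>stab_proj C U A B f. \<delta> g = x" for x
    using bspec[OF that stab_proj_self[OF f]] by simp
qed

text \<open>Since \<open>\<gamma>\<close> is onto, a map on \<open>K\<close> is determined by its
  composite with \<open>\<gamma>\<close>, and choosing preimages defines one because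
  \<open>\<gamma>\<close> identifies only stably equal morphisms. Extensionality fixes the values
  outside the carrier, which makes \<open>THE\<close> well defined.\<close>

lemma beta_eq:
  assumes cl: "\<And>f. f \<in> homs C A B \<Longrightarrow> \<gamma> f \<in> carrier K"
    and su: "\<And>x. x \<in> carrier K \<Longrightarrow> \<exists>f\<in>homs C A B. x = \<gamma> f"
    and ad: "\<And>f g. \<lbrakk>f \<in> homs C A B; g \<in> homs C A B\<rbrakk> \<Longrightarrow> \<gamma> (plus C f g) = \<gamma> f \<otimes>\<^bsub>K\<^esub> \<gamma> g"
    and ke: "\<And>f g. \<lbrakk>f \<in> homs C A B; g \<in> homs C A B; \<gamma> f = \<gamma> g\<rbrakk> \<Longrightarrow> stab_proj C U A B f = stab_proj C U A B g"
    and f: "f \<in> homs C A B"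
  shows "beta C U K A B \<gamma> (\<gamma> f) = stab_proj C U A B f"
proof -
  define P where "P b \<longleftrightarrow> b \<in> hom K (stab C U A B) \<and> b \<in> extensional (carrier K) \<and>
    (\<forall>g\<in>homs C A B. b (\<gamma> g) = stab_proj C U A B g)" for b
  define c where "c x = (SOME f. f \<in> homs C A B \<and> x = \<gamma> f)" for x
  have c: "c x \<in> homs C A B \<and> x = \<gamma> (c x)" if "x \<in> carrier K" for x
    unfolding c_def by (rule someI_ex) (use su[OF that] in blast)
  define b0 where "b0 = (\<lambda>x\<in>carrier K. stab_proj C U A B (c x))"
  have b0: "b0 (\<gamma> g) = stab_proj C U A B g" if "g \<in> homs C A B" for g
    using c[OF cl[OF that]] cl[OF that] ke[of "c (\<gamma> g)" g] that by (simp add: b0_def)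
  have "P b0" unfolding P_def
  proof (intro conjI homI ballI)
    fix x y assume xy: "x \<in> carrier K" "y \<in> carrier K"
    then obtain g h where g: "g \<in> homs C A B" "x = \<gamma> g" "h \<in> homs C A B" "y = \<gamma> h" using su by metis
    show "b0 (x \<otimes>\<^bsub>K\<^esub> y) = b0 x \<otimes>\<^bsub>stab C U A B\<^esub> b0 y"
      using b0 g ad[OF g(1,3)] plus_hom[OF g(1,3)] stab_mult[OF g(1,3)] by metis
  next
    fix x assume "x \<in> carrier K"
    then show "b0 x \<in> carrier (stab C U A B)" using c by (auto simp: b0_def stab_carrier)
  qed (use b0 in \<open>auto simp: b0_def\<close>)
  moreover have "b = b0" if "P b" for b
  proof (rule extensionalityI[of _ "carrier K"])
    show "b x = b0 x" if "x \<in> carrier K" for x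
      using su[OF that] \<open>P b\<close> \<open>P b0\<close> unfolding P_def by auto
  qed (use \<open>P b0\<close> that in \<open>auto simp: P_def\<close>)
  ultimately have "(THE b. P b) = b0" by (rule the_equality)
  then show ?thesis using b0[OF f] unfolding beta_def P_def by simp
qed

end

end

end


section \<open>The comparison map\<close>

text \<open>
  The part of the calculus of Yoneda extensions used below, stated so that the assumptions hold for
  an abelian category and, with the two arguments exchanged, also for its opposite.  Morphisms of
  short exact sequences are written as \<open>emap C 0 g h [a, b] [a', b']\<close>.
\<close>

locale ext_calculus = abelian_category C for C :: "('o, 'm, 'z) precat_scheme" (structure) +
  fixes E :: "int \<Rightarrow> 'o \<Rightarrow> 'o \<Rightarrow> 'x monoid"
    and pull :: "'m \<Rightarrow> 'x \<Rightarrow> 'x" and push :: "'m \<Rightarrow> 'x \<Rightarrow> 'x"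
    and emb :: "'m \<Rightarrow> 'x"
    and cc :: "int \<Rightarrow> 'm \<Rightarrow> 'm \<Rightarrow> 'o \<Rightarrow> 'x \<Rightarrow> 'x"
    and co :: "int \<Rightarrow> 'o \<Rightarrow> 'm \<Rightarrow> 'm \<Rightarrow> 'x \<Rightarrow> 'x"
  assumes E_group: "\<lbrakk>M \<in> obj C; N \<in> obj C\<rbrakk> \<Longrightarrow> comm_group (E k M N)"
    and E_neg: "\<lbrakk>k < 0; x \<in> carrier (E k M N)\<rbrakk> \<Longrightarrow> x = \<one>\<^bsub>E k M N\<^esub>"
    and emb_closed: "f \<in> homs C M N \<Longrightarrow> emb f \<in> carrier (E 0 M N)"
    and emb_surj: "x \<in> carrier (E 0 M N) \<Longrightarrow> \<exists>f\<in>homs C M N. x = emb f"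
    and emb_inj: "\<lbrakk>f \<in> homs C M N; g \<in> homs C M N; emb f = emb g\<rbrakk> \<Longrightarrow> f = g"
    and emb_plus: "\<lbrakk>f \<in> homs C M N; g \<in> homs C M N\<rbrakk> \<Longrightarrow> emb (plus C f g) = emb f \<otimes>\<^bsub>E 0 M N\<^esub> emb g"
    and E_pull_hom: "\<lbrakk>f \<in> homs C M' M; N \<in> obj C\<rbrakk> \<Longrightarrow> pull f \<in> hom (E k M N) (E k M' N)"
    and E_push_hom: "\<lbrakk>g \<in> homs C N N'; M \<in> obj C\<rbrakk> \<Longrightarrow> push g \<in> hom (E k M N) (E k M N')"
    and E_pull_id: "x \<in> carrier (E k M N) \<Longrightarrow> pull (idn C M) x = x"
    and E_pull_comp: "\<lbrakk>x \<in> carrier (E k M N); f \<in> homs C M' M; f' \<in> homs C M'' M'\<rbrakk>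
      \<Longrightarrow> pull f' (pull f x) = pull (f \<cdot> f') x"
    and E_push_pull: "\<lbrakk>x \<in> carrier (E k M N); f \<in> homs C M' M; g \<in> homs C N N'\<rbrakk>
      \<Longrightarrow> push g (pull f x) = pull f (push g x)"
    and E_pull_add: "\<lbrakk>x \<in> carrier (E k M N); f \<in> homs C M' M; f' \<in> homs C M' M\<rbrakk>
      \<Longrightarrow> pull (plus C f f') x = pull f x \<otimes>\<^bsub>E k M' N\<^esub> pull f' x"
    and pull_emb: "\<lbrakk>h \<in> homs C M N; f \<in> homs C M' M\<rbrakk> \<Longrightarrow> pull f (emb h) = emb (h \<cdot> f)"
    and push_emb: "\<lbrakk>h \<in> homs C M N; g \<in> homs C N N'\<rbrakk> \<Longrightarrow> push g (emb h) = emb (g \<cdot> h)"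
    and cc_hom: "\<lbrakk>short_exact C a b; N \<in> obj C\<rbrakk> \<Longrightarrow> cc k a b N \<in> hom (E k (dom C a) N) (E (k + 1) (cod C b) N)"
    and co_hom: "\<lbrakk>short_exact C a b; M \<in> obj C\<rbrakk> \<Longrightarrow> co k M a b \<in> hom (E k M (cod C b)) (E (k + 1) M (dom C a))"
    and E_cc_push: "\<lbrakk>short_exact C a b; x \<in> carrier (E k (dom C a) N); g \<in> homs C N N'\<rbrakk>
      \<Longrightarrow> push g (cc k a b N x) = cc k a b N' (push g x)"
    and E_co_pull: "\<lbrakk>short_exact C a b; x \<in> carrier (E k M (cod C b)); f \<in> homs C M' M\<rbrakk>
      \<Longrightarrow> pull f (co k M a b x) = co k M' a b (pull f x)"
    and E_cc_nat: "\<lbrakk>short_exact C a b; short_exact C a' b'; x \<in> carrier (E k (dom C a') N); N \<in> obj C;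
      emap C 0 g h [a, b] [a', b']\<rbrakk> \<Longrightarrow> cc k a b N (pull g x) = pull h (cc k a' b' N x)"
    and E_co_nat: "\<lbrakk>short_exact C a b; short_exact C a' b'; x \<in> carrier (E k M (cod C b)); M \<in> obj C;
      emap C 0 g h [a, b] [a', b']\<rbrakk> \<Longrightarrow> push g (co k M a b x) = co k M a' b' (push h x)"
    and E_co_cc: "\<lbrakk>short_exact C a b; short_exact C c d; x \<in> carrier (E k (dom C c) (cod C b))\<rbrakk>
      \<Longrightarrow> co (k + 1) (cod C d) a b (cc k c d (cod C b) x) = cc (k + 1) c d (dom C a) (co k (dom C c) a b x)"
    and E_cc0_co0: "\<lbrakk>short_exact C a p; short_exact C b q; emap C 0 f g [a, p] [b, q]\<rbrakk>
      \<Longrightarrow> cc 0 a p (dom C b) (emb f) = co 0 (cod C p) b q (emb g)"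
    and E_les_left: "\<lbrakk>short_exact C a b; M \<in> obj C; k \<ge> 0; x \<in> carrier (E (k + 1) M (dom C a));
      push a x = \<one>\<^bsub>E (k + 1) M (cod C a)\<^esub>\<rbrakk> \<Longrightarrow> \<exists>y\<in>carrier (E k M (cod C b)). co k M a b y = x"
    and E_les_right: "\<lbrakk>short_exact C a b; M \<in> obj C; k \<ge> 0; x \<in> carrier (E k M (cod C b));
      co k M a b x = \<one>\<^bsub>E (k + 1) M (dom C a)\<^esub>\<rbrakk> \<Longrightarrow> \<exists>y\<in>carrier (E k M (dom C b)). push b y = x"
    and E_les_right': "\<lbrakk>short_exact C a b; N \<in> obj C; k \<ge> 0; x \<in> carrier (E k (dom C a) N);
      cc k a b N x = \<one>\<^bsub>E (k + 1) (cod C b) N\<^esub>\<rbrakk> \<Longrightarrow> \<exists>y\<in>carrier (E k (cod C a) N). pull a y = x"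
begin

lemma E_grp: "\<lbrakk>M \<in> obj C; N \<in> obj C\<rbrakk> \<Longrightarrow> group (E k M N)"
  using E_group comm_group.axioms(2) by blast

lemma E_pull_closed: "\<lbrakk>x \<in> carrier (E k M N); f \<in> homs C M' M; N \<in> obj C\<rbrakk> \<Longrightarrow> pull f x \<in> carrier (E k M' N)"
  using hom_in_carrier[OF E_pull_hom] by blast

lemma E_push_closed: "\<lbrakk>x \<in> carrier (E k M N); g \<in> homs C N N'; M \<in> obj C\<rbrakk> \<Longrightarrow> push g x \<in> carrier (E k M N')"
  using hom_in_carrier[OF E_push_hom] by blast

lemma cc_closed': "\<lbrakk>short_exact C a b; x \<in> carrier (E k (dom C a) N); N \<in> obj C\<rbrakk> \<Longrightarrow> cc k a b N x \<in> carrier (E (k + 1) (cod C b) N)"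
  using hom_in_carrier[OF cc_hom] by blast

lemma co_closed': "\<lbrakk>short_exact C a b; x \<in> carrier (E k M (cod C b)); M \<in> obj C\<rbrakk> \<Longrightarrow> co k M a b x \<in> carrier (E (k + 1) M (dom C a))"
  using hom_in_carrier[OF co_hom] by blast

lemma E_pull_one: "\<lbrakk>f \<in> homs C M' M; N \<in> obj C\<rbrakk> \<Longrightarrow> pull f \<one>\<^bsub>E k M N\<^esub> = \<one>\<^bsub>E k M' N\<^esub>"
  by (rule hom_one[OF E_pull_hom]) (auto intro: E_grp homs_obj)

lemma E_push_one: "\<lbrakk>g \<in> homs C N N'; M \<in> obj C\<rbrakk> \<Longrightarrow> push g \<one>\<^bsub>E k M N\<^esub> = \<one>\<^bsub>E k M N'\<^esub>"
  by (rule hom_one[OF E_push_hom]) (auto intro: E_grp homs_obj)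

lemma cc_one': "\<lbrakk>short_exact C a b; N \<in> obj C\<rbrakk> \<Longrightarrow> cc k a b N \<one>\<^bsub>E k (dom C a) N\<^esub> = \<one>\<^bsub>E (k + 1) (cod C b) N\<^esub>"
  by (rule hom_one[OF cc_hom]) (auto intro!: E_grp dest: short_exactD(5,6))

lemma E_idem:
  assumes "M \<in> obj C" "N \<in> obj C" "x \<in> carrier (E k M N)" "x \<otimes>\<^bsub>E k M N\<^esub> x = x"
  shows "x = \<one>\<^bsub>E k M N\<^esub>"
proof -
  interpret G: comm_group "E k M N" using assms by (intro E_group)
  show ?thesis using assms G.l_cancel_one by simp
qed

lemma E_pull_zero:
  assumes x: "x \<in> carrier (E k M N)" and o: "M \<in> obj C" "N \<in> obj C" "M' \<in> obj C"
  shows "pull (zer C M' M) x = \<one>\<^bsub>E k M' N\<^esub>"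
proof (rule E_idem)
  note z = zer_hom[OF o(3,1)]
  show "pull (zer C M' M) x \<in> carrier (E k M' N)" by (rule E_pull_closed[OF x z o(2)])
  show "pull (zer C M' M) x \<otimes>\<^bsub>E k M' N\<^esub> pull (zer C M' M) x = pull (zer C M' M) x"
    using E_pull_add[OF x z z] o by simp
qed (use o in auto)

text \<open>Naturality for the map from \<open>[a, b]\<close> to the sequence that ends in the zero
  object, with \<open>a\<close> at the left, turns the composite into a pullback along a zero
  morphism.\<close>

lemma cc_pull_left:
  assumes ab: "short_exact C a b" and x: "x \<in> carrier (E k (dom C b) N)" and o: "N \<in> obj C"
  shows "cc k a b N (pull a x) = \<one>\<^bsub>E (k + 1) (cod C b) N\<^esub>"
proof -
  note s [simp] = short_exactD(5-8)[OF ab]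
  have t: "short_exact C (idn C (dom C b)) (zer C (dom C b) (zobj C))"
    using id_kernel[of "dom C b" "zobj C"] zobj_epi by (simp add: short_exact_iff)
  have "emap C 0 a (zer C (cod C b) (zobj C)) [a, b] [idn C (dom C b), zer C (dom C b) (zobj C)]"
    unfolding ses_emap[OF ab t] by (intro conjI bexI[of _ "idn C (dom C b)"]) (auto simp: homs_iff)
  moreover have "cc k (idn C (dom C b)) (zer C (dom C b) (zobj C)) N x \<in> carrier (E (k + 1) (zobj C) N)"
    using cc_closed'[OF t _ o, of x k] x by simp
  ultimately show ?thesis using E_cc_nat[OF ab t _ o, of x k] x E_pull_zero[OF _ _ o, of _ "k + 1" "zobj C" "cod C b"] by simp
qed

text \<open>Naturality for the map to \<open>[a, b]\<close> from the sequence that begins with the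
  zero object, with \<open>b\<close> at the right: the class is first pulled back to the zero object
  and becomes trivial there.\<close>

lemma pull_cc_right:
  assumes ab: "short_exact C a b" and x: "x \<in> carrier (E k (dom C a) N)" and o: "N \<in> obj C"
  shows "pull b (cc k a b N x) = \<one>\<^bsub>E (k + 1) (dom C b) N\<^esub>"
proof -
  note s [simp] = short_exactD(5-8)[OF ab]
  have t: "short_exact C (zer C (zobj C) (dom C b)) (idn C (dom C b))"
    using zero_kernel[of "dom C b"] by (simp add: short_exact_iff)
  have "emap C 0 (zer C (zobj C) (dom C a)) b [zer C (zobj C) (dom C b), idn C (dom C b)] [a, b]"
    unfolding ses_emap[OF t ab] by (intro conjI bexI[of _ "idn C (dom C b)"]) (auto simp: homs_iff)
  from E_cc_nat[OF t ab x o this]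
  show ?thesis using E_pull_zero[OF x _ o, of "zobj C"] cc_one'[OF t o, of k] by simp
qed

end

text \<open>What the argument uses about the chosen coresolutions, phrased over an abstract
  \<open>E\<close> so that a resolution in \<open>C\<close> is covered as a coresolution in
  \<open>opc C\<close>. Membership of the cosyzygies in the left orthogonal class enters through
  \<open>vanish\<close>.\<close>

locale coresolution_calculus = ext_calculus C E pull push emb cc co
  for C :: "('o, 'm, 'z) precat_scheme" (structure) and E :: "int \<Rightarrow> 'o \<Rightarrow> 'o \<Rightarrow> 'x monoid"
    and pull push emb cc co +
  fixes V :: "'o set" and I :: "'o \<Rightarrow> 'm coresolution"
  assumes V: "full_additive_subcategory C V"
    and ses: "M \<in> obj C \<Longrightarrow> short_exact C (cinc (I M) i) (cprj (I M) i)"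
    and cod_cprj: "M \<in> obj C \<Longrightarrow> cod C (cprj (I M) i) = Theta C (I M) (Suc i)"
    and Theta_0: "M \<in> obj C \<Longrightarrow> Theta C (I M) 0 = M"
    and cterm_V: "M \<in> obj C \<Longrightarrow> cterm C (I M) i \<in> V"
    and tail: "M \<in> obj C \<Longrightarrow> I (Theta C (I M) 1) = \<lparr>cinc = (\<lambda>i. cinc (I M) (Suc i)), cprj = (\<lambda>i. cprj (I M) (Suc i))\<rparr>"
    and vanish: "\<lbrakk>M \<in> obj C; U \<in> V; j \<ge> 1\<rbrakk> \<Longrightarrow> carrier (E j (Theta C (I M) (Suc i)) U) = {\<one>\<^bsub>E j (Theta C (I M) (Suc i)) U\<^esub>}"
begin

abbreviation "T M i \<equiv> Theta C (I M) i"
abbreviation "inc M i \<equiv> cinc (I M) i"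
abbreviation "prj M i \<equiv> cprj (I M) i"
abbreviation "proj A B \<equiv> stab_proj C V A B"

text \<open>\<open>g\<close> is a morphism that \<open>f\<close> induces on the next cosyzygies. It
  is determined only modulo morphisms factoring through \<open>V\<close>; its class is the image of
  the class of \<open>f\<close> under the stable transition map, see
  \<open>tr_value\<close>.\<close>

definition lift :: "'o \<Rightarrow> nat \<Rightarrow> 'o \<Rightarrow> nat \<Rightarrow> 'm \<Rightarrow> 'm \<Rightarrow> bool" where
  "lift M i N j f g \<longleftrightarrow> emap C 0 f g [inc M i, prj M i] [inc N j, prj N j]"

lemma inc_simps [simp]:
  assumes "M \<in> obj C"
  shows "inc M i \<in> arr C" "prj M i \<in> arr C" "dom C (inc M i) = T M i" "cod C (inc M i) = cterm C (I M) i"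
    "dom C (prj M i) = cterm C (I M) i" "cod C (prj M i) = T M (Suc i)" "T M i \<in> obj C" "cterm C (I M) i \<in> obj C"
  using short_exactD(5-7)[OF ses[OF assms, of i]] cod_cprj[OF assms, of i]
  by (auto simp: Theta_def cterm_def intro: dom_obj cod_obj)

lemma V_obj: "U \<in> V \<Longrightarrow> U \<in> obj C"
  using V unfolding full_additive_subcategory_def by blast

lemma inc_hom: "M \<in> obj C \<Longrightarrow> inc M i \<in> homs C (T M i) (cterm C (I M) i)"
  "M \<in> obj C \<Longrightarrow> prj M i \<in> homs C (cterm C (I M) i) (T M (Suc i))"
  by auto

lemma lift_iff:
  assumes "M \<in> obj C" "N \<in> obj C"
  shows "lift M i N j f g \<longleftrightarrow> f \<in> homs C (T M i) (T N j) \<and> g \<in> homs C (T M (Suc i)) (T N (Suc j)) \<and>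
    (\<exists>u\<in>homs C (cterm C (I M) i) (cterm C (I N) j). inc N j \<cdot> f = u \<cdot> inc M i \<and> prj N j \<cdot> u = g \<cdot> prj M i)"
  unfolding lift_def ses_emap[OF ses[OF assms(1)] ses[OF assms(2)]] using assms by simp

text \<open>The obstruction is the connecting image of \<open>h\<close> in
  \<open>E 1 (T M (Suc i)) U\<close>, which vanishes; exactness in degree zero then gives the
  extension.\<close>

lemma extend:
  assumes o: "M \<in> obj C" and h: "h \<in> homs C (T M i) U" and U: "U \<in> V"
  obtains g where "g \<in> homs C (cterm C (I M) i) U" "g \<cdot> inc M i = h"
proof -
  have e: "emb h \<in> carrier (E 0 (dom C (inc M i)) U)" using emb_closed[OF h] o by simp
  have "cc 0 (inc M i) (prj M i) U (emb h) \<in> carrier (E (0 + 1) (cod C (prj M i)) U)"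
    by (rule cc_closed'[OF ses[OF o] e V_obj[OF U]])
  then have "cc 0 (inc M i) (prj M i) U (emb h) = \<one>\<^bsub>E (0 + 1) (cod C (prj M i)) U\<^esub>"
    using vanish[OF o U, of 1 i] o by simp
  from E_les_right'[OF ses[OF o] V_obj[OF U] _ e this]
  obtain y where y: "y \<in> carrier (E 0 (cterm C (I M) i) U)" "pull (inc M i) y = emb h" using o by auto
  obtain g where g: "g \<in> homs C (cterm C (I M) i) U" "y = emb g" using emb_surj[OF y(1)] by blast
  have "emb (g \<cdot> inc M i) = emb h" using pull_emb[OF g(1) inc_hom(1)[OF o]] y g by simp
  then have "g \<cdot> inc M i = h" using emb_inj[OF cmp_hom[OF inc_hom(1)[OF o] g(1)] h] by simp
  then show ?thesis using that g by blast
qed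

lemma extend_cokernel:
  assumes o: "M \<in> obj C" "N \<in> obj C" and f: "f \<in> homs C (T M i) (T N j)"
    and u: "u \<in> homs C (cterm C (I M) i) (cterm C (I N) j)" "inc N j \<cdot> f = u \<cdot> inc M i"
  obtains g where "g \<in> homs C (T M (Suc i)) (T N (Suc j))" "g \<cdot> prj M i = prj N j \<cdot> u"
proof -
  note a [simp] = homsD[OF f] homsD[OF u(1)]
  note s = short_exactD(8)[OF ses[OF o(2), of j]]
  have "(prj N j \<cdot> u) \<cdot> inc M i = prj N j \<cdot> (inc N j \<cdot> f)" using u(2) o by simp
  also have "\<dots> = zer C (T M i) (T N (Suc j))" using reassoc[OF s, of f] o by simp
  finally obtain g where "g \<in> arr C" "dom C g = T M (Suc i)" "cod C g = T N (Suc j)" "g \<cdot> prj M i = prj N j \<cdot> u"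
    using cokernel_ex[OF short_exactD(2)[OF ses[OF o(1), of i]], of "prj N j \<cdot> u"] o by auto
  then show ?thesis using that by auto
qed

lemma lift_ex:
  assumes o: "M \<in> obj C" "N \<in> obj C" and f: "f \<in> homs C (T M i) (T N j)"
  obtains g where "lift M i N j f g"
proof -
  obtain u where u: "u \<in> homs C (cterm C (I M) i) (cterm C (I N) j)" "u \<cdot> inc M i = inc N j \<cdot> f"
    using extend[OF o(1) cmp_hom[OF f inc_hom(1)[OF o(2)]] cterm_V[OF o(2)]] by metis
  obtain g where "g \<in> homs C (T M (Suc i)) (T N (Suc j))" "g \<cdot> prj M i = prj N j \<cdot> u"
    using extend_cokernel[OF o f u(1)] u(2) by metis
  then show ?thesis using that[of g] u f unfolding lift_iff[OF o] by metis
qed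

lemma lift_homs:
  assumes "M \<in> obj C" "N \<in> obj C" "lift M i N j f g"
  shows "f \<in> homs C (T M i) (T N j)" "g \<in> homs C (T M (Suc i)) (T N (Suc j))"
  using assms lift_iff by auto

lemma lift_comp:
  assumes o: "L \<in> obj C" "M \<in> obj C" "N \<in> obj C" and "lift L i M j f g" "lift M j N k f' g'"
  shows "lift L i N k (f' \<cdot> f) (g' \<cdot> g)"
  using emap_comp[OF sesI[OF ses[OF o(1)]] sesI[OF ses[OF o(2)]] sesI[OF ses[OF o(3)]]] assms(4,5)
  unfolding lift_def by blast

lemma lift_plus:
  assumes o: "M \<in> obj C" "N \<in> obj C" and "lift M i N j f g" "lift M i N j f' g'"
  shows "lift M i N j (plus C f f') (plus C g g')"
  using emap_plus[OF sesI[OF ses[OF o(1)]] sesI[OF ses[OF o(2)]]] assms(3,4) unfolding lift_def by blast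

text \<open>\<open>Theta_map\<close> selects a lift by \<open>SOME\<close>, so one lift has to be
  constructed: dependent choice builds pairs of maps on cosyzygies and terms stage by stage, each
  map on cosyzygies being extended to the terms by \<open>extend\<close>.\<close>

lemma Theta_map_spec:
  assumes o: "M \<in> obj C" "N \<in> obj C" and f: "f \<in> homs C M N"
  shows "Theta_map C I f 0 = f" "lift M i N i (Theta_map C I f i) (Theta_map C I f (Suc i))"
proof -
  define P where "P i p \<longleftrightarrow> fst p \<in> homs C (T M i) (T N i) \<and> snd p \<in> homs C (cterm C (I M) i) (cterm C (I N) i) \<and>
    snd p \<cdot> inc M i = inc N i \<cdot> fst p \<and> (i = 0 \<longrightarrow> fst p = f)" for i p
  have step: "\<exists>q. P (Suc i) q \<and> fst q \<cdot> prj M i = prj N i \<cdot> snd p" if p: "P i p" for i p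
  proof -
    obtain g where g: "g \<in> homs C (T M (Suc i)) (T N (Suc i))" "g \<cdot> prj M i = prj N i \<cdot> snd p"
      using extend_cokernel[OF o, of "fst p" i i "snd p"] p unfolding P_def by metis
    obtain v where "v \<in> homs C (cterm C (I M) (Suc i)) (cterm C (I N) (Suc i))" "v \<cdot> inc M (Suc i) = inc N (Suc i) \<cdot> g"
      using extend[OF o(1) cmp_hom[OF g(1) inc_hom(1)[OF o(2)]] cterm_V[OF o(2)]] by metis
    then show ?thesis using g unfolding P_def by (intro exI[of _ "(g, v)"]) simp
  qed
  have start: "\<exists>p. P 0 p"
  proof -
    have f0: "f \<in> homs C (T M 0) (T N 0)" using f o Theta_0 by simp
    obtain u where "u \<in> homs C (cterm C (I M) 0) (cterm C (I N) 0)" "u \<cdot> inc M 0 = inc N 0 \<cdot> f"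
      using extend[OF o(1) cmp_hom[OF f0 inc_hom(1)[OF o(2)]] cterm_V[OF o(2)]] by metis
    then show ?thesis using f0 unfolding P_def by (intro exI[of _ "(f, u)"]) simp
  qed
  obtain w where w: "\<And>i. P i (w i)" "\<And>i. fst (w (Suc i)) \<cdot> prj M i = prj N i \<cdot> snd (w i)"
    using dependent_nat_choice[of P "\<lambda>i p q. fst q \<cdot> prj M i = prj N i \<cdot> snd p"] start step by metis
  define Q where "Q \<theta> \<longleftrightarrow> (\<exists>u. \<theta> 0 = f \<and>
     (\<forall>i. \<theta> i \<in> homs C (T (dom C f) i) (T (cod C f) i) \<and>
          u i \<in> homs C (cterm C (I (dom C f)) i) (cterm C (I (cod C f)) i) \<and>
          u i \<cdot> inc (dom C f) i = inc (cod C f) i \<cdot> \<theta> i \<and>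
          \<theta> (Suc i) \<cdot> prj (dom C f) i = prj (cod C f) i \<cdot> u i))" for \<theta> :: "nat \<Rightarrow> 'm"
  have "\<exists>\<theta>. Q \<theta>" unfolding Q_def
    using w f unfolding P_def homsD(2,3)[OF f]
    by (intro exI[of _ "\<lambda>i. fst (w i)"] exI[of _ "\<lambda>i. snd (w i)"]) auto
  then have "Q (Theta_map C I f)" unfolding Theta_map_def Q_def[symmetric] by (rule someI_ex)
  then obtain u where u: "Theta_map C I f 0 = f" "\<And>i. Theta_map C I f i \<in> homs C (T M i) (T N i)"
    "\<And>i. u i \<in> homs C (cterm C (I M) i) (cterm C (I N) i)" "\<And>i. u i \<cdot> inc M i = inc N i \<cdot> Theta_map C I f i"
    "\<And>i. Theta_map C I f (Suc i) \<cdot> prj M i = prj N i \<cdot> u i"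
    unfolding Q_def homsD(2,3)[OF f] by blast
  show "Theta_map C I f 0 = f" by (rule u)
  show "lift M i N i (Theta_map C I f i) (Theta_map C I f (Suc i))"
    unfolding lift_iff[OF o] using u(2)[of i] u(2)[of "Suc i"] u(3)[of i] u(4)[of i] u(5)[of i] by metis
qed

lemma Theta_map_hom:
  assumes o: "M \<in> obj C" "N \<in> obj C" and f: "f \<in> homs C M N"
  shows "Theta_map C I f i \<in> homs C (T M i) (T N i)"
  using lift_homs(1)[OF o Theta_map_spec(2)[OF assms]] .

lemma T_T: "M \<in> obj C \<Longrightarrow> T (T M 1) i = T M (Suc i)"
  by (subst tail) (simp_all add: Theta_def del: inc_simps)

text \<open>The choice for \<open>T M 1\<close> is the tail of the choice for \<open>M\<close>, so
  raising the index by one is the same as replacing the object by its first cosyzygy.\<close>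

lemma lift_tail: "\<lbrakk>M \<in> obj C; N \<in> obj C\<rbrakk> \<Longrightarrow> lift (T M 1) i (T N 1) j f g = lift M (Suc i) N (Suc j) f g"
  unfolding lift_def by (subst (1 2) tail, assumption, subst (1 2) tail, assumption) simp

text \<open>An iterated satellite acts on \<open>f\<close> by repeating the one-step lift, each time
  on a new morphism. This can differ from \<open>Theta_map C I f i\<close>, which comes from a
  single lift to the whole coresolution; \<open>tau_Theta_map\<close> shows that they agree
  stably.\<close>

primrec tau :: "nat \<Rightarrow> 'm \<Rightarrow> 'm" where
  "tau 0 f = f"
| "tau (Suc i) f = tau i (Theta_map C I f 1)"

lemma tau_lift:
  assumes "M \<in> obj C" "N \<in> obj C" "f \<in> homs C M N"
  shows "lift M i N i (tau i f) (tau (Suc i) f)"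
  using assms
proof (induction i arbitrary: M N f)
  case 0
  then show ?case using Theta_map_spec(2)[OF 0, of 0] Theta_map_spec(1)[OF 0] by simp
next
  case (Suc i)
  have "lift (T M 1) i (T N 1) i (tau i (Theta_map C I f 1)) (tau (Suc i) (Theta_map C I f 1))"
    by (rule Suc.IH) (use Suc.prems Theta_map_hom[OF Suc.prems, of 1] in auto)
  then show ?case using lift_tail Suc.prems by simp
qed

lemma tau_hom: "\<lbrakk>M \<in> obj C; N \<in> obj C; f \<in> homs C M N\<rbrakk> \<Longrightarrow> tau i f \<in> homs C (T M i) (T N i)"
  using tau_lift lift_homs(1) by blast

abbreviation conn :: "'o \<Rightarrow> nat \<Rightarrow> int \<Rightarrow> 'o \<Rightarrow> 'x \<Rightarrow> 'x" where
  "conn M i k N \<equiv> cc k (inc M i) (prj M i) N"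

text \<open>The stable transition map over the abstract \<open>E\<close>: it becomes
  \<open>stab_trans_V\<close> in \<open>C\<close> and \<open>stab_trans_W\<close> through the
  opposite category.\<close>

definition tr :: "'m \<Rightarrow> 'm \<Rightarrow> 'm \<Rightarrow> 'm \<Rightarrow> 'm set \<Rightarrow> 'm set" where
  "tr a p b q c = beta C V (E 1 (cod C p) (dom C b)) (cod C p) (cod C q) (\<lambda>g. co 0 (cod C p) b q (emb g))
     (induced (\<lambda>f. cc 0 a p (dom C b) (emb f)) c)"

lemma conn_closed: "\<lbrakk>M \<in> obj C; N \<in> obj C; x \<in> carrier (E k (T M i) N)\<rbrakk> \<Longrightarrow> conn M i k N x \<in> carrier (E (k + 1) (T M (Suc i)) N)"
  using cc_closed'[OF ses] by simp

text \<open>A morphism factoring through an object of \<open>V\<close> extends over the term of the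
  coresolution, since its first factor does; so it is pulled back along \<open>inc M i\<close> and
  is killed by the connecting morphism.\<close>

lemma conn_cong:
  assumes o: "M \<in> obj C" "B \<in> obj C" and f: "f \<in> homs C (T M i) B" "f' \<in> homs C (T M i) B"
    and e: "proj (T M i) B f = proj (T M i) B f'"
  shows "conn M i 0 B (emb f) = conn M i 0 B (emb f')"
proof -
  have "plus C f (neg f') \<in> factoring C V (T M i) B"
    using stab_proj_eq[OF V _ o(2) f] e o by simp
  then obtain X g h where x: "X \<in> V" "g \<in> homs C (T M i) X" "h \<in> homs C X B" "plus C f (neg f') = h \<cdot> g"
    by (rule factoring_E)
  obtain g' where g': "g' \<in> homs C (cterm C (I M) i) X" "g' \<cdot> inc M i = g" using extend[OF o(1) x(2,1)] .
  have hg: "h \<cdot> g' \<in> homs C (cterm C (I M) i) B" by (rule cmp_hom[OF g'(1) x(3)])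
  have "h \<cdot> g = (h \<cdot> g') \<cdot> inc M i" using g' cmp_assoc[OF inc_hom(1)[OF o(1)] g'(1) x(3)] by simp
  then have d: "emb (h \<cdot> g) = pull (inc M i) (emb (h \<cdot> g'))" using pull_emb[OF hg inc_hom(1)[OF o(1)]] by simp
  have 1: "conn M i 0 B (emb (h \<cdot> g)) = \<one>\<^bsub>E 1 (T M (Suc i)) B\<^esub>"
    unfolding d using cc_pull_left[OF ses[OF o(1)], of "emb (h \<cdot> g')" 0 i B] emb_closed[OF hg] o by simp
  have "plus C (h \<cdot> g) f' = f" unfolding x(4)[symmetric] using f by (simp add: homs_iff plus_assoc)
  then have "emb f = emb (h \<cdot> g) \<otimes>\<^bsub>E 0 (T M i) B\<^esub> emb f'" using emb_plus[OF cmp_hom[OF x(2,3)] f(2)] by simp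
  then have "conn M i 0 B (emb f) = conn M i 0 B (emb (h \<cdot> g)) \<otimes>\<^bsub>E 1 (T M (Suc i)) B\<^esub> conn M i 0 B (emb f')"
    using hom_mult[OF cc_hom[OF ses[OF o(1)] o(2)], of "emb (h \<cdot> g)" 0 i "emb f'"]
      emb_closed[OF cmp_hom[OF x(2,3)]] emb_closed[OF f(2)] o by simp
  moreover interpret G: comm_group "E 1 (T M (Suc i)) B" using o by (intro E_group) auto
  have "conn M i 0 B (emb f') \<in> carrier (E 1 (T M (Suc i)) B)"
    using conn_closed[OF o emb_closed[OF f(2)]] by simp
  ultimately show ?thesis using 1 by simp
qed

text \<open>The connecting image of \<open>f\<close> equals that of \<open>g\<close> by
  \<open>E_cc0_co0\<close>, and \<open>\<beta>\<close> sends the connecting image of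
  \<open>g\<close> to its stable class. The work lies in showing that \<open>\<beta>\<close> exists
  here.\<close>

lemma tr_value:
  assumes o: "M \<in> obj C" "N \<in> obj C" and l: "lift M i N j f g"
  shows "tr (inc M i) (prj M i) (inc N j) (prj N j) (proj (T M i) (T N j) f) = proj (T M (Suc i)) (T N (Suc j)) g"
    "induced (\<lambda>f. conn M i 0 (T N j) (emb f)) (proj (T M i) (T N j) f) = co 0 (T M (Suc i)) (inc N j) (prj N j) (emb g)"
proof -
  let ?X = "T M (Suc i)" let ?\<gamma> = "\<lambda>g. co 0 ?X (inc N j) (prj N j) (emb g)"
  have oX: "?X \<in> obj C" "T N (Suc j) \<in> obj C" "T N j \<in> obj C" "T M i \<in> obj C" using o by auto
  note h = lift_homs[OF o l]
  note hom = co_hom[OF ses[OF o(2), of j] oX(1), of 0]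
  have "induced (\<lambda>f. conn M i 0 (T N j) (emb f)) (proj (T M i) (T N j) f) = conn M i 0 (T N j) (emb f)"
    by (rule induced_eq[OF V oX(4,3) h(1)]) (rule conn_cong[OF o(1) oX(3) _ h(1)])
  also have "\<dots> = ?\<gamma> g"
    using E_cc0_co0[OF ses[OF o(1)] ses[OF o(2)] l[unfolded lift_def]] o by simp
  finally show i: "induced (\<lambda>f. conn M i 0 (T N j) (emb f)) (proj (T M i) (T N j) f) = ?\<gamma> g" .
  have "beta C V (E 1 ?X (T N j)) ?X (T N (Suc j)) ?\<gamma> (?\<gamma> g) = proj ?X (T N (Suc j)) g"
  proof (rule beta_eq[OF V oX(1,2)])
    show "?\<gamma> f \<in> carrier (E 1 ?X (T N j))" if "f \<in> homs C ?X (T N (Suc j))" for f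
      using hom_in_carrier[OF hom, of "emb f"] emb_closed[OF that] o by simp
    show "?\<gamma> (plus C f f') = ?\<gamma> f \<otimes>\<^bsub>E 1 ?X (T N j)\<^esub> ?\<gamma> f'"
      if "f \<in> homs C ?X (T N (Suc j))" "f' \<in> homs C ?X (T N (Suc j))" for f f'
      using hom_mult[OF hom, of "emb f" "emb f'"] emb_closed[OF that(1)] emb_closed[OF that(2)] emb_plus[OF that] o by simp
    \<comment> \<open>The obstruction to a preimage lies in the first Ext of a cosyzygy into a term
      of the coresolution, which is zero.\<close>
    show "\<exists>f\<in>homs C ?X (T N (Suc j)). x = ?\<gamma> f" if x: "x \<in> carrier (E 1 ?X (T N j))" for x
    proof -
      have "push (inc N j) x \<in> carrier (E 1 ?X (cterm C (I N) j))"
        by (rule E_push_closed[OF x inc_hom(1)[OF o(2)] oX(1)])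
      then have "push (inc N j) x = \<one>\<^bsub>E 1 ?X (cterm C (I N) j)\<^esub>"
        using vanish[OF o(1) cterm_V[OF o(2)], of 1 i j] by simp
      then obtain y where y: "y \<in> carrier (E 0 ?X (T N (Suc j)))" "co 0 ?X (inc N j) (prj N j) y = x"
        using E_les_left[OF ses[OF o(2), of j] oX(1), of 0 x] x o by auto
      then show ?thesis using emb_surj by metis
    qed
    \<comment> \<open>A difference with trivial connecting image lifts along \<open>prj N j\<close>,
      so it factors through a term of the coresolution, an object of \<open>V\<close>.\<close>
    show "proj ?X (T N (Suc j)) f = proj ?X (T N (Suc j)) f'"
      if f: "f \<in> homs C ?X (T N (Suc j))" "f' \<in> homs C ?X (T N (Suc j))" and e: "?\<gamma> f = ?\<gamma> f'" for f f'
    proof -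
      interpret G: comm_group "E 1 ?X (T N j)" using oX by (intro E_group) auto
      have d: "plus C f (neg f') \<in> homs C ?X (T N (Suc j))" using f by (intro plus_hom neg_hom)
      have "plus C (plus C f (neg f')) f' = f" using f by (simp add: homs_iff plus_assoc)
      then have "emb f = emb (plus C f (neg f')) \<otimes>\<^bsub>E 0 ?X (T N (Suc j))\<^esub> emb f'" using emb_plus[OF d f(2)] by simp
      then have "?\<gamma> f = ?\<gamma> (plus C f (neg f')) \<otimes>\<^bsub>E 1 ?X (T N j)\<^esub> ?\<gamma> f'"
        using hom_mult[OF hom, of "emb (plus C f (neg f'))" "emb f'"] emb_closed[OF d] emb_closed[OF f(2)] o by simp
      moreover have "?\<gamma> (plus C f (neg f')) \<in> carrier (E 1 ?X (T N j))" "?\<gamma> f' \<in> carrier (E 1 ?X (T N j))"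
        using hom_in_carrier[OF hom] emb_closed[OF d] emb_closed[OF f(2)] o by simp_all
      ultimately have "?\<gamma> (plus C f (neg f')) = \<one>\<^bsub>E 1 ?X (T N j)\<^esub>" using e by simp
      then obtain y where y: "y \<in> carrier (E 0 ?X (cterm C (I N) j))" "push (prj N j) y = emb (plus C f (neg f'))"
        using E_les_right[OF ses[OF o(2), of j] oX(1), of 0 "emb (plus C f (neg f'))"] emb_closed[OF d] o by auto
      obtain w where w: "w \<in> homs C ?X (cterm C (I N) j)" "y = emb w" using emb_surj[OF y(1)] by blast
      have "emb (prj N j \<cdot> w) = emb (plus C f (neg f'))" using push_emb[OF w(1) inc_hom(2)[OF o(2)]] w y by simp
      then have "prj N j \<cdot> w = plus C f (neg f')" using emb_inj[OF cmp_hom[OF w(1) inc_hom(2)[OF o(2)]] d] by simp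
      moreover have "prj N j \<cdot> w \<in> factoring C V ?X (T N (Suc j))"
        by (rule factoring_I[OF cterm_V[OF o(2)] w(1) inc_hom(2)[OF o(2)]])
      ultimately show ?thesis using stab_proj_eq[OF V oX(1,2) f] by simp
    qed
  qed (rule h)
  then show "tr (inc M i) (prj M i) (inc N j) (prj N j) (proj (T M i) (T N j) f) = proj ?X (T N (Suc j)) g"
    unfolding tr_def using i o by simp
qed

text \<open>Both families are successive lifts, and by \<open>tr_value\<close> the stable class of a
  lift depends only on the stable class of the morphism lifted, so agreement at stage zero
  propagates.\<close>

lemma tau_Theta_map:
  assumes o: "M \<in> obj C" "N \<in> obj C" and f: "f \<in> homs C M N"
  shows "proj (T M i) (T N i) (tau i f) = proj (T M i) (T N i) (Theta_map C I f i)"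
proof (induction i)
  case 0 then show ?case using Theta_map_spec(1)[OF assms] by simp
next
  case (Suc i)
  then show ?case using tr_value(1)[OF o tau_lift[OF assms, of i]] tr_value(1)[OF o Theta_map_spec(2)[OF assms, of i]] by metis
qed

text \<open>Dimension shifting: the Yoneda product with the first \<open>m\<close> short exact
  sequences of the coresolution of \<open>N\<close>, starting from the one that ends in
  \<open>T N m\<close>.\<close>

primrec gam :: "'o \<Rightarrow> 'o \<Rightarrow> nat \<Rightarrow> int \<Rightarrow> 'x \<Rightarrow> 'x" where
  "gam N X 0 = (\<lambda>k x. x)"
| "gam N X (Suc m) = (\<lambda>k x. gam N X m (k + 1) (co k X (inc N m) (prj N m) x))"

lemma gam_hom:
  assumes o: "N \<in> obj C" "X \<in> obj C"
  shows "gam N X m k \<in> hom (E k X (T N m)) (E (k + int m) X N)"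
proof (induction m arbitrary: k)
  case 0 then show ?case using Theta_0 o by (auto intro: homI)
next
  case (Suc m)
  note 1 = co_hom[OF ses[OF o(1), of m] o(2), of k] note 2 = Suc.IH[of "k + 1"]
  show ?case
  proof (rule homI)
    fix x assume x: "x \<in> carrier (E k X (T N (Suc m)))"
    show "gam N X (Suc m) k x \<in> carrier (E (k + int (Suc m)) X N)"
      using hom_in_carrier[OF 1, of x] hom_in_carrier[OF 2] x o by (simp add: ac_simps)
    fix y assume y: "y \<in> carrier (E k X (T N (Suc m)))"
    show "gam N X (Suc m) k (x \<otimes>\<^bsub>E k X (T N (Suc m))\<^esub> y) =
      gam N X (Suc m) k x \<otimes>\<^bsub>E (k + int (Suc m)) X N\<^esub> gam N X (Suc m) k y"
      using hom_mult[OF 1, of x y] hom_in_carrier[OF 1, of x] hom_in_carrier[OF 1, of y] hom_mult[OF 2] x y o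
      by (simp add: ac_simps)
  qed
qed

lemma gam_closed: "\<lbrakk>N \<in> obj C; X \<in> obj C; x \<in> carrier (E k X (T N m))\<rbrakk> \<Longrightarrow> gam N X m k x \<in> carrier (E (k + int m) X N)"
  using hom_in_carrier[OF gam_hom] by blast

lemma gam_pull:
  assumes o: "N \<in> obj C" and f: "f \<in> homs C X' X" and x: "x \<in> carrier (E k X (T N m))"
  shows "pull f (gam N X m k x) = gam N X' m k (pull f x)"
  using x
proof (induction m arbitrary: k x)
  case (Suc m)
  have oX: "X \<in> obj C" using homs_obj f by auto
  have c: "co k X (inc N m) (prj N m) x \<in> carrier (E (k + 1) X (T N m))"
    using co_closed'[OF ses[OF o, of m] _ oX, of x k] Suc.prems o by simp
  have "pull f (co k X (inc N m) (prj N m) x) = co k X' (inc N m) (prj N m) (pull f x)"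
    using E_co_pull[OF ses[OF o] _ f, of x k m] Suc.prems o by simp
  then show ?case using Suc.IH[OF c] by simp
qed simp

text \<open>Products with sequences on the side of \<open>N\<close> commute with the one on the side
  of \<open>M\<close> without sign, by \<open>E_co_cc\<close> at each of the \<open>m\<close>
  shifts.\<close>

lemma gam_conn:
  assumes o: "M \<in> obj C" "N \<in> obj C" and x: "x \<in> carrier (E k (T M i) (T N m))"
  shows "conn M i (k + int m) N (gam N (T M i) m k x) = gam N (T M (Suc i)) m (k + 1) (conn M i k (T N m) x)"
  using x
proof (induction m arbitrary: k x)
  case 0 then show ?case using Theta_0 o by simp
next
  case (Suc m)
  have oX: "T M i \<in> obj C" "T N (Suc m) \<in> obj C" using o by auto
  let ?y = "co k (T M i) (inc N m) (prj N m) x"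
  have c: "?y \<in> carrier (E (k + 1) (T M i) (T N m))"
    using co_closed'[OF ses[OF o(2), of m] _ oX(1), of x k] Suc.prems o by simp
  have "conn M i (k + 1) (T N m) ?y = co (k + 1) (T M (Suc i)) (inc N m) (prj N m) (conn M i k (T N (Suc m)) x)"
    using E_co_cc[OF ses[OF o(2), of m] ses[OF o(1), of i], of x k] Suc.prems o by simp
  then show ?case using Suc.IH[OF c] by (simp add: ac_simps)
qed

lemma gam_push:
  assumes o: "N \<in> obj C" "N' \<in> obj C" "X \<in> obj C" and g: "\<theta> 0 = g" "\<And>i. lift N i N' i (\<theta> i) (\<theta> (Suc i))"
    and x: "x \<in> carrier (E k X (T N m))"
  shows "push g (gam N X m k x) = gam N' X m k (push (\<theta> m) x)"
  using x
proof (induction m arbitrary: k x)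
  case 0 then show ?case using g by simp
next
  case (Suc m)
  have c: "co k X (inc N m) (prj N m) x \<in> carrier (E (k + 1) X (T N m))"
    using co_closed'[OF ses[OF o(1), of m] _ o(3), of x k] Suc.prems o by simp
  have "push (\<theta> m) (co k X (inc N m) (prj N m) x) = co k X (inc N' m) (prj N' m) (push (\<theta> (Suc m)) x)"
    using E_co_nat[OF ses[OF o(1)] ses[OF o(2)] _ o(3) g(2)[of m, unfolded lift_def], of x k] Suc.prems o by simp
  then show ?case using Suc.IH[OF c] by simp
qed

text \<open>The kernel of each shift is an image of Ext, in degree \<open>k\<close>, of a cosyzygy
  into a term of the coresolution of \<open>N\<close>; this is zero as \<open>k\<close> is at least
  1. In degree zero these are Hom groups and injectivity fails in general.\<close>

lemma gam_inj:
  assumes o: "M \<in> obj C" "N \<in> obj C" and k: "k \<ge> 1"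
    and x: "x \<in> carrier (E k (T M (Suc i)) (T N m))" and y: "y \<in> carrier (E k (T M (Suc i)) (T N m))"
    and e: "gam N (T M (Suc i)) m k x = gam N (T M (Suc i)) m k y"
  shows "x = y"
  using k x y e
proof (induction m arbitrary: k x y)
  case (Suc m)
  let ?X = "T M (Suc i)"
  have oX: "?X \<in> obj C" "T N (Suc m) \<in> obj C" "T N m \<in> obj C" using o by auto
  note hom = co_hom[OF ses[OF o(2), of m] oX(1), of k]
  have xy: "x \<in> carrier (E k ?X (cod C (prj N m)))" "y \<in> carrier (E k ?X (cod C (prj N m)))" using Suc.prems o by auto
  have d: "dom C (inc N m) = T N m" using o by simp
  have cx: "co k ?X (inc N m) (prj N m) x \<in> carrier (E (k + 1) ?X (T N m))"
    "co k ?X (inc N m) (prj N m) y \<in> carrier (E (k + 1) ?X (T N m))"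
    using hom_in_carrier[OF hom xy(1)] hom_in_carrier[OF hom xy(2)] d by auto
  have eq: "co k ?X (inc N m) (prj N m) x = co k ?X (inc N m) (prj N m) y"
    by (rule Suc.IH[OF _ cx]) (use Suc.prems in auto)
  interpret G: comm_group "E k ?X (cod C (prj N m))" using o by (intro E_group) auto
  interpret H: comm_group "E (k + 1) ?X (dom C (inc N m))" using o by (intro E_group) auto
  let ?z = "x \<otimes>\<^bsub>E k ?X (cod C (prj N m))\<^esub> inv\<^bsub>E k ?X (cod C (prj N m))\<^esub> y"
  have z: "?z \<in> carrier (E k ?X (cod C (prj N m)))" using xy by simp
  have "?z \<otimes>\<^bsub>E k ?X (cod C (prj N m))\<^esub> y = x" using xy by (simp add: G.m_assoc)
  then have "co k ?X (inc N m) (prj N m) ?z \<otimes>\<^bsub>E (k + 1) ?X (dom C (inc N m))\<^esub> co k ?X (inc N m) (prj N m) y =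
    co k ?X (inc N m) (prj N m) y"
    using hom_mult[OF hom z xy(2)] eq by simp
  then have "co k ?X (inc N m) (prj N m) ?z = \<one>\<^bsub>E (k + 1) ?X (dom C (inc N m))\<^esub>"
    using hom_in_carrier[OF hom z] hom_in_carrier[OF hom xy(2)] by simp
  then obtain w where w: "w \<in> carrier (E k ?X (dom C (prj N m)))" "push (prj N m) w = ?z"
    using E_les_right[OF ses[OF o(2), of m] oX(1) _ z] Suc.prems(1) by auto
  have "w = \<one>\<^bsub>E k ?X (cterm C (I N) m)\<^esub>"
    using w(1) vanish[OF o(1) cterm_V[OF o(2)] Suc.prems(1), of i m] o by simp
  then have "?z = \<one>\<^bsub>E k ?X (cod C (prj N m))\<^esub>"
    using w(2) E_push_one[OF inc_hom(2)[OF o(2)] oX(1)] o by simp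
  then have "\<one>\<^bsub>E k ?X (cod C (prj N m))\<^esub> \<otimes>\<^bsub>E k ?X (cod C (prj N m))\<^esub> y = x"
    using \<open>?z \<otimes>\<^bsub>E k ?X (cod C (prj N m))\<^esub> y = x\<close> by simp
  then show ?case using xy by simp
qed simp

text \<open>The obstruction to a preimage under each shift lies in degree \<open>k + 1\<close>, so
  degree zero is allowed here: every class of degree \<open>m\<close> comes from a morphism to
  \<open>T N m\<close>.\<close>

lemma gam_surj:
  assumes o: "M \<in> obj C" "N \<in> obj C" and k: "k \<ge> 0" and z: "z \<in> carrier (E (k + int m) (T M (Suc i)) N)"
  shows "\<exists>x\<in>carrier (E k (T M (Suc i)) (T N m)). gam N (T M (Suc i)) m k x = z"
  using k z
proof (induction m arbitrary: k)
  case 0 then show ?case using Theta_0 o by simp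
next
  case (Suc m)
  let ?X = "T M (Suc i)"
  have oX: "?X \<in> obj C" using o by auto
  obtain y where y: "y \<in> carrier (E (k + 1) ?X (T N m))" "gam N ?X m (k + 1) y = z"
    using Suc.IH[of "k + 1"] Suc.prems by (auto simp: ac_simps)
  have "push (inc N m) y \<in> carrier (E (k + 1) ?X (cterm C (I N) m))"
    by (rule E_push_closed[OF y(1) inc_hom(1)[OF o(2)] oX])
  then have "push (inc N m) y = \<one>\<^bsub>E (k + 1) ?X (cterm C (I N) m)\<^esub>"
    using vanish[OF o(1) cterm_V[OF o(2)], of "k + 1" i m] Suc.prems by simp
  then obtain x where "x \<in> carrier (E k ?X (T N (Suc m)))" "co k ?X (inc N m) (prj N m) x = y"
    using E_les_left[OF ses[OF o(2), of m] oX Suc.prems(1), of y] y o by auto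
  then show ?case using y by auto
qed

section \<open>Iterated satellites of Ext\<close>

definition contra :: "int \<Rightarrow> 'o \<Rightarrow> ('o, 'm, 'x) abfun" where
  "contra k N = \<lparr>fob = (\<lambda>M. E k M N), fmor = pull\<rparr>"

definition sat_sys :: "int \<Rightarrow> 'o \<Rightarrow> 'o \<Rightarrow> nat \<Rightarrow> 'x monoid" where
  "sat_sys n M N i = fob ((sat_V C I ^^ i) (contra (n + int i) N)) M"

definition sat_trans :: "int \<Rightarrow> 'o \<Rightarrow> 'o \<Rightarrow> nat \<Rightarrow> 'x \<Rightarrow> 'x" where
  "sat_trans n M N i = conn M i (n + int i) N"

definition stab_trans :: "int \<Rightarrow> 'o \<Rightarrow> 'o \<Rightarrow> nat \<Rightarrow> 'm set \<Rightarrow> 'm set" where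
  "stab_trans n M N i = tr (inc M i) (prj M i) (inc N (shift n i)) (prj N (shift n i))"

lemma sat_fmor: "fmor ((sat_V C I ^^ i) F) f = fmor F (tau i f)"
  by (induction i arbitrary: f) (simp_all add: sat_V_def)

text \<open>Inductively the cosyzygy \<open>T U i\<close> is a retract of some \<open>J\<close> in
  \<open>V\<close>. Extending the section \<open>s\<close> over the term and composing with
  \<open>r\<close> gives a retraction of \<open>inc U i\<close>, so the sequence splits and the next
  cosyzygy is a retract of its term.\<close>

lemma prj_section:
  assumes U: "U \<in> V"
  shows "\<exists>\<sigma>\<in>homs C (T U (Suc i)) (cterm C (I U) i). prj U i \<cdot> \<sigma> = idn C (T U (Suc i))"
proof -
  note o = V_obj[OF U]
  have sec: "\<exists>\<sigma>\<in>homs C (T U (Suc i)) (cterm C (I U) i). prj U i \<cdot> \<sigma> = idn C (T U (Suc i))"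
    if J: "J \<in> V" "r \<in> homs C J (T U i)" "s \<in> homs C (T U i) J" "r \<cdot> s = idn C (T U i)" for i J r s
  proof -
    obtain s' where s': "s' \<in> homs C (cterm C (I U) i) J" "s' \<cdot> inc U i = s" using extend[OF o J(3,1)] .
    have "(r \<cdot> s') \<cdot> inc U i = idn C (dom C (inc U i))"
      using cmp_assoc[OF inc_hom(1)[OF o] s'(1) J(2)] s' J o by simp
    moreover have "r \<cdot> s' \<in> homs C (cod C (inc U i)) (dom C (inc U i))" using cmp_hom[OF s'(1) J(2)] o by simp
    ultimately obtain \<sigma> where "\<sigma> \<in> homs C (cod C (prj U i)) (dom C (prj U i))" "prj U i \<cdot> \<sigma> = idn C (cod C (prj U i))"
      using retraction_section[OF ses[OF o]] by metis
    then show ?thesis using o by auto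
  qed
  show ?thesis
  proof (induction i)
    case 0
    show ?case using sec[OF U, of "idn C U" 0 "idn C U"] idn_hom[OF o] Theta_0[OF o] o by simp
  next
    case (Suc i)
    then obtain \<sigma> where "\<sigma> \<in> homs C (T U (Suc i)) (cterm C (I U) i)" "prj U i \<cdot> \<sigma> = idn C (T U (Suc i))" by blast
    then show ?case using sec[OF cterm_V[OF o] inc_hom(2)[OF o]] by blast
  qed
qed

lemma kernel_mem: "x \<in> kernel G H h \<longleftrightarrow> x \<in> carrier G \<and> h x = \<one>\<^bsub>H\<^esub>"
  by (simp add: kernel_def)

text \<open>The inner kernel conditions of the iterated satellite are automatic: on an object of \<open>V\<close> the
  sequences of the coresolution split, so that the satellite vanishes there.\<close>

lemma sat_iterate:
  assumes "M \<in> obj C" "N \<in> obj C"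
  shows "fob ((sat_V C I ^^ Suc i) (contra k N)) M =
    (E k (T M (Suc i)) N)\<lparr>carrier := {x \<in> carrier (E k (T M (Suc i)) N). pull (prj M i) x = \<one>\<^bsub>E k (cterm C (I M) i) N\<^esub>}\<rparr>"
  using assms
proof (induction i arbitrary: M)
  case 0
  then show ?case by (auto simp: sat_V_def contra_def kernel_def)
next
  case (Suc i)
  note o = Suc.prems
  have oT: "T M 1 \<in> obj C" "cterm C (I M) 0 \<in> obj C" using o by auto
  have oc: "cterm C (I M) 0 \<in> V" using cterm_V[OF o(1)] .
  let ?F = "(sat_V C I ^^ Suc i) (contra k N)" let ?J = "cterm C (I M) 0"
  have TM: "T (T M 1) (Suc i) = T M (Suc (Suc i))" "prj (T M 1) i = prj M (Suc i)"
    "cterm C (I (T M 1)) i = cterm C (I M) (Suc i)"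
    using T_T[OF o(1)] tail[OF o(1)] by (auto simp: cterm_def)
  have F: "fob ?F (T M 1) = (E k (T M (Suc (Suc i))) N)\<lparr>carrier := {x \<in> carrier (E k (T M (Suc (Suc i))) N).
      pull (prj M (Suc i)) x = \<one>\<^bsub>E k (cterm C (I M) (Suc i)) N\<^esub>}\<rparr>"
    using Suc.IH[OF oT(1) o(2)] TM by simp
  have pm: "prj M 0 \<in> homs C ?J (T M 1)" using inc_hom(2)[OF o(1), of 0] by simp
  have auto1: "fmor ?F (prj M 0) x = \<one>\<^bsub>fob ?F ?J\<^esub>" if x: "x \<in> carrier (fob ?F (T M 1))" for x
  proof -
    let ?\<tau> = "tau (Suc i) (prj M 0)"
    have t: "?\<tau> \<in> homs C (T ?J (Suc i)) (T M (Suc (Suc i)))"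
      using tau_hom[OF oT(2,1) pm, of "Suc i"] TM by simp
    have x': "x \<in> carrier (E k (T M (Suc (Suc i))) N)" "pull (prj M (Suc i)) x = \<one>\<^bsub>E k (cterm C (I M) (Suc i)) N\<^esub>"
      using x unfolding F by auto
    have "lift ?J i (T M 1) i (tau i (prj M 0)) ?\<tau>" by (rule tau_lift[OF oT(2,1) pm])
    then obtain u where u: "u \<in> homs C (cterm C (I ?J) i) (cterm C (I M) (Suc i))" "prj M (Suc i) \<cdot> u = ?\<tau> \<cdot> prj ?J i"
      unfolding lift_iff[OF oT(2,1)] using TM by auto
    have px: "pull ?\<tau> x \<in> carrier (E k (T ?J (Suc i)) N)" by (rule E_pull_closed[OF x'(1) t o(2)])
    have p: "pull (prj ?J i) (pull ?\<tau> x) = pull u (pull (prj M (Suc i)) x)"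
      using E_pull_comp[OF x'(1) t inc_hom(2)[OF oT(2)]] E_pull_comp[OF x'(1) inc_hom(2)[OF o(1)] u(1)] u(2) by simp
    then have p1: "pull (prj ?J i) (pull ?\<tau> x) = \<one>\<^bsub>E k (cterm C (I ?J) i) N\<^esub>"
      using x'(2) E_pull_one[OF u(1) o(2)] by simp
    obtain \<sigma> where s: "\<sigma> \<in> homs C (T ?J (Suc i)) (cterm C (I ?J) i)" "prj ?J i \<cdot> \<sigma> = idn C (T ?J (Suc i))"
      using prj_section[OF oc] by blast
    \<comment> \<open>The class is killed by \<open>prj ?J i\<close>, and the section makes pulling
      back along \<open>prj ?J i\<close> injective.\<close>
    have "pull ?\<tau> x = pull \<sigma> (pull (prj ?J i) (pull ?\<tau> x))"
      using E_pull_comp[OF px inc_hom(2)[OF oT(2)] s(1)] s(2) E_pull_id[OF px] by simp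
    also have "\<dots> = \<one>\<^bsub>E k (T ?J (Suc i)) N\<^esub>" unfolding p1 by (rule E_pull_one[OF s(1) o(2)])
    finally have "pull ?\<tau> x = \<one>\<^bsub>E k (T ?J (Suc i)) N\<^esub>" .
    moreover have "fmor ?F (prj M 0) x = pull ?\<tau> x" unfolding sat_fmor by (simp add: contra_def)
    moreover have "\<one>\<^bsub>fob ?F ?J\<^esub> = \<one>\<^bsub>E k (T ?J (Suc i)) N\<^esub>" using Suc.IH[OF oT(2) o(2)] by simp
    ultimately show ?thesis by simp
  qed
  have "kernel (fob ?F (T M 1)) (fob ?F ?J) (fmor ?F (prj M 0)) = carrier (fob ?F (T M 1))"
    using auto1 by (auto simp: kernel_mem)
  then have "fob (sat_V C I ?F) M = fob ?F (T M 1)" by (simp add: sat_V_def del: funpow.simps)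
  then show ?case using F by simp
qed

lemma sat_sys_Suc:
  assumes "M \<in> obj C" "N \<in> obj C"
  shows "x \<in> carrier (sat_sys n M N (Suc i)) \<longleftrightarrow> x \<in> carrier (E (n + int (Suc i)) (T M (Suc i)) N) \<and>
      pull (prj M i) x = \<one>\<^bsub>E (n + int (Suc i)) (cterm C (I M) i) N\<^esub>"
    "x \<otimes>\<^bsub>sat_sys n M N (Suc i)\<^esub> y = x \<otimes>\<^bsub>E (n + int (Suc i)) (T M (Suc i)) N\<^esub> y"
  unfolding sat_sys_def sat_iterate[OF assms] by auto

section \<open>The two direct systems\<close>

lemma shift_int: "nat (- n) \<le> i \<Longrightarrow> int (shift n i) = n + int i"
  by (simp add: shift_def)

lemma shift_Suc: "nat (- n) \<le> i \<Longrightarrow> shift n (Suc i) = Suc (shift n i)"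
  unfolding shift_def by linarith

text \<open>Consecutive maps of the long exact sequence compose to zero, so the connecting morphism
  lands in the kernel that defines the next satellite.\<close>

lemma sat_sys_dirsys:
  assumes o: "M \<in> obj C" "N \<in> obj C" shows "dirsys 1 (sat_sys n M N) (sat_trans n M N)"
proof
  fix i :: nat and x assume "1 \<le> i" and x: "x \<in> carrier (sat_sys n M N i)"
  then obtain j where j: "i = Suc j" by (cases i) auto
  have x': "x \<in> carrier (E (n + int i) (T M i) N)" using x sat_sys_Suc(1)[OF o] j by blast
  have c: "sat_trans n M N i x \<in> carrier (E (n + int i + 1) (T M (Suc i)) N)"
    unfolding sat_trans_def by (rule conn_closed[OF o x'])
  moreover have "pull (prj M i) (sat_trans n M N i x) = \<one>\<^bsub>E (n + int i + 1) (cterm C (I M) i) N\<^esub>"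
    using pull_cc_right[OF ses[OF o(1), of i] _ o(2), of x "n + int i"] x' o by (simp add: sat_trans_def)
  ultimately show "sat_trans n M N i x \<in> carrier (sat_sys n M N (Suc i))"
    unfolding sat_sys_Suc(1)[OF o] by (simp add: ac_simps)
  fix y assume y: "y \<in> carrier (sat_sys n M N i)"
  have y': "y \<in> carrier (E (n + int i) (T M i) N)" using y sat_sys_Suc(1)[OF o] j by blast
  interpret G: comm_group "E (n + int (Suc j)) (T M (Suc j)) N" using o by (intro E_group) auto
  interpret H: comm_group "E (n + int (Suc j)) (cterm C (I M) j) N" using o by (intro E_group) auto
  have "pull (prj M j) (x \<otimes>\<^bsub>E (n + int (Suc j)) (T M (Suc j)) N\<^esub> y) = \<one>\<^bsub>E (n + int (Suc j)) (cterm C (I M) j) N\<^esub>"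
    using hom_mult[OF E_pull_hom[OF inc_hom(2)[OF o(1)] o(2)], of x "n + int (Suc j)" j y] x y
    unfolding j sat_sys_Suc(1)[OF o] by (simp del: of_nat_Suc)
  then show "x \<otimes>\<^bsub>sat_sys n M N i\<^esub> y \<in> carrier (sat_sys n M N i)"
    unfolding j sat_sys_Suc(1)[OF o] sat_sys_Suc(2)[OF o] using G.m_closed x' y' j by blast
  show "sat_trans n M N i (x \<otimes>\<^bsub>sat_sys n M N i\<^esub> y) =
    sat_trans n M N i x \<otimes>\<^bsub>sat_sys n M N (Suc i)\<^esub> sat_trans n M N i y"
    unfolding j sat_sys_Suc(2)[OF o] sat_trans_def
    using hom_mult[OF cc_hom[OF ses[OF o(1), of "Suc j"] o(2)], of x "n + int (Suc j)" y] x' y' j o by (simp add: ac_simps)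
qed

lemma stab_elem:
  assumes "M \<in> obj C" "N \<in> obj C"
  shows "c \<in> carrier (check_sys C V I n M N i) \<longleftrightarrow> (\<exists>f\<in>homs C (T M i) (T N (shift n i)). c = proj (T M i) (T N (shift n i)) f)"
  using stab_carrier[OF V, of "T M i" "T N (shift n i)"] assms by (auto simp: check_sys_def)

lemma stab_trans_value:
  assumes o: "M \<in> obj C" "N \<in> obj C" and i: "nat (- n) \<le> i" and l: "lift M i N (shift n i) f g"
  shows "stab_trans n M N i (proj (T M i) (T N (shift n i)) f) = proj (T M (Suc i)) (T N (shift n (Suc i))) g"
  unfolding stab_trans_def shift_Suc[OF i] by (rule tr_value(1)[OF o l])

text \<open>Elements are represented by morphisms and their transitions by lifts, so additivity of
  the transition maps is additivity of lifts.\<close>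

lemma check_sys_dirsys:
  assumes o: "M \<in> obj C" "N \<in> obj C" shows "dirsys (nat (- n)) (check_sys C V I n M N) (stab_trans n M N)"
proof
  fix i c assume i: "nat (- n) \<le> i" and "c \<in> carrier (check_sys C V I n M N i)"
  let ?A = "T M i" let ?B = "T N (shift n i)"
  obtain f where f: "f \<in> homs C ?A ?B" "c = proj ?A ?B f" using stab_elem[OF o] \<open>c \<in> _\<close> by blast
  obtain g where g: "lift M i N (shift n i) f g" using lift_ex[OF o f(1)] .
  have ob: "?A \<in> obj C" "?B \<in> obj C" "T M (Suc i) \<in> obj C" "T N (shift n (Suc i)) \<in> obj C" using o by auto
  have gh: "g \<in> homs C (T M (Suc i)) (T N (shift n (Suc i)))" using lift_homs(2)[OF o g] shift_Suc[OF i] by simp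
  show "stab_trans n M N i c \<in> carrier (check_sys C V I n M N (Suc i))"
    unfolding stab_elem[OF o] f(2) stab_trans_value[OF o i g] using gh by blast
  fix d assume "d \<in> carrier (check_sys C V I n M N i)"
  then obtain f' where f': "f' \<in> homs C ?A ?B" "d = proj ?A ?B f'" using stab_elem[OF o] by blast
  obtain g' where g': "lift M i N (shift n i) f' g'" using lift_ex[OF o f'(1)] .
  have gh': "g' \<in> homs C (T M (Suc i)) (T N (shift n (Suc i)))" using lift_homs(2)[OF o g'] shift_Suc[OF i] by simp
  have m: "c \<otimes>\<^bsub>check_sys C V I n M N i\<^esub> d = proj ?A ?B (plus C f f')"
    unfolding f(2) f'(2) check_sys_def by (rule stab_mult[OF V ob(1,2) f(1) f'(1)])
  show "c \<otimes>\<^bsub>check_sys C V I n M N i\<^esub> d \<in> carrier (check_sys C V I n M N i)"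
    unfolding m stab_elem[OF o] using plus_hom[OF f(1) f'(1)] by blast
  show "stab_trans n M N i (c \<otimes>\<^bsub>check_sys C V I n M N i\<^esub> d) =
    stab_trans n M N i c \<otimes>\<^bsub>check_sys C V I n M N (Suc i)\<^esub> stab_trans n M N i d"
    unfolding m unfolding f(2) f'(2) stab_trans_value[OF o i g] stab_trans_value[OF o i g']
      stab_trans_value[OF o i lift_plus[OF o g g']] unfolding check_sys_def
    by (rule stab_mult[OF V ob(3,4) gh gh', symmetric])
qed

text \<open>The degrees add up to \<open>1 + shift n i\<close>, which is \<open>n + Suc i\<close>,
  so stage \<open>i\<close> of the stable system is sent to stage \<open>Suc i\<close> of the
  satellites.\<close>

definition delta :: "int \<Rightarrow> 'o \<Rightarrow> 'o \<Rightarrow> nat \<Rightarrow> 'm \<Rightarrow> 'x" where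
  "delta n M N i f = gam N (T M (Suc i)) (shift n i) 1 (conn M i 0 (T N (shift n i)) (emb f))"

definition phi :: "int \<Rightarrow> 'o \<Rightarrow> 'o \<Rightarrow> nat \<Rightarrow> 'm set \<Rightarrow> 'x" where
  "phi n M N i = induced (delta n M N i)"

section \<open>The comparison map and its bijectivity\<close>

lemma phi_value:
  assumes o: "M \<in> obj C" "N \<in> obj C" and f: "f \<in> homs C (T M i) (T N (shift n i))"
  shows "phi n M N i (proj (T M i) (T N (shift n i)) f) = delta n M N i f"
  unfolding phi_def
proof (rule induced_eq[OF V _ _ f])
  show "delta n M N i g = delta n M N i f"
    if "g \<in> homs C (T M i) (T N (shift n i))" "proj (T M i) (T N (shift n i)) g = proj (T M i) (T N (shift n i)) f" for g
    unfolding delta_def using conn_cong[OF o(1) _ that(1) f that(2)] o by simp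
qed (use o in auto)

lemma conn_emb_closed:
  assumes o: "M \<in> obj C" "B \<in> obj C" and f: "f \<in> homs C (T M i) B"
  shows "conn M i 0 B (emb f) \<in> carrier (E 1 (T M (Suc i)) B)"
  using conn_closed[OF o emb_closed[OF f]] by simp

text \<open>Pulling back along \<open>prj M i\<close> commutes with the dimension shift and already
  kills the connecting image of \<open>f\<close>.\<close>

lemma delta_sat:
  assumes o: "M \<in> obj C" "N \<in> obj C" and i: "nat (- n) \<le> i" and f: "f \<in> homs C (T M i) (T N (shift n i))"
  shows "delta n M N i f \<in> carrier (sat_sys n M N (Suc i))"
proof -
  let ?y = "conn M i 0 (T N (shift n i)) (emb f)"
  have oT: "T N (shift n i) \<in> obj C" "T M (Suc i) \<in> obj C" "cterm C (I M) i \<in> obj C" using o by auto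
  have y: "?y \<in> carrier (E 1 (T M (Suc i)) (T N (shift n i)))" by (rule conn_emb_closed[OF o(1) oT(1) f])
  have e: "1 + int (shift n i) = n + int (Suc i)" using shift_int[OF i] by simp
  have p: "pull (prj M i) ?y = \<one>\<^bsub>E 1 (cterm C (I M) i) (T N (shift n i))\<^esub>"
    using pull_cc_right[OF ses[OF o(1), of i] _ oT(1), of "emb f" 0] emb_closed[OF f] o by simp
  have "pull (prj M i) (delta n M N i f) = gam N (cterm C (I M) i) (shift n i) 1 \<one>\<^bsub>E 1 (cterm C (I M) i) (T N (shift n i))\<^esub>"
    unfolding delta_def gam_pull[OF o(2) inc_hom(2)[OF o(1)] y] p ..
  also have "\<dots> = \<one>\<^bsub>E (1 + int (shift n i)) (cterm C (I M) i) N\<^esub>"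
    by (rule hom_one[OF gam_hom[OF o(2) oT(3)]]) (use E_grp o oT in auto)
  finally show ?thesis unfolding sat_sys_Suc(1)[OF o] using gam_closed[OF o(2) oT(2) y] e by (simp add: delta_def)
qed

text \<open>The longer shift starts by applying the connecting morphism of \<open>N\<close> to
  \<open>g\<close>, which equals that of \<open>M\<close> applied to \<open>f\<close>. So
  \<open>delta\<close> of \<open>f\<close> is also a pure dimension shift of a morphism.\<close>

lemma delta_lift:
  assumes o: "M \<in> obj C" "N \<in> obj C" and l: "lift M i N (shift n i) f g"
  shows "delta n M N i f = gam N (T M (Suc i)) (Suc (shift n i)) 0 (emb g)"
  unfolding delta_def using E_cc0_co0[OF ses[OF o(1)] ses[OF o(2)] l[unfolded lift_def]] o by simp

text \<open>The image of \<open>f\<close> is a dimension shift of its lift \<open>g\<close>, and the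
  next connecting morphism passes through the shift; what results is the image of \<open>g\<close>,
  which represents the transition of \<open>f\<close>.\<close>

lemma phi_map:
  assumes o: "M \<in> obj C" "N \<in> obj C"
  shows "dirsys_map (nat (- n)) (check_sys C V I n M N) (stab_trans n M N) 1 (sat_sys n M N) (sat_trans n M N) 1 (phi n M N)"
proof (intro dirsys_map.intro dirsys_map_axioms.intro check_sys_dirsys[OF o] sat_sys_dirsys[OF o])
  fix i c assume i: "nat (- n) \<le> i" and c: "c \<in> carrier (check_sys C V I n M N i)"
  let ?s = "shift n i"
  obtain f where f: "f \<in> homs C (T M i) (T N ?s)" "c = proj (T M i) (T N ?s) f" using stab_elem[OF o] c by blast
  show "phi n M N i c \<in> carrier (sat_sys n M N (i + 1))"
    unfolding f(2) phi_value[OF o f(1)] using delta_sat[OF o i f(1)] by simp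
  obtain g where g: "lift M i N ?s f g" using lift_ex[OF o f(1)] .
  have gh: "g \<in> homs C (T M (Suc i)) (T N (shift n (Suc i)))" using lift_homs(2)[OF o g] shift_Suc[OF i] by simp
  have e: "emb g \<in> carrier (E 0 (T M (Suc i)) (T N (Suc ?s)))" using emb_closed[OF gh] shift_Suc[OF i] by simp
  have k: "0 + int (Suc ?s) = n + int (Suc i)" using shift_int[OF i] by simp
  have "sat_trans n M N (Suc i) (delta n M N i f) = delta n M N (Suc i) g"
    unfolding delta_lift[OF o g] sat_trans_def using gam_conn[OF o e] unfolding k
    by (simp add: delta_def shift_Suc[OF i] del: gam.simps)
  then show "sat_trans n M N (i + 1) (phi n M N i c) = phi n M N (Suc i) (stab_trans n M N i c)"
    unfolding f(2) phi_value[OF o f(1)] stab_trans_value[OF o i g] phi_value[OF o gh] by simp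
qed simp

definition Phi :: "int \<Rightarrow> 'o \<Rightarrow> 'o \<Rightarrow> (nat \<times> 'm set) set \<Rightarrow> (nat \<times> 'x) set" where
  "Phi n M N = dirsys_map.map_cl 1 (sat_sys n M N) (sat_trans n M N) 1 (phi n M N)"

lemma Phi_value:
  assumes o: "M \<in> obj C" "N \<in> obj C" and i: "nat (- n) \<le> i" and f: "f \<in> homs C (T M i) (T N (shift n i))"
  shows "Phi n M N (dl_class (nat (- n)) (check_sys C V I n M N) (stab_trans n M N) i (proj (T M i) (T N (shift n i)) f)) =
    dl_class 1 (sat_sys n M N) (sat_trans n M N) (Suc i) (delta n M N i f)"
proof -
  interpret dirsys_map "nat (- n)" "check_sys C V I n M N" "stab_trans n M N" 1 "sat_sys n M N" "sat_trans n M N" 1 "phi n M N"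
    by (rule phi_map[OF o])
  have "proj (T M i) (T N (shift n i)) f \<in> carrier (check_sys C V I n M N i)" using stab_elem[OF o] f by blast
  from map_cl[OF i this] show ?thesis unfolding Phi_def phi_value[OF o f] by simp
qed

lemma Phi_iso:
  assumes o: "M \<in> obj C" "N \<in> obj C"
  shows "Phi n M N \<in> iso (dir_colim (nat (- n)) (check_sys C V I n M N) (stab_trans n M N))
    (dir_colim 1 (sat_sys n M N) (sat_trans n M N))"
proof -
  interpret dirsys_map "nat (- n)" "check_sys C V I n M N" "stab_trans n M N" 1 "sat_sys n M N" "sat_trans n M N" 1 "phi n M N"
    by (rule phi_map[OF o])
  show ?thesis unfolding Phi_def
  proof (rule map_cl_iso)
    fix i c d assume i: "nat (- n) \<le> i" and cd: "c \<in> carrier (check_sys C V I n M N i)" "d \<in> carrier (check_sys C V I n M N i)"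
    let ?s = "shift n i" let ?A = "T M i" let ?B = "T N ?s" let ?X = "T M (Suc i)"
    have oT: "?A \<in> obj C" "?B \<in> obj C" "?X \<in> obj C" using o by auto
    obtain f where f: "f \<in> homs C ?A ?B" "c = proj ?A ?B f" using stab_elem[OF o] cd by blast
    obtain g where g: "g \<in> homs C ?A ?B" "d = proj ?A ?B g" using stab_elem[OF o] cd by blast
    note cf = conn_emb_closed[OF o(1) oT(2) f(1)] note cg = conn_emb_closed[OF o(1) oT(2) g(1)]
    have "c \<otimes>\<^bsub>check_sys C V I n M N i\<^esub> d = proj ?A ?B (plus C f g)"
      unfolding f(2) g(2) check_sys_def by (rule stab_mult[OF V oT(1,2) f(1) g(1)])
    then have 1: "phi n M N i (c \<otimes>\<^bsub>check_sys C V I n M N i\<^esub> d) = delta n M N i (plus C f g)"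
      using phi_value[OF o plus_hom[OF f(1) g(1)]] by simp
    have "conn M i 0 ?B (emb (plus C f g)) = conn M i 0 ?B (emb f) \<otimes>\<^bsub>E 1 ?X ?B\<^esub> conn M i 0 ?B (emb g)"
      using hom_mult[OF cc_hom[OF ses[OF o(1), of i] oT(2)], of "emb f" 0 "emb g"] emb_plus[OF f(1) g(1)]
        emb_closed[OF f(1)] emb_closed[OF g(1)] o by simp
    then have "delta n M N i (plus C f g) = delta n M N i f \<otimes>\<^bsub>E (1 + int ?s) ?X N\<^esub> delta n M N i g"
      unfolding delta_def using hom_mult[OF gam_hom[OF o(2) oT(3)] cf cg] by simp
    moreover have "1 + int ?s = n + int (Suc i)" using shift_int[OF i] by simp
    ultimately show "phi n M N i (c \<otimes>\<^bsub>check_sys C V I n M N i\<^esub> d) =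
      phi n M N i c \<otimes>\<^bsub>sat_sys n M N (i + 1)\<^esub> phi n M N i d"
      unfolding 1 unfolding f(2) g(2) phi_value[OF o f(1)] phi_value[OF o g(1)]
      using sat_sys_Suc(2)[OF o] by simp
    \<comment> \<open>Dimension shifting is injective in degree one, so the connecting images agree;
      the stable transition is defined through the connecting image and so cannot tell
      \<open>c\<close> and \<open>d\<close> apart.\<close>
    assume "phi n M N i c = phi n M N i d"
    then have "delta n M N i f = delta n M N i g"
      unfolding f(2) g(2) phi_value[OF o f(1)] phi_value[OF o g(1)] .
    then have e: "conn M i 0 ?B (emb f) = conn M i 0 ?B (emb g)"
      unfolding delta_def using gam_inj[OF o _ cf cg] by simp
    have ind: "induced (\<lambda>f. conn M i 0 ?B (emb f)) (proj ?A ?B h) = conn M i 0 ?B (emb h)" if "h \<in> homs C ?A ?B" for h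
      by (rule induced_eq[OF V oT(1,2) that]) (rule conn_cong[OF o(1) oT(2) _ that])
    show "stab_trans n M N i c = stab_trans n M N i d"
      unfolding stab_trans_def tr_def using ind[OF f(1)] ind[OF g(1)] e f(2) g(2) o by simp
  next
    fix i x assume i: "nat (- n) \<le> i" "1 \<le> i" and x: "x \<in> carrier (sat_sys n M N i)"
    let ?s = "shift n i"
    obtain j where j: "i = Suc j" using i by (cases i) auto
    have x': "x \<in> carrier (E (0 + int ?s) (T M (Suc j)) N)"
      using x unfolding j sat_sys_Suc(1)[OF o] using shift_int[OF i(1)] j by simp
    \<comment> \<open>Surjectivity of \<open>gam\<close> in degree zero is available at cosyzygies
      of positive index, which \<open>i = Suc j\<close> provides.\<close>
    obtain y where y: "y \<in> carrier (E 0 (T M i) (T N ?s))" "gam N (T M i) ?s 0 y = x"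
      using gam_surj[OF o _ x'] j by auto
    obtain f where f: "f \<in> homs C (T M i) (T N ?s)" "y = emb f" using emb_surj[OF y(1)] by blast
    have "delta n M N i f = sat_trans n M N i x"
      unfolding delta_def sat_trans_def using gam_conn[OF o y(1)] y(2) f(2) shift_int[OF i(1)] by simp
    then have "dl_class 1 (sat_sys n M N) (sat_trans n M N) (i + 1) (phi n M N i (proj (T M i) (T N ?s) f)) =
      dl_class 1 (sat_sys n M N) (sat_trans n M N) i x"
      unfolding phi_value[OF o f(1)] using H.cl_Suc[of i x] by simp
    moreover have "proj (T M i) (T N ?s) f \<in> carrier (check_sys C V I n M N i)" using stab_elem[OF o] f by blast
    ultimately show "\<exists>y\<in>carrier (check_sys C V I n M N i). dl_class 1 (sat_sys n M N) (sat_trans n M N) (i + 1) (phi n M N i y) =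
        dl_class 1 (sat_sys n M N) (sat_trans n M N) i x" by blast
  qed
qed

section \<open>Naturality of the comparison map\<close>

lemma induced_compose_right:
  assumes o: "A \<in> obj C" "A' \<in> obj C" "B \<in> obj C" and k: "k \<in> homs C A' A" and h: "h \<in> homs C A B"
  shows "induced (\<lambda>h. proj A' B (h \<cdot> k)) (proj A B h) = proj A' B (h \<cdot> k)"
proof (rule induced_eq[OF V o(1,3) h])
  fix g assume g: "g \<in> homs C A B" "proj A B g = proj A B h"
  then have "plus C g (neg h) \<in> factoring C V A B" using stab_proj_eq[OF V o(1,3) g(1) h] by simp
  then have "plus C g (neg h) \<cdot> k \<in> factoring C V A' B" by (rule factoring_right[OF _ k])
  moreover have "plus C g (neg h) \<cdot> k = plus C (g \<cdot> k) (neg (h \<cdot> k))" using g h k by (simp add: homs_iff distr)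
  ultimately show "proj A' B (g \<cdot> k) = proj A' B (h \<cdot> k)"
    using stab_proj_eq[OF V o(2,3) cmp_hom[OF k g(1)] cmp_hom[OF k h]] by simp
qed

lemma induced_compose_left:
  assumes o: "A \<in> obj C" "B \<in> obj C" "B' \<in> obj C" and k: "k \<in> homs C B B'" and h: "h \<in> homs C A B"
  shows "induced (\<lambda>h. proj A B' (k \<cdot> h)) (proj A B h) = proj A B' (k \<cdot> h)"
proof (rule induced_eq[OF V o(1,2) h])
  fix g assume g: "g \<in> homs C A B" "proj A B g = proj A B h"
  then have "plus C g (neg h) \<in> factoring C V A B" using stab_proj_eq[OF V o(1,2) g(1) h] by simp
  then have "k \<cdot> plus C g (neg h) \<in> factoring C V A B'" by (rule factoring_left[OF _ k])
  moreover have "k \<cdot> plus C g (neg h) = plus C (k \<cdot> g) (neg (k \<cdot> h))" using g h k by (simp add: homs_iff distl)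
  ultimately show "proj A B' (k \<cdot> g) = proj A B' (k \<cdot> h)"
    using stab_proj_eq[OF V o(1,3) cmp_hom[OF g(1) k] cmp_hom[OF h k]] by simp
qed

lemma colim_elem:
  assumes o: "M \<in> obj C" "N \<in> obj C"
    and c: "c \<in> carrier (dir_colim (nat (- n)) (check_sys C V I n M N) (stab_trans n M N))"
  obtains i h where "nat (- n) \<le> i" "h \<in> homs C (T M i) (T N (shift n i))"
    "c = dl_class (nat (- n)) (check_sys C V I n M N) (stab_trans n M N) i (proj (T M i) (T N (shift n i)) h)"
proof -
  interpret dirsys "nat (- n)" "check_sys C V I n M N" "stab_trans n M N" by (rule check_sys_dirsys[OF o])
  show ?thesis using c that stab_elem[OF o] unfolding colim_carrier by metis
qed

text \<open>The stable groups are acted on by \<open>Theta_map\<close>, the satellites by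
  \<open>tau\<close>. Each action commutes with transitions because both are lifts of
  \<open>f\<close>, and the two are reconciled because the connecting morphism kills morphisms
  factoring through \<open>V\<close>.\<close>

lemma Phi_left:
  assumes o: "M \<in> obj C" "M' \<in> obj C" "N \<in> obj C" and f: "f \<in> homs C M' M"
    and c: "c \<in> carrier (dir_colim (nat (- n)) (check_sys C V I n M N) (stab_trans n M N))"
  shows "Phi n M' N (dir_colim_map (nat (- n)) (check_sys C V I n M' N) (stab_trans n M' N)
      (\<lambda>i. induced (\<lambda>h. proj (T M' i) (T N (shift n i)) (h \<cdot> Theta_map C I f i))) c) =
    dir_colim_map 1 (sat_sys n M' N) (sat_trans n M' N)
      (\<lambda>i. fmor ((sat_V C I ^^ i) (contra (n + int i) N)) f) (Phi n M N c)"
    (is "Phi n M' N (dir_colim_map _ _ _ ?h c) = dir_colim_map _ _ _ ?k _")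
proof -
  obtain i h where i: "nat (- n) \<le> i" and h: "h \<in> homs C (T M i) (T N (shift n i))"
    and ce: "c = dl_class (nat (- n)) (check_sys C V I n M N) (stab_trans n M N) i (proj (T M i) (T N (shift n i)) h)"
    using colim_elem[OF o(1,3) c] .
  let ?\<theta> = "Theta_map C I f"
  have th: "?\<theta> j \<in> homs C (T M' j) (T M j)" for j by (rule Theta_map_hom[OF o(2,1) f])
  have hv: "?h j (proj (T M j) (T N (shift n j)) g) = proj (T M' j) (T N (shift n j)) (g \<cdot> ?\<theta> j)"
    if "g \<in> homs C (T M j) (T N (shift n j))" for j g
    by (rule induced_compose_right[OF _ _ _ th that]) (use o in auto)
  have kv: "?k j x = pull (tau j f) x" for j x unfolding sat_fmor by (simp add: contra_def)
  have pe: "proj (T M i) (T N (shift n i)) h \<in> carrier (check_sys C V I n M N i)" using stab_elem[OF o(1,3)] h by blast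
  have "dir_colim_map (nat (- n)) (check_sys C V I n M' N) (stab_trans n M' N) ?h c =
    dl_class (nat (- n)) (check_sys C V I n M' N) (stab_trans n M' N) i (?h i (proj (T M i) (T N (shift n i)) h))"
    unfolding ce
  proof (rule dir_colim_map_cl[OF check_sys_dirsys[OF o(1,3)] check_sys_dirsys[OF o(2,3)] _ _ i pe])
    fix j d assume j: "nat (- n) \<le> j" and "d \<in> carrier (check_sys C V I n M N j)"
    then obtain g where g: "g \<in> homs C (T M j) (T N (shift n j))" "d = proj (T M j) (T N (shift n j)) g"
      using stab_elem[OF o(1,3)] by blast
    show "?h j d \<in> carrier (check_sys C V I n M' N j)"
      unfolding g(2) hv[OF g(1)] stab_elem[OF o(2,3)] using cmp_hom[OF th g(1)] by blast
    obtain g' where g': "lift M j N (shift n j) g g'" using lift_ex[OF o(1,3) g(1)] .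
    have gh: "g' \<in> homs C (T M (Suc j)) (T N (shift n (Suc j)))" using lift_homs(2)[OF o(1,3) g'] shift_Suc[OF j] by simp
    have l: "lift M' j N (shift n j) (g \<cdot> ?\<theta> j) (g' \<cdot> ?\<theta> (Suc j))"
      by (rule lift_comp[OF o(2,1,3) Theta_map_spec(2)[OF o(2,1) f] g'])
    show "stab_trans n M' N j (?h j d) = ?h (Suc j) (stab_trans n M N j d)"
      unfolding g(2) hv[OF g(1)] stab_trans_value[OF o(2,3) j l] stab_trans_value[OF o(1,3) j g'] hv[OF gh] ..
  qed
  then have 1: "Phi n M' N (dir_colim_map (nat (- n)) (check_sys C V I n M' N) (stab_trans n M' N) ?h c) =
    dl_class 1 (sat_sys n M' N) (sat_trans n M' N) (Suc i) (delta n M' N i (h \<cdot> ?\<theta> i))"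
    unfolding hv[OF h] using Phi_value[OF o(2,3) i cmp_hom[OF th h]] by simp
  have "dir_colim_map 1 (sat_sys n M' N) (sat_trans n M' N) ?k
      (dl_class 1 (sat_sys n M N) (sat_trans n M N) (Suc i) (delta n M N i h)) =
    dl_class 1 (sat_sys n M' N) (sat_trans n M' N) (Suc i) (?k (Suc i) (delta n M N i h))"
  proof (rule dir_colim_map_cl[OF sat_sys_dirsys[OF o(1,3)] sat_sys_dirsys[OF o(2,3)] _ _ _ delta_sat[OF o(1,3) i h]])
    fix j x assume "1 \<le> j" and x: "x \<in> carrier (sat_sys n M N j)"
    then obtain l where l: "j = Suc l" by (cases j) auto
    have x': "x \<in> carrier (E (n + int j) (T M j) N)" "pull (prj M l) x = \<one>\<^bsub>E (n + int j) (cterm C (I M) l) N\<^esub>"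
      using x unfolding l sat_sys_Suc(1)[OF o(1,3)] by auto
    have t: "tau j f \<in> homs C (T M' j) (T M j)" by (rule tau_hom[OF o(2,1) f])
    obtain u where u: "u \<in> homs C (cterm C (I M') l) (cterm C (I M) l)" "prj M l \<cdot> u = tau j f \<cdot> prj M' l"
      using tau_lift[OF o(2,1) f, of l] unfolding lift_iff[OF o(2,1)] l by blast
    have "pull (prj M' l) (pull (tau j f) x) = pull u (pull (prj M l) x)"
      using E_pull_comp[OF x'(1)[unfolded l] t[unfolded l] inc_hom(2)[OF o(2)]]
        E_pull_comp[OF x'(1)[unfolded l] inc_hom(2)[OF o(1)] u(1)] u(2) l by simp
    then have "pull (prj M' l) (pull (tau j f) x) = \<one>\<^bsub>E (n + int j) (cterm C (I M') l) N\<^esub>"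
      using x'(2) E_pull_one[OF u(1) o(3)] by simp
    then show "?k j x \<in> carrier (sat_sys n M' N j)"
      unfolding kv using E_pull_closed[OF x'(1) t o(3)] unfolding l sat_sys_Suc(1)[OF o(2,3)] by simp
    show "sat_trans n M' N j (?k j x) = ?k (Suc j) (sat_trans n M N j x)"
      unfolding kv sat_trans_def
      using E_cc_nat[OF ses[OF o(2), of j] ses[OF o(1), of j] _ o(3) tau_lift[OF o(2,1) f, of j, unfolded lift_def], of x "n + int j"]
        x' o by simp
  qed simp
  note 2 = this
  have 3: "?k (Suc i) (delta n M N i h) = delta n M' N i (h \<cdot> ?\<theta> i)"
  proof -
    let ?B = "T N (shift n i)"
    have oT: "?B \<in> obj C" "T M i \<in> obj C" "T M' i \<in> obj C" using o by auto
    have t: "tau i f \<in> homs C (T M' i) (T M i)" "tau (Suc i) f \<in> homs C (T M' (Suc i)) (T M (Suc i))"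
      by (rule tau_hom[OF o(2,1) f])+
    have "pull (tau (Suc i) f) (conn M i 0 ?B (emb h)) = conn M' i 0 ?B (pull (tau i f) (emb h))"
      using E_cc_nat[OF ses[OF o(2), of i] ses[OF o(1), of i] _ oT(1) tau_lift[OF o(2,1) f, of i, unfolded lift_def], of "emb h" 0]
        emb_closed[OF h] o by simp
    also have "pull (tau i f) (emb h) = emb (h \<cdot> tau i f)" by (rule pull_emb[OF h t(1)])
    \<comment> \<open>Composing with \<open>h\<close> preserves stable equality, and by
      \<open>conn_cong\<close> the connecting image depends on the stable class only.\<close>
    also have "conn M' i 0 ?B (emb (h \<cdot> tau i f)) = conn M' i 0 ?B (emb (h \<cdot> ?\<theta> i))"
    proof (rule conn_cong[OF o(2) oT(1) cmp_hom[OF t(1) h] cmp_hom[OF th h]])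
      have "induced (\<lambda>g. proj (T M' i) ?B (h \<cdot> g)) (proj (T M' i) (T M i) (tau i f)) = proj (T M' i) ?B (h \<cdot> tau i f)"
        "induced (\<lambda>g. proj (T M' i) ?B (h \<cdot> g)) (proj (T M' i) (T M i) (?\<theta> i)) = proj (T M' i) ?B (h \<cdot> ?\<theta> i)"
        using induced_compose_left[OF oT(3,2,1) h t(1)] induced_compose_left[OF oT(3,2,1) h th] by auto
      then show "proj (T M' i) ?B (h \<cdot> tau i f) = proj (T M' i) ?B (h \<cdot> ?\<theta> i)"
        using tau_Theta_map[OF o(2,1) f, of i] by simp
    qed
    finally show ?thesis unfolding kv delta_def
      using gam_pull[OF o(3) t(2) conn_emb_closed[OF o(1) oT(1) h]] by simp
  qed
  show ?thesis unfolding 1 unfolding ce Phi_value[OF o(1,3) i h] 2 3 ..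
qed

lemma sat_nat_const: "(sat_V_nat C I ^^ i) (\<lambda>_. \<eta>) M = \<eta>"
proof -
  have "(sat_V_nat C I ^^ i) (\<lambda>_. \<eta>) = (\<lambda>_. \<eta>)" by (induction i) (auto simp: sat_V_nat_def)
  then show ?thesis by simp
qed

text \<open>In the second argument a satellite acts by \<open>push g\<close> alone, without a lift.
  The lifts \<open>?\<theta>\<close> enter on the stable side and are absorbed one short exact
  sequence at a time by \<open>gam_push\<close>.\<close>

lemma Phi_right:
  assumes o: "M \<in> obj C" "N \<in> obj C" "N' \<in> obj C" and g: "g \<in> homs C N N'"
    and c: "c \<in> carrier (dir_colim (nat (- n)) (check_sys C V I n M N) (stab_trans n M N))"
  shows "Phi n M N' (dir_colim_map (nat (- n)) (check_sys C V I n M N') (stab_trans n M N')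
      (\<lambda>i. induced (\<lambda>h. proj (T M i) (T N' (shift n i)) (Theta_map C I g (shift n i) \<cdot> h))) c) =
    dir_colim_map 1 (sat_sys n M N') (sat_trans n M N')
      (\<lambda>i. (sat_V_nat C I ^^ i) (\<lambda>_. push g) M) (Phi n M N c)"
    (is "Phi n M N' (dir_colim_map _ _ _ ?h c) = dir_colim_map _ _ _ ?k _")
proof -
  obtain i h where i: "nat (- n) \<le> i" and h: "h \<in> homs C (T M i) (T N (shift n i))"
    and ce: "c = dl_class (nat (- n)) (check_sys C V I n M N) (stab_trans n M N) i (proj (T M i) (T N (shift n i)) h)"
    using colim_elem[OF o(1,2) c] .
  let ?\<theta> = "Theta_map C I g"
  have th: "?\<theta> j \<in> homs C (T N j) (T N' j)" for j by (rule Theta_map_hom[OF o(2,3) g])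
  have hv: "?h j (proj (T M j) (T N (shift n j)) f) = proj (T M j) (T N' (shift n j)) (?\<theta> (shift n j) \<cdot> f)"
    if "f \<in> homs C (T M j) (T N (shift n j))" for j f
    by (rule induced_compose_left[OF _ _ _ th that]) (use o in auto)
  have kv: "?k j = push g" for j by (rule sat_nat_const)
  have pe: "proj (T M i) (T N (shift n i)) h \<in> carrier (check_sys C V I n M N i)" using stab_elem[OF o(1,2)] h by blast
  have "dir_colim_map (nat (- n)) (check_sys C V I n M N') (stab_trans n M N') ?h c =
    dl_class (nat (- n)) (check_sys C V I n M N') (stab_trans n M N') i (?h i (proj (T M i) (T N (shift n i)) h))"
    unfolding ce
  proof (rule dir_colim_map_cl[OF check_sys_dirsys[OF o(1,2)] check_sys_dirsys[OF o(1,3)] _ _ i pe])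
    fix j d assume j: "nat (- n) \<le> j" and "d \<in> carrier (check_sys C V I n M N j)"
    then obtain f where f: "f \<in> homs C (T M j) (T N (shift n j))" "d = proj (T M j) (T N (shift n j)) f"
      using stab_elem[OF o(1,2)] by blast
    show "?h j d \<in> carrier (check_sys C V I n M N' j)"
      unfolding f(2) hv[OF f(1)] stab_elem[OF o(1,3)] using cmp_hom[OF f(1) th] by blast
    obtain f' where f': "lift M j N (shift n j) f f'" using lift_ex[OF o(1,2) f(1)] .
    have fh: "f' \<in> homs C (T M (Suc j)) (T N (shift n (Suc j)))" using lift_homs(2)[OF o(1,2) f'] shift_Suc[OF j] by simp
    have l: "lift M j N' (shift n j) (?\<theta> (shift n j) \<cdot> f) (?\<theta> (Suc (shift n j)) \<cdot> f')"
      by (rule lift_comp[OF o(1,2,3) f' Theta_map_spec(2)[OF o(2,3) g]])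
    show "stab_trans n M N' j (?h j d) = ?h (Suc j) (stab_trans n M N j d)"
      unfolding f(2) hv[OF f(1)] stab_trans_value[OF o(1,3) j l] stab_trans_value[OF o(1,2) j f'] hv[OF fh]
      by (simp add: shift_Suc[OF j])
  qed
  then have 1: "Phi n M N' (dir_colim_map (nat (- n)) (check_sys C V I n M N') (stab_trans n M N') ?h c) =
    dl_class 1 (sat_sys n M N') (sat_trans n M N') (Suc i) (delta n M N' i (?\<theta> (shift n i) \<cdot> h))"
    unfolding hv[OF h] using Phi_value[OF o(1,3) i cmp_hom[OF h th]] by simp
  have "dir_colim_map 1 (sat_sys n M N') (sat_trans n M N') ?k
      (dl_class 1 (sat_sys n M N) (sat_trans n M N) (Suc i) (delta n M N i h)) =
    dl_class 1 (sat_sys n M N') (sat_trans n M N') (Suc i) (?k (Suc i) (delta n M N i h))"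
  proof (rule dir_colim_map_cl[OF sat_sys_dirsys[OF o(1,2)] sat_sys_dirsys[OF o(1,3)] _ _ _ delta_sat[OF o(1,2) i h]])
    fix j x assume "1 \<le> j" and x: "x \<in> carrier (sat_sys n M N j)"
    then obtain l where l: "j = Suc l" by (cases j) auto
    have x': "x \<in> carrier (E (n + int j) (T M j) N)" "pull (prj M l) x = \<one>\<^bsub>E (n + int j) (cterm C (I M) l) N\<^esub>"
      using x unfolding l sat_sys_Suc(1)[OF o(1,2)] by auto
    have oc: "cterm C (I M) l \<in> obj C" "T M j \<in> obj C" using o by auto
    have "pull (prj M l) (push g x) = \<one>\<^bsub>E (n + int j) (cterm C (I M) l) N'\<^esub>"
      using E_push_pull[OF x'(1)[unfolded l] inc_hom(2)[OF o(1)] g] x'(2) E_push_one[OF g oc(1)] l by simp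
    then show "?k j x \<in> carrier (sat_sys n M N' j)"
      unfolding kv using E_push_closed[OF x'(1) g oc(2)] unfolding l sat_sys_Suc(1)[OF o(1,3)] by simp
    show "sat_trans n M N' j (?k j x) = ?k (Suc j) (sat_trans n M N j x)"
      unfolding kv sat_trans_def using E_cc_push[OF ses[OF o(1), of j] _ g, of x "n + int j"] x' o by simp
  qed simp
  note 2 = this
  have 3: "?k (Suc i) (delta n M N i h) = delta n M N' i (?\<theta> (shift n i) \<cdot> h)"
  proof -
    let ?B = "T N (shift n i)"
    have oT: "?B \<in> obj C" "T M (Suc i) \<in> obj C" using o by auto
    have "push g (delta n M N i h) = gam N' (T M (Suc i)) (shift n i) 1 (push (?\<theta> (shift n i)) (conn M i 0 ?B (emb h)))"
      unfolding delta_def by (rule gam_push[OF o(2,3) oT(2) Theta_map_spec[OF o(2,3) g] conn_emb_closed[OF o(1) oT(1) h]])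
    also have "push (?\<theta> (shift n i)) (conn M i 0 ?B (emb h)) = conn M i 0 (T N' (shift n i)) (push (?\<theta> (shift n i)) (emb h))"
      using E_cc_push[OF ses[OF o(1), of i] _ th, of "emb h" 0] emb_closed[OF h] o by simp
    also have "push (?\<theta> (shift n i)) (emb h) = emb (?\<theta> (shift n i) \<cdot> h)" by (rule push_emb[OF h th])
    finally show ?thesis unfolding kv delta_def .
  qed
  show ?thesis unfolding 1 unfolding ce Phi_value[OF o(1,2) i h] 2 3 ..
qed

end


section \<open>Both isomorphisms\<close>

context abelian_category
begin

lemma Ext_calculus:
  "ext_calculus C (Ext C) (ext_pull C) (ext_push C) (\<lambda>f. {[f]}) (conn_contra C) (conn_co C)"
proof (intro ext_calculus.intro ext_calculus_axioms.intro)
  show "abelian_category C" by unfold_locales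
  show "comm_group (Ext C k M N)" if "M \<in> obj C" "N \<in> obj C" for k M N by (rule Ext_group[OF that])
  show "ext_pull C f \<in> hom (Ext C k M N) (Ext C k M' N)" if "f \<in> homs C M' M" "N \<in> obj C" for f M' M N k
    by (rule pull_group_hom[OF that(2,1)])
  show "ext_push C g \<in> hom (Ext C k M N) (Ext C k M N')" if "g \<in> homs C N N'" "M \<in> obj C" for g N N' M k
    by (rule push_group_hom[OF that(2,1)])
  show "conn_co C (k + 1) (cod C d) a b (conn_contra C k c d (cod C b) x) =
      conn_contra C (k + 1) c d (dom C a) (conn_co C k (dom C c) a b x)"
    if "short_exact C a b" "short_exact C c d" "x \<in> carrier (Ext C k (dom C c) (cod C b))" for a b c d x k
    by (rule co_cc[OF that])
  show "conn_contra C 0 a p (dom C b) {[f]} = conn_co C 0 (cod C p) b q {[g]}"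
    if "short_exact C a p" "short_exact C b q" "emap C 0 f g [a, p] [b, q]" for a p b q f g
    by (rule cc0_co0[OF that])
  show "\<exists>y\<in>carrier (Ext C k M (cod C b)). conn_co C k M a b y = x"
    if "short_exact C a b" "M \<in> obj C" "k \<ge> 0" "x \<in> carrier (Ext C (k + 1) M (dom C a))"
      "ext_push C a x = \<one>\<^bsub>Ext C (k + 1) M (cod C a)\<^esub>" for a b M k x
    by (rule les_left[OF that])
  show "\<exists>y\<in>carrier (Ext C k M (dom C b)). ext_push C b y = x"
    if "short_exact C a b" "M \<in> obj C" "k \<ge> 0" "x \<in> carrier (Ext C k M (cod C b))"
      "conn_co C k M a b x = \<one>\<^bsub>Ext C (k + 1) M (dom C a)\<^esub>" for a b M k x
    by (rule les_right[OF that])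
  show "\<exists>y\<in>carrier (Ext C k (cod C a) N). ext_pull C a y = x"
    if "short_exact C a b" "N \<in> obj C" "k \<ge> 0" "x \<in> carrier (Ext C k (dom C a) N)"
      "conn_contra C k a b N x = \<one>\<^bsub>Ext C (k + 1) (cod C b) N\<^esub>" for a b N k x
    by (rule les_right'[OF that])
qed ((rule pull_id pull_comp push_pull pull_add cc_group_hom co_group_hom cc_push co_pull cc_nat co_nat; assumption) |
  force simp: Ext_0_carrier Ext_0_mult pull_single push_single)+

text \<open>The groups are those of \<open>C\<close> with arguments exchanged, rather than those of
  \<open>opc C\<close>, so the second isomorphism is obtained for \<open>Ext C\<close> itself,
  without comparing Baer sums in the two categories.\<close>

lemma Ext_calculus_opposite:
  "ext_calculus (opc C) (\<lambda>k M N. Ext C k N M) (ext_push C) (ext_pull C) (\<lambda>f. {[f]})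
    (\<lambda>k a b N. conn_co C k N b a) (\<lambda>k M a b. conn_contra C k b a M)"
proof (intro ext_calculus.intro ext_calculus_axioms.intro)
  interpret O: abelian_category "opc C" by (rule opc_abelian)
  \<comment> \<open>A map of short exact sequences in \<open>opc C\<close> is one in
    \<open>C\<close> in the reverse direction, with its end components exchanged.\<close>
  have em: "emap C 0 h g [b', a'] [b, a]"
    if "short_exact (opc C) a b" "short_exact (opc C) a' b'" "emap (opc C) 0 g h [a, b] [a', b']" for a b a' b' g h
    using emap_rev'[of 0 _ _ "[b', a']" _ _ "[b, a]" g h] sesI[of b' a'] sesI[of b a] that by simp
  show "abelian_category (opc C)" by unfold_locales
  show "comm_group (Ext C k N M)" if "M \<in> obj (opc C)" "N \<in> obj (opc C)" for k M N using Ext_group that by simp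
  show "ext_push C f \<in> hom (Ext C k N M) (Ext C k N M')" if "f \<in> homs (opc C) M' M" "N \<in> obj (opc C)" for f M' M N k
    using push_group_hom that by simp
  show "ext_pull C g \<in> hom (Ext C k N M) (Ext C k N' M)" if "g \<in> homs (opc C) N N'" "M \<in> obj (opc C)" for g N N' M k
    using pull_group_hom that by simp
  show "conn_contra C (k + 1) b a (cod (opc C) d) (conn_co C k (cod (opc C) b) d c x) =
      conn_co C (k + 1) (dom (opc C) a) d c (conn_contra C k b a (dom (opc C) c) x)"
    if "short_exact (opc C) a b" "short_exact (opc C) c d" "x \<in> carrier (Ext C k (cod (opc C) b) (dom (opc C) c))" for a b c d x k
    using co_cc[of d c b a x k] that by simp
  show "conn_co C 0 (dom (opc C) b) p a {[f]} = conn_contra C 0 q b (cod (opc C) p) {[g]}"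
    if "short_exact (opc C) a p" "short_exact (opc C) b q" "emap (opc C) 0 f g [a, p] [b, q]" for a p b q f g
    using cc0_co0[of q b p a g f] em[OF that] that by simp
  show "\<exists>y\<in>carrier (Ext C k (cod (opc C) b) M). conn_contra C k b a M y = x"
    if "short_exact (opc C) a b" "M \<in> obj (opc C)" "k \<ge> 0" "x \<in> carrier (Ext C (k + 1) (dom (opc C) a) M)"
      "ext_pull C a x = \<one>\<^bsub>Ext C (k + 1) (cod (opc C) a) M\<^esub>" for a b M k x
    using les_left'[of b a M k x] that by simp
  show "\<exists>y\<in>carrier (Ext C k (dom (opc C) b) M). ext_pull C b y = x"
    if "short_exact (opc C) a b" "M \<in> obj (opc C)" "k \<ge> 0" "x \<in> carrier (Ext C k (cod (opc C) b) M)"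
      "conn_contra C k b a M x = \<one>\<^bsub>Ext C (k + 1) (dom (opc C) a) M\<^esub>" for a b M k x
    using les_right'[of b a M k x] that by simp
  show "\<exists>y\<in>carrier (Ext C k N (cod (opc C) a)). ext_push C a y = x"
    if "short_exact (opc C) a b" "N \<in> obj (opc C)" "k \<ge> 0" "x \<in> carrier (Ext C k N (dom (opc C) a))"
      "conn_co C k N b a x = \<one>\<^bsub>Ext C (k + 1) N (cod (opc C) b)\<^esub>" for a b N k x
    using les_right[of b a N k x] that by simp
  show "conn_co C k N b a (ext_push C g x) = ext_push C h (conn_co C k N b' a' x)"
    if "short_exact (opc C) a b" "short_exact (opc C) a' b'" "x \<in> carrier (Ext C k N (dom (opc C) a'))"
      "N \<in> obj (opc C)" "emap (opc C) 0 g h [a, b] [a', b']" for a b a' b' x k N g h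
    using co_nat[of b' a' b a x k N h g] em[OF that(1,2,5)] that by simp
  show "ext_pull C g (conn_contra C k b a M x) = conn_contra C k b' a' M (ext_pull C h x)"
    if "short_exact (opc C) a b" "short_exact (opc C) a' b'" "x \<in> carrier (Ext C k (cod (opc C) b) M)"
      "M \<in> obj (opc C)" "emap (opc C) 0 g h [a, b] [a', b']" for a b a' b' x k M g h
    using cc_nat[of b' a' b a x k M h g] em[OF that(1,2,5)] that by simp
qed ((unfold opc_sel homs_opc short_exact_opc)?,
  (rule push_id push_comp push_pull[symmetric] push_add cc_group_hom co_group_hom cc_push co_pull; assumption) |
  force simp: Ext_0_carrier Ext_0_mult pull_single push_single)+

text \<open>The coresolution provides exactness of its differentials only. Both
  \<open>cinc Q (Suc i)\<close> and the image of the differential are kernels of the next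
  differential, so \<open>cprj Q i\<close> is the epic part of the differential followed by the
  comparison of these kernels, which is epic too.\<close>

lemma coresolution_short_exact:
  assumes h: "\<And>i. cinc Q i \<in> homs C (Theta C Q i) (cterm C Q i)" "\<And>i. cprj Q i \<in> homs C (cterm C Q i) (Theta C Q (Suc i))"
    and m: "is_mono C (cinc Q 0)" "exact_at C (cinc Q 0) (cdiff C Q 0)"
    and e: "\<And>i. exact_at C (cdiff C Q i) (cdiff C Q (Suc i))"
    and k: "\<And>i. i \<ge> 1 \<Longrightarrow> is_kernel C (cinc Q i) (cdiff C Q i)"
  shows "short_exact C (cinc Q i) (cprj Q i)"
proof -
  have K: "is_kernel C (cinc Q j) (cdiff C Q j)" for j
    using exact_at_mono_kernel[OF m(2,1)] k by (cases j) auto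
  note mono = kernel_mono[OF K]
  note a [simp] = homsD[OF h(1)] homsD[OF h(2)]
  have d: "cdiff C Q i = cinc Q (Suc i) \<cdot> cprj Q i" by (simp add: cdiff_def)
  have "is_kernel C (cinc Q i) (cprj Q i)"
  proof (rule kernelI[OF _ mono])
    show "cprj Q i \<cdot> cinc Q i = zer C (dom C (cinc Q i)) (cod C (cprj Q i))"
      using mono_zero[OF mono, of "cprj Q i \<cdot> cinc Q i" "Suc i"] kernelD(4)[OF K, of i] d by simp
    fix g assume g: "g \<in> arr C" "cod C g = dom C (cprj Q i)" "cprj Q i \<cdot> g = zer C (dom C g) (cod C (cprj Q i))"
    have "cdiff C Q i \<cdot> g = zer C (dom C g) (cod C (cdiff C Q i))" using g cod_obj[OF a(4), of i] by (simp add: d)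
    then show "\<exists>u. u \<in> arr C \<and> dom C u = dom C g \<and> cod C u = dom C (cinc Q i) \<and> cinc Q i \<cdot> u = g"
      by (intro kernel_ex[OF K]) (use g d in auto)
  qed auto
  moreover have "is_epi C (cprj Q i)"
  proof -
    obtain n p where np: "is_epi C p" "is_kernel C n (cdiff C Q (Suc i))" "cod C p = dom C n" "cdiff C Q i = n \<cdot> p"
      using exact_atE[OF e] by metis
    note nd = kernelD[OF np(2)] note Kd = kernelD[OF K, of "Suc i"]
    obtain u where u: "u \<in> arr C" "dom C u = dom C n" "cod C u = dom C (cinc Q (Suc i))" "cinc Q (Suc i) \<cdot> u = n"
      by (rule kernel_lift[OF K[of "Suc i"] nd(2,3,4)])
    obtain v where v: "v \<in> arr C" "dom C v = dom C (cinc Q (Suc i))" "cod C v = dom C n" "n \<cdot> v = cinc Q (Suc i)"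
      by (rule kernel_lift[OF np(2) Kd(2,3,4)])
    have "u \<cdot> v = idn C (dom C (cinc Q (Suc i)))"
      by (rule monoD[OF mono[of "Suc i"]]) (use u v reassoc[OF u(4), of v] dom_obj[OF a(1)] in auto)
    then have "is_epi C (u \<cdot> v)" using dom_obj[OF a(1), of "Suc i"] by simp
    then have ue: "is_epi C u" by (rule epi_cancel) (use u v in auto)
    have p: "p \<in> arr C" using np by simp
    have "cinc Q (Suc i) \<cdot> cprj Q i = cinc Q (Suc i) \<cdot> (u \<cdot> p)"
      using np(4) d reassoc[OF u(4), of p] u p np by simp
    moreover have "dom C p = cterm C Q i"
      using arg_cong[OF np(4), of "dom C"] p nd(2) np(3) d by simp
    ultimately have "cprj Q i = u \<cdot> p"
      by (intro monoD[OF mono[of "Suc i"], of "cprj Q i" "u \<cdot> p"]) (use u p np in auto)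
    then show ?thesis using epi_cmp[OF np(1) ue] u np by simp
  qed
  ultimately show ?thesis by (simp add: short_exact_iff)
qed

end

lemma naturally_isomorphic_V:
  assumes "abelian_category C" "full_additive_subcategory C V"
    and van: "\<forall>j\<ge>1. \<forall>X\<in>left_perp C V. \<forall>U\<in>V. carrier (Ext C j X U) = {\<one>\<^bsub>Ext C j X U\<^esub>}"
    and ch: "coresolution_choice C V I"
  shows "naturally_isomorphic C (check_Ext C V I n) (colim_sat_V C I n)"
proof -
  interpret abelian_category C by fact
  have res: "special_proper_coresolution C V M (I M)"
    "I (Theta C (I M) 1) = \<lparr>cinc = (\<lambda>i. cinc (I M) (Suc i)), cprj = (\<lambda>i. cprj (I M) (Suc i))\<rparr>" if "M \<in> obj C" for M
    using ch that unfolding coresolution_choice_def by blast+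
  interpret coresolution_calculus C "Ext C" "ext_pull C" "ext_push C" "\<lambda>f. {[f]}" "conn_contra C" "conn_co C" V I
  proof (intro coresolution_calculus.intro coresolution_calculus_axioms.intro Ext_calculus)
    fix M i assume M: "M \<in> obj C"
    note r = res(1)[OF M, unfolded special_proper_coresolution_def]
    show "short_exact C (cinc (I M) i) (cprj (I M) i)"
      by (rule coresolution_short_exact) (use r in auto)
    show "cod C (cprj (I M) i) = Theta C (I M) (Suc i)" using r by (auto simp: homs_iff)
    show "Theta C (I M) 0 = M" "cterm C (I M) i \<in> V" using r by auto
    show "I (Theta C (I M) 1) = \<lparr>cinc = (\<lambda>i. cinc (I M) (Suc i)), cprj = (\<lambda>i. cprj (I M) (Suc i))\<rparr>" by (rule res(2)[OF M])
    show "carrier (Ext C j (Theta C (I M) (Suc i)) U) = {\<one>\<^bsub>Ext C j (Theta C (I M) (Suc i)) U\<^esub>}" if "U \<in> V" "j \<ge> 1" for U j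
      using van r that by simp
  qed fact
  have ct: "check_trans C V I n M N = stab_trans n M N" for M N
    by (rule ext) (simp add: check_trans_def stab_trans_def stab_trans_V_def tr_def fun_eq_iff)
  have ss: "sat_V_sys C I n M N = sat_sys n M N" for M N
    by (rule ext) (simp add: sat_V_sys_def sat_sys_def Ext_contra_def contra_def)
  have st: "sat_V_trans C I n M N = sat_trans n M N" for M N
    by (rule ext) (simp add: sat_V_trans_def sat_trans_def)
  have F: "Ext_contra C k N = contra k N" for k N by (simp add: Ext_contra_def contra_def)
  show ?thesis unfolding naturally_isomorphic_def
  proof (intro exI[of _ "Phi n"] conjI ballI)
    fix M N assume "M \<in> obj C" "N \<in> obj C"
    then show "Phi n M N \<in> iso (bob (check_Ext C V I n) M N) (bob (colim_sat_V C I n) M N)"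
      using Phi_iso by (simp add: check_Ext_def colim_sat_V_def ct ss st)
  next
    fix M M' N f x assume *: "M \<in> obj C" "M' \<in> obj C" "N \<in> obj C" "f \<in> homs C M' M" "x \<in> carrier (bob (check_Ext C V I n) M N)"
    then show "Phi n M' N (bleft (check_Ext C V I n) f N x) = bleft (colim_sat_V C I n) f N (Phi n M N x)"
      using Phi_left[OF *(1-4), of x n] homsD(2)[OF *(4)] by (simp add: check_Ext_def colim_sat_V_def ct ss st F)
  next
    fix M N N' g x assume *: "M \<in> obj C" "N \<in> obj C" "N' \<in> obj C" "g \<in> homs C N N'" "x \<in> carrier (bob (check_Ext C V I n) M N)"
    then show "Phi n M N' (bright (check_Ext C V I n) M g x) = bright (colim_sat_V C I n) M g (Phi n M N x)"
      using Phi_right[OF *(1-4), of x n] homsD(3)[OF *(4)] by (simp add: check_Ext_def colim_sat_V_def ct ss st)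
  qed
qed

section \<open>Resolutions as coresolutions in the opposite category\<close>

definition opres :: "('o \<Rightarrow> 'm resolution) \<Rightarrow> 'o \<Rightarrow> 'm coresolution" where
  "opres P M = \<lparr>cinc = rprj (P M), cprj = rinc (P M)\<rparr>"

lemma opres_sel [simp]:
  "cinc (opres P M) = rprj (P M)" "cprj (opres P M) = rinc (P M)"
  "Theta (opc C) (opres P M) i = Omega C (P M) i" "cterm (opc C) (opres P M) i = rterm C (P M) i"
  "cdiff (opc C) (opres P M) i = rdiff C (P M) i"
  by (simp_all add: opres_def Theta_def Omega_def cterm_def rterm_def cdiff_def rdiff_def)

lemma factoring_opc [simp]: "factoring (opc C) U A B = factoring C U B A"
  by (auto simp: factoring_def)

lemma stab_opc [simp]: "abelian_category C \<Longrightarrow> stab (opc C) U A B = stab C U B A"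
  by (simp add: stab_def)

lemma stab_proj_opc [simp]: "stab_proj (opc C) U A B = stab_proj C U B A"
  by (simp add: stab_proj_def fun_eq_iff)

lemma beta_opc: "abelian_category C \<Longrightarrow> beta (opc C) U K A B \<gamma> = beta C U K B A \<gamma>"
  by (simp add: beta_def)

lemma full_additive_subcategory_opc:
  assumes "full_additive_subcategory C U"
  shows "full_additive_subcategory (opc C) U"
  unfolding full_additive_subcategory_def
proof (intro conjI ballI allI impI)
  note u = assms[unfolded full_additive_subcategory_def]
  show "U \<subseteq> obj (opc C)" "\<exists>Z\<in>U. is_zero_object (opc C) Z" using u by auto
  show "S \<in> U" if "A \<in> U" "B \<in> U" "is_biproduct (opc C) A B S i j p q" for A B S i j p q
    using u that by (metis is_biproduct_opc)
  fix f assume f: "is_iso (opc C) f \<and> dom (opc C) f \<in> U"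
  then obtain g where "g \<in> homs C (cod C f) (dom C f)" "g \<cdot>\<^bsub>C\<^esub> f = idn C (dom C f)" "f \<cdot>\<^bsub>C\<^esub> g = idn C (cod C f)" "f \<in> arr C"
    by (auto simp: is_iso_def)
  \<comment> \<open>Passing to the opposite exchanges domain and codomain, so closure under
    isomorphism is applied to the inverse.\<close>
  then have "is_iso C g \<and> dom C g = cod C f \<and> cod C g = dom C f" by (auto simp: is_iso_def homs_def)
  then show "cod (opc C) f \<in> U" using u f by (metis opc_sel(3,4))
qed

text \<open>Each defining square of one description is the same equation in the other with its sides
  exchanged, hence \<open>eq_commute\<close>.\<close>

lemma Theta_map_opc: "Theta_map (opc C) (opres P) f = Omega_map C P f"
  by (simp add: Theta_map_def Omega_map_def eq_commute)

lemma sat_opc: "sat_V (opc C) (opres P) G = sat_W C P G"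
  by (simp add: sat_V_def sat_W_def Theta_map_opc)

lemma naturally_isomorphic_W:
  assumes "abelian_category C" "full_additive_subcategory C W"
    and van: "\<forall>j\<ge>1. \<forall>U\<in>W. \<forall>Y\<in>right_perp C W. carrier (Ext C j U Y) = {\<one>\<^bsub>Ext C j U Y\<^esub>}"
    and ch: "resolution_choice C W P"
  shows "naturally_isomorphic C (hat_Ext C W P n) (colim_sat_W C P n)"
proof -
  interpret abelian_category C by fact
  interpret O: abelian_category "opc C" by (rule opc_abelian)
  have res: "special_proper_resolution C W M (P M)"
    "P (Omega C (P M) 1) = \<lparr>rinc = (\<lambda>i. rinc (P M) (Suc i)), rprj = (\<lambda>i. rprj (P M) (Suc i))\<rparr>" if "M \<in> obj C" for M
    using ch that unfolding resolution_choice_def by blast+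
  interpret D: coresolution_calculus "opc C" "\<lambda>k M N. Ext C k N M" "ext_push C" "ext_pull C" "\<lambda>f. {[f]}"
    "\<lambda>k a b N. conn_co C k N b a" "\<lambda>k M a b. conn_contra C k b a M" W "opres P"
  proof (intro coresolution_calculus.intro coresolution_calculus_axioms.intro Ext_calculus_opposite)
    show "full_additive_subcategory (opc C) W" by (rule full_additive_subcategory_opc) fact
    fix M i assume "M \<in> obj (opc C)"
    then have M: "M \<in> obj C" by simp
    note r = res(1)[OF M, unfolded special_proper_resolution_def]
    show "short_exact (opc C) (cinc (opres P M) i) (cprj (opres P M) i)"
      by (rule O.coresolution_short_exact) (use r in auto)
    show "cod (opc C) (cprj (opres P M) i) = Theta (opc C) (opres P M) (Suc i)" using r by (auto simp: homs_iff)
    show "Theta (opc C) (opres P M) 0 = M" "cterm (opc C) (opres P M) i \<in> W" using r by auto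
    show "opres P (Theta (opc C) (opres P M) 1) =
      \<lparr>cinc = (\<lambda>i. cinc (opres P M) (Suc i)), cprj = (\<lambda>i. cprj (opres P M) (Suc i))\<rparr>"
      using res(2)[OF M] by (simp add: opres_def Theta_def Omega_def)
    show "carrier (Ext C j U (Theta (opc C) (opres P M) (Suc i))) = {\<one>\<^bsub>Ext C j U (Theta (opc C) (opres P M) (Suc i))\<^esub>}"
      if "U \<in> W" "j \<ge> 1" for U j
      using van r that by simp
  qed
  have cs: "hat_sys C W P n M N = check_sys (opc C) W (opres P) n N M" for M N
    by (rule ext) (simp add: hat_sys_def check_sys_def assms(1))
  have ct: "hat_trans C W P n M N = D.stab_trans n N M" for M N
    by (rule ext) (simp add: hat_trans_def D.stab_trans_def stab_trans_W_def D.tr_def fun_eq_iff beta_opc[OF assms(1)])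
  have S: "sat_V (opc C) (opres P) = sat_W C P" by (rule ext) (rule sat_opc)
  have ss: "sat_W_sys C P n M N = D.sat_sys n N M" for M N
    by (rule ext) (simp add: sat_W_sys_def D.sat_sys_def Ext_co_def D.contra_def S)
  have st: "sat_W_trans C P n M N = D.sat_trans n N M" for M N
    by (rule ext) (simp add: sat_W_trans_def D.sat_trans_def)
  have F: "Ext_co C k M = D.contra k M" for k M by (simp add: Ext_co_def D.contra_def)
  have SN: "sat_V_nat (opc C) (opres P) = sat_W_nat C P"
    by (intro ext) (simp add: sat_V_nat_def sat_W_nat_def)
  show ?thesis unfolding naturally_isomorphic_def
  \<comment> \<open>The arguments are exchanged, so naturality in \<open>M\<close> comes from
    \<open>D.Phi_right\<close> and naturality in \<open>N\<close> from
    \<open>D.Phi_left\<close>.\<close>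
  proof (intro exI[of _ "\<lambda>M N. D.Phi n N M"] conjI ballI)
    fix M N assume "M \<in> obj C" "N \<in> obj C"
    then show "D.Phi n N M \<in> iso (bob (hat_Ext C W P n) M N) (bob (colim_sat_W C P n) M N)"
      using D.Phi_iso[of N M n] by (simp add: hat_Ext_def colim_sat_W_def cs ct ss st)
  next
    fix M M' N f x assume *: "M \<in> obj C" "M' \<in> obj C" "N \<in> obj C" "f \<in> homs C M' M" "x \<in> carrier (bob (hat_Ext C W P n) M N)"
    then show "D.Phi n N M' (bleft (hat_Ext C W P n) f N x) = bleft (colim_sat_W C P n) f N (D.Phi n N M x)"
      using D.Phi_right[of N M M' f x n] homsD(2)[OF *(4)]
      by (simp add: hat_Ext_def colim_sat_W_def cs ct ss st SN Theta_map_opc)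
  next
    fix M N N' g x assume *: "M \<in> obj C" "N \<in> obj C" "N' \<in> obj C" "g \<in> homs C N N'" "x \<in> carrier (bob (hat_Ext C W P n) M N)"
    then show "D.Phi n N' M (bright (hat_Ext C W P n) M g x) = bright (colim_sat_W C P n) M g (D.Phi n N M x)"
      using D.Phi_left[of N N' M g x n] homsD(3)[OF *(4)]
      by (simp add: hat_Ext_def colim_sat_W_def cs ct ss st F S Theta_map_opc)
  qed
qed

theorem proposition3p12:
  fixes C :: "('o, 'm, 'z) precat_scheme"
    and V W :: "'o set"
    and I :: "'o \<Rightarrow> 'm coresolution"
    and P :: "'o \<Rightarrow> 'm resolution"
    and n :: int
  assumes "abelian_category C"
    and "full_additive_subcategory C V" and "special_preenveloping C V"
    and "full_additive_subcategory C W" and "special_precovering C W"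
    and "\<forall>j\<ge>1. \<forall>X\<in>left_perp C V. \<forall>U\<in>V. carrier (Ext C j X U) = {\<one>\<^bsub>Ext C j X U\<^esub>}"
    and "\<forall>j\<ge>1. \<forall>U\<in>W. \<forall>Y\<in>right_perp C W. carrier (Ext C j U Y) = {\<one>\<^bsub>Ext C j U Y\<^esub>}"
    and "coresolution_choice C V I" and "resolution_choice C W P"
  shows "naturally_isomorphic C (check_Ext C V I n) (colim_sat_V C I n) \<and>
         naturally_isomorphic C (hat_Ext C W P n) (colim_sat_W C P n)"
  using naturally_isomorphic_V[OF assms(1,2,6,8)] naturally_isomorphic_W[OF assms(1,4,7,9)] by blast

end
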